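(* Let $\alpha,\beta,\mu,\lambda\in\mathbb{R}$ with $\alpha\neq 0$, let $\sigma_0>0$, and let $a:\mathbb{R}\to\mathbb{R}$ be a smooth function (independent of time) such that (A1) there exists $\gamma>0$ with $a(x)\ge\gamma>0$ for all $x\in\mathbb{R}$; (A2) $\displaystyle\sum_{k=0}^{\infty}(k+1)^{\frac14}\frac{\sigma_0^k}{k!}\,\|\partial_x^k a\|_{L^\infty}<\infty$. Then the Cauchy problem $$\partial_t u+\alpha\partial_x^5u+\beta\partial_x^3u+\mu\partial_x u^2+\lambda\partial_x u^3+a(x)u=0,\qquad u(x,0)=u_0(x),\qquad x\in\mathbb{R},\ t\ge 0,$$ is locally well-posed in $G^{\sigma_0}(\mathbb{R})$. Thus, for each $u_0\in G^{\sigma_0}(\mathbb{R})$ there exists a time interval $I=[0,\delta]$, $\delta>0$, such that the solution $u(t)$ of the Cauchy problem admits, for each $t\in I$, a holomorphic extension $\tilde u(t)$ to the strip $S_{\sigma_0}$.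
   Context: For $\sigma>0$, $G^\sigma(\mathbb{R})$ is the space of functions with finite norm $\|f\|_{G^\sigma}=\left(\int_{\mathbb{R}}e^{2\sigma|\xi|}|\hat f(\xi)|^2\,d\xi\right)^{1/2}$, where $\hat f(\xi)=\int_{\mathbb{R}} f(x)e^{-ix\xi}\,dx$. The strip is $S_\sigma=\{x+iy: x,y\in\mathbb{R},\ |y|<\sigma\}\subset\mathbb{C}$. A (strong $G^{\sigma_0}$) solution on $[0,\delta]$ is a function $u\in C([0,\delta];G^{\sigma_0}(\mathbb{R}))$ satisfying the Duhamel formula $u(t)=S(t)u_0-\int_0^tS(t-t')\left[\mu\partial_x(u^2)+\lambda\partial_x(u^3)+au\right](t')\,dt'$, where $\widehat{S(t)f}(\xi)=e^{-it(\alpha\xi^5-\beta\xi^3)}\hat f(\xi)$. Locally well-posed in $G^{\sigma_0}(\mathbb{R})$ means: for each $u_0^*\in G^{\sigma_0}(\mathbb{R})$ there exist a time $\delta>0$, an open ball $B\subset G^{\sigma_0}(\mathbb{R})$ containing $u_0^*$, and a subset $X$ of $C([0,\delta];G^{\sigma_0}(\mathbb{R}))$ such that for each $u_0\in B$ there is a unique strong $G^{\sigma_0}$ solution $u\in X$ on $[0,\delta]$, and the map $u_0\mapsto u$ is continuous from $B$ to $X$ (with the topology of $C([0,\delta];G^{\sigma_0}(\mathbb{R}))$). *)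

theory Defs
  imports "HOL-Probability.Probability"
begin

section \<open>The Fourier--Plancherel transform\<close>

definition square_integrable :: "(real \<Rightarrow> complex) \<Rightarrow> bool" where
  "square_integrable f \<longleftrightarrow>
     f \<in> borel_measurable lborel \<and> integrable lborel (\<lambda>x. (cmod (f x))\<^sup>2)"

definition fourier_trunc :: "real \<Rightarrow> (real \<Rightarrow> complex) \<Rightarrow> real \<Rightarrow> complex" where
  "fourier_trunc R f \<xi> = (LINT x:{-R..R}|lborel. f x * cis (- (x * \<xi>)))"

text \<open>For square integrable \<open>f\<close> the integral \<open>\<integral> f(x) e\<^sup>-\<^sup>i\<^sup>x\<^sup>\<xi> dx\<close> need not converge absolutely.  As usual
  it is read as the limit in the mean of the integrals over \<open>[-R,R]\<close>; for integrable \<open>f\<close> this is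
  the absolutely convergent integral, up to a null set.\<close>

definition has_fourier :: "(real \<Rightarrow> complex) \<Rightarrow> (real \<Rightarrow> complex) \<Rightarrow> bool" where
  "has_fourier f F \<longleftrightarrow> square_integrable f \<and> square_integrable F \<and>
     ((\<lambda>R. \<integral>\<^sup>+ \<xi>. ennreal ((cmod (F \<xi> - fourier_trunc R f \<xi>))\<^sup>2) \<partial>lborel) \<longlongrightarrow> 0) at_top"

text \<open>The transform is determined only up to a null set (\<open>has_fourier_unique_AE\<close> below); \<open>fourier f\<close>
  is an arbitrary representative.\<close>

definition fourier :: "(real \<Rightarrow> complex) \<Rightarrow> real \<Rightarrow> complex" where
  "fourier f = (SOME F. has_fourier f F)"


section \<open>The spaces \<open>G\<^sup>\<sigma>\<close> and \<open>C([0,\<delta>]; G\<^sup>\<sigma>)\<close>\<close>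

text \<open>For \<open>\<sigma> > 0\<close> the finiteness of the norm forces the transform to be integrable, so
  every almost-everywhere class in \<open>G\<^sup>\<sigma>\<close> contains exactly one continuous function.  We
  take that function as the element of the space; thus equality in \<open>G\<^sup>\<sigma>\<close> is equality of functions,
  and elements have values and derivatives at points.\<close>

definition Gnorm :: "real \<Rightarrow> (real \<Rightarrow> complex) \<Rightarrow> real" where
  "Gnorm \<sigma> f = sqrt (LINT \<xi>|lborel. exp (2 * \<sigma> * \<bar>\<xi>\<bar>) * (cmod (fourier f \<xi>))\<^sup>2)"

definition Gspace :: "real \<Rightarrow> (real \<Rightarrow> complex) set" where
  "Gspace \<sigma> = {f. continuous_on UNIV f \<and> (\<exists>F. has_fourier f F) \<and>
     integrable lborel (\<lambda>\<xi>. exp (2 * \<sigma> * \<bar>\<xi>\<bar>) * (cmod (fourier f \<xi>))\<^sup>2)}"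

definition Gdist :: "real \<Rightarrow> (real \<Rightarrow> complex) \<Rightarrow> (real \<Rightarrow> complex) \<Rightarrow> real" where
  "Gdist \<sigma> f g = Gnorm \<sigma> (\<lambda>x. f x - g x)"

text \<open>That this is a metric space is proved at the end of the theory (\<open>Metric_space_G\<close>).\<close>

definition Gmetric :: "real \<Rightarrow> (real \<Rightarrow> complex) metric" where
  "Gmetric \<sigma> = metric (Gspace \<sigma>, Gdist \<sigma>)"

text \<open>Sup metric; the elements are extensional, i.e.\ \<open>undefined\<close> at times outside \<open>[0,\<delta>]\<close>.\<close>

definition CGmetric :: "real \<Rightarrow> real \<Rightarrow> (real \<Rightarrow> real \<Rightarrow> complex) metric" where
  "CGmetric \<sigma> \<delta> = cfunspace (top_of_set {0..\<delta>}) (Gmetric \<sigma>)"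

definition strip :: "real \<Rightarrow> complex set" where
  "strip \<sigma> = {z. \<bar>Im z\<bar> < \<sigma>}"


section \<open>Strong solutions and local well-posedness\<close>

definition S_group :: "real \<Rightarrow> real \<Rightarrow> real \<Rightarrow> (real \<Rightarrow> complex) \<Rightarrow> real \<Rightarrow> complex" where
  "S_group \<alpha> \<beta> t f = (THE g. continuous_on UNIV g \<and>
     has_fourier g (\<lambda>\<xi>. cis (- t * (\<alpha> * \<xi> ^ 5 - \<beta> * \<xi> ^ 3)) * fourier f \<xi>))"

definition lower_terms ::
  "real \<Rightarrow> real \<Rightarrow> (real \<Rightarrow> real) \<Rightarrow> (real \<Rightarrow> complex) \<Rightarrow> real \<Rightarrow> complex" where
  "lower_terms \<mu> lam a v x =
     of_real \<mu> * vector_derivative (\<lambda>y. v y ^ 2) (at x)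
     + of_real lam * vector_derivative (\<lambda>y. v y ^ 3) (at x)
     + of_real (a x) * v x"

text \<open>The Duhamel integral of a function-valued integrand is evaluated at each point \<open>x\<close>.  For
  \<open>u \<in> C([0,\<delta>]; G\<^sup>\<sigma>)\<close> the integrand is continuous in time with values in \<open>G\<^sup>\<rho>\<close> for every \<open>\<rho> < \<sigma>\<close>, and
  point evaluation is bounded on \<open>G\<^sup>\<rho>\<close> for \<open>\<rho> > 0\<close>, so this is the vector-valued integral.\<close>

definition strong_solution ::
  "real \<Rightarrow> real \<Rightarrow> real \<Rightarrow> real \<Rightarrow> (real \<Rightarrow> real) \<Rightarrow> real \<Rightarrow> real
   \<Rightarrow> (real \<Rightarrow> complex) \<Rightarrow> (real \<Rightarrow> real \<Rightarrow> complex) \<Rightarrow> bool" where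
  "strong_solution \<alpha> \<beta> \<mu> lam a \<sigma> \<delta> u0 u \<longleftrightarrow>
     u \<in> mspace (CGmetric \<sigma> \<delta>) \<and>
     (\<forall>t\<in>{0..\<delta>}. \<forall>x.
        set_integrable lborel {0..t} (\<lambda>s. S_group \<alpha> \<beta> (t - s) (lower_terms \<mu> lam a (u s)) x) \<and>
        u t x = S_group \<alpha> \<beta> t u0 x
          - (LINT s:{0..t}|lborel. S_group \<alpha> \<beta> (t - s) (lower_terms \<mu> lam a (u s)) x))"

text \<open>\<open>\<delta>\<close>, \<open>B\<close> and \<open>X\<close> witness local well-posedness near the datum \<open>w\<close>.\<close>

definition well_posed_near ::
  "real \<Rightarrow> real \<Rightarrow> real \<Rightarrow> real \<Rightarrow> (real \<Rightarrow> real) \<Rightarrow> real \<Rightarrow> (real \<Rightarrow> complex)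
   \<Rightarrow> real \<Rightarrow> (real \<Rightarrow> complex) set \<Rightarrow> (real \<Rightarrow> real \<Rightarrow> complex) set \<Rightarrow> bool" where
  "well_posed_near \<alpha> \<beta> \<mu> lam a \<sigma> w \<delta> B X \<longleftrightarrow>
     \<delta> > 0 \<and>
     (\<exists>c r. B = mball_of (Gmetric \<sigma>) c r) \<and> w \<in> B \<and>
     X \<subseteq> mspace (CGmetric \<sigma> \<delta>) \<and>
     (\<forall>u0\<in>B. \<exists>!u. u \<in> X \<and> strong_solution \<alpha> \<beta> \<mu> lam a \<sigma> \<delta> u0 u) \<and>
     continuous_map (subtopology (mtopology_of (Gmetric \<sigma>)) B)
       (subtopology (mtopology_of (CGmetric \<sigma> \<delta>)) X)
       (\<lambda>u0. THE u. u \<in> X \<and> strong_solution \<alpha> \<beta> \<mu> lam a \<sigma> \<delta> u0 u)"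

definition locally_well_posed ::
  "real \<Rightarrow> real \<Rightarrow> real \<Rightarrow> real \<Rightarrow> (real \<Rightarrow> real) \<Rightarrow> real \<Rightarrow> bool" where
  "locally_well_posed \<alpha> \<beta> \<mu> lam a \<sigma> \<longleftrightarrow>
     (\<forall>w\<in>Gspace \<sigma>. \<exists>\<delta> B X. well_posed_near \<alpha> \<beta> \<mu> lam a \<sigma> w \<delta> B X)"


section \<open>\<open>G\<^sup>\<sigma>\<close> is a metric space\<close>

lemma square_integrable_measurable [measurable_dest]:
  "square_integrable f \<Longrightarrow> f \<in> borel_measurable lborel"
  by (simp add: square_integrable_def)

lemma square_integrableI_nn:
  assumes "f \<in> borel_measurable lborel" "(\<integral>\<^sup>+x. ennreal ((cmod (f x))\<^sup>2) \<partial>lborel) < \<infinity>"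
  shows "square_integrable f"
  unfolding square_integrable_def using assms by (auto intro!: integrableI_bounded)

lemma cmod_diff_sq_le: "(cmod (p - q))\<^sup>2 \<le> 2 * (cmod p)\<^sup>2 + 2 * (cmod q)\<^sup>2"
proof -
  have "(cmod (p - q))\<^sup>2 \<le> (cmod p + cmod q)\<^sup>2"
    by (intro power_mono norm_triangle_ineq4) simp
  also have "\<dots> \<le> 2 * (cmod p)\<^sup>2 + 2 * (cmod q)\<^sup>2"
    using sum_squares_bound[of "cmod p" "cmod q"] by (simp add: power2_sum)
  finally show ?thesis .
qed

lemma nn_diff_sq_le:
  assumes [measurable]: "p \<in> borel_measurable lborel" "q \<in> borel_measurable lborel"
  shows "(\<integral>\<^sup>+x. ennreal ((cmod (p x - q x))\<^sup>2) \<partial>lborel)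
    \<le> 2 * (\<integral>\<^sup>+x. ennreal ((cmod (p x))\<^sup>2) \<partial>lborel) + 2 * (\<integral>\<^sup>+x. ennreal ((cmod (q x))\<^sup>2) \<partial>lborel)"
proof -
  have "(\<integral>\<^sup>+x. ennreal ((cmod (p x - q x))\<^sup>2) \<partial>lborel)
     \<le> (\<integral>\<^sup>+x. 2 * ennreal ((cmod (p x))\<^sup>2) + 2 * ennreal ((cmod (q x))\<^sup>2) \<partial>lborel)"
  proof (rule nn_integral_mono)
    fix x
    have "ennreal ((cmod (p x - q x))\<^sup>2) \<le> ennreal (2 * (cmod (p x))\<^sup>2 + 2 * (cmod (q x))\<^sup>2)"
      by (intro ennreal_leI cmod_diff_sq_le)
    then show "ennreal ((cmod (p x - q x))\<^sup>2) \<le> 2 * ennreal ((cmod (p x))\<^sup>2) + 2 * ennreal ((cmod (q x))\<^sup>2)"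
      by (simp add: ennreal_mult ennreal_plus)
  qed
  also have "\<dots> = 2 * (\<integral>\<^sup>+x. ennreal ((cmod (p x))\<^sup>2) \<partial>lborel) + 2 * (\<integral>\<^sup>+x. ennreal ((cmod (q x))\<^sup>2) \<partial>lborel)"
    by (subst nn_integral_add) (auto simp: nn_integral_cmult)
  finally show ?thesis .
qed

lemma square_integrable_nn:
  "square_integrable f \<Longrightarrow> (\<integral>\<^sup>+x. ennreal ((cmod (f x))\<^sup>2) \<partial>lborel) < \<infinity>"
  unfolding square_integrable_def using nn_integral_eq_integral[of lborel "\<lambda>x. (cmod (f x))\<^sup>2"] by auto

lemma square_integrable_diff:
  assumes "square_integrable f" "square_integrable g"
  shows "square_integrable (\<lambda>x. f x - g x)"
proof (rule square_integrableI_nn)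
  have [measurable]: "f \<in> borel_measurable lborel" "g \<in> borel_measurable lborel"
    using assms by (auto simp: square_integrable_def)
  show "(\<lambda>x. f x - g x) \<in> borel_measurable lborel" by simp
  show "(\<integral>\<^sup>+x. ennreal ((cmod (f x - g x))\<^sup>2) \<partial>lborel) < \<infinity>"
    using square_integrable_nn[OF assms(1)] square_integrable_nn[OF assms(2)]
    by (intro le_less_trans[OF nn_diff_sq_le]) (auto simp: ennreal_mult_less_top)
qed

lemma square_integrable_truncated:
  assumes "square_integrable f"
  shows "set_integrable lborel {-R..R} f"
proof -
  have m: "f \<in> borel_measurable lborel" using assms by (simp add: square_integrable_def)
  have "integrable lborel (\<lambda>x. indicator {-R..R} x *\<^sub>R (1::real))"
    by (simp add: integrable_indicator_iff emeasure_lborel_Icc_eq)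
  moreover have "integrable lborel (\<lambda>x. indicator {-R..R} x *\<^sub>R (cmod (f x))\<^sup>2)"
    using assms unfolding square_integrable_def by (intro integrable_mult_indicator) auto
  ultimately have "integrable lborel (\<lambda>x. indicator {-R..R} x *\<^sub>R (1 + (cmod (f x))\<^sup>2))"
    unfolding scaleR_add_right by (rule Bochner_Integration.integrable_add)
  then show ?thesis
    unfolding set_integrable_def
  proof (rule Bochner_Integration.integrable_bound)
    show "(\<lambda>x. indicator {-R..R} x *\<^sub>R f x) \<in> borel_measurable lborel" using m by simp
    show "AE x in lborel. norm (indicator {-R..R} x *\<^sub>R f x)
       \<le> norm (indicator {-R..R} x *\<^sub>R (1 + (cmod (f x))\<^sup>2))"
    proof (intro AE_I2)
      fix x
      have "cmod (f x) \<le> 1 + (cmod (f x))\<^sup>2"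
        using sum_squares_bound[of "cmod (f x)" 1] by (smt (verit) norm_ge_zero one_power2 mult.right_neutral)
      then show "norm (indicator {-R..R} x *\<^sub>R f x) \<le> norm (indicator {-R..R} x *\<^sub>R (1 + (cmod (f x))\<^sup>2))"
        by (auto simp: indicator_def)
    qed
  qed
qed

lemma cis_measurable [measurable]: "cis \<in> borel_measurable borel"
  by (intro borel_measurable_continuous_onI continuous_on_cis continuous_on_id)

lemma fourier_trunc_integrable:
  assumes "square_integrable f"
  shows "set_integrable lborel {-R..R} (\<lambda>x. f x * cis (- (x * \<xi>)))"
proof -
  have m: "f \<in> borel_measurable lborel" using assms by (simp add: square_integrable_def)
  show ?thesis
    using square_integrable_truncated[OF assms, of R] unfolding set_integrable_def
    by (rule Bochner_Integration.integrable_bound) (use m in \<open>auto simp: norm_mult\<close>)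
qed

lemma fourier_trunc_diff:
  assumes "square_integrable f" "square_integrable g"
  shows "fourier_trunc R (\<lambda>x. f x - g x) \<xi> = fourier_trunc R f \<xi> - fourier_trunc R g \<xi>"
  unfolding fourier_trunc_def
  using fourier_trunc_integrable[OF assms(1)] fourier_trunc_integrable[OF assms(2)]
  by (simp add: left_diff_distrib set_integral_diff)

lemma fourier_trunc_measurable:
  assumes "square_integrable f"
  shows "fourier_trunc R f \<in> borel_measurable lborel"
proof -
  have [measurable]: "f \<in> borel_measurable lborel" using assms by (simp add: square_integrable_def)
  show ?thesis unfolding fourier_trunc_def set_lebesgue_integral_def by measurable
qed

lemma has_fourier_diff:
  assumes "has_fourier f F" "has_fourier g G"
  shows "has_fourier (\<lambda>x. f x - g x) (\<lambda>\<xi>. F \<xi> - G \<xi>)"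
proof -
  have sq: "square_integrable f" "square_integrable F" "square_integrable g" "square_integrable G"
    using assms by (auto simp: has_fourier_def)
  have meas: "(\<lambda>\<xi>. F \<xi> - fourier_trunc R f \<xi>) \<in> borel_measurable lborel"
      "(\<lambda>\<xi>. G \<xi> - fourier_trunc R g \<xi>) \<in> borel_measurable lborel" for R
    using sq(2,4) fourier_trunc_measurable[OF sq(1)] fourier_trunc_measurable[OF sq(3)]
    by (auto simp: square_integrable_def)
  let ?a = "\<lambda>R. \<integral>\<^sup>+\<xi>. ennreal ((cmod (F \<xi> - fourier_trunc R f \<xi>))\<^sup>2) \<partial>lborel"
  let ?b = "\<lambda>R. \<integral>\<^sup>+\<xi>. ennreal ((cmod (G \<xi> - fourier_trunc R g \<xi>))\<^sup>2) \<partial>lborel"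
  have lim: "((\<lambda>R. 2 * ?a R + 2 * ?b R) \<longlongrightarrow> 2 * 0 + 2 * 0) at_top"
    using assms unfolding has_fourier_def
    by (intro tendsto_add ennreal_tendsto_cmult) auto
  have "((\<lambda>R. \<integral>\<^sup>+\<xi>. ennreal ((cmod ((F \<xi> - G \<xi>) - fourier_trunc R (\<lambda>x. f x - g x) \<xi>))\<^sup>2) \<partial>lborel) \<longlongrightarrow> 0) at_top"
  proof (rule tendsto_sandwich[OF _ _ tendsto_const])
    show "\<forall>\<^sub>F R in at_top. (\<integral>\<^sup>+\<xi>. ennreal ((cmod ((F \<xi> - G \<xi>) - fourier_trunc R (\<lambda>x. f x - g x) \<xi>))\<^sup>2) \<partial>lborel)
        \<le> 2 * ?a R + 2 * ?b R"
    proof (intro always_eventually allI)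
      fix R
      have "(F \<xi> - G \<xi>) - fourier_trunc R (\<lambda>x. f x - g x) \<xi>
        = (F \<xi> - fourier_trunc R f \<xi>) - (G \<xi> - fourier_trunc R g \<xi>)" for \<xi>
        using sq by (simp add: fourier_trunc_diff)
      then show "(\<integral>\<^sup>+\<xi>. ennreal ((cmod ((F \<xi> - G \<xi>) - fourier_trunc R (\<lambda>x. f x - g x) \<xi>))\<^sup>2) \<partial>lborel)
        \<le> 2 * ?a R + 2 * ?b R"
        using nn_diff_sq_le[OF meas(1)[of R] meas(2)[of R]] by (simp only:)
    qed
  qed (use lim in auto)
  then show ?thesis
    using sq by (simp add: has_fourier_def square_integrable_diff)
qed

lemma has_fourier_unique_AE:
  assumes "has_fourier f F" "has_fourier f G"
  shows "AE \<xi> in lborel. F \<xi> = G \<xi>"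
proof -
  have "has_fourier (\<lambda>x. f x - f x) (\<lambda>\<xi>. F \<xi> - G \<xi>)"
    by (rule has_fourier_diff[OF assms])
  then have "((\<lambda>R::real. \<integral>\<^sup>+\<xi>. ennreal ((cmod (F \<xi> - G \<xi>))\<^sup>2) \<partial>lborel) \<longlongrightarrow> 0) at_top"
    by (simp add: has_fourier_def fourier_trunc_def)
  then have "(\<integral>\<^sup>+\<xi>. ennreal ((cmod (F \<xi> - G \<xi>))\<^sup>2) \<partial>lborel) = 0"
    by (simp add: tendsto_const_iff)
  moreover have "F \<in> borel_measurable lborel" "G \<in> borel_measurable lborel"
    using assms by (auto simp: has_fourier_def square_integrable_def)
  ultimately have "AE \<xi> in lborel. ennreal ((cmod (F \<xi> - G \<xi>))\<^sup>2) = 0"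
    by (subst (asm) nn_integral_0_iff_AE) auto
  then show ?thesis by eventually_elim auto
qed

lemma has_fourier_fourier: "has_fourier f F \<Longrightarrow> has_fourier f (fourier f)"
  unfolding fourier_def by (rule someI[where P="has_fourier f"])

lemma fourier_AE: "has_fourier f F \<Longrightarrow> AE \<xi> in lborel. fourier f \<xi> = F \<xi>"
  using has_fourier_fourier has_fourier_unique_AE by blast

text \<open>Injectivity: test the truncated transforms against modulated Gaussians.\<close>

lemma gaussian_integral:
  assumes "n > 0"
  shows "integrable lborel (\<lambda>\<xi>. std_normal_density (\<xi> / n))"
    "(LINT \<xi>|lborel. cis (t * \<xi>) * of_real (std_normal_density (\<xi> / n)))
      = of_real (n * exp (- (n\<^sup>2 * t\<^sup>2) / 2))"
proof -
  have i: "integrable lborel std_normal_density" by simp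
  show "integrable lborel (\<lambda>\<xi>. std_normal_density (\<xi> / n))"
    using lborel_integrable_real_affine[OF i, of "1/n" 0] assms by simp
  have "complex_of_real (exp (- ((n*t)^2) / 2)) = char std_normal_distribution (n * t)"
    by (simp add: char_std_normal_distribution)
  also have "\<dots> = (LINT x|lborel. std_normal_density x *\<^sub>R iexp (n * t * x))"
    unfolding char_def by (subst integral_density) auto
  also have "\<dots> = (LINT x|lborel. cis (n * t * x) * of_real (std_normal_density x))"
    by (intro Bochner_Integration.integral_cong) (auto simp: scaleR_conv_of_real cis_conv_exp mult.commute)
  also have "\<dots> = \<bar>1/n\<bar> *\<^sub>R (LINT x|lborel. cis (n * t * (0 + 1/n * x)) * of_real (std_normal_density (0 + 1/n * x)))"
    using assms by (intro lborel_integral_real_affine) auto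
  also have "\<dots> = (1/n) *\<^sub>R (LINT x|lborel. cis (t * x) * of_real (std_normal_density (x/n)))"
    using assms by simp
  finally show "(LINT \<xi>|lborel. cis (t * \<xi>) * of_real (std_normal_density (\<xi> / n)))
      = of_real (n * exp (- (n\<^sup>2 * t\<^sup>2) / 2))"
    using assms by (simp add: scaleR_conv_of_real field_simps power_mult_distrib)
qed

lemma fourier_trunc_gaussian:
  assumes f: "square_integrable f" and n: "n > 0"
  shows "(LINT \<xi>|lborel. fourier_trunc R f \<xi> * (cis (y * \<xi>) * of_real (std_normal_density (\<xi> / n))))
    = (LINT x:{-R..R}|lborel. f x * of_real (n * exp (- (n\<^sup>2 * (y - x)\<^sup>2) / 2)))"
proof -
  have [measurable]: "f \<in> borel_measurable lborel" using f by (simp add: square_integrable_def)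
  let ?g = "\<lambda>\<xi>. std_normal_density (\<xi> / n)"
  let ?k = "\<lambda>x \<xi>. (indicator {-R..R} x *\<^sub>R f x) * (cis ((y - x) * \<xi>) * complex_of_real (?g \<xi>))"
  have gi: "integrable lborel ?g" using gaussian_integral(1)[OF n] .
  have int: "integrable (lborel \<Otimes>\<^sub>M lborel) (case_prod ?k)"
  proof (rule lborel_pair.Fubini_integrable)
    show "case_prod ?k \<in> borel_measurable (lborel \<Otimes>\<^sub>M lborel)" by measurable
    have "(\<lambda>x. LINT \<xi>|lborel. norm (case_prod ?k (x, \<xi>)))
      = (\<lambda>x. norm (indicator {-R..R} x *\<^sub>R f x) * (LINT \<xi>|lborel. ?g \<xi>))"
      by (auto simp: norm_mult fun_eq_iff)
    moreover have "integrable lborel \<dots>"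
      using square_integrable_truncated[OF f, of R] unfolding set_integrable_def
      by (intro integrable_mult_left integrable_norm)
    ultimately show "integrable lborel (\<lambda>x. LINT \<xi>|lborel. norm (case_prod ?k (x, \<xi>)))" by simp
    show "AE x in lborel. integrable lborel (\<lambda>\<xi>. case_prod ?k (x, \<xi>))"
    proof (intro AE_I2)
      fix x
      have "integrable lborel (\<lambda>\<xi>. cis ((y - x) * \<xi>) * complex_of_real (?g \<xi>))"
        using gi by (rule Bochner_Integration.integrable_bound) (auto simp: norm_mult)
      then show "integrable lborel (\<lambda>\<xi>. case_prod ?k (x, \<xi>))" by simp
    qed
  qed
  have "(LINT \<xi>|lborel. fourier_trunc R f \<xi> * (cis (y * \<xi>) * of_real (?g \<xi>)))
     = (LINT \<xi>|lborel. LINT x|lborel. ?k x \<xi>)"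
  proof (rule Bochner_Integration.integral_cong[OF refl])
    fix \<xi>
    have "fourier_trunc R f \<xi> * (cis (y * \<xi>) * of_real (?g \<xi>))
      = (LINT x|lborel. (indicator {-R..R} x *\<^sub>R (f x * cis (- (x * \<xi>)))) * (cis (y * \<xi>) * of_real (?g \<xi>)))"
      unfolding fourier_trunc_def set_lebesgue_integral_def by (simp only: integral_mult_left_zero)
    also have "\<dots> = (LINT x|lborel. ?k x \<xi>)"
    proof (rule Bochner_Integration.integral_cong[OF refl])
      fix x
      have "cis ((y - x) * \<xi>) = cis (- (x * \<xi>)) * cis (y * \<xi>)"
        by (simp add: cis_mult algebra_simps)
      then show "(indicator {-R..R} x *\<^sub>R (f x * cis (- (x * \<xi>)))) * (cis (y * \<xi>) * of_real (?g \<xi>)) = ?k x \<xi>"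
        by simp
    qed
    finally show "fourier_trunc R f \<xi> * (cis (y * \<xi>) * of_real (?g \<xi>)) = (LINT x|lborel. ?k x \<xi>)" .
  qed
  also have "\<dots> = (LINT x|lborel. LINT \<xi>|lborel. ?k x \<xi>)"
    by (rule lborel_pair.Fubini_integral[OF int])
  also have "\<dots> = (LINT x|lborel. (indicator {-R..R} x *\<^sub>R f x) * of_real (n * exp (- (n\<^sup>2 * (y - x)\<^sup>2) / 2)))"
    by (simp only: integral_mult_right_zero gaussian_integral(2)[OF n])
  finally show ?thesis by (simp add: set_lebesgue_integral_def)
qed

lemma cmod_integral_Cauchy_Schwarz:
  assumes [measurable]: "p \<in> borel_measurable lborel" "q \<in> borel_measurable lborel"
  shows "ennreal ((cmod (LINT x|lborel. p x * q x))\<^sup>2)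
    \<le> (\<integral>\<^sup>+x. ennreal ((cmod (p x))\<^sup>2) \<partial>lborel) * (\<integral>\<^sup>+x. ennreal ((cmod (q x))\<^sup>2) \<partial>lborel)"
proof -
  have "ennreal (cmod (LINT x|lborel. p x * q x)) \<le> (\<integral>\<^sup>+x. ennreal (cmod (p x)) * ennreal (cmod (q x)) \<partial>lborel)"
  proof (cases "integrable lborel (\<lambda>x. p x * q x)")
    case True
    from integral_norm_bound_ennreal[OF True] show ?thesis
      by (simp add: norm_mult ennreal_mult)
  qed (simp add: not_integrable_integral_eq)
  then have "(ennreal (cmod (LINT x|lborel. p x * q x)))\<^sup>2
      \<le> (\<integral>\<^sup>+x. ennreal (cmod (p x)) * ennreal (cmod (q x)) \<partial>lborel)\<^sup>2"
    by (rule power_mono) simp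
  also have "\<dots> \<le> (\<integral>\<^sup>+x. (ennreal (cmod (p x)))\<^sup>2 \<partial>lborel) * (\<integral>\<^sup>+x. (ennreal (cmod (q x)))\<^sup>2 \<partial>lborel)"
    by (rule Cauchy_Schwarz_nn_integral) auto
  finally show ?thesis by (simp add: ennreal_power)
qed

lemma gauss_kernel:
  fixes n y :: real
  assumes n: "n > 0"
  shows "integrable lborel (\<lambda>x. exp (- (n\<^sup>2 * (y - x)\<^sup>2) / 2))"
    "(LINT x|lborel. exp (- (n\<^sup>2 * (y - x)\<^sup>2) / 2)) = sqrt (2 * pi) / n"
proof -
  have eq: "(\<lambda>x. exp (- (n\<^sup>2 * (y - x)\<^sup>2) / 2)) = (\<lambda>x. sqrt (2 * pi) * std_normal_density (- n * y + n * x))"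
  proof
    fix x
    have "(- n * y + n * x)\<^sup>2 = n\<^sup>2 * (y - x)\<^sup>2" by (simp add: power2_eq_square algebra_simps)
    then show "exp (- (n\<^sup>2 * (y - x)\<^sup>2) / 2) = sqrt (2 * pi) * std_normal_density (- n * y + n * x)"
      by (simp add: std_normal_density_def)
  qed
  show "integrable lborel (\<lambda>x. exp (- (n\<^sup>2 * (y - x)\<^sup>2) / 2))"
    unfolding eq using lborel_integrable_real_affine[of std_normal_density n "- n * y"] n
    by (intro integrable_mult_right) auto
  have "1 = (LINT x|lborel. std_normal_density x)" by simp
  also have "\<dots> = \<bar>n\<bar> *\<^sub>R (LINT x|lborel. std_normal_density (- n * y + n * x))"
    using n by (intro lborel_integral_real_affine) auto
  finally have "(LINT x|lborel. std_normal_density (- n * y + n * x)) = 1 / n"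
    using n by (simp add: field_simps)
  then show "(LINT x|lborel. exp (- (n\<^sup>2 * (y - x)\<^sup>2) / 2)) = sqrt (2 * pi) / n"
    unfolding eq by (simp only: integral_mult_right_zero times_divide_eq_right mult_1_right)
qed

lemma has_fourier_zero_gaussian:
  assumes "has_fourier f (\<lambda>_. 0)" and n: "n > 0"
  shows "integrable lborel (\<lambda>x. f x * of_real (exp (- (n\<^sup>2 * (y - x)\<^sup>2) / 2)))"
    "(LINT x|lborel. f x * of_real (exp (- (n\<^sup>2 * (y - x)\<^sup>2) / 2))) = 0"
proof -
  have f: "square_integrable f" using assms by (simp add: has_fourier_def)
  have [measurable]: "f \<in> borel_measurable lborel" using f by (simp add: square_integrable_def)
  let ?h = "\<lambda>x. f x * complex_of_real (exp (- (n\<^sup>2 * (y - x)\<^sup>2) / 2))"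
  let ?g = "\<lambda>\<xi>. cis (y * \<xi>) * complex_of_real (std_normal_density (\<xi> / n))"
  note ge = gauss_kernel(1)[OF n, of y]
  show int: "integrable lborel ?h"
  proof (rule Bochner_Integration.integrable_bound)
    show "integrable lborel (\<lambda>x. (cmod (f x))\<^sup>2 + exp (- (n\<^sup>2 * (y - x)\<^sup>2) / 2))"
      using f ge by (intro Bochner_Integration.integrable_add) (auto simp: square_integrable_def)
    show "AE x in lborel. norm (?h x) \<le> norm ((cmod (f x))\<^sup>2 + exp (- (n\<^sup>2 * (y - x)\<^sup>2) / 2))"
    proof (intro AE_I2)
      fix x
      define e where "e = exp (- (n\<^sup>2 * (y - x)\<^sup>2) / 2)"
      have e: "0 \<le> e" "e \<le> 1" by (auto simp: e_def)
      have "cmod (f x) * e \<le> ((cmod (f x))\<^sup>2 + 1) * e"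
        using sum_squares_bound[of "cmod (f x)" 1] e(1)
        by (intro mult_right_mono) (smt (verit) norm_ge_zero one_power2 mult.right_neutral, auto)
      also have "\<dots> \<le> (cmod (f x))\<^sup>2 + e"
        using e mult_left_le[of e "(cmod (f x))\<^sup>2"] by (simp add: algebra_simps)
      finally show "norm (?h x) \<le> norm ((cmod (f x))\<^sup>2 + exp (- (n\<^sup>2 * (y - x)\<^sup>2) / 2))"
        by (simp add: norm_mult e_def)
    qed
  qed simp
  let ?I = "\<lambda>R. LINT x:{-R..R}|lborel. f x * of_real (n * exp (- (n\<^sup>2 * (y - x)\<^sup>2) / 2))"
  have g2: "(\<integral>\<^sup>+\<xi>. ennreal ((cmod (?g \<xi>))\<^sup>2) \<partial>lborel) < \<infinity>" (is "?C < _")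
  proof -
    have "?C \<le> (\<integral>\<^sup>+\<xi>. ennreal (std_normal_density (\<xi> / n)) \<partial>lborel)"
    proof (intro nn_integral_mono ennreal_leI)
      fix \<xi>
      have s: "1 \<le> sqrt (2 * pi)" using pi_gt3 by (intro real_le_rsqrt) auto
      have "std_normal_density (\<xi> / n) \<le> 1 * 1"
        unfolding std_normal_density_def using s by (intro mult_mono) (auto simp: field_simps)
      then have "(std_normal_density (\<xi> / n))\<^sup>2 \<le> std_normal_density (\<xi> / n)"
        using normal_density_nonneg[of 1 0 "\<xi> / n"] by (simp add: power2_eq_square mult_left_le)
      then show "(cmod (?g \<xi>))\<^sup>2 \<le> std_normal_density (\<xi> / n)"
        by (simp add: norm_mult)
    qed
    also have "\<dots> < \<infinity>"
      using gaussian_integral(1)[OF n] by (subst nn_integral_eq_integral) auto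
    finally show ?thesis .
  qed
  have "((\<lambda>R. ennreal ((cmod (?I R))\<^sup>2)) \<longlongrightarrow> 0) at_top"
  proof (rule tendsto_sandwich[OF _ _ tendsto_const])
    have "((\<lambda>R. ?C * (\<integral>\<^sup>+\<xi>. ennreal ((cmod (fourier_trunc R f \<xi>))\<^sup>2) \<partial>lborel)) \<longlongrightarrow> ?C * 0) at_top"
      using assms(1) g2 unfolding has_fourier_def by (intro ennreal_tendsto_cmult) auto
    then show "((\<lambda>R. ?C * (\<integral>\<^sup>+\<xi>. ennreal ((cmod (fourier_trunc R f \<xi>))\<^sup>2) \<partial>lborel)) \<longlongrightarrow> 0) at_top"
      by simp
    show "\<forall>\<^sub>F R in at_top. ennreal ((cmod (?I R))\<^sup>2)
        \<le> ?C * (\<integral>\<^sup>+\<xi>. ennreal ((cmod (fourier_trunc R f \<xi>))\<^sup>2) \<partial>lborel)"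
      using cmod_integral_Cauchy_Schwarz[OF fourier_trunc_measurable[OF f], of ?g]
      by (intro always_eventually allI)
        (simp only: fourier_trunc_gaussian[OF f n, symmetric] mult.commute[of ?C], measurable)
  qed auto
  then have "((\<lambda>R. (cmod (?I R))\<^sup>2) \<longlongrightarrow> 0) at_top"
    by (subst (asm) ennreal_0[symmetric], subst (asm) tendsto_ennreal_iff) auto
  then have I0: "(?I \<longlongrightarrow> 0) at_top"
    using tendsto_real_sqrt[of "\<lambda>R. (cmod (?I R))\<^sup>2" 0 at_top]
    by (intro tendsto_norm_zero_cancel[of ?I]) (simp only: real_sqrt_zero real_sqrt_abs abs_norm_cancel)
  have "((\<lambda>R. LINT x:{-R..R}|lborel. f x * of_real (n * exp (- (n\<^sup>2 * (y - x)\<^sup>2) / 2))) \<longlongrightarrow>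
      (LINT x|lborel. f x * of_real (n * exp (- (n\<^sup>2 * (y - x)\<^sup>2) / 2)))) at_top"
    unfolding set_lebesgue_integral_def
  proof (rule integral_dominated_convergence_at_top)
    have "integrable lborel (\<lambda>x. of_real n * ?h x)" using int by (rule integrable_mult_right)
    then show "integrable lborel (\<lambda>x. norm (of_real n * ?h x))" by (rule integrable_norm)
    show "\<forall>\<^sub>F R in at_top. AE x in lborel.
       norm (indicator {-R..R} x *\<^sub>R (f x * of_real (n * exp (- (n\<^sup>2 * (y - x)\<^sup>2) / 2)))) \<le> norm (of_real n * ?h x)"
      by (intro always_eventually allI AE_I2) (auto simp: indicator_def norm_mult)
    show "AE x in lborel. ((\<lambda>R. indicator {-R..R} x *\<^sub>R (f x * complex_of_real (n * exp (- (n\<^sup>2 * (y - x)\<^sup>2) / 2))))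
       \<longlongrightarrow> f x * of_real (n * exp (- (n\<^sup>2 * (y - x)\<^sup>2) / 2))) at_top"
    proof (intro AE_I2 tendsto_eventually)
      fix x :: real
      show "\<forall>\<^sub>F R in at_top. indicator {-R..R} x *\<^sub>R (f x * complex_of_real (n * exp (- (n\<^sup>2 * (y - x)\<^sup>2) / 2)))
         = f x * of_real (n * exp (- (n\<^sup>2 * (y - x)\<^sup>2) / 2))"
        using eventually_ge_at_top[of "\<bar>x\<bar>"] by eventually_elim (auto simp: indicator_def)
    qed
  qed simp_all
  then have "(LINT x|lborel. f x * of_real (n * exp (- (n\<^sup>2 * (y - x)\<^sup>2) / 2))) = 0"
    using I0 tendsto_unique[OF trivial_limit_at_top_linorder] by blast
  moreover have "(LINT x|lborel. f x * of_real (n * exp (- (n\<^sup>2 * (y - x)\<^sup>2) / 2))) = of_real n * (LINT x|lborel. ?h x)"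
    by (subst integral_mult_right_zero[symmetric]) (simp add: mult_ac)
  ultimately show "(LINT x|lborel. ?h x) = 0" using n by simp
qed


lemma has_fourier_zero:
  assumes F: "has_fourier f (\<lambda>_. 0)" and cont: "continuous_on UNIV f"
  shows "f y = 0"
proof -
  let ?E = "\<lambda>n x::real. exp (- ((real n)\<^sup>2 * (y - x)\<^sup>2) / 2)"
  define c where "c = f y"
  define K where "K = (LINT x|lborel. cmod (c - f x) * ?E 1 x)"
  have int: "integrable lborel (\<lambda>x. (c - f x) * of_real (?E n x))" if "n > 0" for n
  proof -
    have "integrable lborel (\<lambda>x. c * of_real (?E n x))"
      using gauss_kernel(1)[of "real n" y] that by (intro integrable_mult_right integrable_of_real) auto
    moreover have "integrable lborel (\<lambda>x. f x * of_real (?E n x))"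
      using has_fourier_zero_gaussian(1)[OF F, of "real n" y] that by simp
    ultimately show ?thesis
      unfolding left_diff_distrib by (rule Bochner_Integration.integrable_diff)
  qed
  have intn: "integrable lborel (\<lambda>x. cmod (c - f x) * ?E n x)" if "n > 0" for n
    using integrable_norm[OF int[OF that]] by (simp add: norm_mult)
  have "cmod c \<le> \<epsilon>" if "\<epsilon> > 0" for \<epsilon>
  proof -
    from cont that obtain \<eta> where \<eta>: "\<eta> > 0" "\<And>x. \<bar>x - y\<bar> < \<eta> \<Longrightarrow> cmod (c - f x) < \<epsilon>"
      unfolding continuous_on_iff c_def by (metis UNIV_I dist_commute dist_norm real_norm_def)
    have bound: "cmod c \<le> \<epsilon> + (4 * K / (\<eta>\<^sup>2 * sqrt (2 * pi))) * (1 / real n)" if n: "n \<ge> 2" for n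
    proof -
      have n0: "n > 0" "real n > 0" using n by auto
      have "c * of_real (sqrt (2 * pi) / n) = (LINT x|lborel. c * of_real (?E n x))"
        by (simp only: integral_mult_right_zero integral_complex_of_real gauss_kernel(2)[OF n0(2)])
      also have "\<dots> = (LINT x|lborel. c * of_real (?E n x)) - (LINT x|lborel. f x * of_real (?E n x))"
        using has_fourier_zero_gaussian(2)[OF F n0(2), of y] by simp
      also have "\<dots> = (LINT x|lborel. (c - f x) * of_real (?E n x))"
        unfolding left_diff_distrib
        using gauss_kernel(1)[OF n0(2), of y] has_fourier_zero_gaussian(1)[OF F n0(2), of y]
        by (intro Bochner_Integration.integral_diff[symmetric] integrable_mult_right integrable_of_real)
      finally have "cmod c * (sqrt (2 * pi) / n) = cmod (LINT x|lborel. (c - f x) * of_real (?E n x))"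
        by (metis (no_types, lifting) abs_of_nonneg divide_nonneg_nonneg n0(2) norm_mult norm_of_real
            of_nat_0_le_iff pi_ge_zero real_sqrt_ge_zero mult_nonneg_nonneg zero_le_numeral)
      also have "\<dots> \<le> (LINT x|lborel. cmod (c - f x) * ?E n x)"
        using integral_norm_bound[of lborel "\<lambda>x. (c - f x) * of_real (?E n x)"] by (simp add: norm_mult)
      also have "\<dots> \<le> (LINT x|lborel. \<epsilon> * ?E n x + 4 / ((real n)\<^sup>2 * \<eta>\<^sup>2) * (cmod (c - f x) * ?E 1 x))"
      proof (rule integral_mono)
        show "integrable lborel (\<lambda>x. \<epsilon> * ?E n x + 4 / ((real n)\<^sup>2 * \<eta>\<^sup>2) * (cmod (c - f x) * ?E 1 x))"
          using gauss_kernel(1)[OF n0(2), of y] intn[of 1]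
          by (intro Bochner_Integration.integrable_add integrable_mult_right) simp_all
        fix x
        show "cmod (c - f x) * ?E n x \<le> \<epsilon> * ?E n x + 4 / ((real n)\<^sup>2 * \<eta>\<^sup>2) * (cmod (c - f x) * ?E 1 x)"
        proof (cases "\<bar>x - y\<bar> < \<eta>")
          case True
          then have "cmod (c - f x) * ?E n x \<le> \<epsilon> * ?E n x"
            using \<eta>(2) by (intro mult_right_mono) (auto intro: less_imp_le)
          moreover have "0 \<le> 4 / ((real n)\<^sup>2 * \<eta>\<^sup>2) * (cmod (c - f x) * ?E 1 x)" by simp
          ultimately show ?thesis by linarith
        next
          case False
          define d where "d = (y - x)\<^sup>2"
          have d: "\<eta>\<^sup>2 \<le> d" "d > 0"
          proof -
            have "\<eta> \<le> \<bar>y - x\<bar>" using False by linarith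
            then show "\<eta>\<^sup>2 \<le> d" unfolding d_def using \<eta>(1) abs_le_square_iff[of \<eta> "y - x"] by simp
            then show "d > 0" using \<eta>(1) by (smt (verit) zero_less_power)
          qed
          have "(real n)\<^sup>2 * \<eta>\<^sup>2 / 4 \<le> (real n)\<^sup>2 * d / 4"
            using d by (intro divide_right_mono mult_left_mono) auto
          also have "\<dots> \<le> exp ((real n)\<^sup>2 * d / 4)"
            using exp_ge_add_one_self[of "(real n)\<^sup>2 * d / 4"] by linarith
          finally have "exp (- ((real n)\<^sup>2 * d / 4)) \<le> 4 / ((real n)\<^sup>2 * \<eta>\<^sup>2)"
            using \<eta>(1) n0 by (simp add: exp_minus field_simps)
          moreover have "exp (- ((real n)\<^sup>2 * d / 4)) \<le> exp (- d / 2)"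
          proof -
            have "2\<^sup>2 \<le> (real n)\<^sup>2" using n by (intro power_mono) auto
            then have "4 * d \<le> (real n)\<^sup>2 * d" using d by (intro mult_right_mono) auto
            then show ?thesis using d by simp
          qed
          ultimately have "exp (- ((real n)\<^sup>2 * d / 4)) * exp (- ((real n)\<^sup>2 * d / 4))
              \<le> 4 / ((real n)\<^sup>2 * \<eta>\<^sup>2) * exp (- d / 2)"
            by (intro mult_mono) auto
          moreover have "exp (- ((real n)\<^sup>2 * d / 4)) * exp (- ((real n)\<^sup>2 * d / 4)) = ?E n x"
            by (simp add: d_def flip: exp_add)
          ultimately have "?E n x \<le> 4 / ((real n)\<^sup>2 * \<eta>\<^sup>2) * ?E 1 x"
            by (simp add: d_def)
          then have "cmod (c - f x) * ?E n x \<le> cmod (c - f x) * (4 / ((real n)\<^sup>2 * \<eta>\<^sup>2) * ?E 1 x)"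
            by (intro mult_left_mono) auto
          moreover have "0 \<le> \<epsilon> * ?E n x" using \<open>\<epsilon> > 0\<close> by simp
          ultimately show ?thesis by (simp only: mult_ac)
        qed
      qed (rule intn[OF n0(1)])
      also have "\<dots> = \<epsilon> * (sqrt (2 * pi) / n) + 4 / ((real n)\<^sup>2 * \<eta>\<^sup>2) * K"
        unfolding K_def using gauss_kernel[OF n0(2), of y] intn[of 1]
        by (subst Bochner_Integration.integral_add)
          (auto intro!: integrable_mult_right simp only: integral_mult_right_zero zero_less_one)
      finally have *: "cmod c * (sqrt (2 * pi) / n) \<le> \<epsilon> * (sqrt (2 * pi) / n) + 4 / ((real n)\<^sup>2 * \<eta>\<^sup>2) * K" .
      define s where "s = sqrt (2 * pi)"
      have s: "s > 0" by (simp add: s_def)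
      have "cmod c = cmod c * (s / n) * (n / s)" using s n0 by simp
      also have "\<dots> \<le> (\<epsilon> * (s / n) + 4 / ((real n)\<^sup>2 * \<eta>\<^sup>2) * K) * (n / s)"
        using * s n0 unfolding s_def[symmetric] by (intro mult_right_mono) auto
      also have "\<dots> = \<epsilon> + (4 * K / (\<eta>\<^sup>2 * s)) * (1 / real n)"
        using s n0 \<eta>(1) by (simp add: field_simps power2_eq_square)
      finally show ?thesis unfolding s_def .
    qed
    have "(\<lambda>n. \<epsilon> + (4 * K / (\<eta>\<^sup>2 * sqrt (2 * pi))) * (1 / real n)) \<longlonglongrightarrow> \<epsilon> + (4 * K / (\<eta>\<^sup>2 * sqrt (2 * pi))) * 0"
      by (intro tendsto_intros lim_1_over_n)
    then show ?thesis
      using bound by (intro LIMSEQ_le_const[where X = "\<lambda>n. \<epsilon> + (4 * K / (\<eta>\<^sup>2 * sqrt (2 * pi))) * (1 / real n)"]) auto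
  qed
  then have "cmod c \<le> 0" by (meson dense_ge)
  then show ?thesis by (simp add: c_def)
qed

text \<open>Hence the description in \<open>S_group\<close> determines at most one function.\<close>

lemma has_fourier_inj:
  assumes "has_fourier f F" "has_fourier g F" "continuous_on UNIV f" "continuous_on UNIV g"
  shows "f = g"
proof
  fix y
  have "has_fourier (\<lambda>x. f x - g x) (\<lambda>_. 0)"
    using has_fourier_diff[OF assms(1,2)] by simp
  then show "f y = g y"
    using has_fourier_zero[of "\<lambda>x. f x - g x" y] assms(3,4) by (simp add: continuous_on_diff)
qed

lemma L2_triangle:
  assumes "square_integrable p" "square_integrable q"
  shows "sqrt (LINT x|lborel. (cmod (p x + q x))\<^sup>2)
    \<le> sqrt (LINT x|lborel. (cmod (p x))\<^sup>2) + sqrt (LINT x|lborel. (cmod (q x))\<^sup>2)"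
proof -
  have [measurable]: "p \<in> borel_measurable lborel" "q \<in> borel_measurable lborel"
    and ip: "integrable lborel (\<lambda>x. (cmod (p x))\<^sup>2)" and iq: "integrable lborel (\<lambda>x. (cmod (q x))\<^sup>2)"
    using assms by (auto simp: square_integrable_def)
  define A where "A = (LINT x|lborel. (cmod (p x))\<^sup>2)"
  define B where "B = (LINT x|lborel. (cmod (q x))\<^sup>2)"
  define C where "C = (LINT x|lborel. cmod (p x) * cmod (q x))"
  have AB: "A \<ge> 0" "B \<ge> 0" "C \<ge> 0" unfolding A_def B_def C_def by (auto intro!: integral_nonneg_AE)
  have ipq: "integrable lborel (\<lambda>x. cmod (p x) * cmod (q x))"
  proof (rule Bochner_Integration.integrable_bound[OF Bochner_Integration.integrable_add[OF ip iq]])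
    show "AE x in lborel. norm (cmod (p x) * cmod (q x)) \<le> norm ((cmod (p x))\<^sup>2 + (cmod (q x))\<^sup>2)"
    proof (intro AE_I2)
      fix x
      have "0 \<le> cmod (p x) * cmod (q x)" by simp
      then have "cmod (p x) * cmod (q x) \<le> (cmod (p x))\<^sup>2 + (cmod (q x))\<^sup>2"
        using sum_squares_bound[of "cmod (p x)" "cmod (q x)"] by linarith
      then show "norm (cmod (p x) * cmod (q x)) \<le> norm ((cmod (p x))\<^sup>2 + (cmod (q x))\<^sup>2)" by simp
    qed
  qed simp
  have "(LINT x|lborel. complex_of_real (cmod (p x)) * complex_of_real (cmod (q x))) = of_real C"
    unfolding C_def by (simp flip: of_real_mult)
  then have "ennreal (C\<^sup>2) \<le> ennreal A * ennreal B"
    using cmod_integral_Cauchy_Schwarz[of "\<lambda>x. of_real (cmod (p x))" "\<lambda>x. of_real (cmod (q x))"] AB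
    by (simp add: nn_integral_eq_integral[OF ip] nn_integral_eq_integral[OF iq] flip: A_def B_def)
  then have "C\<^sup>2 \<le> A * B" using AB by (simp flip: ennreal_mult)
  then have C: "C \<le> sqrt A * sqrt B" by (simp add: real_le_rsqrt flip: real_sqrt_mult)
  have "(LINT x|lborel. (cmod (p x + q x))\<^sup>2)
     \<le> (LINT x|lborel. (cmod (p x))\<^sup>2 + (cmod (q x))\<^sup>2 + 2 * (cmod (p x) * cmod (q x)))"
  proof (rule integral_mono_AE')
    show "integrable lborel (\<lambda>x. (cmod (p x))\<^sup>2 + (cmod (q x))\<^sup>2 + 2 * (cmod (p x) * cmod (q x)))"
      using ip iq ipq by (intro Bochner_Integration.integrable_add integrable_mult_right)
    show "AE x in lborel. (cmod (p x + q x))\<^sup>2 \<le> (cmod (p x))\<^sup>2 + (cmod (q x))\<^sup>2 + 2 * (cmod (p x) * cmod (q x))"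
    proof (intro AE_I2)
      fix x
      have "(cmod (p x + q x))\<^sup>2 \<le> (cmod (p x) + cmod (q x))\<^sup>2"
        by (intro power_mono norm_triangle_ineq) simp
      then show "(cmod (p x + q x))\<^sup>2 \<le> (cmod (p x))\<^sup>2 + (cmod (q x))\<^sup>2 + 2 * (cmod (p x) * cmod (q x))"
        by (simp add: power2_sum)
    qed
  qed simp
  also have "\<dots> = A + B + 2 * C"
    unfolding A_def B_def C_def using ip iq ipq by simp
  also have "\<dots> \<le> (sqrt A + sqrt B)\<^sup>2"
    using C AB by (simp add: power2_sum)
  finally show ?thesis
    using AB by (intro real_le_lsqrt) (auto simp: A_def B_def)
qed

lemma Gnorm_eq:
  assumes "has_fourier f F"
  shows "Gnorm \<sigma> f = sqrt (LINT \<xi>|lborel. (cmod (of_real (exp (\<sigma> * \<bar>\<xi>\<bar>)) * F \<xi>))\<^sup>2)"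
proof -
  have [measurable]: "fourier f \<in> borel_measurable lborel" "F \<in> borel_measurable lborel"
    using assms has_fourier_fourier[OF assms] by (auto simp: has_fourier_def square_integrable_def)
  have "exp (2 * \<sigma> * \<bar>\<xi>\<bar>) = (exp (\<sigma> * \<bar>\<xi>\<bar>))\<^sup>2" for \<xi>
    by (simp add: power2_eq_square flip: exp_add)
  then show ?thesis
    unfolding Gnorm_def using fourier_AE[OF assms]
    by (intro arg_cong[where f = sqrt] integral_cong_AE) (auto simp: norm_mult power_mult_distrib)
qed

lemma Gspace_has_fourier:
  assumes "f \<in> Gspace \<sigma>"
  shows "has_fourier f (fourier f)"
    "square_integrable (\<lambda>\<xi>. of_real (exp (\<sigma> * \<bar>\<xi>\<bar>)) * fourier f \<xi>)"
proof -
  show 1: "has_fourier f (fourier f)"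
    using assms has_fourier_fourier by (auto simp: Gspace_def)
  then have [measurable]: "fourier f \<in> borel_measurable lborel"
    by (auto simp: has_fourier_def square_integrable_def)
  have "exp (2 * \<sigma> * \<bar>\<xi>\<bar>) = (exp (\<sigma> * \<bar>\<xi>\<bar>))\<^sup>2" for \<xi>
    by (simp add: power2_eq_square flip: exp_add)
  then show "square_integrable (\<lambda>\<xi>. of_real (exp (\<sigma> * \<bar>\<xi>\<bar>)) * fourier f \<xi>)"
    using assms by (simp add: Gspace_def square_integrable_def norm_mult power_mult_distrib)
qed

lemma Gdist_eq:
  assumes "f \<in> Gspace \<sigma>" "g \<in> Gspace \<sigma>"
  shows "Gdist \<sigma> f g = sqrt (LINT \<xi>|lborel. (cmod (of_real (exp (\<sigma> * \<bar>\<xi>\<bar>)) * fourier f \<xi>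
    - of_real (exp (\<sigma> * \<bar>\<xi>\<bar>)) * fourier g \<xi>))\<^sup>2)"
  unfolding Gdist_def right_diff_distrib[symmetric]
  using assms by (intro Gnorm_eq has_fourier_diff Gspace_has_fourier)

lemma has_fourier_0: "has_fourier (\<lambda>_. 0) (\<lambda>_. 0)"
  by (simp add: has_fourier_def square_integrable_def fourier_trunc_def)

theorem Metric_space_G: "Metric_space (Gspace \<sigma>) (Gdist \<sigma>)"
proof
  fix f g :: "real \<Rightarrow> complex"
  show "0 \<le> Gdist \<sigma> f g"
    by (auto simp: Gdist_def Gnorm_def intro!: integral_nonneg_AE)
  have neg: "has_fourier (\<lambda>x. g x - f x) (\<lambda>\<xi>. - F \<xi>)" if "has_fourier (\<lambda>x. f x - g x) F" for f g F
    using has_fourier_diff[OF has_fourier_0 that] by simp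
  show "Gdist \<sigma> f g = Gdist \<sigma> g f"
  proof (cases "\<exists>F. has_fourier (\<lambda>x. f x - g x) F")
    case True
    then obtain F where F: "has_fourier (\<lambda>x. f x - g x) F" ..
    show ?thesis
      unfolding Gdist_def Gnorm_eq[OF F] Gnorm_eq[OF neg[OF F]] by simp
  next
    case False
    moreover have "\<not> (\<exists>F. has_fourier (\<lambda>x. g x - f x) F)" using False neg by blast
    ultimately have "has_fourier (\<lambda>x. f x - g x) = has_fourier (\<lambda>x. g x - f x)" by auto
    then show ?thesis by (simp add: Gdist_def Gnorm_def fourier_def)
  qed
next
  fix f g assume fg: "f \<in> Gspace \<sigma>" "g \<in> Gspace \<sigma>"
  let ?w = "\<lambda>f \<xi>. complex_of_real (exp (\<sigma> * \<bar>\<xi>\<bar>)) * fourier f \<xi>"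
  show "Gdist \<sigma> f g = 0 \<longleftrightarrow> f = g"
  proof
    assume "Gdist \<sigma> f g = 0"
    then have "(LINT \<xi>|lborel. (cmod (?w f \<xi> - ?w g \<xi>))\<^sup>2) = 0"
      using fg by (simp add: Gdist_eq)
    moreover have "square_integrable (\<lambda>\<xi>. ?w f \<xi> - ?w g \<xi>)"
      using fg by (intro square_integrable_diff Gspace_has_fourier)
    ultimately have "AE \<xi> in lborel. (cmod (?w f \<xi> - ?w g \<xi>))\<^sup>2 = 0"
      by (subst (asm) integral_nonneg_eq_0_iff_AE) (auto simp: square_integrable_def)
    then have ae: "AE \<xi> in lborel. fourier f \<xi> - fourier g \<xi> = 0"
      by eventually_elim (simp flip: right_diff_distrib)
    have d: "has_fourier (\<lambda>x. f x - g x) (\<lambda>\<xi>. fourier f \<xi> - fourier g \<xi>)"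
      using fg by (intro has_fourier_diff Gspace_has_fourier)
    have "has_fourier (\<lambda>x. f x - g x) (\<lambda>_. 0)"
    proof -
      have "(\<integral>\<^sup>+\<xi>. ennreal ((cmod (fourier f \<xi> - fourier g \<xi> - fourier_trunc R (\<lambda>x. f x - g x) \<xi>))\<^sup>2) \<partial>lborel)
        = (\<integral>\<^sup>+\<xi>. ennreal ((cmod (0 - fourier_trunc R (\<lambda>x. f x - g x) \<xi>))\<^sup>2) \<partial>lborel)" for R
        using ae by (intro nn_integral_cong_AE) auto
      then show ?thesis
        using d by (simp add: has_fourier_def square_integrable_def)
    qed
    moreover have "continuous_on UNIV (\<lambda>x. f x - g x)"
      using fg by (auto simp: Gspace_def intro: continuous_on_diff)
    ultimately have "f y - g y = 0" for y by (rule has_fourier_zero)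
    then show "f = g" by auto
  next
    assume "f = g"
    then show "Gdist \<sigma> f g = 0" using fg by (simp add: Gdist_eq)
  qed
  fix h assume h: "h \<in> Gspace \<sigma>"
  have "square_integrable (\<lambda>\<xi>. ?w f \<xi> - ?w g \<xi>)" "square_integrable (\<lambda>\<xi>. ?w g \<xi> - ?w h \<xi>)"
    by (rule square_integrable_diff; rule Gspace_has_fourier; fact)+
  from L2_triangle[OF this] show "Gdist \<sigma> f h \<le> Gdist \<sigma> f g + Gdist \<sigma> g h"
    using fg h by (simp add: Gdist_eq)
qed

lemma mspace_Gmetric: "mspace (Gmetric \<sigma>) = Gspace \<sigma>"
  and mdist_Gmetric: "mdist (Gmetric \<sigma>) = Gdist \<sigma>"
  by (simp_all add: Gmetric_def Metric_space.mspace_metric[OF Metric_space_G]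
      Metric_space.mdist_metric[OF Metric_space_G])

end

theory Submission imports Defs
begin

text \<open>Put \<open>v(t,xi) = exp(\<sigma>|xi|) exp(i t \<phi>(xi)) u^(t,xi)\<close> with \<open>\<phi>(xi) = \<alpha> xi^5 - \<beta> xi^3\<close>.  Duhamel's formula
  turns into an integral equation for \<open>v\<close> whose quadratic and cubic terms carry the phases \<open>exp(i s \<Omega>)\<close>, with
  \<open>\<Omega>\<close> the resonance function, and the weights \<open>exp(-\<sigma>(|x| + |y| + ... - |xi|))\<close>, which confine the
  interacting frequencies to the convex hull of \<open>0\<close> and \<open>xi\<close>.  A path \<open>v\<close> is measured by a single
  \<open>U \<in> L\<^sup>2\<close> with \<open>|v(t,xi)| \<le> U(xi)\<close> and \<open>\<integral>|\<partial>\<^sub>t v(t,xi)| dt \<le> (1 + xi\<^sup>2) U(xi)\<close>.  Integrating the phase by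
  parts in time costs one derivative \<open>\<partial>\<^sub>t v\<close> and gains \<open>1 / (\<tau>\<^sup>-\<^sup>1 (1 + xi\<^sup>2) + |\<Omega>|)\<close>.  For large \<open>xi\<close> one has
  \<open>|\<Omega>| \<ge> c xi^4 d\<close>, \<open>d\<close> being the distance to the resonant set (this uses \<open>\<alpha> \<noteq> 0\<close>), so the
  kernel that remains has square integral \<open>O(sqrt \<tau>)\<close> in the interaction variables, uniformly in \<open>xi\<close>.
  Cauchy--Schwarz then makes the Duhamel map a contraction on short time intervals.  Multiplication by \<open>a\<close>
  is bounded on \<open>G\<^sup>\<sigma>\<close> by (A2).  The set \<open>X\<close> consists of the fixed points; the datum of a solution is its
  value at time \<open>0\<close>, which gives uniqueness in \<open>X\<close>.\<close>

text \<open>The rate \<open>\<sigma>\<close> must not drop, yet the x-derivative of a product of two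
  elements of G^sigma lies in general only in G^rho with rho < sigma. Duhamel's integrand leaves the
  data space, so the missing derivative has to come from the phase. The weight 1 + xi^2 in the time
  norm is the exponent at which this balances: with |Omega| about xi^4 d the squared kernel is about
  tau^2 xi^2 (1 + tau xi^2 d)^(-2), and integrating over d yields 1/(tau xi^2), which removes xi^2
  exactly. In the cubic case a resonant line is met at distance d by a segment of length about 2 d
  only; this turns tau^(-1) into at worst tau^(-3/2), and tau^2 tau^(-3/2) is the source of sqrt
  tau. The supremum in time is taken inside the L^2 norm in frequency because Cauchy-Schwarz is
  applied at each fixed xi. Majorants take values in [0, infinity], so that exceptional null sets of
  frequencies can be absorbed in U.\<close>

type_synonym path = "real => real => complex"

abbreviation nn_lborel :: "(real => ennreal) => ennreal" (binder "NN " 10) where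
 "nn_lborel f \<equiv> integral\<^sup>N lborel f"

abbreviation bm where "bm \<equiv> borel_measurable borel"

abbreviation joint where
 "joint (q :: real => real => _) \<equiv> (\<lambda>z. q (fst z) (snd z)) \<in> borel_measurable (borel \<Otimes>\<^sub>M borel)"

abbreviation sqn where "sqn U \<equiv> NN xi. (U xi)\<^sup>2"

abbreviation tnorm :: "real => (real => complex) => ennreal" where
 "tnorm \<tau> q \<equiv> NN s. ennreal (cmod (q s)) * indicator {0..\<tau>} s"

abbreviation l2sq :: "(real => complex) => ennreal" where
 "l2sq f \<equiv> (NN x. ennreal ((cmod (f x))\<^sup>2))"

abbreviation wl2 :: "real => (real => complex) => ennreal" where
 "wl2 \<sigma> F \<equiv> l2sq (\<lambda>xi. of_real (exp (\<sigma> * \<bar>xi\<bar>)) * F xi)"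

section \<open>The Fourier transform on \<open>L\<^sup>2\<close>\<close>

definition ft :: "(real => complex) => real => complex" where
 "ft f xi = (LINT x|lborel. f x * cis (- (x * xi)))"

definition ift :: "(real => complex) => real => complex" where
 "ift F x = (LINT xi|lborel. F xi * cis (x * xi)) / of_real (2 * pi)"

lemma integrable_cis_mult:
 assumes "integrable lborel f" "g \<in> borel_measurable lborel"
 shows "integrable lborel (\<lambda>x. f x * cis (g x))"
 using assms(1)
 by (rule Bochner_Integration.integrable_bound) (use assms in \<open>auto simp: norm_mult\<close>)

lemma ft_measurable [measurable]:
 assumes [measurable]: "f \<in> bm"
 shows "ft f \<in> bm"
 unfolding ft_def by measurable

lemma ift_measurable [measurable]:
 assumes [measurable]: "f \<in> bm"
 shows "ift f \<in> bm"
 unfolding ift_def by measurable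

lemma ift_eq_ft: "ift F x = ft F (- x) / of_real (2 * pi)"
 by (simp add: ift_def ft_def mult.commute)

lemma ft_bound: "cmod (ft f xi) \<le> (LINT x|lborel. cmod (f x))"
 unfolding ft_def using integral_norm_bound[of lborel "\<lambda>x. f x * cis (- (x * xi))"] by (simp add: norm_mult)

lemma ft_mult_integrable:
 assumes h: "integrable lborel h" and [measurable]: "f \<in> bm"
 shows "integrable lborel (\<lambda>xi. ft f xi * h xi)"
proof (rule Bochner_Integration.integrable_bound[OF integrable_mult_right[OF integrable_norm[OF h], of "LINT x|lborel. cmod (f x)"]])
 show "(\<lambda>xi. ft f xi * h xi) \<in> borel_measurable lborel"
  using borel_measurable_integrable[OF h] by measurable
 show "AE xi in lborel. norm (ft f xi * h xi) \<le> norm ((LINT x|lborel. cmod (f x)) * norm (h xi))"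
  using ft_bound[of f] by (intro AE_I2) (auto simp: norm_mult abs_mult intro!: mult_right_mono order_trans[OF ft_bound])
qed

lemma ft_multiplication:
 assumes f: "integrable lborel f" and h: "integrable lborel h"
 shows "(LINT xi|lborel. ft f xi * h xi) = (LINT x|lborel. f x * ft h x)"
proof -
 have [measurable]: "f \<in> bm" "h \<in> bm"
  using f h by auto
 have int: "integrable (lborel \<Otimes>\<^sub>M lborel) (\<lambda>(x, xi). f x * (h xi * cis (- (x * xi))))"
 proof (rule lborel_pair.Fubini_integrable)
  have "(LINT xi|lborel. norm (case (x, xi) of (x, xi) => f x * (h xi * cis (- (x * xi)))))
    = norm (f x) * (LINT xi|lborel. norm (h xi))" for x
   by (simp add: norm_mult)
  then show "integrable lborel (\<lambda>x. LINT xi|lborel. norm (case (x, xi) of (x, xi) => f x * (h xi * cis (- (x * xi)))))"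
   using f by (simp add: integrable_norm)
  show "AE x in lborel. integrable lborel (\<lambda>xi. case (x, xi) of (x, xi) => f x * (h xi * cis (- (x * xi))))"
   by (intro AE_I2) (auto intro!: integrable_mult_right integrable_cis_mult h)
 qed measurable
 have "(LINT xi|lborel. ft f xi * h xi) = (LINT xi|lborel. LINT x|lborel. f x * (h xi * cis (- (x * xi))))"
  unfolding ft_def by (subst integral_mult_left_zero[symmetric]) (simp add: mult_ac)
 also have "... = (LINT x|lborel. LINT xi|lborel. f x * (h xi * cis (- (x * xi))))"
  by (rule lborel_pair.Fubini_integral[OF int])
 also have "... = (LINT x|lborel. f x * ft h x)"
  unfolding ft_def by (subst integral_mult_right_zero[symmetric]) (simp add: mult_ac)
 finally show ?thesis .
qed

lemma ft_gaussian:
 assumes "n > 0"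
 shows "ft (\<lambda>xi. cis (y * xi) * of_real (std_normal_density (xi / n))) x = of_real (n * exp (- (n\<^sup>2 * (y - x)\<^sup>2) / 2))"
proof -
 have "cis (y * xi) * of_real (std_normal_density (xi / n)) * cis (- (x * xi))
   = cis ((y - x) * xi) * of_real (std_normal_density (xi / n))" for xi
  using cis_mult[of "y * xi" "- (x * xi)"] by (simp add: algebra_simps)
 then have "ft (\<lambda>xi. cis (y * xi) * of_real (std_normal_density (xi / n))) x
   = (LINT xi|lborel. cis ((y - x) * xi) * of_real (std_normal_density (xi / n)))"
  unfolding ft_def by (intro Bochner_Integration.integral_cong) (simp_all only: mult.commute[of _ x])
 then show ?thesis using gaussian_integral(2)[OF assms, of "y - x"] by (simp only:)
qed

lemma gaussian_cis_integrable:
 assumes "n > 0"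
 shows "integrable lborel (\<lambda>xi. cis (y * xi) * complex_of_real (std_normal_density (xi / n)))"
 using gaussian_integral(1)[OF assms] by (rule Bochner_Integration.integrable_bound) (auto simp: norm_mult)

lemma nn_gauss_kernel:
 assumes "n > 0"
 shows "(NN x. ennreal (n * exp (- (n\<^sup>2 * (y - x)\<^sup>2) / 2))) = ennreal (sqrt (2 * pi))"
proof -
 have "integrable lborel (\<lambda>x. n * exp (- (n\<^sup>2 * (y - x)\<^sup>2) / 2))"
  using gauss_kernel(1)[OF assms, of y] by (rule integrable_mult_right)
 then have "(NN x. ennreal (n * exp (- (n\<^sup>2 * (y - x)\<^sup>2) / 2))) = ennreal (LINT x|lborel. n * exp (- (n\<^sup>2 * (y - x)\<^sup>2) / 2))"
  using assms by (intro nn_integral_eq_integral) auto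
 also have "(LINT x|lborel. n * exp (- (n\<^sup>2 * (y - x)\<^sup>2) / 2)) = sqrt (2 * pi)"
  using gauss_kernel(2)[OF assms, of y] assms by simp
 finally show ?thesis .
qed

section \<open>Bessel's inequality for integrable functions\<close>

lemma l2sq_reflect:
 assumes [measurable]: "f \<in> bm"
 shows "l2sq (\<lambda>x. f (- x)) = l2sq f"
 using nn_integral_real_affine[of "\<lambda>x. ennreal ((cmod (f x))\<^sup>2)" "-1" 0] by simp

text \<open>Schur's test: 2|f g| is at most |f|^2 + |g|^2, and every row and column of the Gaussian
  kernel has mass sqrt(2 pi), whatever \<open>n\<close> is. Keeping the factor 2 on the left avoids
  division in \<open>ennreal\<close>.\<close>

lemma young_gauss:
 assumes n: "n > 0" and [measurable]: "f \<in> bm" "g \<in> bm"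
 shows "2 * (NN x. NN y. ennreal (cmod (f x) * cmod (g y) * (n * exp (- (n\<^sup>2 * (y - x)\<^sup>2) / 2))))
   \<le> ennreal (sqrt (2 * pi)) * (l2sq f + l2sq g)"
proof -
 let ?K = "\<lambda>x y. n * exp (- (n\<^sup>2 * (y - x)\<^sup>2) / 2)"
 have K0: "?K x y \<ge> 0" for x y using n by simp
 have sym: "?K x y = ?K y x" for x y by (simp add: power2_commute)
 have "2 * (NN x. NN y. ennreal (cmod (f x) * cmod (g y) * ?K x y))
   = (NN x. NN y. ennreal 2 * ennreal (cmod (f x) * cmod (g y) * ?K x y))"
  by (simp add: nn_integral_cmult)
 also have "... \<le> (NN x. NN y. ennreal ((cmod (f x))\<^sup>2) * ennreal (?K x y) + ennreal ((cmod (g y))\<^sup>2) * ennreal (?K x y))"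
 proof (intro nn_integral_mono)
  fix x y
  have "2 * (cmod (f x) * cmod (g y) * k) \<le> (cmod (f x))\<^sup>2 * k + (cmod (g y))\<^sup>2 * k" if "k \<ge> 0" for k
   using mult_right_mono[OF sum_squares_bound[of "cmod (f x)" "cmod (g y)"] that] by (simp add: algebra_simps)
  from this[OF K0[of y x]] have "2 * (cmod (f x) * cmod (g y) * ?K x y) \<le> (cmod (f x))\<^sup>2 * ?K x y + (cmod (g y))\<^sup>2 * ?K x y" .
  then have "ennreal (2 * (cmod (f x) * cmod (g y) * ?K x y)) \<le> ennreal ((cmod (f x))\<^sup>2 * ?K x y + (cmod (g y))\<^sup>2 * ?K x y)"
   by (rule ennreal_leI)
  then show "ennreal 2 * ennreal (cmod (f x) * cmod (g y) * ?K x y)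
    \<le> ennreal ((cmod (f x))\<^sup>2) * ennreal (?K x y) + ennreal ((cmod (g y))\<^sup>2) * ennreal (?K x y)"
   using K0[of y x] n by (subst (asm) ennreal_plus) (auto simp: ennreal_mult simp flip: ennreal_numeral)
 qed
 also have "... = (NN x. NN y. ennreal ((cmod (f x))\<^sup>2) * ennreal (?K x y))
    + (NN x. NN y. ennreal ((cmod (g y))\<^sup>2) * ennreal (?K x y))"
  by (simp add: nn_integral_add)
 also have "(NN x. NN y. ennreal ((cmod (g y))\<^sup>2) * ennreal (?K x y))
   = (NN y. NN x. ennreal ((cmod (g y))\<^sup>2) * ennreal (?K x y))"
  by (rule lborel_pair.Fubini') simp
 also have "... = (NN y. ennreal ((cmod (g y))\<^sup>2) * ennreal (sqrt (2 * pi)))"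
  using nn_gauss_kernel[OF n] by (subst nn_integral_cmult) (simp_all add: sym[of _ y for y] power2_commute)
 also have "(NN x. NN y. ennreal ((cmod (f x))\<^sup>2) * ennreal (?K x y))
   = (NN x. ennreal ((cmod (f x))\<^sup>2) * ennreal (sqrt (2 * pi)))"
  using nn_gauss_kernel[OF n] by (subst nn_integral_cmult) (simp_all add: power2_commute)
 also have "(NN y. ennreal ((cmod (g y))\<^sup>2) * ennreal (sqrt (2 * pi))) = l2sq g * ennreal (sqrt (2 * pi))"
  by (rule nn_integral_multc) simp
 also have "(NN y. ennreal ((cmod (f y))\<^sup>2) * ennreal (sqrt (2 * pi))) = l2sq f * ennreal (sqrt (2 * pi))"
  by (rule nn_integral_multc) simp
 finally show ?thesis by (simp only: distrib_left mult.commute)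
qed

text \<open>With \<open>f2\<close> the conjugate reflection of \<open>f\<close>, |ft f|^2 is the
  product of \<open>ft f\<close> and \<open>ft f2\<close>. After damping by a Gaussian the
  multiplication formula can be applied twice, and the result pairs \<open>f\<close> and
  \<open>f2\<close> through a Gaussian kernel, bounded by \<open>young_gauss\<close> uniformly in
  \<open>n\<close>. Fatou removes the damping. The right-hand side may be infinite.\<close>

lemma bessel:
 assumes f: "integrable lborel f"
 shows "l2sq (ft f) \<le> ennreal (2 * pi) * l2sq f"
proof -
 have [measurable]: "f \<in> bm" using f by auto
 define e where "e n xi = sqrt (2 * pi) * std_normal_density (xi / n)" for n xi :: real
 have e_eq: "e n xi = exp (- (xi / n)\<^sup>2 / 2)" for n xi
  by (simp add: e_def std_normal_density_def)
 have [measurable]: "e n \<in> bm" for n unfolding e_def by measurable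
 define f2 where "f2 = (\<lambda>y. cnj (f (- y)))"
 have [measurable]: "f2 \<in> bm"
  unfolding f2_def using borel_measurable_continuous_on[OF continuous_on_cnj[OF continuous_on_id]] by measurable
 have f2i: "integrable lborel f2"
 proof -
  have "integrable lborel (\<lambda>y. f (- y))" using lborel_integrable_real_affine[OF f, of "-1" 0] by simp
  then show ?thesis unfolding f2_def by simp
 qed
 have f2: "ft f2 xi = cnj (ft f xi)" for xi
 proof -
  have "ft f2 xi = (LINT y|lborel. cnj (f (- y) * cis (y * xi)))"
   by (simp add: ft_def f2_def cis_cnj)
  also have "... = cnj (LINT y|lborel. f (- y) * cis (y * xi))" by (rule Bochner_Integration.integral_cnj)
  also have "(LINT y|lborel. f (- y) * cis (y * xi)) = ft f xi"
   using lborel_integral_real_affine[of "-1" "\<lambda>x. f x * cis (- (x * xi))" 0] by (simp add: ft_def)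
  finally show ?thesis .
 qed
 have main: "(NN xi. ennreal ((cmod (ft f xi))\<^sup>2) * ennreal (e n xi)) \<le> ennreal (2 * pi) * l2sq f" if n: "n > 0" for n
 proof -
  let ?K = "\<lambda>x y. n * exp (- (n\<^sup>2 * (y - x)\<^sup>2) / 2)"
  have ei: "integrable lborel (\<lambda>xi. complex_of_real (e n xi))"
   using gaussian_integral(1)[OF n] unfolding e_def by (intro integrable_of_real integrable_mult_right)
  have hi: "integrable lborel (\<lambda>xi. ft f2 xi * of_real (e n xi))"
   using ei by (rule ft_mult_integrable) simp
  have "ft f xi * (ft f2 xi * of_real (e n xi)) = complex_of_real ((cmod (ft f xi))\<^sup>2 * e n xi)" for xi
   unfolding f2 of_real_mult complex_norm_square by simp
  then have i1: "integrable lborel (\<lambda>xi. complex_of_real ((cmod (ft f xi))\<^sup>2 * e n xi))"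
   and eq1: "(LINT xi|lborel. complex_of_real ((cmod (ft f xi))\<^sup>2 * e n xi)) = (LINT x|lborel. f x * ft (\<lambda>xi. ft f2 xi * of_real (e n xi)) x)"
   using ft_mult_integrable[OF hi, of f] ft_multiplication[OF f hi] by (simp_all only:) simp
  \<comment> \<open>The second use of \<open>ft_multiplication\<close>: the transform leaves
    \<open>f2\<close> and falls on a modulated Gaussian, which is again a Gaussian.\<close>
  have eq2: "ft (\<lambda>xi. ft f2 xi * of_real (e n xi)) x = (LINT y|lborel. f2 y * of_real (sqrt (2 * pi) * ?K (- x) y))" for x
  proof -
   have "ft (\<lambda>xi. ft f2 xi * of_real (e n xi)) x
     = (LINT xi|lborel. ft f2 xi * (of_real (sqrt (2 * pi)) * (cis ((- x) * xi) * of_real (std_normal_density (xi / n)))))"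
    unfolding ft_def[of "\<lambda>xi. ft f2 xi * of_real (e n xi)"]
    by (intro Bochner_Integration.integral_cong refl) (simp add: e_def mult_ac)
   also have "... = of_real (sqrt (2 * pi)) * (LINT xi|lborel. ft f2 xi * (cis ((- x) * xi) * of_real (std_normal_density (xi / n))))"
    by (subst integral_mult_right_zero[symmetric]) (simp add: mult_ac)
   also have "(LINT xi|lborel. ft f2 xi * (cis ((- x) * xi) * of_real (std_normal_density (xi / n))))
     = (LINT y|lborel. f2 y * of_real (?K y (- x)))"
    by (subst ft_multiplication[OF f2i gaussian_cis_integrable[OF n]]) (simp only: ft_gaussian[OF n])
   also have "of_real (sqrt (2 * pi)) * ... = (LINT y|lborel. f2 y * of_real (sqrt (2 * pi) * ?K (- x) y))"
    by (subst integral_mult_right_zero[symmetric]) (simp add: mult_ac power2_commute)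
   finally show ?thesis .
  qed
  have nn: "(NN xi. ennreal ((cmod (ft f xi))\<^sup>2 * e n xi)) = ennreal (cmod (LINT xi|lborel. complex_of_real ((cmod (ft f xi))\<^sup>2 * e n xi)))"
  proof -
   have i2: "integrable lborel (\<lambda>xi. (cmod (ft f xi))\<^sup>2 * e n xi)"
    using integrable_Re[OF i1] by (simp only: Re_complex_of_real)
   have "(NN xi. ennreal ((cmod (ft f xi))\<^sup>2 * e n xi)) = ennreal (LINT xi|lborel. (cmod (ft f xi))\<^sup>2 * e n xi)"
    using i2 by (intro nn_integral_eq_integral) (auto simp: e_eq)
   moreover have "0 \<le> (LINT xi|lborel. (cmod (ft f xi))\<^sup>2 * e n xi)"
    by (intro integral_nonneg_AE) (auto simp: e_eq)
   ultimately show ?thesis by (simp only: integral_complex_of_real norm_of_real) simp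
  qed
  have "(NN xi. ennreal ((cmod (ft f xi))\<^sup>2 * e n xi))
    \<le> (NN x. ennreal (cmod (f x * ft (\<lambda>xi. ft f2 xi * of_real (e n xi)) x)))"
   unfolding nn eq1
   using integral_norm_bound_ennreal[of lborel "\<lambda>x. f x * ft (\<lambda>xi. ft f2 xi * of_real (e n xi)) x"]
   by (cases "integrable lborel (\<lambda>x. f x * ft (\<lambda>xi. ft f2 xi * of_real (e n xi)) x)") (auto simp: not_integrable_integral_eq)
  also have "... \<le> (NN x. NN y. ennreal (sqrt (2 * pi)) * ennreal (cmod (f x) * cmod (f2 y) * ?K (- x) y))"
  proof (rule nn_integral_mono)
   fix x
   have "ennreal (cmod (LINT y|lborel. f2 y * of_real (sqrt (2 * pi) * ?K (- x) y))) \<le> (NN y. ennreal (cmod (f2 y) * (sqrt (2 * pi) * ?K (- x) y)))"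
    using integral_norm_bound_ennreal[of lborel "\<lambda>y. f2 y * of_real (sqrt (2 * pi) * ?K (- x) y)"] n
    by (cases "integrable lborel (\<lambda>y. f2 y * of_real (sqrt (2 * pi) * ?K (- x) y))")
     (auto simp: not_integrable_integral_eq norm_mult abs_mult)
   then have "ennreal (cmod (f x)) * ennreal (cmod (LINT y|lborel. f2 y * of_real (sqrt (2 * pi) * ?K (- x) y)))
     \<le> (NN y. ennreal (cmod (f x)) * ennreal (cmod (f2 y) * (sqrt (2 * pi) * ?K (- x) y)))"
    by (subst nn_integral_cmult) (auto intro!: mult_left_mono)
   also have "... = (NN y. ennreal (sqrt (2 * pi)) * ennreal (cmod (f x) * cmod (f2 y) * ?K (- x) y))"
    using n by (intro nn_integral_cong) (simp add: mult_ac flip: ennreal_mult')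
   finally show "ennreal (cmod (f x * ft (\<lambda>xi. ft f2 xi * of_real (e n xi)) x))
     \<le> (NN y. ennreal (sqrt (2 * pi)) * ennreal (cmod (f x) * cmod (f2 y) * ?K (- x) y))"
    unfolding eq2 norm_mult by (subst ennreal_mult) auto
  qed
  also have "... = ennreal (sqrt (2 * pi)) * (NN x. NN y. ennreal (cmod (f x) * cmod (f2 y) * ?K (- x) y))"
   by (simp add: nn_integral_cmult)
  also have "(NN x. NN y. ennreal (cmod (f x) * cmod (f2 y) * ?K (- x) y))
    = (NN x. NN y. ennreal (cmod (f (- x)) * cmod (f2 y) * ?K x y))"
   using nn_integral_real_affine[of "\<lambda>x. NN y. ennreal (cmod (f x) * cmod (f2 y) * ?K (- x) y)" "-1" 0] by simp
  finally have le: "(NN xi. ennreal ((cmod (ft f xi))\<^sup>2 * e n xi))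
    \<le> ennreal (sqrt (2 * pi)) * (NN x. NN y. ennreal (cmod (f (- x)) * cmod (f2 y) * ?K x y))" (is "_ \<le> _ * ?I") .
  have "2 * ?I \<le> ennreal (sqrt (2 * pi)) * (l2sq (\<lambda>x. f (- x)) + l2sq f2)"
   by (rule young_gauss[OF n]) auto
  also have "l2sq f2 = l2sq f"
   using l2sq_reflect[of f] by (simp add: f2_def)
  also have "l2sq (\<lambda>x. f (- x)) = l2sq f" by (rule l2sq_reflect) simp
  also have "ennreal (sqrt (2 * pi)) * (l2sq f + l2sq f) = 2 * (ennreal (sqrt (2 * pi)) * l2sq f)"
   by (simp only: mult_2 distrib_left)
  finally have "?I \<le> ennreal (sqrt (2 * pi)) * l2sq f"
   by (rule ennreal_mult_le_mult_iff[THEN iffD1, rotated 2]) simp_all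
  with le have "(NN xi. ennreal ((cmod (ft f xi))\<^sup>2 * e n xi)) \<le> ennreal (sqrt (2 * pi)) * (ennreal (sqrt (2 * pi)) * l2sq f)"
   by (meson mult_left_mono order_trans zero_le)
  moreover have "ennreal (sqrt (2 * pi)) * (ennreal (sqrt (2 * pi)) * l2sq f) = ennreal (2 * pi) * l2sq f"
   by (subst mult.assoc[symmetric], subst ennreal_mult[symmetric]) simp_all
  moreover have "ennreal ((cmod (ft f xi))\<^sup>2 * e n xi) = ennreal ((cmod (ft f xi))\<^sup>2) * ennreal (e n xi)" for xi
   by (rule ennreal_mult) (simp_all add: e_eq)
  ultimately show ?thesis by (simp only:)
 qed
 \<comment> \<open>The damping factors tend to 1 pointwise, so Fatou passes to the undamped norm;
   \<open>Suc n\<close> keeps the width positive.\<close>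
 have "l2sq (ft f) = (NN xi. liminf (\<lambda>n. ennreal ((cmod (ft f xi))\<^sup>2) * ennreal (e (Suc n) xi)))"
 proof (rule nn_integral_cong)
  fix xi
  have "(\<lambda>n. xi * inverse (real (Suc n))) \<longlonglongrightarrow> xi * 0" by (intro tendsto_intros LIMSEQ_inverse_real_of_nat)
  then have "(\<lambda>n. exp (- (xi * inverse (real (Suc n)))\<^sup>2 / 2)) \<longlonglongrightarrow> exp (- (xi * 0)\<^sup>2 / 2)"
   by (rule tendsto_exp[OF tendsto_divide[OF tendsto_minus[OF tendsto_power] tendsto_const]]) simp
  then have "(\<lambda>n. ennreal (exp (- (xi * inverse (real (Suc n)))\<^sup>2 / 2))) \<longlonglongrightarrow> ennreal (exp (- (xi * 0)\<^sup>2 / 2))"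
   by (rule tendsto_ennrealI)
  then have "(\<lambda>n. ennreal ((cmod (ft f xi))\<^sup>2) * ennreal (e (Suc n) xi)) \<longlonglongrightarrow> ennreal ((cmod (ft f xi))\<^sup>2) * ennreal (exp (- (xi * 0)\<^sup>2 / 2))"
   unfolding e_eq divide_inverse[of xi] by (intro ennreal_tendsto_cmult) auto
  then show "ennreal ((cmod (ft f xi))\<^sup>2) = liminf (\<lambda>n. ennreal ((cmod (ft f xi))\<^sup>2) * ennreal (e (Suc n) xi))"
   by (subst lim_imp_Liminf) auto
 qed
 also have "... \<le> liminf (\<lambda>n. NN xi. ennreal ((cmod (ft f xi))\<^sup>2) * ennreal (e (Suc n) xi))"
  by (rule nn_integral_liminf) simp
 also have "... \<le> limsup (\<lambda>n. NN xi. ennreal ((cmod (ft f xi))\<^sup>2) * ennreal (e (Suc n) xi))"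
  by (rule Liminf_le_Limsup) simp
 also have "... \<le> ennreal (2 * pi) * l2sq f"
  using main[of "real (Suc n)" for n] by (intro Limsup_bounded always_eventually allI) simp
 finally show ?thesis .
qed


text \<open>Positive and negative part of \<open>g\<close> have equal mass (take y = 0) and, divided
  by that mass, become probability densities with the same characteristic function. Levy's
  uniqueness theorem makes them equal almost everywhere.\<close>

lemma L1_fourier_inj_real:
 fixes g :: "real => real"
 assumes g: "integrable lborel g" and z: "\<And>y. (LINT x|lborel. of_real (g x) * cis (y * x)) = 0"
 shows "AE x in lborel. g x = 0"
proof -
 define p where "p x = max 0 (g x)" for x
 define q where "q x = max 0 (- g x)" for x
 have pq: "p x \<ge> 0" "q x \<ge> 0" "g x = p x - q x" for x by (auto simp: p_def q_def)
 have ip: "integrable lborel p" and iq: "integrable lborel q"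
  unfolding p_def q_def using g by auto
 have [measurable]: "p \<in> bm" "q \<in> bm" using ip iq by auto
 have cp: "integrable lborel (\<lambda>x. of_real (p x) * cis (y * x))" "integrable lborel (\<lambda>x. of_real (q x) * cis (y * x))" for y
  using ip iq by (intro integrable_cis_mult integrable_of_real; simp)+
 have eq: "(LINT x|lborel. of_real (p x) * cis (y * x)) = (LINT x|lborel. of_real (q x) * cis (y * x))" for y
  using z[of y] Bochner_Integration.integral_diff[OF cp[of y]] by (simp add: pq(3) left_diff_distrib)
 define m where "m = (LINT x|lborel. p x)"
 have mq: "m = (LINT x|lborel. q x)"
  using eq[of 0] unfolding m_def by simp
 have m0: "m \<ge> 0" unfolding m_def using pq by (intro integral_nonneg_AE) auto
 show ?thesis
 proof (cases "m = 0")
  case True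
  have "AE x in lborel. p x = 0" "AE x in lborel. q x = 0"
   using True m_def mq pq ip iq integral_nonneg_eq_0_iff_AE[OF ip] integral_nonneg_eq_0_iff_AE[OF iq] by auto
  then show ?thesis by eventually_elim (simp add: pq(3))
 next
  case False
  with m0 have m: "m > 0" by simp
  have rd: "real_distribution (density lborel (\<lambda>x. ennreal (r x / m)))" and
   ch: "char (density lborel (\<lambda>x. ennreal (r x / m))) y = (LINT x|lborel. of_real (r x) * cis (y * x)) / of_real m"
   if r: "integrable lborel r" "\<And>x. r x \<ge> 0" "m = (LINT x|lborel. r x)" for r y
  proof -
   have [measurable]: "r \<in> bm" using r by auto
   have "prob_space (density lborel (\<lambda>x. ennreal (r x / m)))"
   proof (rule prob_spaceI)
    have "emeasure (density lborel (\<lambda>x. ennreal (r x / m))) (space (density lborel (\<lambda>x. ennreal (r x / m)))) = (NN x. ennreal (r x / m))"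
     by (simp add: emeasure_density)
    also have "... = ennreal (LINT x|lborel. r x / m)"
     using r m by (intro nn_integral_eq_integral) auto
    finally show "emeasure (density lborel (\<lambda>x. ennreal (r x / m))) (space (density lborel (\<lambda>x. ennreal (r x / m)))) = 1"
     using r(3) m by simp
   qed
   then show "real_distribution (density lborel (\<lambda>x. ennreal (r x / m)))"
    by (intro real_distribution.intro real_distribution_axioms.intro) auto
   have "char (density lborel (\<lambda>x. ennreal (r x / m))) y = (LINT x|lborel. (r x / m) *\<^sub>R iexp (y * x))"
    unfolding char_def using r m by (subst integral_density) auto
   also have "... = (LINT x|lborel. (of_real (r x) * cis (y * x)) / of_real m)"
    by (intro Bochner_Integration.integral_cong) (auto simp: scaleR_conv_of_real cis_conv_exp)
   finally show "char (density lborel (\<lambda>x. ennreal (r x / m))) y = (LINT x|lborel. of_real (r x) * cis (y * x)) / of_real m"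
    by simp
  qed
  have "density lborel (\<lambda>x. ennreal (p x / m)) = density lborel (\<lambda>x. ennreal (q x / m))"
   using rd[OF ip pq(1) m_def] rd[OF iq pq(2) mq] ch[OF ip pq(1) m_def] ch[OF iq pq(2) mq] eq
   by (intro Levy_uniqueness ext) (simp_all only:)
  then have "AE x in lborel. ennreal (p x / m) = ennreal (q x / m)"
   by (intro sigma_finite_measure.density_unique_iff[OF sigma_finite_lborel, THEN iffD1]) auto
  then show ?thesis
  proof eventually_elim
   case (elim x)
   then have "p x / m = q x / m" using m pq(1,2)[of x] by (subst (asm) ennreal_inj) auto
   then show "g x = 0" using m pq(3)[of x] by (simp add: field_simps)
  qed
 qed
qed

lemma L1_fourier_inj:
 assumes F: "integrable lborel F" and z: "\<And>y. (LINT x|lborel. F x * cis (y * x)) = 0"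
 shows "AE x in lborel. F x = (0::complex)"
proof -
 have iF: "integrable lborel (\<lambda>x. F x * cis (y * x))" for y
  using F by (rule integrable_cis_mult) simp
 have iG: "integrable lborel (\<lambda>x. cnj (F x) * cis (y * x))" for y
  using F by (intro integrable_cis_mult) auto
 have zc: "(LINT x|lborel. cnj (F x) * cis (y * x)) = 0" for y
 proof -
  have "(LINT x|lborel. cnj (F x) * cis (y * x)) = cnj (LINT x|lborel. F x * cis ((- y) * x))"
   by (subst Bochner_Integration.integral_cnj[symmetric]) (simp add: cis_cnj)
  then show ?thesis using z[of "- y"] by (simp only: complex_cnj_zero)
 qed
 have "AE x in lborel. Re (F x) = 0"
 proof (rule L1_fourier_inj_real)
  fix y
  have "of_real (Re (F x)) * cis (y * x) = (F x * cis (y * x) + cnj (F x) * cis (y * x)) / 2" for x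
   by (simp add: complex_eq_iff algebra_simps)
  then have "(LINT x|lborel. of_real (Re (F x)) * cis (y * x)) = (LINT x|lborel. (F x * cis (y * x) + cnj (F x) * cis (y * x)) / 2)"
   by (simp only:)
  also have "... = 0"
   using iF[of y] iG[of y] z[of y] zc[of y] by simp
  finally show "(LINT x|lborel. of_real (Re (F x)) * cis (y * x)) = 0" .
 qed (use F in auto)
 moreover have "AE x in lborel. Im (F x) = 0"
 proof (rule L1_fourier_inj_real)
  fix y
  have "of_real (Im (F x)) * cis (y * x) = (F x * cis (y * x) - cnj (F x) * cis (y * x)) / (2 * \<i>)" for x
   by (simp add: complex_eq_iff algebra_simps Re_divide Im_divide)
  then have "(LINT x|lborel. of_real (Im (F x)) * cis (y * x)) = (LINT x|lborel. (F x * cis (y * x) - cnj (F x) * cis (y * x)) / (2 * \<i>))"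
   by (simp only:)
  also have "... = 0"
   using iF[of y] iG[of y] z[of y] zc[of y] by simp
  finally show "(LINT x|lborel. of_real (Im (F x)) * cis (y * x)) = 0" .
 qed (use F in auto)
 ultimately show ?thesis by eventually_elim (simp add: complex_eq_iff)
qed

text \<open>Weighted by 2^k the squared increments still have summable integrals. Where the weighted
  series converges, an increment is either at most 2^(-k) or at most 2^k times its own square, so
  the increments are absolutely summable.\<close>

lemma AE_convergent_L2:
 fixes f :: "nat => 'a => complex"
 assumes [measurable]: "\<And>k. f k \<in> borel_measurable M"
  and b: "\<And>k. (\<integral>\<^sup>+x. ennreal ((cmod (f (Suc k) x - f k x))\<^sup>2) \<partial>M) \<le> c * ennreal ((1/4) ^ k)" and c: "c < \<infinity>"
 shows "AE x in M. convergent (\<lambda>k. f k x)"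
proof -
 have "(\<integral>\<^sup>+x. (\<Sum>k. ennreal (2 ^ k * (cmod (f (Suc k) x - f k x))\<^sup>2)) \<partial>M)
   = (\<Sum>k. \<integral>\<^sup>+x. ennreal (2 ^ k * (cmod (f (Suc k) x - f k x))\<^sup>2) \<partial>M)"
  by (rule nn_integral_suminf) simp
 also have "... \<le> (\<Sum>k. c * ennreal ((1/2) ^ k))"
 proof (intro suminf_le)
  fix k
  have "(\<integral>\<^sup>+x. ennreal (2 ^ k * (cmod (f (Suc k) x - f k x))\<^sup>2) \<partial>M) = ennreal (2 ^ k) * (\<integral>\<^sup>+x. ennreal ((cmod (f (Suc k) x - f k x))\<^sup>2) \<partial>M)"
   by (subst nn_integral_cmult[symmetric]) (auto simp: ennreal_mult)
  also have "... \<le> ennreal (2 ^ k) * (c * ennreal ((1/4) ^ k))" by (intro mult_left_mono b) simp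
  also have "... = c * ennreal (2 ^ k * (1/4) ^ k)" by (simp add: ennreal_mult mult_ac)
  also have "(2 ^ k * (1/4) ^ k :: real) = (1/2) ^ k" by (subst power_mult_distrib[symmetric]) simp
  finally show "(\<integral>\<^sup>+x. ennreal (2 ^ k * (cmod (f (Suc k) x - f k x))\<^sup>2) \<partial>M) \<le> c * ennreal ((1/2) ^ k)" .
 qed auto
 also have "... = c * (\<Sum>k. ennreal ((1/2) ^ k))" by (rule ennreal_suminf_cmult)
 also have "... < \<infinity>"
  using c by (subst suminf_ennreal2) (auto simp: ennreal_mult_less_top intro!: summable_geometric)
 finally have "AE x in M. (\<Sum>k. ennreal (2 ^ k * (cmod (f (Suc k) x - f k x))\<^sup>2)) \<noteq> \<infinity>"
  by (intro nn_integral_PInf_AE) auto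
 then show ?thesis
 proof eventually_elim
  case (elim x)
  have s1: "summable (\<lambda>k. 2 ^ k * (cmod (f (Suc k) x - f k x))\<^sup>2)"
   using elim by (intro summable_suminf_not_top) auto
  have "summable (\<lambda>k. f (Suc k) x - f k x)"
  proof (rule summable_comparison_test'[where N=0])
   show "summable (\<lambda>k. (1/2) ^ k + 2 ^ k * (cmod (f (Suc k) x - f k x))\<^sup>2)"
    using s1 by (intro summable_add summable_geometric) auto
   fix k
   define d where "d = cmod (f (Suc k) x - f k x)"
   have "d \<le> (1/2) ^ k + 2 ^ k * d\<^sup>2"
   proof (cases "d \<le> (1/2) ^ k")
    case True then show ?thesis by (simp add: add_increasing2 d_def)
   next
    case False
    then have "1 \<le> 2 ^ k * d" by (simp add: power_one_over field_simps)
    then have "d * 1 \<le> d * (2 ^ k * d)" by (intro mult_left_mono) (auto simp: d_def)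
    then show ?thesis by (simp add: power2_eq_square mult_ac add_increasing)
   qed
   then show "norm (f (Suc k) x - f k x) \<le> (1/2) ^ k + 2 ^ k * (cmod (f (Suc k) x - f k x))\<^sup>2"
    by (simp add: d_def)
  qed
  then have "convergent (\<lambda>n. \<Sum>k<n. f (Suc k) x - f k x)"
   by (simp add: summable_iff_convergent)
  then have "convergent (\<lambda>n. (\<Sum>k<n. f (Suc k) x - f k x) + f 0 x)"
   by (intro convergent_add convergent_const)
  moreover have "(\<lambda>n. (\<Sum>k<n. f (Suc k) x - f k x) + f 0 x) = (\<lambda>n. f n x)"
   using sum_lessThan_telescope[of "\<lambda>k. f k x"] by simp
  ultimately show "convergent (\<lambda>n. f n x)" by (simp only:)
 qed
qed

section \<open>Existence of the transform in L^2\<close>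

definition tail :: "(real => complex) => real => ennreal" where
 "tail f R = (NN x. ennreal ((cmod (f x))\<^sup>2) * indicator {x. \<bar>x\<bar> > R} x)"

lemma fourier_trunc_eq_ft: "fourier_trunc R f = ft (\<lambda>x. indicator {-R..R} x *\<^sub>R f x)"
 by (simp add: fun_eq_iff fourier_trunc_def ft_def set_lebesgue_integral_def)

lemma fourier_trunc_bound:
 assumes f: "square_integrable f"
 shows "l2sq (fourier_trunc R f) \<le> ennreal (2 * pi) * l2sq f"
proof -
 have "l2sq (fourier_trunc R f) \<le> ennreal (2 * pi) * l2sq (\<lambda>x. indicator {-R..R} x *\<^sub>R f x)"
  unfolding fourier_trunc_eq_ft using square_integrable_truncated[OF f]
  by (intro bessel) (simp add: set_integrable_def)
 also have "... \<le> ennreal (2 * pi) * l2sq f"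
  by (intro mult_left_mono nn_integral_mono) (auto simp: indicator_def)
 finally show ?thesis .
qed

lemma fourier_trunc_tail:
 assumes f: "square_integrable f" and le: "R \<le> R'"
 shows "(NN xi. ennreal ((cmod (fourier_trunc R' f xi - fourier_trunc R f xi))\<^sup>2)) \<le> ennreal (2 * pi) * tail f R"
proof -
 have [measurable]: "f \<in> bm" using f by (auto simp: square_integrable_def)
 let ?d = "\<lambda>x. indicator {-R'..R'} x *\<^sub>R f x - indicator {-R..R} x *\<^sub>R f x"
 have i: "integrable lborel (\<lambda>x. indicator {-R..R} x *\<^sub>R f x)" for R
  using square_integrable_truncated[OF f] by (simp add: set_integrable_def)
 have "fourier_trunc R' f xi - fourier_trunc R f xi = ft ?d xi" for xi
  unfolding fourier_trunc_eq_ft ft_def left_diff_distrib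
  by (intro Bochner_Integration.integral_diff[symmetric] integrable_cis_mult i) simp_all
 then have "(NN xi. ennreal ((cmod (fourier_trunc R' f xi - fourier_trunc R f xi))\<^sup>2)) = l2sq (ft ?d)" by simp
 also have "... \<le> ennreal (2 * pi) * l2sq ?d"
  by (intro bessel Bochner_Integration.integrable_diff i)
 also have "... \<le> ennreal (2 * pi) * tail f R"
  unfolding tail_def using le by (intro mult_left_mono nn_integral_mono) (auto simp: indicator_def)
 finally show ?thesis .
qed

lemma tail_tendsto:
 assumes f: "square_integrable f"
 shows "(tail f \<longlongrightarrow> 0) at_top"
proof (rule tendsto_at_topI_sequentially)
 fix X :: "nat => real" assume X: "filterlim X at_top sequentially"
 have [measurable]: "f \<in> bm" using f by (auto simp: square_integrable_def)
 have "(\<lambda>n. NN x. ennreal ((cmod (f x))\<^sup>2) * indicator {x. \<bar>x\<bar> > X n} x) \<longlonglongrightarrow> (NN x. (\<lambda>_::real. 0) x)"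
 proof (rule nn_integral_dominated_convergence)
  show "(NN x. ennreal ((cmod (f x))\<^sup>2)) < \<infinity>" by (rule square_integrable_nn[OF f])
  show "AE x in lborel. (\<lambda>n. ennreal ((cmod (f x))\<^sup>2) * indicator {x. \<bar>x\<bar> > X n} x) \<longlonglongrightarrow> 0"
  proof (intro AE_I2 tendsto_eventually)
   fix x :: real
   have "\<forall>\<^sub>F n in sequentially. X n \<ge> \<bar>x\<bar>" using X by (simp add: filterlim_at_top)
   then show "\<forall>\<^sub>F n in sequentially. ennreal ((cmod (f x))\<^sup>2) * indicator {x. \<bar>x\<bar> > X n} x = 0"
    by eventually_elim (auto simp: indicator_def)
  qed
 qed (auto simp: indicator_def)
 then show "(\<lambda>n. tail f (X n)) \<longlonglongrightarrow> 0" by (simp add: tail_def)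
qed

text \<open>Taking \<open>h\<close> zero bounds the norm of the limit, other \<open>h\<close> bound
  a distance to it.\<close>

lemma l2_fatou:
 assumes [measurable]: "\<And>k. g k \<in> borel_measurable M" "h \<in> borel_measurable M"
  and lim: "AE x in M. (\<lambda>k. g k x) \<longlonglongrightarrow> (G x :: complex)"
  and b: "\<forall>\<^sub>F k in sequentially. (\<integral>\<^sup>+x. ennreal ((cmod (g k x - h x))\<^sup>2) \<partial>M) \<le> c"
 shows "(\<integral>\<^sup>+x. ennreal ((cmod (G x - h x))\<^sup>2) \<partial>M) \<le> c"
proof -
 have "(\<integral>\<^sup>+x. ennreal ((cmod (G x - h x))\<^sup>2) \<partial>M) = (\<integral>\<^sup>+x. liminf (\<lambda>k. ennreal ((cmod (g k x - h x))\<^sup>2)) \<partial>M)"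
 proof (rule nn_integral_cong_AE, use lim in eventually_elim)
  fix x assume "(\<lambda>k. g k x) \<longlonglongrightarrow> G x"
  then have "(\<lambda>k. ennreal ((cmod (g k x - h x))\<^sup>2)) \<longlonglongrightarrow> ennreal ((cmod (G x - h x))\<^sup>2)"
   by (intro tendsto_intros)
  then show "ennreal ((cmod (G x - h x))\<^sup>2) = liminf (\<lambda>k. ennreal ((cmod (g k x - h x))\<^sup>2))"
   by (subst lim_imp_Liminf) auto
 qed
 also have "... \<le> liminf (\<lambda>k. \<integral>\<^sup>+x. ennreal ((cmod (g k x - h x))\<^sup>2) \<partial>M)"
  by (rule nn_integral_liminf) simp
 also have "... \<le> limsup (\<lambda>k. \<integral>\<^sup>+x. ennreal ((cmod (g k x - h x))\<^sup>2) \<partial>M)"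
  by (rule Liminf_le_Limsup) simp
 also have "... \<le> c" using b by (rule Limsup_bounded)
 finally show ?thesis .
qed

text \<open>Along radii whose tails decay like 4^(-k), Bessel makes the truncated transforms Cauchy
  fast enough to converge almost everywhere. Fatou then compares the limit with the truncation at
  every radius, not only at those of the sequence.\<close>

lemma has_fourier_exists:
 assumes f: "square_integrable f"
 shows "\<exists>F. has_fourier f F"
proof -
 have [measurable]: "fourier_trunc R f \<in> bm" for R
  using fourier_trunc_measurable[OF f] by simp
 have "\<forall>k B. \<exists>R. R \<ge> B \<and> tail f R < ennreal ((1/4)^k)"
 proof (intro allI)
  fix k :: nat and B :: real
  have "\<forall>\<^sub>F R in at_top. tail f R < ennreal ((1/4)^k)"
   by (rule order_tendstoD(2)[OF tail_tendsto[OF f]]) simp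
  moreover have "\<forall>\<^sub>F R in at_top. B \<le> R" by (rule eventually_ge_at_top)
  ultimately have "\<forall>\<^sub>F R in at_top. B \<le> R \<and> tail f R < ennreal ((1/4)^k)"
   by eventually_elim simp
  then show "\<exists>R. R \<ge> B \<and> tail f R < ennreal ((1/4)^k)"
   by (rule eventually_happens'[OF trivial_limit_at_top_linorder])
 qed
 then obtain S where S: "\<And>k B. S k B \<ge> B \<and> tail f (S k B) < ennreal ((1/4)^k)" by metis
 \<comment> \<open>Adding 1 to the previous radius drives the radii to infinity, so that any given
   \<open>r\<close> is eventually below \<open>R k\<close>.\<close>
 define R :: "nat => real" where "R = rec_nat (S 0 0) (\<lambda>k r. S (Suc k) (r + 1))"
 have R0: "R 0 = S 0 0" and RS: "R (Suc k) = S (Suc k) (R k + 1)" for k by (simp_all add: R_def)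
 have R: "tail f (R k) < ennreal ((1/4)^k)" "R (Suc k) \<ge> R k + 1" for k
  using S by (cases k; simp only: R0 RS)+
 have Rk: "R k \<ge> R 0 + real k" for k
  by (induction k) (use R(2) in \<open>auto intro: order_trans simp: algebra_simps\<close>, smt (verit) R(2))
 have conv: "AE xi in lborel. convergent (\<lambda>k. fourier_trunc (R k) f xi)"
 proof (rule AE_convergent_L2[where c="ennreal (2 * pi)"])
  fix k
  have "R k \<le> R (Suc k)" using R(2)[of k] by simp
  from fourier_trunc_tail[OF f this]
  show "(NN xi. ennreal ((cmod (fourier_trunc (R (Suc k)) f xi - fourier_trunc (R k) f xi))\<^sup>2)) \<le> ennreal (2 * pi) * ennreal ((1/4)^k)"
   using R(1)[of k] by (meson less_imp_le mult_left_mono order_trans zero_le)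
 qed auto
 define F where "F xi = lim (\<lambda>k. fourier_trunc (R k) f xi)" for xi
 have lim: "AE xi in lborel. (\<lambda>k. fourier_trunc (R k) f xi) \<longlonglongrightarrow> F xi"
  using conv by eventually_elim (simp add: F_def convergent_LIMSEQ_iff)
 have [measurable]: "F \<in> bm" unfolding F_def by measurable
 have b: "(NN xi. ennreal ((cmod (F xi - fourier_trunc r f xi))\<^sup>2)) \<le> ennreal (2 * pi) * tail f r" for r
 proof (rule l2_fatou[OF _ _ lim])
  obtain k0 :: nat where k0: "real k0 \<ge> r - R 0" using real_arch_simple by blast
  show "\<forall>\<^sub>F k in sequentially. (NN x. ennreal ((cmod (fourier_trunc (R k) f x - fourier_trunc r f x))\<^sup>2)) \<le> ennreal (2 * pi) * tail f r"
   using eventually_ge_at_top[of k0]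
   by eventually_elim (intro fourier_trunc_tail[OF f], use Rk k0 in \<open>smt (verit) of_nat_mono\<close>)
 qed auto
 have "(NN xi. ennreal ((cmod (F xi - 0))\<^sup>2)) \<le> ennreal (2 * pi) * l2sq f"
  by (rule l2_fatou[OF _ _ lim]) (auto intro!: always_eventually fourier_trunc_bound[OF f])
 then have "square_integrable F"
  using square_integrable_nn[OF f] by (intro square_integrableI_nn) (auto intro: le_less_trans simp: ennreal_mult_less_top)
 moreover have "((\<lambda>r. NN xi. ennreal ((cmod (F xi - fourier_trunc r f xi))\<^sup>2)) \<longlongrightarrow> 0) at_top"
 proof (rule tendsto_sandwich[OF _ _ tendsto_const])
  show "((\<lambda>r. ennreal (2 * pi) * tail f r) \<longlongrightarrow> 0) at_top"
   using ennreal_tendsto_cmult[OF _ tail_tendsto[OF f], of "ennreal (2 * pi)"] by simp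
 qed (use b in \<open>auto\<close>)
 ultimately show ?thesis using f by (auto simp: has_fourier_def)
qed

text \<open>The constant is twice that of Plancherel, since the triangle inequality enters as |p -
  q|^2 <= 2|p|^2 + 2|q|^2. Later only its being a fixed number matters.\<close>

lemma has_fourier_l2sq:
 assumes F: "has_fourier f F"
 shows "l2sq F \<le> ennreal (4 * pi) * l2sq f"
proof -
 have f: "square_integrable f" and [measurable]: "F \<in> bm" 
  using F by (auto simp: has_fourier_def square_integrable_def)
 have [measurable]: "fourier_trunc R f \<in> bm" for R
  using fourier_trunc_measurable[OF f] by simp
 let ?e = "\<lambda>R. NN xi. ennreal ((cmod (F xi - fourier_trunc R f xi))\<^sup>2)"
 have b: "l2sq F \<le> 2 * ?e R + 2 * (ennreal (2 * pi) * l2sq f)" for R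
 proof -
  have "l2sq F = (NN xi. ennreal ((cmod ((F xi - fourier_trunc R f xi) - (- fourier_trunc R f xi)))\<^sup>2))" by simp
  also have "... \<le> 2 * ?e R + 2 * l2sq (\<lambda>xi. - fourier_trunc R f xi)"
   by (rule nn_diff_sq_le) auto
  also have "... \<le> 2 * ?e R + 2 * (ennreal (2 * pi) * l2sq f)"
   using fourier_trunc_bound[OF f, of R] by (intro add_mono mult_left_mono) auto
  finally show ?thesis .
 qed
 have "((\<lambda>R. 2 * ?e R + 2 * (ennreal (2 * pi) * l2sq f)) \<longlongrightarrow> 2 * 0 + 2 * (ennreal (2 * pi) * l2sq f)) at_top"
  using F unfolding has_fourier_def by (intro tendsto_add ennreal_tendsto_cmult tendsto_const) auto
 then have "l2sq F \<le> 2 * 0 + 2 * (ennreal (2 * pi) * l2sq f)"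
  by (rule tendsto_lowerbound) (use b in auto)
 also have "... = ennreal (4 * pi) * l2sq f"
 proof -
  have "2 * ennreal (2 * pi) = ennreal (4 * pi)" using ennreal_mult'[of "2 * pi" 2] by (simp add: mult.commute)
  then show ?thesis by (simp only: mult.assoc[symmetric] mult_zero_right add_0)
 qed
 finally show ?thesis .
qed

lemma has_fourier_cong_AE:
 assumes F: "has_fourier f F" and G: "G \<in> bm" and eq: "AE xi in lborel. F xi = G xi"
 shows "has_fourier f G"
proof -
 have "(NN xi. ennreal ((cmod (G xi - fourier_trunc R f xi))\<^sup>2)) = (NN xi. ennreal ((cmod (F xi - fourier_trunc R f xi))\<^sup>2))" for R
  using eq by (intro nn_integral_cong_AE) auto
 moreover have "square_integrable G"
 proof (rule square_integrableI_nn)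
  have "l2sq G = l2sq F" using eq by (intro nn_integral_cong_AE) auto
  then show "l2sq G < \<infinity>" using F square_integrable_nn[of F] by (simp add: has_fourier_def)
 qed (use G in simp)
 ultimately show ?thesis using F by (simp add: has_fourier_def)
qed

lemma ift_l2sq:
 assumes F: "integrable lborel F"
 shows "ennreal (2 * pi) * l2sq (ift F) \<le> l2sq F"
proof -
 have [measurable]: "F \<in> bm" using F by auto
 have "l2sq (ift F) = (NN x. ennreal (1 / (2 * pi)^2) * ennreal ((cmod (ft F (- x)))\<^sup>2))"
  unfolding ift_eq_ft by (intro nn_integral_cong) (simp add: norm_divide power_divide flip: ennreal_mult')
 also have "... = ennreal (1 / (2 * pi)^2) * l2sq (ft F)"
  using l2sq_reflect[of "ft F"] by (simp add: nn_integral_cmult)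
 also have "... \<le> ennreal (1 / (2 * pi)^2) * (ennreal (2 * pi) * l2sq F)"
  by (intro mult_left_mono bessel F) simp
 finally have "ennreal (2 * pi) * l2sq (ift F) \<le> ennreal (2 * pi) * (ennreal (1 / (2 * pi)^2) * (ennreal (2 * pi) * l2sq F))"
  by (intro mult_left_mono) auto
 also have "... = ennreal (2 * pi * (1 / (2 * pi)^2) * (2 * pi)) * l2sq F"
  by (simp only: ennreal_mult' mult.assoc pi_ge_zero zero_le_numeral mult_nonneg_nonneg zero_le_divide_iff zero_le_power2 zero_le_one simp_thms)
 also have "2 * pi * (1 / (2 * pi)^2) * (2 * pi) = 1" by (simp add: power2_eq_square)
 finally show ?thesis by simp
qed

lemma ift_continuous:
 assumes F: "integrable lborel F"
 shows "continuous_on UNIV (ift F)"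
proof -
 have [measurable]: "F \<in> bm" using F by auto
 have "isCont (ift F) x" for x
  unfolding isCont_def tendsto_at_iff_sequentially comp_def
 proof (intro allI impI)
  fix X :: "nat => real" assume X: "X \<longlonglongrightarrow> x"
  have "(\<lambda>n. LINT xi|lborel. F xi * cis (X n * xi)) \<longlonglongrightarrow> (LINT xi|lborel. F xi * cis (x * xi))"
  proof (rule integral_dominated_convergence)
   show "integrable lborel (\<lambda>xi. cmod (F xi))" using F by (rule integrable_norm)
   show "AE xi in lborel. (\<lambda>n. F xi * cis (X n * xi)) \<longlonglongrightarrow> F xi * cis (x * xi)"
    using X by (intro AE_I2 tendsto_intros)
  qed (auto simp: norm_mult)
  then show "(\<lambda>n. ift F (X n)) \<longlonglongrightarrow> ift F x" unfolding ift_def by (intro tendsto_intros) auto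
 qed
 then show ?thesis by (simp add: continuous_on_eq_continuous_at)
qed

section \<open>Fourier inversion, tested against modulated Gaussians\<close>

lemma L2_mult_integrable:
 fixes f g :: "real => complex"
 assumes "square_integrable f" "square_integrable g"
 shows "integrable lborel (\<lambda>x. f x * g x)"
proof (rule Bochner_Integration.integrable_bound)
 show "integrable lborel (\<lambda>x. (cmod (f x))\<^sup>2 + (cmod (g x))\<^sup>2)"
  using assms by (auto simp: square_integrable_def)
 show "(\<lambda>x. f x * g x) \<in> borel_measurable lborel" using assms by (auto simp: square_integrable_def)
 show "AE x in lborel. norm (f x * g x) \<le> norm ((cmod (f x))\<^sup>2 + (cmod (g x))\<^sup>2)"
 proof (intro AE_I2)
  fix x
  have "2 * (cmod (f x) * cmod (g x)) \<le> (cmod (f x))\<^sup>2 + (cmod (g x))\<^sup>2" "0 \<le> cmod (f x) * cmod (g x)"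
   using sum_squares_bound[of "cmod (f x)" "cmod (g x)"] by auto
  then show "norm (f x * g x) \<le> norm ((cmod (f x))\<^sup>2 + (cmod (g x))\<^sup>2)" unfolding norm_mult real_norm_def by linarith
 qed
qed

lemma gaussian_cis_sq: "square_integrable (\<lambda>xi. cis (y * xi) * of_real (std_normal_density (xi / 1)))"
proof -
 have "(std_normal_density xi)\<^sup>2 \<le> std_normal_density xi" for xi
 proof -
  have s: "1 \<le> sqrt (2 * pi)" using pi_gt3 by (intro real_le_rsqrt) auto
  have "std_normal_density xi \<le> 1 * 1"
   unfolding std_normal_density_def using s by (intro mult_mono) (auto simp: field_simps)
  then show ?thesis
   using normal_density_nonneg[of 1 0 "xi"] by (simp add: power2_eq_square mult_left_le)
 qed
 then have le: "norm ((std_normal_density xi)\<^sup>2) \<le> norm (std_normal_density xi)" for xi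
  by (simp only: real_norm_def abs_of_nonneg zero_le_power2 order_trans[OF _ abs_ge_self])
 have "integrable lborel std_normal_density" by simp
 then have i: "integrable lborel (\<lambda>xi. (std_normal_density xi)\<^sup>2)"
  by (rule Bochner_Integration.integrable_bound) (use le in \<open>auto simp only: intro!: AE_I2\<close>, measurable)
 have "(cmod (cis (y * xi) * of_real (std_normal_density (xi / 1))))\<^sup>2 = (std_normal_density xi)\<^sup>2" for xi
  by (simp only: norm_mult norm_cis norm_of_real power2_abs mult_1_left div_by_1)
 with i show ?thesis unfolding square_integrable_def by (simp only:) measurable
qed

text \<open>Pairing with a modulated Gaussian is continuous in L^2 and hence passes to the limit
  that defines the transform. Such pairings can be computed on both sides and they separate
  functions.\<close>

lemma has_fourier_gaussian_test:
 assumes F: "has_fourier f F"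
 shows "((\<lambda>R. LINT x:{-R..R}|lborel. f x * of_real (exp (- (y - x)\<^sup>2 / 2))) \<longlongrightarrow>
   (LINT xi|lborel. F xi * (cis (y * xi) * of_real (std_normal_density (xi / 1))))) at_top"
proof -
 let ?g = "\<lambda>xi. cis (y * xi) * complex_of_real (std_normal_density (xi / 1))"
 have f: "square_integrable f" "square_integrable F" using F by (auto simp: has_fourier_def)
 have tm: "fourier_trunc R f \<in> bm" for R
  using fourier_trunc_measurable[OF f(1)] by simp
 have ts: "square_integrable (fourier_trunc R f)" for R
  using fourier_trunc_bound[OF f(1), of R] square_integrable_nn[OF f(1)] tm
  by (intro square_integrableI_nn) (auto intro: le_less_trans simp: ennreal_mult_less_top)
 have [measurable]: "F \<in> bm" using f by (auto simp: square_integrable_def)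
 note [measurable] = tm
 let ?I = "\<lambda>R. LINT x:{-R..R}|lborel. f x * of_real (exp (- (y - x)\<^sup>2 / 2))"
 let ?J = "LINT xi|lborel. F xi * ?g xi"
 have eq: "?J - ?I R = (LINT xi|lborel. (F xi - fourier_trunc R f xi) * ?g xi)" for R
 proof -
  have "?I R = (LINT xi|lborel. fourier_trunc R f xi * ?g xi)"
   using fourier_trunc_gaussian[OF f(1), of 1 R y] by simp
  then show ?thesis
   unfolding left_diff_distrib
   using L2_mult_integrable[OF f(2) gaussian_cis_sq[of y]] L2_mult_integrable[OF ts gaussian_cis_sq[of y]]
   by (subst Bochner_Integration.integral_diff) auto
 qed
 have "((\<lambda>R. ennreal ((cmod (?J - ?I R))\<^sup>2)) \<longlongrightarrow> 0) at_top"
 proof (rule tendsto_sandwich[OF _ _ tendsto_const])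
  have "((\<lambda>R. l2sq ?g * (NN xi. ennreal ((cmod (F xi - fourier_trunc R f xi))\<^sup>2))) \<longlongrightarrow> l2sq ?g * 0) at_top"
   using F square_integrable_nn[OF gaussian_cis_sq[of y]] unfolding has_fourier_def by (intro ennreal_tendsto_cmult) auto
  then show "((\<lambda>R. l2sq ?g * (NN xi. ennreal ((cmod (F xi - fourier_trunc R f xi))\<^sup>2))) \<longlongrightarrow> 0) at_top" by simp
  show "\<forall>\<^sub>F R in at_top. ennreal ((cmod (?J - ?I R))\<^sup>2) \<le> l2sq ?g * (NN xi. ennreal ((cmod (F xi - fourier_trunc R f xi))\<^sup>2))"
  proof (intro always_eventually allI)
   fix R
   have "ennreal ((cmod (LINT xi|lborel. (F xi - fourier_trunc R f xi) * ?g xi))\<^sup>2)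
     \<le> (NN xi. ennreal ((cmod (F xi - fourier_trunc R f xi))\<^sup>2)) * l2sq ?g"
    by (rule cmod_integral_Cauchy_Schwarz) auto
   then show "ennreal ((cmod (?J - ?I R))\<^sup>2) \<le> l2sq ?g * (NN xi. ennreal ((cmod (F xi - fourier_trunc R f xi))\<^sup>2))"
    unfolding eq by (simp only: mult.commute)
  qed
 qed auto
 then have "((\<lambda>R. (cmod (?J - ?I R))\<^sup>2) \<longlongrightarrow> 0) at_top"
  by (subst (asm) ennreal_0[symmetric], subst (asm) tendsto_ennreal_iff) auto
 then have "((\<lambda>R. ?J - ?I R) \<longlongrightarrow> 0) at_top"
  using tendsto_real_sqrt[of "\<lambda>R. (cmod (?J - ?I R))\<^sup>2" 0 at_top]
  by (intro tendsto_norm_zero_cancel[of "\<lambda>R. ?J - ?I R"]) (simp only: real_sqrt_zero real_sqrt_abs abs_norm_cancel)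
 from tendsto_diff[OF tendsto_const[of ?J] this] show ?thesis by simp
qed

lemma ft_shifted_gaussian:
 "ft (\<lambda>x. complex_of_real (exp (- (y - (- x))\<^sup>2 / 2))) xi
  = of_real (2 * pi) * (cis (y * xi) * complex_of_real (std_normal_density (xi / 1)))"
proof -
   let ?e = "\<lambda>y x. complex_of_real (exp (- (y - x)\<^sup>2 / 2))"
   have "ft (\<lambda>x. ?e y (- x)) xi = (LINT x|lborel. ?e y (- x) * cis (- (x * xi)))" by (simp add: ft_def)
   also have "... = (LINT x|lborel. ?e y (- (- y + 1 * x)) * cis (- ((- y + 1 * x) * xi)))"
    by (rule lborel_integral_real_affine[of 1 _ "- y", unfolded abs_one scaleR_one]) simp
   also have "... = (LINT x|lborel. (of_real (sqrt (2 * pi)) * cis (y * xi)) * (cis ((- xi) * x) * of_real (std_normal_density (x / 1))))"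
   proof (intro Bochner_Integration.integral_cong refl)
    fix x :: real
    have a: "cis (- ((- y + 1 * x) * xi)) = cis (y * xi) * cis ((- xi) * x)"
     unfolding cis_mult by (rule arg_cong[of _ _ cis]) (simp add: algebra_simps)
    have b: "exp (- (y - (- (- y + 1 * x)))\<^sup>2 / 2) = sqrt (2 * pi) * std_normal_density (x / 1)"
     by (simp add: std_normal_density_def)
    show "?e y (- (- y + 1 * x)) * cis (- ((- y + 1 * x) * xi)) = (of_real (sqrt (2 * pi)) * cis (y * xi)) * (cis ((- xi) * x) * of_real (std_normal_density (x / 1)))"
     unfolding a b of_real_mult by (simp only: mult_ac)
   qed
   also have "... = (of_real (sqrt (2 * pi)) * cis (y * xi)) * of_real (exp (- xi\<^sup>2 / 2))"
    by (subst integral_mult_right_zero) (use gaussian_integral(2)[of 1 "- xi"] in simp)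
   also have "exp (- xi\<^sup>2 / 2) = sqrt (2 * pi) * std_normal_density xi" by (simp add: std_normal_density_def)
   finally have "ft (\<lambda>x. ?e y (- x)) xi = (of_real (sqrt (2 * pi)) * cis (y * xi)) * of_real (sqrt (2 * pi) * std_normal_density xi)" .
   also have "... = (of_real (sqrt (2 * pi)) * of_real (sqrt (2 * pi))) * (cis (y * xi) * of_real (std_normal_density (xi / 1)))"
    unfolding of_real_mult by simp
   also have "complex_of_real (sqrt (2 * pi)) * of_real (sqrt (2 * pi)) = of_real (2 * pi)"
    by (subst of_real_mult[symmetric]) simp
   finally show ?thesis .
qed

text \<open>Bessel puts \<open>ift F\<close> in L^2, so it has some transform \<open>F'\<close>.
  Against every modulated Gaussian \<open>F'\<close> and \<open>F\<close> give the same number, by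
  \<open>has_fourier_gaussian_test\<close> on one side and the multiplication formula on the other.
  Hence F' - F times a Gaussian is integrable with vanishing Fourier integrals, and a Gaussian has
  no zeros.\<close>

lemma has_fourier_ift:
 assumes F: "integrable lborel F" "square_integrable F"
 shows "has_fourier (ift F) F"
proof -
 have [measurable]: "F \<in> bm" using F by auto
 have sq: "square_integrable (ift F)"
 proof (rule square_integrableI_nn)
  have "ennreal (2 * pi) * l2sq (ift F) < \<infinity>"
   using ift_l2sq[OF F(1)] square_integrable_nn[OF F(2)] by (rule le_less_trans)
  then show "l2sq (ift F) < \<infinity>" by (auto simp: ennreal_mult_less_top)
 qed simp
 obtain F' where F': "has_fourier (ift F) F'" using has_fourier_exists[OF sq] by blast
 have F's: "square_integrable F'" using F' by (simp add: has_fourier_def)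
 have [measurable]: "F' \<in> bm" using F's by (auto simp: square_integrable_def)
 let ?g = "\<lambda>y xi. cis (y * xi) * complex_of_real (std_normal_density (xi / 1))"
 let ?e = "\<lambda>y x. complex_of_real (exp (- (y - x)\<^sup>2 / 2))"
 have eq: "(LINT xi|lborel. F' xi * ?g y xi) = (LINT xi|lborel. F xi * ?g y xi)" for y
 proof -
  have ie: "integrable lborel (\<lambda>x. ?e y x)" using gauss_kernel(1)[of 1 y] by (intro integrable_of_real) simp
  have sb: "cmod (ift F x) \<le> (LINT xi|lborel. cmod (F xi)) / (2 * pi)" for x
   unfolding ift_eq_ft using ft_bound[of F "- x"] by (simp add: norm_divide divide_right_mono)
  have ii: "integrable lborel (\<lambda>x. ift F x * ?e y x)"
  proof (rule Bochner_Integration.integrable_bound[OF integrable_mult_right[OF integrable_norm[OF ie], of "(LINT xi|lborel. cmod (F xi)) / (2 * pi)"]])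
   show "AE x in lborel. norm (ift F x * ?e y x) \<le> norm ((LINT xi|lborel. cmod (F xi)) / (2 * pi) * norm (?e y x))"
   proof (intro AE_I2)
    fix x
    have "norm (ift F x * ?e y x) \<le> (LINT xi|lborel. cmod (F xi)) / (2 * pi) * norm (?e y x)"
     unfolding norm_mult by (intro mult_right_mono sb) simp
    then show "norm (ift F x * ?e y x) \<le> norm ((LINT xi|lborel. cmod (F xi)) / (2 * pi) * norm (?e y x))"
     by (simp only: real_norm_def)
   qed
  qed simp
  have "((\<lambda>R. LINT x:{-R..R}|lborel. ift F x * ?e y x) \<longlongrightarrow> (LINT x|lborel. ift F x * ?e y x)) at_top"
   unfolding set_lebesgue_integral_def
  proof (rule integral_dominated_convergence_at_top)
   show "integrable lborel (\<lambda>x. norm (ift F x * ?e y x))" using ii by (rule integrable_norm)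
   show "\<forall>\<^sub>F R in at_top. AE x in lborel. norm (indicator {-R..R} x *\<^sub>R (ift F x * ?e y x)) \<le> norm (ift F x * ?e y x)"
    by (intro always_eventually allI AE_I2) (auto simp: indicator_def)
   show "AE x in lborel. ((\<lambda>R. indicator {-R..R} x *\<^sub>R (ift F x * ?e y x)) \<longlongrightarrow> ift F x * ?e y x) at_top"
   proof (intro AE_I2 tendsto_eventually)
    fix x :: real
    show "\<forall>\<^sub>F R in at_top. indicator {-R..R} x *\<^sub>R (ift F x * ?e y x) = ift F x * ?e y x"
     using eventually_ge_at_top[of "\<bar>x\<bar>"] by eventually_elim (auto simp: indicator_def)
   qed
  qed auto
  with has_fourier_gaussian_test[OF F', of y]
  have "(LINT xi|lborel. F' xi * ?g y xi) = (LINT x|lborel. ift F x * ?e y x)"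
   using tendsto_unique[OF trivial_limit_at_top_linorder] by blast
  also have "... = (LINT x|lborel. ft F x * ?e y (- x)) / of_real (2 * pi)"
   using lborel_integral_real_affine[of "-1" "\<lambda>x. ift F x * ?e y x" 0] by (simp add: ift_eq_ft)
  also have "(LINT x|lborel. ft F x * ?e y (- x)) = (LINT xi|lborel. F xi * ft (\<lambda>x. ?e y (- x)) xi)"
  proof (rule ft_multiplication[OF F(1)])
   show "integrable lborel (\<lambda>x. ?e y (- x))" using lborel_integrable_real_affine[OF ie, of "-1" 0] by simp
  qed
  also have "... = (LINT xi|lborel. F xi * (of_real (2 * pi) * ?g y xi))"
   by (simp only: ft_shifted_gaussian)
  also have "(LINT xi|lborel. F xi * (of_real (2 * pi) * ?g y xi)) = of_real (2 * pi) * (LINT xi|lborel. F xi * ?g y xi)"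
   by (subst integral_mult_right_zero[symmetric]) (simp add: mult_ac)
  finally show ?thesis by simp
 qed
 have "AE xi in lborel. (F' xi - F xi) * complex_of_real (std_normal_density (xi / 1)) = 0"
 proof (rule L1_fourier_inj)
  have i: "integrable lborel (\<lambda>xi. F' xi * ?g y xi)" "integrable lborel (\<lambda>xi. F xi * ?g y xi)" for y
   by (rule L2_mult_integrable gaussian_cis_sq F's F)+
  have d: "(F' xi - F xi) * complex_of_real (std_normal_density (xi / 1)) * cis (y * xi) = F' xi * ?g y xi - F xi * ?g y xi" for y xi
   by (simp add: algebra_simps)
  show "integrable lborel (\<lambda>xi. (F' xi - F xi) * complex_of_real (std_normal_density (xi / 1)))"
   using Bochner_Integration.integrable_diff[OF i[of 0]] d[of _ 0] by (simp add: left_diff_distrib)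
  show "(LINT xi|lborel. (F' xi - F xi) * complex_of_real (std_normal_density (xi / 1)) * cis (y * xi)) = 0" for y
   unfolding d using i[of y] eq[of y] by (subst Bochner_Integration.integral_diff) auto
 qed
 then have "AE xi in lborel. F' xi = F xi"
  by eventually_elim (use normal_density_pos[of 1 0] in \<open>auto simp: less_imp_neq[symmetric]\<close>)
 then show ?thesis by (intro has_fourier_cong_AE[OF F']) simp_all
qed

section \<open>Exponentially weighted transforms\<close>

text \<open>The frequency side of \<open>Gspace\<close>, with the representative left free instead
  of tied to the choice made by \<open>fourier\<close>. \<open>Gspace_GF\<close> and
  \<open>ift_in_Gspace\<close> translate between the two.\<close>

definition GF :: "real => (real => complex) => bool" where
 "GF \<sigma> F \<longleftrightarrow> F \<in> bm \<and> wl2 \<sigma> F < \<infinity>"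

lemma GF_measurable [measurable_dest]: "GF \<sigma> F \<Longrightarrow> F \<in> bm"
 by (simp add: GF_def)

lemma GF_square_integrable: "GF \<sigma> F \<Longrightarrow> square_integrable (\<lambda>xi. of_real (exp (\<sigma> * \<bar>xi\<bar>)) * F xi)"
 by (intro square_integrableI_nn) (auto simp: GF_def)

lemma GF_bound:
 assumes G: "GF \<sigma> G" and [measurable]: "F \<in> bm"
  and b: "\<And>xi. cmod (F xi) * exp (\<rho> * \<bar>xi\<bar>) \<le> C * (cmod (G xi) * exp (\<sigma> * \<bar>xi\<bar>))"
 shows "GF \<rho> F"
proof -
 have [measurable]: "G \<in> bm" using G by (rule GF_measurable)
 have "l2sq (\<lambda>xi. of_real (exp (\<rho> * \<bar>xi\<bar>)) * F xi)
   \<le> (NN xi. ennreal (C\<^sup>2) * ennreal ((cmod (of_real (exp (\<sigma> * \<bar>xi\<bar>)) * G xi))\<^sup>2))"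
 proof (rule nn_integral_mono)
  fix xi
  have "(cmod (F xi) * exp (\<rho> * \<bar>xi\<bar>))\<^sup>2 \<le> (C * (cmod (G xi) * exp (\<sigma> * \<bar>xi\<bar>)))\<^sup>2"
   by (intro power_mono b) auto
  then have "(cmod (of_real (exp (\<rho> * \<bar>xi\<bar>)) * F xi))\<^sup>2 \<le> C\<^sup>2 * (cmod (of_real (exp (\<sigma> * \<bar>xi\<bar>)) * G xi))\<^sup>2"
   by (simp add: norm_mult power_mult_distrib mult_ac)
  then have "ennreal ((cmod (of_real (exp (\<rho> * \<bar>xi\<bar>)) * F xi))\<^sup>2) \<le> ennreal (C\<^sup>2 * (cmod (of_real (exp (\<sigma> * \<bar>xi\<bar>)) * G xi))\<^sup>2)"
   by (rule ennreal_leI)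
  then show "ennreal ((cmod (of_real (exp (\<rho> * \<bar>xi\<bar>)) * F xi))\<^sup>2) \<le> ennreal (C\<^sup>2) * ennreal ((cmod (of_real (exp (\<sigma> * \<bar>xi\<bar>)) * G xi))\<^sup>2)"
   by (subst (asm) ennreal_mult) auto
 qed
 also have "... = ennreal (C\<^sup>2) * wl2 \<sigma> G"
  by (rule nn_integral_cmult) simp
 also have "... < \<infinity>" using G by (auto simp: GF_def ennreal_mult_less_top)
 finally show ?thesis by (simp add: GF_def)
qed

lemma GF_mono: "GF \<sigma> F \<Longrightarrow> \<rho> \<le> \<sigma> \<Longrightarrow> GF \<rho> F"
 by (rule GF_bound[where C=1]) (auto intro!: mult_left_mono mult_right_mono)

lemma GF_add:
 assumes "GF \<sigma> F" "GF \<sigma> G" shows "GF \<sigma> (\<lambda>xi. F xi + G xi)"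
proof -
 have [measurable]: "F \<in> bm" "G \<in> bm" using assms by (auto simp: GF_def)
 let ?e = "\<lambda>xi. complex_of_real (exp (\<sigma> * \<bar>xi\<bar>))"
 have "square_integrable (\<lambda>xi. - (?e xi * G xi))"
  using GF_square_integrable[OF assms(2)] by (simp add: square_integrable_def)
 from square_integrable_nn[OF square_integrable_diff[OF GF_square_integrable[OF assms(1)] this]]
 show ?thesis by (simp add: GF_def distrib_left)
qed

lemma GF_cmult: "GF \<sigma> F \<Longrightarrow> GF \<sigma> (\<lambda>xi. c * F xi)"
 by (rule GF_bound[where C="cmod c" and G=F]) (auto simp: norm_mult)

lemma GF_diff: "GF \<sigma> F \<Longrightarrow> GF \<sigma> G \<Longrightarrow> GF \<sigma> (\<lambda>xi. F xi - G xi)"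
 using GF_add[of \<sigma> F "\<lambda>xi. (-1) * G xi"] GF_cmult[of \<sigma> G "-1"] by simp

lemma GF_cis: "GF \<sigma> F \<Longrightarrow> g \<in> bm \<Longrightarrow> GF \<sigma> (\<lambda>xi. cis (g xi) * F xi)"
 by (rule GF_bound[where C="1" and G=F]) (auto simp: norm_mult)

text \<open>A single term of the exponential series.\<close>

lemma pow_le_exp:
 fixes x c :: real
 assumes "c > 0" "x \<ge> 0"
 shows "x ^ n \<le> (fact n / c ^ n) * exp (c * x)"
proof -
 have "(c * x) ^ n / fact n \<le> exp (c * x)"
 proof -
  have "(c * x) ^ n /\<^sub>R fact n \<le> (\<Sum>k. (c * x) ^ k /\<^sub>R fact k)"
   using summable_exp_generic[of "c * x"] assms
   by (intro sum_le_suminf[of _ "{n}", simplified]) auto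
  then show ?thesis by (simp add: exp_def divide_inverse mult.commute)
 qed
 then show ?thesis using assms by (simp add: power_mult_distrib field_simps)
qed

text \<open>Any gap between the two rates absorbs polynomial growth. A derivative thus costs
  exponential weight, however little; the resonance estimates exist to avoid that cost.\<close>

lemma GF_poly:
 assumes "GF \<sigma> F" "\<rho> < \<sigma>"
 shows "GF \<rho> (\<lambda>xi. of_real xi ^ n * F xi)"
proof (rule GF_bound[OF assms(1), where C="fact n / (\<sigma> - \<rho>) ^ n"])
 show "(\<lambda>xi. of_real xi ^ n * F xi) \<in> bm" using assms(1)[THEN GF_measurable] by measurable
 fix xi :: real
 have "\<bar>xi\<bar> ^ n \<le> (fact n / (\<sigma> - \<rho>) ^ n) * exp ((\<sigma> - \<rho>) * \<bar>xi\<bar>)" using assms by (intro pow_le_exp) auto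
 then have "\<bar>xi\<bar> ^ n * (cmod (F xi) * exp (\<rho> * \<bar>xi\<bar>)) \<le> ((fact n / (\<sigma> - \<rho>) ^ n) * exp ((\<sigma> - \<rho>) * \<bar>xi\<bar>)) * (cmod (F xi) * exp (\<rho> * \<bar>xi\<bar>))"
  by (intro mult_right_mono) auto
 also have "... = (fact n / (\<sigma> - \<rho>) ^ n) * (cmod (F xi) * (exp ((\<sigma> - \<rho>) * \<bar>xi\<bar>) * exp (\<rho> * \<bar>xi\<bar>)))" by (simp only: mult_ac)
 also have "exp ((\<sigma> - \<rho>) * \<bar>xi\<bar>) * exp (\<rho> * \<bar>xi\<bar>) = exp (\<sigma> * \<bar>xi\<bar>)" by (simp add: algebra_simps flip: exp_add)
 finally show "cmod (of_real xi ^ n * F xi) * exp (\<rho> * \<bar>xi\<bar>) \<le> fact n / (\<sigma> - \<rho>) ^ n * (cmod (F xi) * exp (\<sigma> * \<bar>xi\<bar>))"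
  by (simp add: norm_mult norm_power mult.assoc)
qed

lemma nn_exp_abs:
 assumes "c > 0"
 shows "(NN x. ennreal (exp (- (c * \<bar>x\<bar>)))) = ennreal (2 / c)"
proof -
 have half: "(NN x. ennreal (exp (- (c * x))) * indicator {0..} x) = ennreal (1 / c)"
 proof -
  have "(NN x. ennreal (exp (- (c * x))) * indicator {0..} x) = ennreal (0 - (- exp (- (c * 0)) / c))"
  proof (rule nn_integral_FTC_atLeast)
   have "((\<lambda>x. - exp (- (c * x)) / c) \<longlongrightarrow> - 0 / c) at_top"
    using assms by (intro tendsto_divide tendsto_minus tendsto_const filterlim_compose[OF exp_at_bot]
     filterlim_compose[OF filterlim_uminus_at_bot_at_top] filterlim_tendsto_pos_mult_at_top[OF tendsto_const]) (auto simp: filterlim_ident)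
   then show "((\<lambda>x. - exp (- (c * x)) / c) \<longlongrightarrow> 0) at_top" by simp
   show "((\<lambda>x. - exp (- (c * x)) / c) has_real_derivative exp (- (c * x))) (at x)" for x
    using assms by (auto intro!: derivative_eq_intros)
  qed (use assms in auto)
  then show ?thesis by simp
 qed
 have "(NN x. ennreal (exp (- (c * \<bar>x\<bar>))))
   = (NN x. ennreal (exp (- (c * x))) * indicator {0..} x + ennreal (exp (- (c * (- x)))) * indicator {0..} (- x))"
  by (rule nn_integral_cong_AE, rule AE_mp[OF AE_lborel_singleton[of 0]]) (auto intro!: AE_I2 simp: indicator_def)
 also have "... = (NN x. ennreal (exp (- (c * x))) * indicator {0..} x)
   + (NN x. ennreal (exp (- (c * (- x)))) * indicator {0..} (- x))"
  by (rule nn_integral_add) auto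
 also have "(NN x. ennreal (exp (- (c * (- x)))) * indicator {0..} (- x)) = (NN x. ennreal (exp (- (c * x))) * indicator {0..} x)"
  using nn_integral_real_affine[of "\<lambda>x. ennreal (exp (- (c * x))) * indicator {0..} x" "-1" 0] by simp
 finally show ?thesis unfolding half using assms by (simp flip: ennreal_plus)
qed

text \<open>Both the weighted function and the inverse weight are in L^2.\<close>

lemma GF_integrable0:
 assumes "GF \<sigma> F" "\<sigma> > 0"
 shows "integrable lborel F"
proof -
 have "square_integrable (\<lambda>xi. complex_of_real (exp (- (\<sigma> * \<bar>xi\<bar>))))"
 proof (rule square_integrableI_nn)
  have "l2sq (\<lambda>xi. complex_of_real (exp (- (\<sigma> * \<bar>xi\<bar>)))) = (NN x. ennreal (exp (- ((2 * \<sigma>) * \<bar>x\<bar>))))"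
   by (intro nn_integral_cong) (simp add: power2_eq_square flip: exp_add)
  then show "l2sq (\<lambda>xi. complex_of_real (exp (- (\<sigma> * \<bar>xi\<bar>)))) < \<infinity>" using assms by (simp only: nn_exp_abs) simp
 qed simp
 from L2_mult_integrable[OF this GF_square_integrable[OF assms(1)]]
 have "integrable lborel (\<lambda>xi. (of_real (exp (- (\<sigma> * \<bar>xi\<bar>))) * of_real (exp (\<sigma> * \<bar>xi\<bar>))) * F xi)" by (simp only: mult.assoc)
 moreover have "complex_of_real (exp (- (\<sigma> * \<bar>xi\<bar>))) * of_real (exp (\<sigma> * \<bar>xi\<bar>)) = 1" for xi
  by (simp flip: of_real_mult exp_add)
 ultimately show ?thesis by simp
qed

lemma GF_weight:
 assumes "GF \<sigma> F"
 shows "GF (\<sigma> - \<rho>) (\<lambda>xi. of_real (exp (\<rho> * \<bar>xi\<bar>)) * F xi)"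
proof (rule GF_bound[OF assms, where C=1])
 show "(\<lambda>xi. of_real (exp (\<rho> * \<bar>xi\<bar>)) * F xi) \<in> bm" using assms[THEN GF_measurable] by measurable
 fix xi
 have "exp (\<rho> * \<bar>xi\<bar>) * exp ((\<sigma> - \<rho>) * \<bar>xi\<bar>) = exp (\<sigma> * \<bar>xi\<bar>)" by (simp add: algebra_simps flip: exp_add)
 then show "cmod (of_real (exp (\<rho> * \<bar>xi\<bar>)) * F xi) * exp ((\<sigma> - \<rho>) * \<bar>xi\<bar>) \<le> 1 * (cmod (F xi) * exp (\<sigma> * \<bar>xi\<bar>))"
  by (simp add: norm_mult mult_ac)
qed

lemma GF_integrable:
 assumes "GF \<sigma> F" "\<rho> < \<sigma>"
 shows "integrable lborel (\<lambda>xi. of_real (\<bar>xi\<bar> ^ n * exp (\<rho> * \<bar>xi\<bar>)) * F xi)"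
proof -
 define \<tau> where "\<tau> = (\<rho> + \<sigma>) / 2"
 have t: "\<rho> < \<tau>" "\<tau> < \<sigma>" using assms by (auto simp: \<tau>_def)
 have "GF \<tau> (\<lambda>xi. of_real xi ^ n * F xi)" by (rule GF_poly[OF assms(1) t(2)])
 from GF_weight[OF this, of \<rho>] have "integrable lborel (\<lambda>xi. of_real (exp (\<rho> * \<bar>xi\<bar>)) * (of_real xi ^ n * F xi))"
  by (rule GF_integrable0) (use t in simp)
 then show ?thesis
  by (rule Bochner_Integration.integrable_bound) (use assms(1)[THEN GF_measurable] in \<open>auto simp: norm_mult norm_power power_abs\<close>)
qed

lemma GF_sq: "GF \<sigma> F \<Longrightarrow> \<sigma> \<ge> 0 \<Longrightarrow> square_integrable F"
 using GF_square_integrable[of 0 F] GF_mono[of \<sigma> F 0] by simp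

lemma GF_has_fourier: "GF \<sigma> F \<Longrightarrow> \<sigma> > 0 \<Longrightarrow> has_fourier (ift F) F"
 by (intro has_fourier_ift GF_integrable0 GF_sq) auto

lemma GF_cong_AE:
 assumes "GF \<sigma> F" "AE xi in lborel. F xi = G xi" "G \<in> bm"
 shows "GF \<sigma> G"
proof -
 have "wl2 \<sigma> G = wl2 \<sigma> F"
  using assms(2) by (intro nn_integral_cong_AE) auto
 then show ?thesis using assms by (simp add: GF_def)
qed

lemma ift_cong_AE:
 assumes "AE xi in lborel. F xi = G xi" "F \<in> bm" "G \<in> bm"
 shows "ift F = ift G"
proof
 fix x
 have [measurable]: "F \<in> bm" "G \<in> bm" by fact+
 have "(LINT xi|lborel. F xi * cis (x * xi)) = (LINT xi|lborel. G xi * cis (x * xi))"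
  using assms(1) by (intro integral_cong_AE) auto
 then show "ift F x = ift G x" by (simp add: ift_def)
qed

lemma ift_in_Gspace:
 assumes F: "GF \<sigma> F" "\<sigma> > 0"
 shows "ift F \<in> Gspace \<sigma>"
proof -
 have hf: "has_fourier (ift F) F" by (rule GF_has_fourier[OF F])
 then have [measurable]: "fourier (ift F) \<in> bm"
  using has_fourier_fourier[OF hf] by (auto simp: has_fourier_def square_integrable_def)
 have "GF \<sigma> (fourier (ift F))"
  using fourier_AE[OF hf] by (intro GF_cong_AE[OF F(1)]) auto
 from GF_square_integrable[OF this]
 have "integrable lborel (\<lambda>xi. exp (\<sigma> * \<bar>xi\<bar>) ^ 2 * (cmod (fourier (ift F) xi))\<^sup>2)"
  by (simp add: square_integrable_def norm_mult power_mult_distrib)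
 moreover have "exp (\<sigma> * \<bar>xi\<bar>) ^ 2 = exp (2 * \<sigma> * \<bar>xi\<bar>)" for xi
  by (simp add: power2_eq_square flip: exp_add)
 ultimately have "integrable lborel (\<lambda>xi. exp (2 * \<sigma> * \<bar>xi\<bar>) * (cmod (fourier (ift F) xi))\<^sup>2)"
  by (simp only:)
 then show ?thesis
  using hf ift_continuous[OF GF_integrable0[OF F]] by (auto simp: Gspace_def)
qed

lemma Gspace_GF:
 assumes "f \<in> Gspace \<sigma>"
 shows "GF \<sigma> (fourier f)"
 using Gspace_has_fourier[OF assms] square_integrable_nn[of "\<lambda>xi. of_real (exp (\<sigma> * \<bar>xi\<bar>)) * fourier f xi"]
 by (auto simp: GF_def has_fourier_def square_integrable_def)

lemma has_fourier_eq_ift: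
 assumes "has_fourier f F" "continuous_on UNIV f" "GF \<sigma> F" "\<sigma> > 0"
 shows "f = ift F"
 using assms by (intro has_fourier_inj[OF assms(1) GF_has_fourier]) (auto intro: ift_continuous GF_integrable0)

lemma Gspace_ift:
 assumes "f \<in> Gspace \<sigma>" "\<sigma> > 0"
 shows "f = ift (fourier f)"
 using assms Gspace_has_fourier[OF assms(1)] Gspace_GF[OF assms(1)]
 by (intro has_fourier_eq_ift) (auto simp: Gspace_def)

lemma Gdist_ift:
 assumes F: "GF \<sigma> F" "GF \<sigma> G" "\<sigma> > 0"
 shows "ennreal ((Gdist \<sigma> (ift F) (ift G))\<^sup>2) = l2sq (\<lambda>xi. of_real (exp (\<sigma> * \<bar>xi\<bar>)) * (F xi - G xi))"
proof -
 have sq: "square_integrable (\<lambda>xi. of_real (exp (\<sigma> * \<bar>xi\<bar>)) * (F xi - G xi))"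
  by (intro GF_square_integrable GF_diff F)
 have "Gdist \<sigma> (ift F) (ift G) = sqrt (LINT xi|lborel. (cmod (of_real (exp (\<sigma> * \<bar>xi\<bar>)) * (F xi - G xi)))\<^sup>2)"
  unfolding Gdist_def using F by (intro Gnorm_eq has_fourier_diff GF_has_fourier)
 then have "(Gdist \<sigma> (ift F) (ift G))\<^sup>2 = (LINT xi|lborel. (cmod (of_real (exp (\<sigma> * \<bar>xi\<bar>)) * (F xi - G xi)))\<^sup>2)"
  by (simp add: integral_nonneg_AE)
 then show ?thesis
  using sq by (subst nn_integral_eq_integral) (auto simp: square_integrable_def)
qed

text \<open>Any transform \<open>F\<close> of \<open>f\<close> serves, whatever representative
  \<open>fourier f\<close> is: \<open>ift\<close> does not see null sets, and
  \<open>has_fourier_eq_ift\<close> supplies the uniqueness that \<open>THE\<close> asks for. The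
  rate is arbitrary because Duhamel's integrand has a smaller one than the data.\<close>

lemma S_group_ift:
 assumes f: "has_fourier f F" and F: "GF \<sigma> F" "\<sigma> > 0"
 shows "S_group \<alpha> \<beta> t f = ift (\<lambda>xi. cis (- t * (\<alpha> * xi ^ 5 - \<beta> * xi ^ 3)) * F xi)"
proof -
 let ?p = "\<lambda>xi. cis (- t * (\<alpha> * xi ^ 5 - \<beta> * xi ^ 3))"
 have [measurable]: "F \<in> bm" "fourier f \<in> bm"
  using F has_fourier_fourier[OF f] by (auto simp: has_fourier_def square_integrable_def GF_def)
 have G: "GF \<sigma> (\<lambda>xi. ?p xi * fourier f xi)"
  using fourier_AE[OF f] by (intro GF_cis GF_cong_AE[OF F(1)]) auto
 have "S_group \<alpha> \<beta> t f = ift (\<lambda>xi. ?p xi * fourier f xi)"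
  unfolding S_group_def
 proof (rule the_equality)
  show "continuous_on UNIV (ift (\<lambda>xi. ?p xi * fourier f xi)) \<and> has_fourier (ift (\<lambda>xi. ?p xi * fourier f xi)) (\<lambda>xi. ?p xi * fourier f xi)"
   using G F(2) GF_has_fourier ift_continuous GF_integrable0 by blast
 qed (use has_fourier_eq_ift[OF _ _ G F(2)] in blast)
 also have "... = ift (\<lambda>xi. ?p xi * F xi)"
  using fourier_AE[OF f] by (intro ift_cong_AE) auto
 finally show ?thesis .
qed

section \<open>Holomorphic extension to the strip\<close>

definition cift :: "(real => complex) => complex => complex" where
 "cift F z = (LINT xi|lborel. F xi * exp (\<i> * z * of_real xi)) / of_real (2 * pi)"

lemma cift_of_real: "cift F (of_real x) = ift F x"
 by (simp add: cift_def ift_def cis_conv_exp mult_ac)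

lemma norm_exp_diff_le:
 fixes w h :: complex
 shows "cmod (exp (w + h) - exp w) \<le> cmod h * exp (Re w + cmod h)"
proof -
 have "exp (w + h) - exp w = exp w * (exp h - 1)" by (simp add: exp_add algebra_simps)
 moreover have "cmod (exp h - 1) \<le> cmod h * exp (cmod h)"
 proof -
  have "exp h - 1 = (\<Sum>n. h ^ Suc n /\<^sub>R fact (Suc n))"
   using suminf_split_initial_segment[OF summable_exp_generic[of h], of 1] by (simp add: exp_def)
  also have "cmod ... \<le> (\<Sum>n. cmod h * (cmod h ^ n /\<^sub>R fact n))"
  proof (rule norm_suminf_le)
   show "summable (\<lambda>n. cmod h * (cmod h ^ n /\<^sub>R fact n))" by (intro summable_mult summable_exp_generic)
   fix n
   have "cmod h ^ Suc n / fact (Suc n) \<le> cmod h ^ Suc n / fact n"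
    by (intro divide_left_mono) (auto intro: fact_mono)
   then show "norm (h ^ Suc n /\<^sub>R fact (Suc n)) \<le> cmod h * (cmod h ^ n /\<^sub>R fact n)"
    by (simp add: norm_power norm_mult divide_inverse mult_ac)
  qed
  also have "... = cmod h * exp (cmod h)" by (subst suminf_mult[OF summable_exp_generic]) (simp add: exp_def)
  finally show ?thesis .
 qed
 ultimately show ?thesis
  by (simp add: norm_mult exp_add mult_left_mono mult_ac)
qed

text \<open>Differentiation under the integral. Increments are kept below \<open>r\<close>, half the
  distance to the edge of the strip, so that difference quotients are dominated by |xi| exp((|Im z|
  + r)|xi|) |F|, which is integrable because |Im z| + r is still below
  \<open>\<sigma>\<close>.\<close>

lemma cift_deriv:
 assumes F: "GF \<sigma> F" and z: "\<bar>Im z\<bar> < \<sigma>"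
 shows "(cift F has_field_derivative cift (\<lambda>xi. \<i> * of_real xi * F xi) z) (at z)"
proof -
 have [measurable]: "F \<in> bm" using F by (rule GF_measurable)
 have [measurable]: "(exp :: complex => complex) \<in> bm"
  by (intro borel_measurable_continuous_onI continuous_on_exp continuous_on_id)
 define r where "r = (\<sigma> - \<bar>Im z\<bar>) / 2"
 have r: "r > 0" "\<bar>Im z\<bar> + r < \<sigma>" using z by (auto simp: r_def field_simps)
 define G where "G = (\<lambda>xi. of_real (\<bar>xi\<bar> ^ 1 * exp ((\<bar>Im z\<bar> + r) * \<bar>xi\<bar>)) * F xi)"
 have G: "integrable lborel G" unfolding G_def by (rule GF_integrable[OF F r(2)])
 have Re: "Re (\<i> * w * of_real xi) \<le> \<bar>Im w\<bar> * \<bar>xi\<bar>" for w xi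
  using abs_ge_minus_self[of "Im w * xi"] by (simp add: abs_mult)
 have int: "integrable lborel (\<lambda>xi. F xi * exp (\<i> * w * of_real xi))" if "\<bar>Im w\<bar> < \<sigma>" for w
 proof (rule Bochner_Integration.integrable_bound[OF GF_integrable[OF F that, of 0]])
  show "AE xi in lborel. norm (F xi * exp (\<i> * w * of_real xi)) \<le> norm (of_real (\<bar>xi\<bar> ^ 0 * exp (\<bar>Im w\<bar> * \<bar>xi\<bar>)) * F xi)"
  proof (intro AE_I2)
   fix xi
   have "exp (Re (\<i> * w * of_real xi)) * cmod (F xi) \<le> exp (\<bar>Im w\<bar> * \<bar>xi\<bar>) * cmod (F xi)"
    using Re[of w xi] by (intro mult_right_mono) (simp_all only: exp_le_cancel_iff norm_ge_zero)
   then show "norm (F xi * exp (\<i> * w * of_real xi)) \<le> norm (of_real (\<bar>xi\<bar> ^ 0 * exp (\<bar>Im w\<bar> * \<bar>xi\<bar>)) * F xi)"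
    unfolding norm_mult norm_exp_eq_Re norm_of_real by (simp add: mult.commute)
  qed
 qed simp
 have "((\<lambda>h. (cift F (z + h) - cift F z) / h) \<longlongrightarrow> cift (\<lambda>xi. \<i> * of_real xi * F xi) z) (at 0)"
  unfolding tendsto_at_iff_sequentially comp_def
 proof (intro allI impI)
  fix X :: "nat => complex" assume X0: "\<forall>i. X i \<in> UNIV - {0}" and X: "X \<longlonglongrightarrow> 0"
  let ?q = "\<lambda>n xi. F xi * ((exp (\<i> * (z + X n) * of_real xi) - exp (\<i> * z * of_real xi)) / X n)"
  have "\<forall>\<^sub>F n in sequentially. cmod (X n) < r"
   using tendsto_norm_zero[OF X] r(1) by (rule order_tendstoD(2))
  then obtain N where N: "\<And>n. n \<ge> N \<Longrightarrow> cmod (X n) < r" by (auto simp: eventually_sequentially)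
  have lim: "(\<lambda>n. LINT xi|lborel. ?q (n + N) xi) \<longlonglongrightarrow> (LINT xi|lborel. F xi * (\<i> * of_real xi * exp (\<i> * z * of_real xi)))"
  proof (rule integral_dominated_convergence)
   show "integrable lborel (\<lambda>xi. norm (G xi))" using G by (rule integrable_norm)
   show "AE xi in lborel. (\<lambda>n. ?q (n + N) xi) \<longlonglongrightarrow> F xi * (\<i> * of_real xi * exp (\<i> * z * of_real xi))"
   proof (intro AE_I2)
    fix xi :: real
    have "((\<lambda>w. exp (\<i> * w * of_real xi)) has_field_derivative \<i> * of_real xi * exp (\<i> * z * of_real xi)) (at z)"
     by (auto intro!: derivative_eq_intros simp: mult_ac)
    then have "((\<lambda>h. (exp (\<i> * (z + h) * of_real xi) - exp (\<i> * z * of_real xi)) / h) \<longlongrightarrow> \<i> * of_real xi * exp (\<i> * z * of_real xi)) (at 0)"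
     by (simp add: DERIV_def)
    then have "(\<lambda>n. (exp (\<i> * (z + X n) * of_real xi) - exp (\<i> * z * of_real xi)) / X n) \<longlonglongrightarrow> \<i> * of_real xi * exp (\<i> * z * of_real xi)"
     using X X0 unfolding tendsto_at_iff_sequentially comp_def by blast
    then have "(\<lambda>n. ?q n xi) \<longlonglongrightarrow> F xi * (\<i> * of_real xi * exp (\<i> * z * of_real xi))"
     by (intro tendsto_mult tendsto_const)
    then show "(\<lambda>n. ?q (n + N) xi) \<longlonglongrightarrow> F xi * (\<i> * of_real xi * exp (\<i> * z * of_real xi))"
     by (rule LIMSEQ_ignore_initial_segment)
   qed
   show "AE xi in lborel. norm (?q (n + N) xi) \<le> norm (G xi)" for n
   proof (intro AE_I2)
    fix xi :: real
    let ?h = "X (n + N)"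
    have h: "cmod ?h < r" "?h \<noteq> 0" using N[of "n + N"] X0 by auto
    have "cmod (exp (\<i> * z * of_real xi + \<i> * ?h * of_real xi) - exp (\<i> * z * of_real xi))
      \<le> cmod (\<i> * ?h * of_real xi) * exp (Re (\<i> * z * of_real xi) + cmod (\<i> * ?h * of_real xi))"
     by (rule norm_exp_diff_le)
    also have "... \<le> (cmod ?h * \<bar>xi\<bar>) * exp ((\<bar>Im z\<bar> + r) * \<bar>xi\<bar>)"
    proof (intro mult_mono)
     have "Re (\<i> * z * of_real xi) + cmod (\<i> * ?h * of_real xi) \<le> \<bar>Im z\<bar> * \<bar>xi\<bar> + r * \<bar>xi\<bar>"
      using h by (intro add_mono Re) (simp add: norm_mult mult_right_mono)
     then show "exp (Re (\<i> * z * of_real xi) + cmod (\<i> * ?h * of_real xi)) \<le> exp ((\<bar>Im z\<bar> + r) * \<bar>xi\<bar>)"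
      by (simp only: exp_le_cancel_iff distrib_right)
    qed (auto simp: norm_mult)
    finally have "cmod ((exp (\<i> * (z + ?h) * of_real xi) - exp (\<i> * z * of_real xi)) / ?h) \<le> \<bar>xi\<bar> * exp ((\<bar>Im z\<bar> + r) * \<bar>xi\<bar>)"
     using h by (simp add: norm_divide field_simps)
    then have "cmod (F xi) * cmod ((exp (\<i> * (z + ?h) * of_real xi) - exp (\<i> * z * of_real xi)) / ?h) \<le> cmod (F xi) * (\<bar>xi\<bar> * exp ((\<bar>Im z\<bar> + r) * \<bar>xi\<bar>))"
     by (intro mult_left_mono) auto
    then show "norm (?q (n + N) xi) \<le> norm (G xi)"
     unfolding G_def norm_mult[of "F xi"] norm_mult[of "of_real _"] norm_of_real by (simp add: mult.commute abs_mult)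
   qed
  qed simp_all
  have eq: "(LINT xi|lborel. ?q (n + N) xi) / of_real (2 * pi) = (cift F (z + X (n + N)) - cift F z) / X (n + N)" for n
  proof -
   have "\<bar>Im (z + X (n + N))\<bar> < \<sigma>"
    using N[of "n + N"] abs_Im_le_cmod[of "X (n + N)"] r abs_triangle_ineq[of "Im z" "Im (X (n + N))"] by simp
   from int[OF this] int[OF z]
   have "(LINT xi|lborel. ?q (n + N) xi) = ((LINT xi|lborel. F xi * exp (\<i> * (z + X (n + N)) * of_real xi)) - (LINT xi|lborel. F xi * exp (\<i> * z * of_real xi))) / X (n + N)"
    by (simp only: Bochner_Integration.integral_diff[symmetric] right_diff_distrib[symmetric] times_divide_eq_right integral_divide_zero)
   then show ?thesis by (simp only: cift_def diff_divide_distrib[symmetric] divide_divide_eq_left mult.commute)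
  qed
  have "(\<lambda>n. (LINT xi|lborel. ?q (n + N) xi) / of_real (2 * pi)) \<longlonglongrightarrow> (LINT xi|lborel. F xi * (\<i> * of_real xi * exp (\<i> * z * of_real xi))) / of_real (2 * pi)"
   using lim by (intro tendsto_divide tendsto_const) auto
  then have "(\<lambda>n. (cift F (z + X (n + N)) - cift F z) / X (n + N)) \<longlonglongrightarrow> cift (\<lambda>xi. \<i> * of_real xi * F xi) z"
   unfolding eq by (simp add: cift_def mult_ac)
  then show "(\<lambda>n. (cift F (z + X n) - cift F z) / X n) \<longlonglongrightarrow> cift (\<lambda>xi. \<i> * of_real xi * F xi) z"
   by (rule LIMSEQ_offset)
 qed
 then show ?thesis by (simp add: DERIV_def)
qed

lemma cift_holomorphic: "GF \<sigma> F \<Longrightarrow> cift F holomorphic_on strip \<sigma>"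
 by (intro holomorphic_onI)
  (auto simp: strip_def field_differentiable_def intro!: exI cift_deriv DERIV_subset[OF cift_deriv, of \<sigma>])

lemma ift_vector_derivative:
 assumes F: "GF \<sigma> F" "\<sigma> > 0"
 shows "(ift F has_vector_derivative ift (\<lambda>xi. \<i> * of_real xi * F xi) x) (at x)"
proof -
 have "(cift F has_field_derivative cift (\<lambda>xi. \<i> * of_real xi * F xi) (of_real x)) (at (of_real x))"
  by (rule cift_deriv[OF F(1)]) (use F(2) in simp)
 from has_vector_derivative_real_field[OF this] show ?thesis by (simp add: cift_of_real comp_def)
qed

section \<open>Convolutions and products\<close>

lemma norm_integral_le_nn:
 fixes f :: "'a => 'b::{banach, second_countable_topology}"
 shows "ennreal (norm (integral\<^sup>L M f)) \<le> (\<integral>\<^sup>+x. ennreal (norm (f x)) \<partial>M)"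
 by (cases "integrable M f") (auto intro: integral_norm_bound_ennreal simp: not_integrable_integral_eq)

definition conv :: "(real => complex) => (real => complex) => real => complex" where
 "conv F G xi = (LINT x|lborel. F x * G (xi - x))"

lemma conv_measurable [measurable]:
 assumes [measurable]: "F \<in> bm" "G \<in> bm"
 shows "conv F G \<in> bm"
 unfolding conv_def by measurable

lemma nn_integral_shift:
 fixes x :: real
 assumes [measurable]: "f \<in> bm"
 shows "(NN xi. f (xi - x)) = (NN xi. f xi)"
 using nn_integral_real_affine[of f 1 "- x"] by simp

text \<open>Cauchy-Schwarz with \<open>f\<close> split into sqrt f times sqrt f: one factor becomes
  the L^1 mass, the other integrates by translation invariance.\<close>

lemma young_L1_L2:
 fixes f g :: "real => real"
 assumes [measurable]: "f \<in> bm" "g \<in> bm" and f0: "\<And>x. f x \<ge> 0" and g0: "\<And>x. g x \<ge> 0"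
 shows "(NN xi. (NN x. ennreal (f x * g (xi - x)))\<^sup>2) \<le> (NN x. ennreal (f x))\<^sup>2 * (NN x. ennreal ((g x)\<^sup>2))"
proof -
 let ?I = "NN x. ennreal (f x)" and ?J = "NN x. ennreal ((g x)\<^sup>2)"
 have "(NN x. ennreal (f x * g (xi - x)))\<^sup>2 \<le> ?I * (NN x. ennreal (f x) * ennreal ((g (xi - x))\<^sup>2))" for xi
 proof -
  have "(NN x. ennreal (sqrt (f x)) * ennreal (sqrt (f x) * g (xi - x)))\<^sup>2
    \<le> (NN x. (ennreal (sqrt (f x)))\<^sup>2) * (NN x. (ennreal (sqrt (f x) * g (xi - x)))\<^sup>2)"
   by (rule Cauchy_Schwarz_nn_integral) auto
  moreover have "ennreal (sqrt (f x)) * ennreal (sqrt (f x) * g (xi - x)) = ennreal (f x * g (xi - x))" for x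
   using f0[of x] g0[of "xi - x"] by (subst ennreal_mult[symmetric]) (auto simp flip: mult.assoc)
  moreover have "(ennreal (sqrt (f x)))\<^sup>2 = ennreal (f x)" for x
   using f0[of x] by (simp add: ennreal_power)
  moreover have "(ennreal (sqrt (f x) * g (xi - x)))\<^sup>2 = ennreal (f x) * ennreal ((g (xi - x))\<^sup>2)" for x
   using f0[of x] g0[of "xi - x"] by (simp add: ennreal_power power_mult_distrib ennreal_mult)
  ultimately show ?thesis by (simp only:)
 qed
 then have "(NN xi. (NN x. ennreal (f x * g (xi - x)))\<^sup>2)
   \<le> (NN xi. ?I * (NN x. ennreal (f x) * ennreal ((g (xi - x))\<^sup>2)))"
  by (intro nn_integral_mono)
 also have "... = ?I * (NN xi. NN x. ennreal (f x) * ennreal ((g (xi - x))\<^sup>2))"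
  by (rule nn_integral_cmult) measurable
 also have "(NN xi. NN x. ennreal (f x) * ennreal ((g (xi - x))\<^sup>2))
   = (NN x. NN xi. ennreal (f x) * ennreal ((g (xi - x))\<^sup>2))"
  by (rule lborel_pair.Fubini') measurable
 also have "... = (NN x. ennreal (f x) * ?J)"
  using nn_integral_shift[of "\<lambda>x. ennreal ((g x)\<^sup>2)"] by (simp add: nn_integral_cmult)
 also have "... = ?I * ?J" by (rule nn_integral_multc) simp
 finally show ?thesis by (simp only: power2_eq_square mult.assoc)
qed

text \<open>By the triangle inequality the weight at xi is at most the product of the weights at x
  and xi - x. The gap between \<open>\<rho>\<close> and \<open>\<sigma>\<close> puts one factor in
  L^1, the other stays in L^2.\<close>

lemma GF_conv:
 assumes F: "GF \<sigma> F" and G: "GF \<sigma> G" and r: "0 \<le> \<rho>" "\<rho> < \<sigma>"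
 shows "GF \<rho> (conv F G)"
proof -
 have [measurable]: "F \<in> bm" "G \<in> bm" using F G by (auto simp: GF_def)
 let ?f = "\<lambda>x. cmod (of_real (\<bar>x\<bar> ^ 0 * exp (\<rho> * \<bar>x\<bar>)) * F x)" and ?g = "\<lambda>x. cmod (of_real (exp (\<rho> * \<bar>x\<bar>)) * G x)"
 have "l2sq (\<lambda>xi. of_real (exp (\<rho> * \<bar>xi\<bar>)) * conv F G xi) \<le> (NN xi. (NN x. ennreal (?f x * ?g (xi - x)))\<^sup>2)"
 proof (rule nn_integral_mono)
  fix xi
  have "ennreal (cmod (of_real (exp (\<rho> * \<bar>xi\<bar>)) * conv F G xi)) = ennreal (cmod (LINT x|lborel. of_real (exp (\<rho> * \<bar>xi\<bar>)) * (F x * G (xi - x))))"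
   by (simp only: conv_def integral_mult_right_zero)
  also have "... \<le> (NN x. ennreal (cmod (of_real (exp (\<rho> * \<bar>xi\<bar>)) * (F x * G (xi - x)))))"
   by (rule norm_integral_le_nn)
  also have "... \<le> (NN x. ennreal (?f x * ?g (xi - x)))"
  proof (intro nn_integral_mono ennreal_leI)
   fix x
   have "\<rho> * \<bar>xi\<bar> \<le> \<rho> * \<bar>x\<bar> + \<rho> * \<bar>xi - x\<bar>"
    unfolding distrib_left[symmetric] using r by (intro mult_left_mono) auto
   then have "exp (\<rho> * \<bar>xi\<bar>) \<le> exp (\<rho> * \<bar>x\<bar>) * exp (\<rho> * \<bar>xi - x\<bar>)" by (simp flip: exp_add)
   then have "exp (\<rho> * \<bar>xi\<bar>) * (cmod (F x) * cmod (G (xi - x))) \<le> (exp (\<rho> * \<bar>x\<bar>) * exp (\<rho> * \<bar>xi - x\<bar>)) * (cmod (F x) * cmod (G (xi - x)))"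
    by (intro mult_right_mono) auto
   then show "cmod (of_real (exp (\<rho> * \<bar>xi\<bar>)) * (F x * G (xi - x))) \<le> ?f x * ?g (xi - x)"
    by (simp add: norm_mult mult_ac)
  qed
  finally have "(ennreal (cmod (of_real (exp (\<rho> * \<bar>xi\<bar>)) * conv F G xi)))\<^sup>2 \<le> (NN x. ennreal (?f x * ?g (xi - x)))\<^sup>2"
   by (intro power_mono) auto
  then show "ennreal ((cmod (of_real (exp (\<rho> * \<bar>xi\<bar>)) * conv F G xi))\<^sup>2) \<le> (NN x. ennreal (?f x * ?g (xi - x)))\<^sup>2"
   by (simp add: ennreal_power)
 qed
 also have "... \<le> (NN x. ennreal (?f x))\<^sup>2 * (NN x. ennreal ((?g x)\<^sup>2))"
  by (rule young_L1_L2) auto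
 also have "... < \<infinity>"
 proof -
  have "(NN x. ennreal (?f x)) < \<infinity>" using GF_integrable[OF F r(2), of 0] unfolding integrable_iff_bounded by blast
  moreover have "(NN x. ennreal ((?g x)\<^sup>2)) < \<infinity>" using GF_mono[OF G, of \<rho>] r by (simp add: GF_def)
  ultimately show ?thesis by (auto simp: ennreal_mult_less_top power2_eq_square)
 qed
 finally show ?thesis by (simp add: GF_def)
qed

lemma ift_mult:
 assumes F: "integrable lborel F" and G: "integrable lborel G"
 shows "ift F x * ift G x = ift (\<lambda>xi. conv F G xi / of_real (2 * pi)) x"
proof -
 have [measurable]: "F \<in> bm" "G \<in> bm" using F G by auto
 let ?k = "\<lambda>y xi. F y * (G (xi - y) * cis (x * xi))"
 have Gs: "integrable lborel (\<lambda>xi. G (xi - y))" for y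
  using lborel_integrable_real_affine[OF G, of 1 "- y"] by simp
 have n: "(LINT xi|lborel. cmod (G (xi - y))) = (LINT xi|lborel. cmod (G xi))" for y
  using lborel_integral_real_affine[of 1 "\<lambda>xi. cmod (G xi)" "- y"] by simp
 have int: "integrable (lborel \<Otimes>\<^sub>M lborel) (\<lambda>(y, xi). ?k y xi)"
 proof (rule lborel_pair.Fubini_integrable)
  have "(LINT xi|lborel. norm (case (y, xi) of (y, xi) => ?k y xi)) = norm (F y) * (LINT xi|lborel. norm (G xi))" for y
   using n[of y] by (simp add: norm_mult)
  then show "integrable lborel (\<lambda>y. LINT xi|lborel. norm (case (y, xi) of (y, xi) => ?k y xi))"
   using F by (simp add: integrable_norm)
  show "AE y in lborel. integrable lborel (\<lambda>xi. case (y, xi) of (y, xi) => ?k y xi)"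
   by (intro AE_I2) (auto intro!: integrable_mult_right integrable_cis_mult Gs)
 qed measurable
 have inner: "(LINT xi|lborel. ?k y xi) = (F y * cis (x * y)) * (LINT xi|lborel. G xi * cis (x * xi))" for y
 proof -
  have "(LINT xi|lborel. ?k y xi) = F y * (LINT xi|lborel. G (xi - y) * cis (x * xi))" by (rule integral_mult_right_zero)
  also have "(LINT xi|lborel. G (xi - y) * cis (x * xi)) = (LINT xi|lborel. G ((y + 1 * xi) - y) * cis (x * (y + 1 * xi)))"
   by (rule lborel_integral_real_affine[of 1 _ "y", unfolded abs_one scaleR_one]) simp
  also have "... = (LINT xi|lborel. cis (x * y) * (G xi * cis (x * xi)))"
   by (intro Bochner_Integration.integral_cong refl) (simp add: distrib_left mult_ac flip: cis_mult)
  also have "... = cis (x * y) * (LINT xi|lborel. G xi * cis (x * xi))" by (rule integral_mult_right_zero)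
  finally show ?thesis by (simp only: mult.assoc)
 qed
 have "(LINT xi|lborel. conv F G xi * cis (x * xi)) = (LINT xi|lborel. LINT y|lborel. ?k y xi)"
  unfolding conv_def integral_mult_left_zero[symmetric] by (simp only: mult.assoc)
 also have "... = (LINT y|lborel. LINT xi|lborel. ?k y xi)"
  by (rule lborel_pair.Fubini_integral[OF int])
 also have "... = (LINT y|lborel. F y * cis (x * y)) * (LINT xi|lborel. G xi * cis (x * xi))"
  unfolding inner by (rule integral_mult_left_zero)
 finally have e: "(LINT xi|lborel. conv F G xi * cis (x * xi)) = (LINT y|lborel. F y * cis (x * y)) * (LINT xi|lborel. G xi * cis (x * xi))" .
 have "(LINT xi|lborel. (conv F G xi / of_real (2 * pi)) * cis (x * xi)) = (LINT xi|lborel. conv F G xi * cis (x * xi)) / of_real (2 * pi)"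
  by (simp only: integral_divide_zero[symmetric] times_divide_eq_left)
 then show ?thesis unfolding ift_def e by simp
qed

section \<open>Linearity, and transforms of derivatives\<close>

lemma ift_add:
 assumes "integrable lborel F" "integrable lborel G"
 shows "ift (\<lambda>xi. F xi + G xi) x = ift F x + ift G x"
 unfolding ift_def distrib_right
 using assms by (subst Bochner_Integration.integral_add) (auto intro!: integrable_cis_mult simp: add_divide_distrib)

lemma ift_cmult: "ift (\<lambda>xi. c * F xi) x = c * ift F x"
 unfolding ift_def by (simp only: mult.assoc integral_mult_right_zero times_divide_eq_right)

lemma ift_sum:
 assumes "finite S" "\<And>i. i \<in> S \<Longrightarrow> integrable lborel (F i)"
 shows "ift (\<lambda>xi. \<Sum>i\<in>S. F i xi) x = (\<Sum>i\<in>S. ift (F i) x)"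
 using assms
proof (induction S rule: finite_induct)
 case empty then show ?case by (simp add: ift_def)
next
 case (insert i S)
 then show ?case using ift_add[of "F i" "\<lambda>xi. \<Sum>i\<in>S. F i xi" x] by simp
qed

lemma has_fourier_cmult:
 assumes "has_fourier f F"
 shows "has_fourier (\<lambda>x. c * f x) (\<lambda>xi. c * F xi)"
proof -
 have sq: "square_integrable (\<lambda>x. c * f x)" if "square_integrable f" for f
  using that by (auto simp: square_integrable_def norm_mult power_mult_distrib)
 have f: "square_integrable f" and [measurable]: "F \<in> bm"
  using assms by (auto simp: has_fourier_def square_integrable_def)
 have [measurable]: "fourier_trunc R f \<in> bm" for R
  using fourier_trunc_measurable[OF f] by simp
 have t: "fourier_trunc R (\<lambda>x. c * f x) xi = c * fourier_trunc R f xi" for R xi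
  unfolding fourier_trunc_def by (simp only: mult.assoc set_integral_mult_right)
 have "(NN xi. ennreal ((cmod (c * F xi - fourier_trunc R (\<lambda>x. c * f x) xi))\<^sup>2))
   = ennreal ((cmod c)\<^sup>2) * (NN xi. ennreal ((cmod (F xi - fourier_trunc R f xi))\<^sup>2))" for R
 proof -
  have "ennreal ((cmod (c * F xi - fourier_trunc R (\<lambda>x. c * f x) xi))\<^sup>2) = ennreal ((cmod c)\<^sup>2) * ennreal ((cmod (F xi - fourier_trunc R f xi))\<^sup>2)" for xi
   unfolding t right_diff_distrib[symmetric] norm_mult power_mult_distrib by (rule ennreal_mult) auto
  then show ?thesis by (simp add: nn_integral_cmult)
 qed
 moreover have "((\<lambda>R. ennreal ((cmod c)\<^sup>2) * (NN xi. ennreal ((cmod (F xi - fourier_trunc R f xi))\<^sup>2))) \<longlongrightarrow> ennreal ((cmod c)\<^sup>2) * 0) at_top"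
  using assms unfolding has_fourier_def by (intro ennreal_tendsto_cmult) auto
 ultimately show ?thesis using assms sq by (simp add: has_fourier_def)
qed

lemma has_fourier_add:
 assumes "has_fourier f F" "has_fourier g G"
 shows "has_fourier (\<lambda>x. f x + g x) (\<lambda>xi. F xi + G xi)"
 using has_fourier_diff[OF assms(1) has_fourier_cmult[OF assms(2), of "-1"]] by simp

lemma has_fourier_sum:
 assumes "finite S" "\<And>i. i \<in> S \<Longrightarrow> has_fourier (f i) (F i)"
 shows "has_fourier (\<lambda>x. \<Sum>i\<in>S. f i x) (\<lambda>xi. \<Sum>i\<in>S. F i xi)"
 using assms
proof (induction S rule: finite_induct)
 case empty then show ?case using has_fourier_0 by simp
next
 case (insert i S)
 then show ?case using has_fourier_add[of "f i" "F i"] by simp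
qed

lemma AE_L2_tendsto:
 assumes [measurable]: "\<And>k. g k \<in> borel_measurable M" "G \<in> borel_measurable M"
  and b: "\<And>k. (\<integral>\<^sup>+x. ennreal ((cmod (G x - g k x))\<^sup>2) \<partial>M) \<le> ennreal ((1/2) ^ k)"
 shows "AE x in M. (\<lambda>k. g k x) \<longlonglongrightarrow> (G x :: complex)"
proof -
 have "(\<integral>\<^sup>+x. (\<Sum>k. ennreal ((cmod (G x - g k x))\<^sup>2)) \<partial>M) = (\<Sum>k. \<integral>\<^sup>+x. ennreal ((cmod (G x - g k x))\<^sup>2) \<partial>M)"
  by (rule nn_integral_suminf) simp
 also have "... \<le> (\<Sum>k. ennreal ((1/2) ^ k))" by (intro suminf_le b) auto
 also have "... < \<infinity>" by (subst suminf_ennreal2) (auto intro!: summable_geometric)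
 finally have "AE x in M. (\<Sum>k. ennreal ((cmod (G x - g k x))\<^sup>2)) \<noteq> \<infinity>"
  by (intro nn_integral_PInf_AE) auto
 then show ?thesis
 proof eventually_elim
  case (elim x)
  have "summable (\<lambda>k. (cmod (G x - g k x))\<^sup>2)"
   using elim by (intro summable_suminf_not_top) auto
  then have "(\<lambda>k. (cmod (G x - g k x))\<^sup>2) \<longlonglongrightarrow> 0" by (rule summable_LIMSEQ_zero)
  from tendsto_real_sqrt[OF this] have "(\<lambda>k. G x - g k x) \<longlonglongrightarrow> 0"
   by (intro tendsto_norm_zero_cancel[of "\<lambda>k. G x - g k x"]) (simp only: real_sqrt_zero real_sqrt_abs abs_norm_cancel)
  from tendsto_diff[OF tendsto_const[of "G x"] this] show ?case by simp
 qed
qed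

text \<open>Otherwise |f(R)|^2 + |f(-R)|^2 would stay above a positive constant on a half-line and
  have infinite integral. Along suitable radii this kills the boundary terms of an integration by
  parts.\<close>

lemma square_integrable_small_ends:
 assumes f: "square_integrable f" and e: "\<epsilon> > 0"
 shows "\<exists>R\<ge>B. cmod (f R) < \<epsilon> \<and> cmod (f (- R)) < \<epsilon>"
proof (rule ccontr)
 assume "\<not> ?thesis"
 then have big: "\<And>R. R \<ge> B \<Longrightarrow> cmod (f R) \<ge> \<epsilon> \<or> cmod (f (- R)) \<ge> \<epsilon>" by (meson not_le)
 have [measurable]: "f \<in> bm" using f by (auto simp: square_integrable_def)
 have "(NN x. ennreal (\<epsilon>\<^sup>2) * indicator {B..} x) \<le> (NN x. ennreal ((cmod (f x))\<^sup>2) + ennreal ((cmod (f (- x)))\<^sup>2))"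
 proof (rule nn_integral_mono)
  fix x
  show "ennreal (\<epsilon>\<^sup>2) * indicator {B..} x \<le> ennreal ((cmod (f x))\<^sup>2) + ennreal ((cmod (f (- x)))\<^sup>2)"
  proof (cases "x \<ge> B")
   case True
   from big[OF this] have "\<epsilon>\<^sup>2 \<le> (cmod (f x))\<^sup>2 \<or> \<epsilon>\<^sup>2 \<le> (cmod (f (- x)))\<^sup>2"
    using e by (auto intro!: power_mono)
   then show ?thesis using True by (auto intro: add_increasing add_increasing2 ennreal_leI)
  qed auto
 qed
 also have "... = l2sq f + l2sq (\<lambda>x. f (- x))" by (rule nn_integral_add) auto
 also have "... < \<infinity>" using square_integrable_nn[OF f] l2sq_reflect[of f] by simp
 finally have "(NN x. ennreal (\<epsilon>\<^sup>2) * indicator {B..} x) < \<infinity>" .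
 moreover have "emeasure lborel {B..} = \<infinity>"
 proof -
  have "ennreal n \<le> emeasure lborel {B..}" for n :: nat
  proof -
   have "ennreal n = emeasure lborel {B..B + n}" by (subst emeasure_lborel_Icc) auto
   also have "... \<le> emeasure lborel {B..}" by (intro emeasure_mono) auto
   finally show ?thesis .
  qed
  then have "of_nat n \<le> emeasure lborel {B..}" for n :: nat by (simp add: ennreal_of_nat_eq_real_of_nat)
  then have "\<not> emeasure lborel {B..} < top"
   using ennreal_Ex_less_of_nat[of "emeasure lborel {B..}"] by (meson not_le)
  then show ?thesis by (simp add: less_top[symmetric] infinity_ennreal_def)
 qed
 ultimately show False using e by (simp add: nn_integral_cmult ennreal_mult_top)
qed

text \<open>Integration by parts on [-R, R] relates the truncated transforms of \<open>f\<close> and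
  \<open>f'\<close>. The radii are chosen so that the boundary values are small and both truncations
  are within 2^(-k) in squared L^2 distance; then everything converges almost everywhere and the
  limits can be compared.\<close>

lemma has_fourier_deriv:
 assumes d: "\<And>x. (f has_vector_derivative f' x) (at x)" and c: "continuous_on UNIV f'"
  and f': "square_integrable f'" and F: "has_fourier f F"
 shows "has_fourier f' (\<lambda>xi. \<i> * of_real xi * F xi)"
proof -
 have f: "square_integrable f" and [measurable]: "F \<in> bm"
  using F by (auto simp: has_fourier_def square_integrable_def)
 obtain G where G: "has_fourier f' G" using has_fourier_exists[OF f'] by blast
 then have [measurable]: "G \<in> bm" by (auto simp: has_fourier_def square_integrable_def)
 have [measurable]: "fourier_trunc R f \<in> bm" "fourier_trunc R f' \<in> bm" for R
  using fourier_trunc_measurable f f' by auto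
 have ibp: "fourier_trunc R f' xi = f R * cis (- (R * xi)) - f (- R) * cis (R * xi) + \<i> * of_real xi * fourier_trunc R f xi"
  if R: "R \<ge> 0" for R xi
 proof -
  let ?h' = "\<lambda>x. f' x * cis (- (x * xi)) - \<i> * of_real xi * (f x * cis (- (x * xi)))"
  have cd: "((\<lambda>x. cis (- (x * xi))) has_vector_derivative (- \<i> * of_real xi * cis (- (x * xi)))) (at x)" for x
  proof -
   have "((\<lambda>z. exp (- (\<i> * z * of_real xi))) has_field_derivative (- \<i> * of_real xi * exp (- (\<i> * of_real x * of_real xi)))) (at (of_real x))"
    by (auto intro!: derivative_eq_intros simp: mult_ac)
   from has_vector_derivative_real_field[OF this] show ?thesis
    by (simp add: comp_def cis_conv_exp mult_ac)
  qed
  have "(LINT x|lborel. indicator {-R..R} x *\<^sub>R ?h' x) = f R * cis (- (R * xi)) - f (- R) * cis (- (- R * xi))"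
  proof (rule integral_FTC_Icc)
   show "- R \<le> R" using R by simp
   fix x
   show "((\<lambda>x. f x * cis (- (x * xi))) has_vector_derivative ?h' x) (at x within {-R..R})"
    using has_vector_derivative_mult[OF d[of x] cd[of x]]
    by (auto intro!: has_vector_derivative_at_within simp: algebra_simps)
  next
   have "continuous_on UNIV f"
    using d by (meson continuous_at_imp_continuous_on has_vector_derivative_continuous)
   then show "continuous_on {-R..R} ?h'"
    using c by (intro continuous_intros) (auto intro: continuous_on_subset)
  qed
  also have "(LINT x|lborel. indicator {-R..R} x *\<^sub>R ?h' x) = fourier_trunc R f' xi - \<i> * of_real xi * fourier_trunc R f xi"
  proof -
   have "(LINT x:{-R..R}|lborel. ?h' x) = (LINT x:{-R..R}|lborel. f' x * cis (- (x * xi))) - (LINT x:{-R..R}|lborel. \<i> * of_real xi * (f x * cis (- (x * xi))))"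
    using fourier_trunc_integrable[OF f, of R xi] fourier_trunc_integrable[OF f', of R xi]
    by (intro set_integral_diff) auto
   then show ?thesis unfolding fourier_trunc_def set_lebesgue_integral_def[of _ _ ?h'] by (simp only: set_integral_mult_right)
  qed
  finally show ?thesis by (simp add: algebra_simps)
 qed
 let ?e = "\<lambda>f F R. NN xi. ennreal ((cmod (F xi - fourier_trunc R f xi))\<^sup>2)"
 have ex: "\<exists>R. R \<ge> 0 \<and> ?e f F R \<le> ennreal ((1/2)^k) \<and> ?e f' G R \<le> ennreal ((1/2)^k) \<and> cmod (f R) < inverse (Suc k) \<and> cmod (f (- R)) < inverse (Suc k)" for k
 proof -
  have "\<forall>\<^sub>F R in at_top. ?e f F R < ennreal ((1/2)^k)" "\<forall>\<^sub>F R in at_top. ?e f' G R < ennreal ((1/2)^k)"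
   using F G unfolding has_fourier_def by (auto intro!: order_tendstoD(2)[where y=0])
  then have "\<forall>\<^sub>F R in at_top. R \<ge> 0 \<and> ?e f F R < ennreal ((1/2)^k) \<and> ?e f' G R < ennreal ((1/2)^k)"
   using eventually_ge_at_top[of 0] by eventually_elim simp
  then obtain B where B: "\<And>R. R \<ge> B \<Longrightarrow> R \<ge> 0 \<and> ?e f F R < ennreal ((1/2)^k) \<and> ?e f' G R < ennreal ((1/2)^k)"
   by (auto simp: eventually_at_top_linorder)
  obtain R where "R \<ge> B" "cmod (f R) < inverse (Suc k)" "cmod (f (- R)) < inverse (Suc k)"
   using square_integrable_small_ends[OF f, of "inverse (Suc k)" B] by auto
  with B[of R] show ?thesis by (intro exI[of _ R]) (simp add: less_imp_le)
 qed
 have "\<exists>R. \<forall>k. R k \<ge> 0 \<and> ?e f F (R k) \<le> ennreal ((1/2)^k) \<and> ?e f' G (R k) \<le> ennreal ((1/2)^k)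
   \<and> cmod (f (R k)) < inverse (Suc k) \<and> cmod (f (- R k)) < inverse (Suc k)"
  by (intro choice allI ex)
 then obtain R where Rall: "\<forall>k. R k \<ge> 0 \<and> ?e f F (R k) \<le> ennreal ((1/2)^k) \<and> ?e f' G (R k) \<le> ennreal ((1/2)^k)
   \<and> cmod (f (R k)) < inverse (Suc k) \<and> cmod (f (- R k)) < inverse (Suc k)" ..
 have R: "R k \<ge> 0" "?e f F (R k) \<le> ennreal ((1/2)^k)" "?e f' G (R k) \<le> ennreal ((1/2)^k)"
   "cmod (f (R k)) < inverse (Suc k)" "cmod (f (- R k)) < inverse (Suc k)" for k
  using Rall[rule_format, of k] by (simp_all only: simp_thms)
 have z: "(\<lambda>k. f (R k)) \<longlonglongrightarrow> 0" "(\<lambda>k. f (- R k)) \<longlonglongrightarrow> 0"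
  using R(4,5) by (auto intro!: Lim_null_comparison[OF _ LIMSEQ_inverse_real_of_nat] always_eventually less_imp_le)
 have a1: "AE xi in lborel. (\<lambda>k. fourier_trunc (R k) f xi) \<longlonglongrightarrow> F xi"
 proof (rule AE_L2_tendsto)
  show "(NN xi. ennreal ((cmod (F xi - fourier_trunc (R k) f xi))\<^sup>2)) \<le> ennreal ((1/2)^k)" for k by (rule R(2))
 qed simp_all
 have a2: "AE xi in lborel. (\<lambda>k. fourier_trunc (R k) f' xi) \<longlonglongrightarrow> G xi"
 proof (rule AE_L2_tendsto)
  show "(NN xi. ennreal ((cmod (G xi - fourier_trunc (R k) f' xi))\<^sup>2)) \<le> ennreal ((1/2)^k)" for k by (rule R(3))
 qed simp_all
 have "AE xi in lborel. G xi = \<i> * of_real xi * F xi"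
 proof (rule eventually_mono[OF eventually_conj[OF a1 a2]])
  fix xi
  assume elim: "((\<lambda>k. fourier_trunc (R k) f xi) \<longlonglongrightarrow> F xi) \<and> ((\<lambda>k. fourier_trunc (R k) f' xi) \<longlonglongrightarrow> G xi)"
  have zc: "(\<lambda>k. f (R k) * cis (- (R k * xi))) \<longlonglongrightarrow> 0" "(\<lambda>k. f (- R k) * cis (R k * xi)) \<longlonglongrightarrow> 0"
   by (rule tendsto_norm_zero_cancel, unfold norm_mult norm_cis mult_1_right, rule tendsto_norm_zero, rule z)+
  have "(\<lambda>k. f (R k) * cis (- (R k * xi)) - f (- R k) * cis (R k * xi) + \<i> * of_real xi * fourier_trunc (R k) f xi) \<longlonglongrightarrow> 0 - 0 + \<i> * of_real xi * F xi"
   by (intro tendsto_add tendsto_diff zc tendsto_mult tendsto_const conjunct1[OF elim])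
  then have "(\<lambda>k. fourier_trunc (R k) f' xi) \<longlonglongrightarrow> \<i> * of_real xi * F xi"
   using ibp[OF R(1)] by simp
  from LIMSEQ_unique[OF conjunct2[OF elim] this] show "G xi = \<i> * of_real xi * F xi" .
 qed
 then show ?thesis by (intro has_fourier_cong_AE[OF G]) auto
qed

section \<open>Multiplication by the damping coefficient\<close>

lemma square_integrable_mult_bounded:
 assumes f: "square_integrable f" and [measurable]: "g \<in> bm" and b: "\<And>x. cmod (g x) \<le> B"
 shows "square_integrable (\<lambda>x. g x * f x)"
proof (rule square_integrableI_nn)
 have [measurable]: "f \<in> bm" using f by (auto simp: square_integrable_def)
 show "(\<lambda>x. g x * f x) \<in> borel_measurable lborel" by simp
 have "l2sq (\<lambda>x. g x * f x) \<le> (NN x. ennreal (B\<^sup>2) * ennreal ((cmod (f x))\<^sup>2))"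
 proof (rule nn_integral_mono)
  fix x
  have "(cmod (g x * f x))\<^sup>2 \<le> B\<^sup>2 * (cmod (f x))\<^sup>2"
   unfolding norm_mult power_mult_distrib using b[of x] by (intro mult_right_mono power_mono) auto
  then have "ennreal ((cmod (g x * f x))\<^sup>2) \<le> ennreal (B\<^sup>2 * (cmod (f x))\<^sup>2)" by (rule ennreal_leI)
  then show "ennreal ((cmod (g x * f x))\<^sup>2) \<le> ennreal (B\<^sup>2) * ennreal ((cmod (f x))\<^sup>2)" by (subst (asm) ennreal_mult) auto
 qed
 also have "... = ennreal (B\<^sup>2) * l2sq f" by (rule nn_integral_cmult) simp
 also have "... < \<infinity>" using square_integrable_nn[OF f] by (simp add: ennreal_mult_less_top)
 finally show "l2sq (\<lambda>x. g x * f x) < \<infinity>" .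
qed

lemma square_integrable_sum:
 assumes "finite S" "\<And>i. i \<in> S \<Longrightarrow> square_integrable (f i)"
 shows "square_integrable (\<lambda>x. \<Sum>i\<in>S. f i x)"
 using assms
proof (induction S rule: finite_induct)
 case empty then show ?case by (simp add: square_integrable_def)
next
 case (insert i S)
 have "square_integrable (\<lambda>x. (-1) * (\<Sum>i\<in>S. f i x))"
  using insert by (intro square_integrable_mult_bounded[where B=1]) auto
 from square_integrable_diff[OF _ this, of "f i"] insert show ?case by simp
qed

lemma weighted_sum_square_le:
 fixes w y :: "nat => real"
 assumes w: "\<And>j. w j \<ge> 0"
 shows "(\<Sum>j\<in>S. w j * y j)\<^sup>2 \<le> (\<Sum>j\<in>S. w j) * (\<Sum>j\<in>S. w j * (y j)\<^sup>2)"
proof -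
 have "(\<Sum>j\<in>S. sqrt (w j) * (sqrt (w j) * y j))\<^sup>2 \<le> (\<Sum>j\<in>S. (sqrt (w j))\<^sup>2) * (\<Sum>j\<in>S. (sqrt (w j) * y j)\<^sup>2)"
  by (rule Cauchy_Schwarz_ineq_sum)
 then show ?thesis using w by (simp add: power_mult_distrib mult.assoc[symmetric])
qed

lemma sum_triangle_swap:
 fixes g :: "nat => nat => 'a::comm_monoid_add"
 shows "(\<Sum>n\<le>N. \<Sum>j\<le>n. g j (n - j)) = (\<Sum>j\<le>N. \<Sum>k\<le>N - j. g j k)"
proof -
 have "(\<Sum>j\<le>N. \<Sum>k\<le>N - j. g j k) = (\<Sum>(j, k)\<in>(SIGMA j:{..N}. {..N - j}). g j k)"
  by (rule sum.Sigma) auto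
 also have "(SIGMA j:{..N}. {..N - j}) = {(i, j). i + j \<le> N}" by auto
 also have "(\<Sum>(j, k)\<in>{(i, j). i + j \<le> N}. g j k) = (\<Sum>n\<le>N. \<Sum>j\<le>n. g j (n - j))"
  by (rule sum.triangle_reindex_eq)
 finally show ?thesis by simp
qed

lemma norm_exp_partial_sum_le: "cmod (\<Sum>k\<le>K. of_real (x ^ k / fact k)) \<le> exp \<bar>x :: real\<bar>"
proof -
 have "cmod (\<Sum>k\<le>K. of_real (x ^ k / fact k)) \<le> (\<Sum>k\<le>K. \<bar>x\<bar> ^ k /\<^sub>R fact k)"
  by (rule sum_norm_le) (simp add: norm_mult norm_inverse norm_power divide_inverse mult.commute)
 also have "... \<le> (\<Sum>k. \<bar>x\<bar> ^ k /\<^sub>R fact k)"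
  by (rule sum_le_suminf[OF summable_exp_generic]) auto
 finally show ?thesis by (simp add: exp_def)
qed

text \<open>Write a for \<open>d 0\<close> and f for \<open>ift F\<close>. The partial Taylor sums
  of (a f)(x + c) at the imaginary shift c = -i s \<open>\<sigma>\<close>, s = 1 or -1, have
  transforms P_N(xi) H(xi) with P_N tending to exp(s \<open>\<sigma>\<close> xi). By Leibniz they
  are sums over j of c^j a^(j)/j! times partial Taylor sums of f alone, whose L^2 norms are
  controlled by the weighted norm of \<open>F\<close>. Cauchy-Schwarz with weights of total mass at
  most \<open>A\<close> gives a bound uniform in N, and Fatou lets N grow. Each sign contributes 2
  A^2: A^2 from Cauchy-Schwarz, 2 from the constant in \<open>has_fourier_l2sq\<close>.\<close>

lemma mult_GF:
 fixes d :: "nat => real => real"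
 assumes der: "\<And>k x. (d k has_real_derivative d (Suc k) x) (at x)"
  and M: "\<And>k x. \<bar>d k x\<bar> \<le> M k" and A: "(\<lambda>k. \<sigma> ^ k / fact k * M k) sums A"
  and \<sigma>: "\<sigma> > 0" and F: "GF \<sigma> F"
 shows "\<exists>H. has_fourier (\<lambda>x. of_real (d 0 x) * ift F x) H \<and> GF \<sigma> H \<and>
  wl2 \<sigma> H \<le> ennreal (4 * A\<^sup>2) * wl2 \<sigma> F"
proof -
 have [measurable]: "F \<in> bm" using F by (rule GF_measurable)
 define Q where "Q = wl2 \<sigma> F"
 have Qfin: "Q < \<infinity>" using F by (simp add: Q_def GF_def)
 define w where "w j = \<sigma> ^ j / fact j * M j" for j
 have M0: "M j \<ge> 0" for j using M[of j 0] by (rule order_trans[OF abs_ge_zero])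
 have w0: "w j \<ge> 0" for j using M0 \<sigma> by (simp add: w_def)
 have sw: "(\<Sum>j\<in>S. w j) \<le> A" if "finite S" for S
  using sum_le_suminf[OF sums_summable[OF A] that] w0 sums_unique[OF A] by (simp add: w_def)
 have A0: "A \<ge> 0" using sw[of "{}"] by simp
 define c\<phi> where "c\<phi> k = (\<lambda>xi. (\<i> * of_real xi) ^ k / fact k * F xi)" for k
 define \<phi> where "\<phi> k = ift (c\<phi> k)" for k
 define \<alpha> where "\<alpha> k x = complex_of_real (d k x / fact k)" for k x
 define b where "b n x = (\<Sum>j\<le>n. \<alpha> j x * \<phi> (n - j) x)" for n x
 have c\<phi>: "GF (\<sigma>/2) (c\<phi> k)" for k
 proof -
  have "GF (\<sigma>/2) (\<lambda>xi. (\<i> ^ k / fact k) * (of_real xi ^ k * F xi))"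
   using \<sigma> by (intro GF_cmult GF_poly[OF F]) auto
  then show ?thesis by (simp add: c\<phi>_def power_mult_distrib mult_ac)
 qed
 have s2: "\<sigma>/2 > 0" using \<sigma> by simp
 have \<phi>d: "(\<phi> k has_vector_derivative of_nat (Suc k) * \<phi> (Suc k) x) (at x)" for k x
 proof -
  have "(\<phi> k has_vector_derivative ift (\<lambda>xi. \<i> * of_real xi * c\<phi> k xi) x) (at x)"
   unfolding \<phi>_def by (rule ift_vector_derivative[OF c\<phi> s2])
  also have "(\<lambda>xi. \<i> * of_real xi * c\<phi> k xi) = (\<lambda>xi. of_nat (Suc k) * c\<phi> (Suc k) xi)"
   by (simp add: c\<phi>_def fun_eq_iff del: of_nat_Suc)
  finally show ?thesis unfolding \<phi>_def ift_cmult .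
 qed
 have \<alpha>d: "(\<alpha> k has_vector_derivative of_nat (Suc k) * \<alpha> (Suc k) x) (at x)" for k x
 proof -
  have "((\<lambda>x. d k x / fact k) has_real_derivative (d (Suc k) x / fact k)) (at x)"
   by (intro DERIV_cdivide der)
  then have "(\<alpha> k has_vector_derivative of_real (d (Suc k) x / fact k)) (at x)"
   unfolding \<alpha>_def by (intro has_vector_derivative_of_real) (simp add: has_real_derivative_iff_has_vector_derivative)
  also have "complex_of_real (d (Suc k) x / fact k) = of_nat (Suc k) * \<alpha> (Suc k) x"
   by (simp add: \<alpha>_def del: of_nat_Suc)
  finally show ?thesis .
 qed
 \<comment> \<open>Dividing by factorials turns Leibniz' rule into a convolution without binomial
   coefficients: in each term of the derivative the factors j and n + 1 - j add up to n + 1.\<close>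
 have bd: "(b n has_vector_derivative of_nat (Suc n) * b (Suc n) x) (at x)" for n x
 proof -
  have "((\<lambda>x. \<Sum>j\<le>n. \<alpha> j x * \<phi> (n - j) x) has_vector_derivative
    (\<Sum>j\<le>n. \<alpha> j x * (of_nat (Suc (n - j)) * \<phi> (Suc (n - j)) x) + of_nat (Suc j) * \<alpha> (Suc j) x * \<phi> (n - j) x)) (at x)"
   by (intro has_vector_derivative_sum has_vector_derivative_mult \<alpha>d \<phi>d)
  also have "(\<Sum>j\<le>n. \<alpha> j x * (of_nat (Suc (n - j)) * \<phi> (Suc (n - j)) x) + of_nat (Suc j) * \<alpha> (Suc j) x * \<phi> (n - j) x)
    = (\<Sum>j\<le>n. of_nat (Suc n - j) * (\<alpha> j x * \<phi> (Suc n - j) x)) + (\<Sum>j\<le>n. of_nat (Suc j) * (\<alpha> (Suc j) x * \<phi> (Suc n - Suc j) x))"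
   unfolding sum.distrib by (intro arg_cong2[of _ _ _ _ "(+)"] sum.cong refl) (simp_all add: Suc_diff_le mult_ac)
  also have "(\<Sum>j\<le>n. of_nat (Suc n - j) * (\<alpha> j x * \<phi> (Suc n - j) x)) = (\<Sum>j\<le>Suc n. of_nat (Suc n - j) * (\<alpha> j x * \<phi> (Suc n - j) x))"
   by simp
  also have "(\<Sum>j\<le>n. of_nat (Suc j) * (\<alpha> (Suc j) x * \<phi> (Suc n - Suc j) x)) = (\<Sum>j\<le>Suc n. of_nat j * (\<alpha> j x * \<phi> (Suc n - j) x))"
   by (subst sum.atMost_Suc_shift) simp
  also have "(\<Sum>j\<le>Suc n. of_nat (Suc n - j) * (\<alpha> j x * \<phi> (Suc n - j) x)) + ... = of_nat (Suc n) * b (Suc n) x"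
   unfolding b_def sum_distrib_left sum.distrib[symmetric]
   by (intro sum.cong refl) (simp add: of_nat_diff algebra_simps)
  finally show ?thesis by (simp add: b_def[abs_def])
 qed
 have \<phi>sq: "square_integrable (\<phi> k)" for k
  using GF_has_fourier[OF c\<phi> s2, of k] by (simp add: \<phi>_def has_fourier_def)
 have dcont: "continuous_on UNIV (d k)" for k
  using der by (meson DERIV_isCont continuous_at_imp_continuous_on)
 have [measurable]: "\<alpha> k \<in> bm" for k
  unfolding \<alpha>_def using borel_measurable_continuous_onI[OF dcont[of k]] by measurable
 have bsq: "square_integrable (b n)" for n
  unfolding b_def
 proof (intro square_integrable_sum square_integrable_mult_bounded \<phi>sq)
  show "cmod (\<alpha> j x) \<le> M j / fact j" for j x
   using M[of j x] by (simp add: \<alpha>_def norm_divide divide_right_mono)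
 qed auto
 have bcont: "continuous_on UNIV (b n)" for n
  using bd by (meson continuous_at_imp_continuous_on has_vector_derivative_continuous)
 obtain H where H: "has_fourier (b 0) H" using has_fourier_exists[OF bsq] by blast
 have [measurable]: "H \<in> bm" using H by (auto simp: has_fourier_def square_integrable_def)
 have hb: "has_fourier (b n) (\<lambda>xi. (\<i> * of_real xi) ^ n / fact n * H xi)" for n
 proof (induction n)
  case 0 then show ?case using H by simp
 next
  case (Suc n)
  have "has_fourier (\<lambda>x. of_nat (Suc n) * b (Suc n) x) (\<lambda>xi. \<i> * of_real xi * ((\<i> * of_real xi) ^ n / fact n * H xi))"
   by (rule has_fourier_deriv[OF bd _ _ Suc])
    (auto intro!: square_integrable_mult_bounded bsq continuous_on_mult bcont continuous_on_const simp del: of_nat_Suc)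
  from has_fourier_cmult[OF this, of "1 / of_nat (Suc n)"]
  have "has_fourier (\<lambda>x. 1 / of_nat (Suc n) * (of_nat (Suc n) * b (Suc n) x)) (\<lambda>xi. 1 / of_nat (Suc n) * (\<i> * of_real xi * ((\<i> * of_real xi) ^ n / fact n * H xi)))" .
  moreover have "1 / of_nat (Suc n) * (of_nat (Suc n) * z) = z" for z :: complex by (simp del: of_nat_Suc)
  moreover have "1 / of_nat (Suc n) * (\<i> * of_real xi * ((\<i> * of_real xi) ^ n / fact n * H xi)) = (\<i> * of_real xi) ^ Suc n / fact (Suc n) * H xi" for xi
   by (simp add: divide_inverse mult_ac del: of_nat_Suc)
  ultimately show ?case by (simp only:)
 qed
 have bound: "l2sq (\<lambda>xi. of_real (exp (s * \<sigma> * xi)) * H xi) \<le> ennreal (2 * A\<^sup>2) * Q" if s: "\<bar>s\<bar> = 1" for s :: real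
 proof -
  define c where "c = - \<i> * of_real (s * \<sigma>)"
  have ci: "c ^ k * ((\<i> * of_real xi) ^ k / fact k * z) = of_real ((s * \<sigma> * xi) ^ k / fact k) * z" for k xi z
  proof -
   have "c ^ k * (\<i> * of_real xi) ^ k = of_real ((s * \<sigma> * xi) ^ k)"
    unfolding power_mult_distrib[symmetric] c_def by (simp add: mult_ac flip: of_real_mult of_real_power)
   then show ?thesis by (simp add: mult.assoc[symmetric])
  qed
  have nc: "cmod c = \<sigma>" using s \<sigma> by (simp add: c_def norm_mult abs_mult)
  define P where "P K xi = (\<Sum>k\<le>K. complex_of_real ((s * \<sigma> * xi) ^ k / fact k))" for K xi
  have [measurable]: "P K \<in> bm" for K unfolding P_def by measurable
  have Pb: "cmod (P K xi) \<le> exp (\<sigma> * \<bar>xi\<bar>)" for K xi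
   using norm_exp_partial_sum_le[of "s * \<sigma> * xi" K] s \<sigma> by (simp add: P_def abs_mult)
  define \<Phi> where "\<Phi> K x = (\<Sum>k\<le>K. c ^ k * \<phi> k x)" for K x
  define g where "g N x = (\<Sum>n\<le>N. c ^ n * b n x)" for N x
  have [measurable]: "\<phi> k \<in> bm" for k
   using \<phi>sq[of k] by (auto simp: square_integrable_def)
  have [measurable]: "\<Phi> K \<in> bm" for K
   unfolding \<Phi>_def by measurable
  have \<Phi>: "ennreal (2 * pi) * l2sq (\<Phi> K) \<le> Q" for K
  proof -
   have i: "integrable lborel (\<lambda>xi. c ^ k * c\<phi> k xi)" for k
    by (intro integrable_mult_right GF_integrable0[OF c\<phi> s2])
   have "\<Phi> K = ift (\<lambda>xi. \<Sum>k\<le>K. c ^ k * c\<phi> k xi)"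
    unfolding \<Phi>_def \<phi>_def ift_cmult[symmetric] by (intro ext ift_sum[symmetric] i) auto
   also have "(\<lambda>xi. \<Sum>k\<le>K. c ^ k * c\<phi> k xi) = (\<lambda>xi. P K xi * F xi)"
    by (simp only: c\<phi>_def ci P_def sum_distrib_right)
   finally have e: "\<Phi> K = ift (\<lambda>xi. P K xi * F xi)" .
   have "integrable lborel (\<lambda>xi. \<Sum>k\<le>K. c ^ k * c\<phi> k xi)"
    by (intro Bochner_Integration.integrable_sum i)
   then have "integrable lborel (\<lambda>xi. P K xi * F xi)"
    by (simp only: c\<phi>_def ci P_def sum_distrib_right)
   then have "ennreal (2 * pi) * l2sq (\<Phi> K) \<le> l2sq (\<lambda>xi. P K xi * F xi)"
    unfolding e by (rule ift_l2sq)
   also have "... \<le> Q"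
    unfolding Q_def
    by (intro nn_integral_mono ennreal_leI power_mono) (auto simp: norm_mult intro!: mult_right_mono Pb)
   finally show ?thesis .
  qed
  \<comment> \<open>The triangle j + k <= N is summed over k first: each coefficient of
    \<open>a\<close> then multiplies a partial sum \<open>\<Phi> (N - j)\<close>, for which a bound
    independent of its length is available.\<close>
  have gx: "g N x = (\<Sum>j\<le>N. c ^ j * \<alpha> j x * \<Phi> (N - j) x)" for N x
  proof -
   have "g N x = (\<Sum>n\<le>N. \<Sum>j\<le>n. (c ^ j * \<alpha> j x) * (c ^ (n - j) * \<phi> (n - j) x))"
    unfolding g_def b_def sum_distrib_left
   proof (intro sum.cong refl)
    fix n j :: nat assume "j \<in> {..n}"
    then have "c ^ n = c ^ j * c ^ (n - j)" by (simp flip: power_add)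
    then show "c ^ n * (\<alpha> j x * \<phi> (n - j) x) = (c ^ j * \<alpha> j x) * (c ^ (n - j) * \<phi> (n - j) x)" by (simp only: mult_ac)
   qed
   also have "... = (\<Sum>j\<le>N. \<Sum>k\<le>N - j. (c ^ j * \<alpha> j x) * (c ^ k * \<phi> k x))" by (rule sum_triangle_swap)
   finally show ?thesis unfolding \<Phi>_def sum_distrib_left .
  qed
  have gb: "(cmod (g N x))\<^sup>2 \<le> A * (\<Sum>j\<le>N. w j * (cmod (\<Phi> (N - j) x))\<^sup>2)" for N x
  proof -
   have "cmod (g N x) \<le> (\<Sum>j\<le>N. w j * cmod (\<Phi> (N - j) x))"
    unfolding gx
   proof (rule sum_norm_le)
    fix j
    have "cmod (c ^ j * \<alpha> j x) \<le> w j"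
     unfolding norm_mult norm_power nc w_def \<alpha>_def using M[of j x] \<sigma> by (simp add: norm_divide divide_right_mono mult_left_mono)
    then show "cmod (c ^ j * \<alpha> j x * \<Phi> (N - j) x) \<le> w j * cmod (\<Phi> (N - j) x)"
     unfolding norm_mult[of "c ^ j * \<alpha> j x"] by (intro mult_right_mono) auto
   qed
   then have "(cmod (g N x))\<^sup>2 \<le> (\<Sum>j\<le>N. w j * cmod (\<Phi> (N - j) x))\<^sup>2" by (intro power_mono) auto
   also have "... \<le> (\<Sum>j\<le>N. w j) * (\<Sum>j\<le>N. w j * (cmod (\<Phi> (N - j) x))\<^sup>2)" by (rule weighted_sum_square_le[OF w0])
   also have "... \<le> A * (\<Sum>j\<le>N. w j * (cmod (\<Phi> (N - j) x))\<^sup>2)"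
    by (intro mult_right_mono sw sum_nonneg) (auto simp: w0)
   finally show ?thesis .
  qed
  have gl: "ennreal (2 * pi) * l2sq (g N) \<le> ennreal (A\<^sup>2) * Q" for N
  proof -
   have "l2sq (g N) \<le> (NN x. ennreal A * (\<Sum>j\<le>N. ennreal (w j) * ennreal ((cmod (\<Phi> (N - j) x))\<^sup>2)))"
   proof (rule nn_integral_mono)
    fix x
    have "ennreal ((cmod (g N x))\<^sup>2) \<le> ennreal (A * (\<Sum>j\<le>N. w j * (cmod (\<Phi> (N - j) x))\<^sup>2))"
     by (intro ennreal_leI gb)
    also have "... = ennreal A * (\<Sum>j\<le>N. ennreal (w j) * ennreal ((cmod (\<Phi> (N - j) x))\<^sup>2))"
     using A0 w0 by (subst ennreal_mult) (auto intro!: sum_nonneg simp: ennreal_mult simp flip: sum_ennreal)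
    finally show "ennreal ((cmod (g N x))\<^sup>2) \<le> ennreal A * (\<Sum>j\<le>N. ennreal (w j) * ennreal ((cmod (\<Phi> (N - j) x))\<^sup>2))" .
   qed
   also have "... = ennreal A * (\<Sum>j\<le>N. ennreal (w j) * l2sq (\<Phi> (N - j)))"
    by (subst nn_integral_cmult, simp, subst nn_integral_sum, simp, subst nn_integral_cmult, simp, rule refl)
   finally have "ennreal (2 * pi) * l2sq (g N) \<le> ennreal (2 * pi) * (ennreal A * (\<Sum>j\<le>N. ennreal (w j) * l2sq (\<Phi> (N - j))))"
    by (rule mult_left_mono) simp
   also have "... = ennreal A * (\<Sum>j\<le>N. ennreal (w j) * (ennreal (2 * pi) * l2sq (\<Phi> (N - j))))"
    unfolding sum_distrib_left by (intro sum.cong refl) (simp only: mult_ac)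
   also have "... \<le> ennreal A * (\<Sum>j\<le>N. ennreal (w j) * Q)"
    by (intro mult_left_mono sum_mono \<Phi>) auto
   also have "... = ennreal A * (ennreal (\<Sum>j\<le>N. w j) * Q)"
    using w0 by (simp add: sum_distrib_right[symmetric])
   also have "... \<le> ennreal A * (ennreal A * Q)"
    by (intro mult_left_mono mult_right_mono ennreal_leI sw) auto
   also have "... = ennreal (A\<^sup>2) * Q"
    using A0 by (simp only: mult.assoc[symmetric] ennreal_mult[symmetric] power2_eq_square)
   finally show ?thesis .
  qed
  have hg: "has_fourier (g N) (\<lambda>xi. P N xi * H xi)" for N
  proof -
   have "has_fourier (g N) (\<lambda>xi. \<Sum>n\<le>N. c ^ n * ((\<i> * of_real xi) ^ n / fact n * H xi))"
    unfolding g_def by (intro has_fourier_sum has_fourier_cmult hb) auto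
   then show ?thesis by (simp only: ci P_def sum_distrib_right)
  qed
  have "l2sq (\<lambda>xi. of_real (exp (s * \<sigma> * xi)) * H xi - 0) \<le> ennreal (2 * A\<^sup>2) * Q"
  proof (rule l2_fatou)
   show "AE xi in lborel. (\<lambda>N. P N xi * H xi) \<longlonglongrightarrow> of_real (exp (s * \<sigma> * xi)) * H xi"
   proof (intro AE_I2 tendsto_mult tendsto_const)
    fix xi
    have "(\<lambda>k. (s * \<sigma> * xi) ^ k / fact k) sums exp (s * \<sigma> * xi)"
     using exp_converges[of "s * \<sigma> * xi"] by (simp add: divide_inverse mult.commute)
    then have "(\<lambda>N. \<Sum>k\<le>N. (s * \<sigma> * xi) ^ k / fact k) \<longlonglongrightarrow> exp (s * \<sigma> * xi)"
     by (simp only: sums_def_le)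
    from tendsto_of_real[OF this, where 'a=complex]
    show "(\<lambda>N. P N xi) \<longlonglongrightarrow> of_real (exp (s * \<sigma> * xi))"
     unfolding P_def of_real_sum[symmetric] .
   qed
   have "l2sq (\<lambda>xi. P N xi * H xi - 0) \<le> ennreal (2 * A\<^sup>2) * Q" for N
   proof -
    have "l2sq (\<lambda>xi. P N xi * H xi - 0) \<le> ennreal (4 * pi) * l2sq (g N)"
     using has_fourier_l2sq[OF hg] by simp
    also have "ennreal (4 * pi) = ennreal 2 * ennreal (2 * pi)" by (subst ennreal_mult[symmetric]) simp_all
    also have "ennreal 2 * ennreal (2 * pi) * l2sq (g N) \<le> ennreal 2 * (ennreal (A\<^sup>2) * Q)"
     unfolding mult.assoc by (intro mult_left_mono gl) auto
    also have "... = ennreal (2 * A\<^sup>2) * Q" by (simp only: mult.assoc[symmetric] ennreal_mult[symmetric] zero_le_power2 zero_le_numeral)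
    finally show ?thesis .
   qed
   then show "\<forall>\<^sub>F N in sequentially. l2sq (\<lambda>xi. P N xi * H xi - 0) \<le> ennreal (2 * A\<^sup>2) * Q" by (intro always_eventually allI)
  qed auto
  then show ?thesis by simp
 qed
 \<comment> \<open>The even weight is one of the two one-sided exponentials, so its square is at
   most the sum of their squares.\<close>
 have fin: "wl2 \<sigma> H \<le> ennreal (4 * A\<^sup>2) * Q"
 proof -
  have "wl2 \<sigma> H
    \<le> (NN xi. ennreal ((cmod (of_real (exp (1 * \<sigma> * xi)) * H xi))\<^sup>2) + ennreal ((cmod (of_real (exp ((-1) * \<sigma> * xi)) * H xi))\<^sup>2))"
   by (rule nn_integral_mono) (auto simp: abs_if intro: add_increasing add_increasing2)
  also have "... = l2sq (\<lambda>xi. of_real (exp (1 * \<sigma> * xi)) * H xi) + l2sq (\<lambda>xi. of_real (exp ((-1) * \<sigma> * xi)) * H xi)"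
   by (rule nn_integral_add) auto
  also have "... \<le> ennreal (2 * A\<^sup>2) * Q + ennreal (2 * A\<^sup>2) * Q"
   by (intro add_mono bound) auto
  also have "... = ennreal (4 * A\<^sup>2) * Q"
   by (simp only: distrib_right[symmetric] ennreal_plus[symmetric] mult_nonneg_nonneg zero_le_numeral zero_le_power2) simp
  finally show ?thesis .
 qed
 moreover have "GF \<sigma> H"
  using fin Qfin by (auto simp: GF_def ennreal_mult_less_top intro: le_less_trans)
 moreover have "b 0 = (\<lambda>x. of_real (d 0 x) * ift F x)"
  by (simp add: b_def fun_eq_iff \<alpha>_def \<phi>_def c\<phi>_def)
 ultimately show ?thesis using H unfolding Q_def by (intro exI[of _ H] conjI) simp_all
qed

section \<open>Resonance kernels\<close>

definition W :: "real => real" where "W xi = 1 + xi\<^sup>2"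

lemma W_ge_1: "W xi \<ge> 1" and W_pos: "W xi > 0"
 by (auto simp: W_def add_pos_nonneg)

lemma W_measurable [measurable]: "W \<in> bm"
 unfolding W_def by measurable

text \<open>The kernel left over after one integration by parts in time: the three weights come from
  \<open>\<integral>|\<partial>\<^sub>t v| \<le> W U\<close>, and the last summand controls the time integral of the nonlinearity itself.\<close>

definition ker :: "real => real => real => real => real => real => real => real" where
 "ker \<tau> xi k \<Omega> a b c = \<bar>k\<bar> * (2 * (W xi + 2 + (W a + W b + W c)) / (W xi / \<tau> + \<bar>\<Omega>\<bar>) + \<tau> / W xi)"

definition phi :: "real => real => real => real" where
 "phi \<alpha> \<beta> xi = \<alpha> * xi ^ 5 - \<beta> * xi ^ 3"

text \<open>\<open>E\<close> is the amount by which the interacting frequencies exceed |xi| in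
  total. Beyond W xi they enlarge the weights only by a factor 1 + E^2, which half of the decay
  exp(-\<open>\<sigma>\<close> E) absorbs; the square of the other half is the full decay again. The
  numeral 18 is twice 9: W + 2 is at most 3 W, and the three weights contribute 6 W.\<close>

lemma ker_sq_bound:
 assumes \<sigma>: "\<sigma> > 0" and E: "E \<ge> 0" and k: "\<bar>k\<bar> \<le> \<bar>xi\<bar> * exp (- (\<sigma> * E))"
  and w: "W a + W b + W c \<le> 6 * W xi * (1 + E\<^sup>2)" and \<tau>: "0 < \<tau>"
 shows "(ker \<tau> xi k \<Omega> a b c)\<^sup>2 \<le> 2 * (18 * (1 + 8 / \<sigma>\<^sup>2))\<^sup>2 * \<tau>\<^sup>2 *
  (xi\<^sup>2 * exp (- (\<sigma> * E)) * (1 / (1 + \<tau> * \<bar>\<Omega>\<bar> / W xi))\<^sup>2 + (xi\<^sup>2 / (W xi)\<^sup>2) * exp (- (\<sigma> * E)))"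
proof -
 \<comment> \<open>8 / \<open>\<sigma>\<close>^2 is 2! / (\<open>\<sigma>\<close>/2)^2, the constant
   of \<open>pow_le_exp\<close> for E^2 against half the decay rate.\<close>
 define C1 where "C1 = 1 + 8 / \<sigma>\<^sup>2"
 have C1: "C1 \<ge> 1" by (simp add: C1_def)
 define \<mu> where "\<mu> = exp (- (\<sigma> * E / 2))"
 have \<mu>2: "exp (- (\<sigma> * E)) = \<mu> * \<mu>" by (simp add: \<mu>_def flip: exp_add)
 have \<mu>: "0 < \<mu>" "\<mu> \<le> 1" using \<sigma> E by (auto simp: \<mu>_def)
 define \<Psi> where "\<Psi> = 1 / (1 + \<tau> * \<bar>\<Omega>\<bar> / W xi)"
 have Wp: "W xi > 0" "W xi \<ge> 1" by (rule W_pos W_ge_1)+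
 have den: "1 + \<tau> * \<bar>\<Omega>\<bar> / W xi \<ge> 1" using \<tau> Wp by simp
 have \<Psi>: "\<Psi> > 0" using den by (simp add: \<Psi>_def)
 have "(1 + E\<^sup>2) * \<mu> \<le> C1"
 proof -
  have "E ^ 2 \<le> (fact 2 / (\<sigma>/2) ^ 2) * exp ((\<sigma>/2) * E)" using \<sigma> E by (intro pow_le_exp) auto
  then have "E\<^sup>2 \<le> (8 / \<sigma>\<^sup>2) * exp (\<sigma> * E / 2)" by (simp add: power_divide fact_numeral)
  moreover have "1 \<le> exp (\<sigma> * E / 2)" using \<sigma> E by simp
  ultimately have "1 + E\<^sup>2 \<le> C1 * exp (\<sigma> * E / 2)"
   unfolding C1_def distrib_right mult_1_left by (intro add_mono)
  then have "(1 + E\<^sup>2) * \<mu> \<le> (C1 * exp (\<sigma> * E / 2)) * \<mu>" using \<mu> by (intro mult_right_mono) auto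
  also have "... = C1" by (simp add: \<mu>_def mult.assoc flip: exp_add)
  finally show ?thesis .
 qed
 then have E1: "(1 + E\<^sup>2) * exp (- (\<sigma> * E)) \<le> C1 * \<mu>"
  unfolding \<mu>2 mult.assoc[symmetric] using \<mu> by (intro mult_right_mono) auto
 have frac: "1 / (W xi / \<tau> + \<bar>\<Omega>\<bar>) = \<tau> * \<Psi> / W xi"
 proof -
  have "W xi / \<tau> + \<bar>\<Omega>\<bar> = (W xi / \<tau>) * (1 + \<tau> * \<bar>\<Omega>\<bar> / W xi)"
   using \<tau> Wp by (simp add: distrib_left)
  then show ?thesis unfolding \<Psi>_def using \<tau> Wp by (simp only:) simp
 qed
 have sumw: "W xi + 2 + (W a + W b + W c) \<le> 9 * W xi * (1 + E\<^sup>2)"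
 proof -
  have "W xi + 2 \<le> 3 * W xi" using Wp by simp
  also have "... \<le> 3 * W xi * (1 + E\<^sup>2)" using Wp by (simp add: algebra_simps)
  finally show ?thesis using w by (simp add: algebra_simps)
 qed
 have "2 * (W xi + 2 + (W a + W b + W c)) / (W xi / \<tau> + \<bar>\<Omega>\<bar>) = 2 * (W xi + 2 + (W a + W b + W c)) * (\<tau> * \<Psi> / W xi)"
  using frac by (metis divide_inverse inverse_eq_divide)
 also have "... \<le> 2 * (9 * W xi * (1 + E\<^sup>2)) * (\<tau> * \<Psi> / W xi)"
  using sumw \<tau> \<Psi> Wp by (intro mult_right_mono mult_left_mono) auto
 also have "... = 18 * (1 + E\<^sup>2) * \<tau> * \<Psi>" using Wp by (simp add: field_simps)
 finally have b1: "2 * (W xi + 2 + (W a + W b + W c)) / (W xi / \<tau> + \<bar>\<Omega>\<bar>) \<le> 18 * (1 + E\<^sup>2) * \<tau> * \<Psi>" .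
 have "ker \<tau> xi k \<Omega> a b c \<le> (\<bar>xi\<bar> * exp (- (\<sigma> * E))) * (18 * (1 + E\<^sup>2) * \<tau> * \<Psi> + \<tau> / W xi)"
  unfolding ker_def using k b1 \<tau> Wp W_pos[of a] W_pos[of b] W_pos[of c]
  by (intro mult_mono add_mono) (auto intro!: add_nonneg_nonneg divide_nonneg_nonneg)
 also have "... = \<bar>xi\<bar> * 18 * \<tau> * \<Psi> * ((1 + E\<^sup>2) * exp (- (\<sigma> * E))) + \<bar>xi\<bar> * exp (- (\<sigma> * E)) * \<tau> / W xi"
  by (simp add: algebra_simps)
 also have "... \<le> \<bar>xi\<bar> * 18 * \<tau> * \<Psi> * (C1 * \<mu>) + \<bar>xi\<bar> * \<mu> * \<tau> / W xi"
  using E1 \<tau> \<Psi> Wp \<mu> mult_left_le[of \<mu> \<mu>]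
  by (intro add_mono mult_left_mono divide_right_mono mult_right_mono) (auto simp: \<mu>2)
 finally have le: "ker \<tau> xi k \<Omega> a b c \<le> (18 * C1) * \<tau> * (\<bar>xi\<bar> * \<mu> * \<Psi>) + \<tau> * (\<bar>xi\<bar> * \<mu> / W xi)"
  by (simp add: mult_ac)
 have "0 \<le> ker \<tau> xi k \<Omega> a b c"
  unfolding ker_def using \<tau> Wp W_pos[of a] W_pos[of b] W_pos[of c] by (auto intro!: mult_nonneg_nonneg add_nonneg_nonneg divide_nonneg_nonneg)
 with le have "(ker \<tau> xi k \<Omega> a b c)\<^sup>2 \<le> ((18 * C1) * \<tau> * (\<bar>xi\<bar> * \<mu> * \<Psi>) + \<tau> * (\<bar>xi\<bar> * \<mu> / W xi))\<^sup>2"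
  by (rule power_mono)
 also have "... \<le> 2 * ((18 * C1) * \<tau> * (\<bar>xi\<bar> * \<mu> * \<Psi>))\<^sup>2 + 2 * (\<tau> * (\<bar>xi\<bar> * \<mu> / W xi))\<^sup>2"
  using sum_squares_bound[of "(18 * C1) * \<tau> * (\<bar>xi\<bar> * \<mu> * \<Psi>)" "\<tau> * (\<bar>xi\<bar> * \<mu> / W xi)"] unfolding power2_sum by linarith
 also have "... = 2 * (18 * C1)\<^sup>2 * \<tau>\<^sup>2 * (xi\<^sup>2 * exp (- (\<sigma> * E)) * \<Psi>\<^sup>2) + 2 * \<tau>\<^sup>2 * ((xi\<^sup>2 / (W xi)\<^sup>2) * exp (- (\<sigma> * E)))"
  unfolding \<mu>2 by (simp add: power_mult_distrib power_divide power2_eq_square mult_ac)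
 also have "... \<le> 2 * (18 * C1)\<^sup>2 * \<tau>\<^sup>2 * (xi\<^sup>2 * exp (- (\<sigma> * E)) * \<Psi>\<^sup>2) + 2 * (18 * C1)\<^sup>2 * \<tau>\<^sup>2 * ((xi\<^sup>2 / (W xi)\<^sup>2) * exp (- (\<sigma> * E)))"
 proof -
  have "1 \<le> (18 * C1)\<^sup>2" using C1 by (intro one_le_power) auto
  then have "2 * \<tau>\<^sup>2 \<le> 2 * (18 * C1)\<^sup>2 * \<tau>\<^sup>2" using mult_right_mono[of 1 "(18 * C1)\<^sup>2" "2 * \<tau>\<^sup>2"] by simp
  then have "2 * \<tau>\<^sup>2 * ((xi\<^sup>2 / (W xi)\<^sup>2) * exp (- (\<sigma> * E))) \<le> 2 * (18 * C1)\<^sup>2 * \<tau>\<^sup>2 * ((xi\<^sup>2 / (W xi)\<^sup>2) * exp (- (\<sigma> * E)))"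
   by (rule mult_right_mono) simp
  then show ?thesis by (rule add_left_mono)
 qed
 finally show ?thesis unfolding C1_def \<Psi>_def distrib_left .
qed

section \<open>One-dimensional integrals behind the kernel bounds\<close>

lemma nn_soft:
 assumes "c > 0" "R \<ge> 0"
 shows "(NN x. ennreal (exp (- (c * max 0 (\<bar>x\<bar> - R))))) \<le> ennreal (2 * R + 4 / c)"
proof -
 have "(NN x. ennreal (exp (- (c * max 0 (\<bar>x\<bar> - R)))))
   \<le> (NN x. indicator {-R..R} x + (ennreal (exp (- (c * \<bar>x - R\<bar>))) + ennreal (exp (- (c * \<bar>x - (-R)\<bar>)))))"
 proof (rule nn_integral_mono)
  fix x
  consider "\<bar>x\<bar> \<le> R" | "x > R" | "x < - R" by linarith
  then show "ennreal (exp (- (c * max 0 (\<bar>x\<bar> - R)))) \<le> indicator {-R..R} x + (ennreal (exp (- (c * \<bar>x - R\<bar>))) + ennreal (exp (- (c * \<bar>x - (-R)\<bar>))))"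
  proof cases
   case 1 then show ?thesis using assms by (auto simp: indicator_def max_def intro: add_increasing2)
  next
   case 2
   then have "max 0 (\<bar>x\<bar> - R) = \<bar>x - R\<bar>" using assms by auto
   then show ?thesis by (simp add: add_increasing add_increasing2)
  next
   case 3
   then have "max 0 (\<bar>x\<bar> - R) = \<bar>x - (- R)\<bar>" using assms by auto
   then show ?thesis by (simp add: add_increasing add_increasing2)
  qed
 qed
 also have "... = (NN x. indicator {-R..R} x) + ((NN x. ennreal (exp (- (c * \<bar>x - R\<bar>)))) + (NN x. ennreal (exp (- (c * \<bar>x - (-R)\<bar>)))))"
  by (subst nn_integral_add, simp, simp, subst nn_integral_add) auto
 also have "... = ennreal (2 * R) + (ennreal (2 / c) + ennreal (2 / c))"
  using assms nn_integral_shift[of "\<lambda>x. ennreal (exp (- (c * \<bar>x\<bar>)))" R] nn_integral_shift[of "\<lambda>x. ennreal (exp (- (c * \<bar>x\<bar>)))" "- R"]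
   nn_exp_abs[OF assms(1)] by simp
 also have "... = ennreal (2 * R + 4 / c)"
  using assms by (simp add: ennreal_plus[symmetric] del: ennreal_plus)
 finally show ?thesis .
qed

lemma nn_inverse_square:
 assumes "A > 0"
 shows "(NN x. ennreal ((1 / (1 + A * \<bar>x\<bar>))\<^sup>2)) = ennreal (2 / A)"
proof -
 have half: "(NN x. ennreal ((1 / (1 + A * x))\<^sup>2) * indicator {0..} x) = ennreal (1 / A)"
 proof -
  have "(NN x. ennreal ((1 / (1 + A * x))\<^sup>2) * indicator {0..} x) = ennreal (0 - (- (1 / (A * (1 + A * 0)))))"
  proof (rule nn_integral_FTC_atLeast)
   have "filterlim (\<lambda>x. A * (1 + A * x)) at_top at_top"
    using assms by (intro filterlim_tendsto_pos_mult_at_top[OF tendsto_const] filterlim_tendsto_add_at_top[OF tendsto_const]) (auto simp: filterlim_ident)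
   then have "((\<lambda>x. - (1 / (A * (1 + A * x)))) \<longlongrightarrow> - 0) at_top"
    by (intro tendsto_minus tendsto_divide_0[OF tendsto_const] filterlim_at_top_imp_at_infinity)
   then show "((\<lambda>x. - (1 / (A * (1 + A * x)))) \<longlongrightarrow> 0) at_top" by simp
   show "((\<lambda>x. - (1 / (A * (1 + A * x)))) has_real_derivative (1 / (1 + A * x))\<^sup>2) (at x)" if "0 \<le> x" for x
   proof -
    have p: "1 + A * x > 0" using assms that by (simp add: add_pos_nonneg)
    have "((\<lambda>x. 1 + A * x) has_real_derivative A) (at x)" by (auto intro!: derivative_eq_intros)
    from DERIV_cmult[OF DERIV_inverse'[OF this], of "- (1 / A)"] p
    have "((\<lambda>x. - (1 / A) * inverse (1 + A * x)) has_real_derivative - (1 / A) * (- (inverse (1 + A * x) * A * inverse (1 + A * x)))) (at x)"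
     by simp
    moreover have "- (1 / A) * inverse (1 + A * x) = - (1 / (A * (1 + A * x)))" for x by (simp add: divide_inverse)
    moreover have "- (1 / A) * (- (inverse (1 + A * x) * A * inverse (1 + A * x))) = (1 / (1 + A * x))\<^sup>2"
     using assms by (simp add: power2_eq_square divide_inverse)
    ultimately show ?thesis by (simp only:)
   qed
  qed (use assms in auto)
  then show ?thesis by simp
 qed
 have "(NN x. ennreal ((1 / (1 + A * \<bar>x\<bar>))\<^sup>2))
   = (NN x. ennreal ((1 / (1 + A * x))\<^sup>2) * indicator {0..} x + ennreal ((1 / (1 + A * (- x)))\<^sup>2) * indicator {0..} (- x))"
  by (rule nn_integral_cong_AE, rule AE_mp[OF AE_lborel_singleton[of 0]]) (auto intro!: AE_I2 simp: indicator_def)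
 also have "... = (NN x. ennreal ((1 / (1 + A * x))\<^sup>2) * indicator {0..} x)
   + (NN x. ennreal ((1 / (1 + A * (- x)))\<^sup>2) * indicator {0..} (- x))"
  by (rule nn_integral_add) auto
 also have "(NN x. ennreal ((1 / (1 + A * (- x)))\<^sup>2) * indicator {0..} (- x)) = (NN x. ennreal ((1 / (1 + A * x))\<^sup>2) * indicator {0..} x)"
  using nn_integral_real_affine[of "\<lambda>x. ennreal ((1 / (1 + A * x))\<^sup>2) * indicator {0..} x" "-1" 0] by simp
 finally show ?thesis unfolding half using assms by (subst (asm) ennreal_plus[symmetric]) auto
qed

text \<open>The linear factor is the length of the interaction segment at distance p from a resonant
  line, see \<open>nn_resonant_lines\<close>. The exact integral carries a logarithm; for |p| > 1
  the cruder s^(3/2) <= (1 + s)^2 with s = A|p| bounds |p|/(1 + A|p|)^2 by A^(-3/2). With A of size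
  xi^2 and R of size |xi| the result, multiplied by xi^2, is uniform in xi.\<close>

lemma nn_h_bound:
 assumes A: "A > 0" and C: "C \<ge> 0" and R: "R \<ge> 0"
 shows "(NN p. ennreal ((2 * \<bar>p\<bar> + C) * (1 / (1 + A * \<bar>p\<bar>))\<^sup>2) * indicator {-R..R} p)
   \<le> ennreal ((2 + C) * (2 / A) + 4 * R / (A * sqrt A))"
proof -
 have pt: "(2 * \<bar>p\<bar> + C) * (1 / (1 + A * \<bar>p\<bar>))\<^sup>2 \<le> (2 + C) * (1 / (1 + A * \<bar>p\<bar>))\<^sup>2 + 2 / (A * sqrt A)" for p
 proof (cases "\<bar>p\<bar> \<le> 1")
  case True
  then have "(2 * \<bar>p\<bar> + C) * (1 / (1 + A * \<bar>p\<bar>))\<^sup>2 \<le> (2 + C) * (1 / (1 + A * \<bar>p\<bar>))\<^sup>2" by (intro mult_right_mono) auto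
  then show ?thesis using A by (simp add: add_increasing2)
 next
  case False
  define s where "s = A * \<bar>p\<bar>"
  have s: "s > 0" using A False by (simp add: s_def)
  have "s * sqrt s \<le> (1 + s)\<^sup>2"
  proof -
   have "sqrt s \<le> 1 + s" using s by (intro real_le_lsqrt) (auto simp: power2_eq_square algebra_simps)
   then have "s * sqrt s \<le> (1 + s) * (1 + s)" using s by (intro mult_mono) auto
   then show ?thesis by (simp add: power2_eq_square)
  qed
  then have "\<bar>p\<bar> * (A * sqrt A) \<le> (1 + A * \<bar>p\<bar>)\<^sup>2"
  proof -
   have "A * \<bar>p\<bar> * sqrt A * 1 \<le> A * \<bar>p\<bar> * sqrt A * sqrt \<bar>p\<bar>"
    using A False by (intro mult_left_mono) auto
   also have "... = s * sqrt s" by (simp add: s_def real_sqrt_mult mult_ac)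
   finally show ?thesis using \<open>s * sqrt s \<le> (1 + s)\<^sup>2\<close> by (simp add: s_def mult_ac)
  qed
  then have "\<bar>p\<bar> / (1 + A * \<bar>p\<bar>)\<^sup>2 \<le> 1 / (A * sqrt A)"
   using A s unfolding s_def by (simp add: field_simps)
  then have "2 * \<bar>p\<bar> * (1 / (1 + A * \<bar>p\<bar>))\<^sup>2 \<le> 2 / (A * sqrt A)" by (simp add: power_divide)
  moreover have "C * (1 / (1 + A * \<bar>p\<bar>))\<^sup>2 \<le> (2 + C) * (1 / (1 + A * \<bar>p\<bar>))\<^sup>2" by (intro mult_right_mono) auto
  ultimately show ?thesis unfolding distrib_right by linarith
 qed
 have "(NN p. ennreal ((2 * \<bar>p\<bar> + C) * (1 / (1 + A * \<bar>p\<bar>))\<^sup>2) * indicator {-R..R} p)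
   \<le> (NN p. ennreal (2 + C) * ennreal ((1 / (1 + A * \<bar>p\<bar>))\<^sup>2) + ennreal (2 / (A * sqrt A)) * indicator {-R..R} p)"
 proof (rule nn_integral_mono)
  fix p
  have "ennreal ((2 * \<bar>p\<bar> + C) * (1 / (1 + A * \<bar>p\<bar>))\<^sup>2) \<le> ennreal ((2 + C) * (1 / (1 + A * \<bar>p\<bar>))\<^sup>2 + 2 / (A * sqrt A))"
   by (intro ennreal_leI pt)
  also have "... = ennreal (2 + C) * ennreal ((1 / (1 + A * \<bar>p\<bar>))\<^sup>2) + ennreal (2 / (A * sqrt A))"
   using A C by (subst ennreal_plus, simp, simp, subst ennreal_mult) auto
  finally show "ennreal ((2 * \<bar>p\<bar> + C) * (1 / (1 + A * \<bar>p\<bar>))\<^sup>2) * indicator {-R..R} p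
    \<le> ennreal (2 + C) * ennreal ((1 / (1 + A * \<bar>p\<bar>))\<^sup>2) + ennreal (2 / (A * sqrt A)) * indicator {-R..R} p"
   by (auto simp: indicator_def)
 qed
 also have "... = ennreal (2 + C) * ennreal (2 / A) + ennreal (2 / (A * sqrt A)) * ennreal (2 * R)"
  using R by (subst nn_integral_add, simp, simp, subst nn_integral_cmult, simp, subst nn_integral_cmult_indicator) (auto simp: nn_inverse_square[OF A])
 also have "... = ennreal ((2 + C) * (2 / A) + 4 * R / (A * sqrt A))"
  using A C R by (subst ennreal_mult[symmetric], simp, simp, subst ennreal_mult[symmetric], simp, simp, subst ennreal_plus[symmetric]) auto
 finally show ?thesis .
qed

lemma nn_integral_cmult_real:
 fixes f :: "'a => real"
 assumes [measurable]: "f \<in> borel_measurable M" and "\<And>x. f x \<ge> 0" "c \<ge> 0"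
 shows "(\<integral>\<^sup>+x. ennreal (c * f x) \<partial>M) = ennreal c * (\<integral>\<^sup>+x. ennreal (f x) \<partial>M)"
 using assms by (simp only: ennreal_mult nn_integral_cmult measurable_compose[OF assms(1) measurable_ennreal])

section \<open>Lower bounds for the resonance functions\<close>

lemma phi_diff2:
 "phi \<alpha> \<beta> xi - phi \<alpha> \<beta> x - phi \<alpha> \<beta> (xi - x) = xi * x * (xi - x) * (5/2 * \<alpha> * (xi\<^sup>2 + x\<^sup>2 + (xi - x)\<^sup>2) - 3 * \<beta>)"
 unfolding phi_def by (simp add: field_simps power2_eq_square power3_eq_cube eval_nat_numeral)

text \<open>The third or fifth power of a + b + c minus the separate powers vanishes when a + b, b +
  c or c + a does; for frequencies x, y, xi - x - y these sums are x + y, xi - x and xi - y. The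
  quadratic factor left from the fifth power is 5/2 times the sum of their squares. With c = 0 this
  is the quadratic case.\<close>

lemma phi_diff3:
 "phi \<alpha> \<beta> xi - phi \<alpha> \<beta> x - phi \<alpha> \<beta> y - phi \<alpha> \<beta> (xi - x - y)
  = (xi - x) * (xi - y) * (x + y) * (5/2 * \<alpha> * ((xi - x)\<^sup>2 + (xi - y)\<^sup>2 + (x + y)\<^sup>2) - 3 * \<beta>)"
 unfolding phi_def by (simp add: field_simps power2_eq_square power3_eq_cube eval_nat_numeral)

text \<open>Beyond the threshold, 3|\<open>\<beta>\<close>| is at most half of
  |\<open>\<alpha>\<close>| xi^2, so the fifth-order part dominates the third-order one whatever the
  signs are.\<close>

lemma phase_factor_ge:
 fixes \<alpha> \<beta> xi S :: real
 assumes \<alpha>: "\<alpha> \<noteq> 0" and xi: "\<bar>xi\<bar> \<ge> 1 + 6 * \<bar>\<beta>\<bar> / \<bar>\<alpha>\<bar>" and S: "S \<ge> xi\<^sup>2"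
 shows "\<bar>5/2 * \<alpha> * S - 3 * \<beta>\<bar> \<ge> \<bar>\<alpha>\<bar> * xi\<^sup>2"
proof -
 have a: "\<bar>\<alpha>\<bar> > 0" using \<alpha> by simp
 have r: "6 * \<bar>\<beta>\<bar> / \<bar>\<alpha>\<bar> \<ge> 0" by simp
 have "\<bar>xi\<bar> \<ge> 1" using xi r by linarith
 then have "\<bar>xi\<bar> * 1 \<le> \<bar>xi\<bar> * \<bar>xi\<bar>" by (intro mult_left_mono) auto
 then have "6 * \<bar>\<beta>\<bar> / \<bar>\<alpha>\<bar> \<le> xi\<^sup>2" using xi by (simp add: power2_eq_square)
 then have "6 * \<bar>\<beta>\<bar> \<le> \<bar>\<alpha>\<bar> * xi\<^sup>2" using a by (simp add: field_simps)
 moreover have "\<bar>5/2 * \<alpha> * S\<bar> = 5/2 * \<bar>\<alpha>\<bar> * S" using S by (simp add: abs_mult order_trans[OF zero_le_power2])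
 moreover have "\<bar>\<alpha>\<bar> * xi\<^sup>2 \<le> \<bar>\<alpha>\<bar> * S" using S a by (intro mult_left_mono) auto
 moreover have "\<bar>5/2 * \<alpha> * S - 3 * \<beta>\<bar> \<ge> \<bar>5/2 * \<alpha> * S\<bar> - 3 * \<bar>\<beta>\<bar>" using abs_triangle_ineq2[of "5/2 * \<alpha> * S" "3 * \<beta>"] by (simp add: abs_mult)
 ultimately show ?thesis by linarith
qed

text \<open>Dividing by W xi <= 2 xi^2 takes two of the four powers of xi. The remaining xi^2 is
  what the integral over the distance later trades for the square of the derivative.\<close>

lemma resonance_weight_le:
 assumes \<tau>: "0 < \<tau>" and c: "0 < c" and xi: "\<bar>xi\<bar> \<ge> 1" and \<Omega>: "\<bar>\<Omega>\<bar> \<ge> 2 * c * xi^4 * d" and d: "d \<ge> 0"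
 shows "(1 / (1 + \<tau> * \<bar>\<Omega>\<bar> / W xi))\<^sup>2 \<le> (1 / (1 + (\<tau> * c * xi\<^sup>2) * d))\<^sup>2"
proof -
 have "1 \<le> xi\<^sup>2" using xi by (metis one_le_power power2_abs)
 then have W2: "W xi \<le> 2 * xi\<^sup>2" by (simp add: W_def)
 have "(\<tau> * c * xi\<^sup>2) * d * W xi \<le> (\<tau> * c * xi\<^sup>2) * d * (2 * xi\<^sup>2)" using \<tau> c d W2 by (intro mult_left_mono) auto
 also have "... = \<tau> * (2 * c * xi^4 * d)" by (simp add: eval_nat_numeral mult_ac)
 also have "... \<le> \<tau> * \<bar>\<Omega>\<bar>" using \<tau> \<Omega> by (intro mult_left_mono) auto
 finally have "(\<tau> * c * xi\<^sup>2) * d \<le> \<tau> * \<bar>\<Omega>\<bar> / W xi" using W_pos[of xi] by (simp add: field_simps)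
 moreover have "0 \<le> (\<tau> * c * xi\<^sup>2) * d" using \<tau> c d by simp
 ultimately show ?thesis by (intro power_mono divide_left_mono) auto
qed

section \<open>Square integrals of the two kernels\<close>

lemma weight_sum_le:
 assumes "\<bar>p\<bar> \<le> \<bar>xi\<bar> + E" "E \<ge> 0"
 shows "W p \<le> 2 * W xi * (1 + E\<^sup>2)"
proof -
 have "p\<^sup>2 \<le> (\<bar>xi\<bar> + E)\<^sup>2" using assms(1) by (metis abs_ge_zero power2_abs power_mono)
 also have "... \<le> 2 * xi\<^sup>2 + 2 * E\<^sup>2" using sum_squares_bound[of "\<bar>xi\<bar>" E] by (simp add: power2_sum)
 finally have "p\<^sup>2 \<le> 2 * xi\<^sup>2 + 2 * E\<^sup>2" .
 moreover have "0 \<le> 2 * (xi\<^sup>2 * E\<^sup>2)" by simp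
 moreover have "2 * W xi * (1 + E\<^sup>2) = 2 + 2 * E\<^sup>2 + 2 * xi\<^sup>2 + 2 * (xi\<^sup>2 * E\<^sup>2)" by (simp add: W_def algebra_simps)
 ultimately show ?thesis unfolding W_def[of p] by linarith
qed

lemma two_small_factor:
 fixes xi :: real
 shows "xi\<^sup>2 / (W xi)\<^sup>2 * (2 * \<bar>xi\<bar> + D)\<^sup>2 \<le> 2 * (2 + \<bar>D\<bar>)\<^sup>2"
proof -
 have "(2 * \<bar>xi\<bar> + D)\<^sup>2 \<le> ((2 + \<bar>D\<bar>) * (1 + \<bar>xi\<bar>))\<^sup>2"
 proof -
  have "\<bar>2 * \<bar>xi\<bar> + D\<bar> \<le> (2 + \<bar>D\<bar>) * (1 + \<bar>xi\<bar>)"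
  proof -
   have "\<bar>2 * \<bar>xi\<bar> + D\<bar> \<le> 2 * \<bar>xi\<bar> + \<bar>D\<bar>" by linarith
   moreover have "0 \<le> \<bar>D\<bar> * \<bar>xi\<bar>" by simp
   moreover have "(2 + \<bar>D\<bar>) * (1 + \<bar>xi\<bar>) = 2 + 2 * \<bar>xi\<bar> + \<bar>D\<bar> + \<bar>D\<bar> * \<bar>xi\<bar>" by (simp add: algebra_simps)
   ultimately show ?thesis by linarith
  qed
  then show ?thesis by (metis abs_ge_zero power2_abs power_mono)
 qed
 also have "... \<le> (2 + \<bar>D\<bar>)\<^sup>2 * (2 * W xi)"
  unfolding power_mult_distrib
 proof (rule mult_left_mono)
  show "(1 + \<bar>xi\<bar>)\<^sup>2 \<le> 2 * W xi" using sum_squares_bound[of 1 "\<bar>xi\<bar>"] by (simp add: power2_sum W_def)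
 qed simp
 finally have "xi\<^sup>2 / (W xi)\<^sup>2 * (2 * \<bar>xi\<bar> + D)\<^sup>2 \<le> xi\<^sup>2 / (W xi)\<^sup>2 * ((2 + \<bar>D\<bar>)\<^sup>2 * (2 * W xi))"
  by (rule mult_left_mono) simp
 also have "... = 2 * (2 + \<bar>D\<bar>)\<^sup>2 * (xi\<^sup>2 / W xi)"
  using W_pos[of xi] by (simp add: power2_eq_square)
 also have "... \<le> 2 * (2 + \<bar>D\<bar>)\<^sup>2 * 1"
  using W_pos[of xi] by (intro mult_left_mono) (auto simp: W_def)
 finally show ?thesis by simp
qed

lemma exp_decay_bound:
 fixes xi :: real
 assumes c: "c > 0" and D: "D \<ge> 0"
 shows "xi\<^sup>2 * exp (- (c * \<bar>xi\<bar>)) * (2 * \<bar>xi\<bar> + D)\<^sup>2 \<le> 8 * (fact 4 / c^4) + 2 * D\<^sup>2 * (fact 2 / c^2)"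
proof -
 have p: "\<bar>xi\<bar> ^ n * exp (- (c * \<bar>xi\<bar>)) \<le> fact n / c ^ n" for n
 proof -
  have "\<bar>xi\<bar> ^ n * exp (- (c * \<bar>xi\<bar>)) \<le> ((fact n / c ^ n) * exp (c * \<bar>xi\<bar>)) * exp (- (c * \<bar>xi\<bar>))"
   using pow_le_exp[OF c abs_ge_zero] by (intro mult_right_mono) auto
  then show ?thesis by (simp add: mult.assoc flip: exp_add)
 qed
 have "(2 * \<bar>xi\<bar> + D)\<^sup>2 \<le> 8 * \<bar>xi\<bar>\<^sup>2 + 2 * D\<^sup>2"
  using sum_squares_bound[of "2 * \<bar>xi\<bar>" D] by (simp add: power2_sum power_mult_distrib)
 then have "xi\<^sup>2 * exp (- (c * \<bar>xi\<bar>)) * (2 * \<bar>xi\<bar> + D)\<^sup>2 \<le> xi\<^sup>2 * exp (- (c * \<bar>xi\<bar>)) * (8 * \<bar>xi\<bar>\<^sup>2 + 2 * D\<^sup>2)"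
  by (intro mult_left_mono) auto
 also have "... = 8 * (\<bar>xi\<bar> ^ 4 * exp (- (c * \<bar>xi\<bar>))) + 2 * D\<^sup>2 * (\<bar>xi\<bar>^2 * exp (- (c * \<bar>xi\<bar>)))"
  by (simp add: eval_nat_numeral algebra_simps)
 also have "... \<le> 8 * (fact 4 / c^4) + 2 * D\<^sup>2 * (fact 2 / c^2)"
  by (intro add_mono mult_left_mono p) auto
 finally show ?thesis .
qed

text \<open>The squared kernel carries tau^2. Against the worst singularity tau^(-3/2) this leaves
  sqrt tau, and the other terms are smaller for \<open>\<tau> \<le> 1\<close>.\<close>

lemma sqrt_bound_collect:
 fixes \<tau> :: real
 assumes d: "0 < \<tau>" "\<tau> \<le> 1" and C: "C \<ge> 0" "a \<ge> 0" "b \<ge> 0" "c \<ge> 0"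
 shows "C * \<tau>\<^sup>2 * (a + b / \<tau> + c / (\<tau> * sqrt \<tau>)) \<le> C * (a + b + c) * sqrt \<tau>"
proof -
 have s: "sqrt \<tau> > 0" "sqrt \<tau> \<le> 1" "sqrt \<tau> * sqrt \<tau> = \<tau>" using d by auto
 have d1: "\<tau> \<le> sqrt \<tau>" using s mult_left_le[of "sqrt \<tau>" "sqrt \<tau>"] by simp
 have d2: "\<tau>\<^sup>2 \<le> sqrt \<tau>" using d1 d mult_left_le[of \<tau> \<tau>] unfolding power2_eq_square by linarith
 have d3: "\<tau>\<^sup>2 / (\<tau> * sqrt \<tau>) = sqrt \<tau>"
  using d by (simp add: power2_eq_square real_div_sqrt)
 have "\<tau>\<^sup>2 * (a + b / \<tau> + c / (\<tau> * sqrt \<tau>)) = \<tau>\<^sup>2 * a + (\<tau>\<^sup>2 / \<tau>) * b + (\<tau>\<^sup>2 / (\<tau> * sqrt \<tau>)) * c"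
  by (simp add: distrib_left)
 also have "... = \<tau>\<^sup>2 * a + \<tau> * b + sqrt \<tau> * c" unfolding d3 using d by (simp add: power2_eq_square)
 also have "... \<le> sqrt \<tau> * a + sqrt \<tau> * b + sqrt \<tau> * c"
  using d1 d2 C by (intro add_mono mult_right_mono) auto
 finally have "C * (\<tau>\<^sup>2 * (a + b / \<tau> + c / (\<tau> * sqrt \<tau>))) \<le> C * (sqrt \<tau> * a + sqrt \<tau> * b + sqrt \<tau> * c)"
  using C by (intro mult_left_mono) auto
 then show ?thesis by (simp add: algebra_simps)
qed

text \<open>The exponential is the weight at xi divided by those at x and xi - x, and the factor xi
  stands for the derivative. The indicator makes y a dummy variable, which gives the quadratic term
  the shape required by \<open>trilinear\<close>.\<close>

definition k2 :: "real => real => real => real => real" where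
 "k2 \<sigma> xi x y = xi * exp (- (\<sigma> * (\<bar>x\<bar> + \<bar>xi - x\<bar> - \<bar>xi\<bar>))) * indicator {0..1} y"

definition k3 :: "real => real => real => real => real" where
 "k3 \<sigma> xi x y = xi * exp (- (\<sigma> * (\<bar>x\<bar> + \<bar>y\<bar> + \<bar>xi - x - y\<bar> - \<bar>xi\<bar>)))"

definition om2 where "om2 \<alpha> \<beta> xi x (y::real) = phi \<alpha> \<beta> xi - phi \<alpha> \<beta> x - phi \<alpha> \<beta> (xi - x)"
definition om3 where "om3 \<alpha> \<beta> xi x y = phi \<alpha> \<beta> xi - phi \<alpha> \<beta> x - phi \<alpha> \<beta> y - phi \<alpha> \<beta> (xi - x - y)"

text \<open>The resonant points are x = 0 and x = xi. The farther one is at least |xi|/2 away, so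
  |Omega| is of size xi^4 times the distance to the nearer one. Each point contributes an integral
  2/A with A = tau c xi^2, and xi^2 times 4/A is free of xi. Below the threshold \<open>N\<close>
  the phase is given up and the exponential weight alone gives integrability.\<close>

lemma kernel2_bound:
 assumes \<alpha>: "\<alpha> \<noteq> 0" and \<sigma>: "\<sigma> > 0"
 shows "\<exists>C\<ge>0. \<forall>\<tau>. 0 < \<tau> \<longrightarrow> \<tau> \<le> 1 \<longrightarrow> (\<forall>xi. (NN x. NN y. ennreal ((ker \<tau> xi (k2 \<sigma> xi x y) (om2 \<alpha> \<beta> xi x y) x (xi - x) y)\<^sup>2)) \<le> ennreal (C * sqrt \<tau>))"
proof -
 define N where "N = 1 + 6 * \<bar>\<beta>\<bar> / \<bar>\<alpha>\<bar>"
 have N: "N \<ge> 1" by (simp add: N_def)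
 define c where "c = \<bar>\<alpha>\<bar> / 4"
 have c: "c > 0" using \<alpha> by (simp add: c_def)
 define C2 where "C2 = 2 * (18 * (1 + 8 / \<sigma>\<^sup>2))\<^sup>2"
 have C2: "C2 \<ge> 0" by (simp add: C2_def)
 define D where "D = 4 / \<sigma>"
 have D: "D \<ge> 0" using \<sigma> by (simp add: D_def)
 define a where "a = N\<^sup>2 * (2 * N + D) + (2 + D)"
 define b where "b = 4 / c"
 show ?thesis
 proof (intro exI[of _ "C2 * (a + b + 0)"] conjI allI impI)
  show "0 \<le> C2 * (a + b + 0)" using C2 N D c by (auto simp: a_def b_def)
  fix \<tau> xi :: real assume \<tau>: "0 < \<tau>" "\<tau> \<le> 1"
  let ?K = "\<lambda>x y. ker \<tau> xi (k2 \<sigma> xi x y) (om2 \<alpha> \<beta> xi x y) x (xi - x) y"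
  define A where "A = \<tau> * c * xi\<^sup>2"
  define E where "E x = \<bar>x\<bar> + \<bar>xi - x\<bar> - \<bar>xi\<bar>" for x
  have E0: "E x \<ge> 0" for x unfolding E_def by linarith
  define e where "e x = exp (- (\<sigma> * E x))" for x
  have e01: "0 \<le> e x" "e x \<le> 1" for x using E0[of x] \<sigma> by (auto simp: e_def)
  define f where "f x = (if \<bar>xi\<bar> \<ge> N then xi\<^sup>2 * ((1 / (1 + A * \<bar>x\<bar>))\<^sup>2 + (1 / (1 + A * \<bar>xi - x\<bar>))\<^sup>2) else N\<^sup>2 * e x)
    + (xi\<^sup>2 / (W xi)\<^sup>2) * e x" for x
  have f0: "f x \<ge> 0" for x unfolding f_def using e01[of x] by auto
  have pt: "(?K x y)\<^sup>2 \<le> C2 * \<tau>\<^sup>2 * f x * indicator {0..1} y" for x y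
  proof (cases "y \<in> {0..1}")
   case False
   then show ?thesis by (simp add: ker_def k2_def)
  next
   case True
   have "W x \<le> 2 * W xi * (1 + (E x)\<^sup>2)" "W (xi - x) \<le> 2 * W xi * (1 + (E x)\<^sup>2)"
    by (intro weight_sum_le E0; simp add: E_def)+
   moreover have "W y \<le> 2 * W xi * (1 + (E x)\<^sup>2)"
   proof -
    have "y\<^sup>2 \<le> 1" using True by (simp add: power_le_one)
    then have "W y \<le> 2 * 1 * 1" by (simp add: W_def)
    also have "... \<le> 2 * W xi * (1 + (E x)\<^sup>2)" using W_ge_1[of xi] by (intro mult_mono) auto
    finally show ?thesis .
   qed
   ultimately have w: "W x + W (xi - x) + W y \<le> 6 * W xi * (1 + (E x)\<^sup>2)" by linarith
   have k: "\<bar>k2 \<sigma> xi x y\<bar> \<le> \<bar>xi\<bar> * exp (- (\<sigma> * E x))" using True by (simp add: k2_def E_def abs_mult)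
   let ?\<Psi> = "(1 / (1 + \<tau> * \<bar>om2 \<alpha> \<beta> xi x y\<bar> / W xi))\<^sup>2"
   have "(?K x y)\<^sup>2 \<le> C2 * \<tau>\<^sup>2 * (xi\<^sup>2 * e x * ?\<Psi> + (xi\<^sup>2 / (W xi)\<^sup>2) * e x)"
    unfolding C2_def e_def by (rule ker_sq_bound[OF \<sigma> E0 k w \<tau>(1)])
   also have "... \<le> C2 * \<tau>\<^sup>2 * f x"
   proof (intro mult_left_mono)
    have "1 \<le> 1 + \<tau> * \<bar>om2 \<alpha> \<beta> xi x y\<bar> / W xi" using \<tau> W_pos[of xi] by simp
    then have P01: "0 \<le> ?\<Psi>" "?\<Psi> \<le> 1" by (auto intro!: power_le_one)
    show "xi\<^sup>2 * e x * ?\<Psi> + (xi\<^sup>2 / (W xi)\<^sup>2) * e x \<le> f x"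
    proof (cases "\<bar>xi\<bar> \<ge> N")
     case False
     then have "xi\<^sup>2 \<le> N\<^sup>2" by (metis abs_ge_zero linear power2_abs power_mono)
     then have "xi\<^sup>2 * e x * ?\<Psi> \<le> N\<^sup>2 * e x * 1" using e01[of x] P01 by (intro mult_mono) auto
     then show ?thesis using False by (simp add: f_def)
    next
     case True
     then have x1: "\<bar>xi\<bar> \<ge> 1" using N by linarith
     have fac: "\<bar>5/2 * \<alpha> * (xi\<^sup>2 + x\<^sup>2 + (xi - x)\<^sup>2) - 3 * \<beta>\<bar> \<ge> \<bar>\<alpha>\<bar> * xi\<^sup>2"
      by (rule phase_factor_ge[OF \<alpha>]) (use True in \<open>auto simp: N_def\<close>)
     define d where "d = min \<bar>x\<bar> \<bar>xi - x\<bar>"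
     have d0: "d \<ge> 0" by (simp add: d_def)
     have dd: "d * (\<bar>xi\<bar> / 2) \<le> \<bar>x\<bar> * \<bar>xi - x\<bar>"
     proof (cases "\<bar>x\<bar> \<le> \<bar>xi - x\<bar>")
      case True
      then have "\<bar>xi\<bar> / 2 \<le> \<bar>xi - x\<bar>" by linarith
      from mult_left_mono[OF this, of "\<bar>x\<bar>"] True show ?thesis unfolding d_def min_def by simp
     next
      case False
      then have "\<bar>xi\<bar> / 2 \<le> \<bar>x\<bar>" by linarith
      from mult_left_mono[OF this, of "\<bar>xi - x\<bar>"] False show ?thesis unfolding d_def min_def by (simp add: mult.commute[of "\<bar>x\<bar>"])
     qed
     have "(\<bar>xi\<bar> * (d * (\<bar>xi\<bar> / 2))) * (\<bar>\<alpha>\<bar> * xi\<^sup>2) \<le> (\<bar>xi\<bar> * (\<bar>x\<bar> * \<bar>xi - x\<bar>)) * \<bar>5/2 * \<alpha> * (xi\<^sup>2 + x\<^sup>2 + (xi - x)\<^sup>2) - 3 * \<beta>\<bar>"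
      by (intro mult_mono[OF mult_left_mono[OF dd] fac]) auto
     also have "... = \<bar>om2 \<alpha> \<beta> xi x y\<bar>" unfolding om2_def phi_diff2 by (simp add: abs_mult mult.assoc)
     also have "(\<bar>xi\<bar> * (d * (\<bar>xi\<bar> / 2))) * (\<bar>\<alpha>\<bar> * xi\<^sup>2) = 2 * c * xi^4 * d"
     proof -
      have "\<bar>xi\<bar> * \<bar>xi\<bar> = xi\<^sup>2" by (simp add: power2_eq_square)
      moreover have "(t * (d * (t / 2))) * (s * r) = ((t * t) * r) * (s / 2 * d)" for t s r :: real by simp
      ultimately have "(\<bar>xi\<bar> * (d * (\<bar>xi\<bar> / 2))) * (\<bar>\<alpha>\<bar> * xi\<^sup>2) = (xi\<^sup>2 * xi\<^sup>2) * (\<bar>\<alpha>\<bar> / 2 * d)" by (simp only:)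
      moreover have "xi\<^sup>2 * xi\<^sup>2 = xi^4" by (simp add: eval_nat_numeral)
      moreover have "xi^4 * (\<bar>\<alpha>\<bar> / 2 * d) = 2 * c * xi^4 * d" by (simp add: c_def)
      ultimately show ?thesis by (simp only:)
     qed
     finally have "?\<Psi> \<le> (1 / (1 + A * d))\<^sup>2"
      unfolding A_def by (intro resonance_weight_le \<tau> c x1 d0)
     also have "... \<le> (1 / (1 + A * \<bar>x\<bar>))\<^sup>2 + (1 / (1 + A * \<bar>xi - x\<bar>))\<^sup>2"
      by (simp add: d_def min_def)
     finally have "xi\<^sup>2 * e x * ?\<Psi> \<le> xi\<^sup>2 * 1 * ((1 / (1 + A * \<bar>x\<bar>))\<^sup>2 + (1 / (1 + A * \<bar>xi - x\<bar>))\<^sup>2)"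
      using e01[of x] by (intro mult_mono) auto
     then show ?thesis using True by (simp add: f_def)
    qed
   qed (use C2 in auto)
   finally show ?thesis using True by simp
  qed
  have [measurable]: "E \<in> bm" unfolding E_def by measurable
  have [measurable]: "e \<in> bm" unfolding e_def by measurable
  have [measurable]: "f \<in> bm" unfolding f_def by measurable
  have ie: "(NN x. ennreal (e x)) \<le> ennreal (2 * \<bar>xi\<bar> + D)"
  proof -
   have "(NN x. ennreal (e x)) \<le> (NN x. ennreal (exp (- (\<sigma> * max 0 (\<bar>x\<bar> - \<bar>xi\<bar>)))))"
    unfolding e_def E_def using \<sigma> by (intro nn_integral_mono ennreal_leI) auto
   also have "... \<le> ennreal (2 * \<bar>xi\<bar> + D)" unfolding D_def by (rule nn_soft[OF \<sigma>]) simp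
   finally show ?thesis .
  qed
  \<comment> \<open>This is the part from the summand \<open>\<tau> / W xi\<close> of the kernel:
    xi^2/W^2 is at most 1/W, which pays for the length 2|xi| of the interaction range.\<close>
  have last: "(NN x. ennreal ((xi\<^sup>2 / (W xi)\<^sup>2) * e x)) \<le> ennreal (2 + D)"
  proof -
   have "(NN x. ennreal ((xi\<^sup>2 / (W xi)\<^sup>2) * e x)) = ennreal (xi\<^sup>2 / (W xi)\<^sup>2) * (NN x. ennreal (e x))"
    by (intro nn_integral_cmult_real e01) auto
   also have "... \<le> ennreal (xi\<^sup>2 / (W xi)\<^sup>2) * ennreal (2 * \<bar>xi\<bar> + D)" by (intro mult_left_mono ie) simp
   also have "... = ennreal (xi\<^sup>2 / (W xi)\<^sup>2 * (2 * \<bar>xi\<bar> + D))" by (rule ennreal_mult[symmetric]) (use D in auto)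
   also have "... \<le> ennreal (2 + D)"
   proof (rule ennreal_leI)
    have W1: "xi\<^sup>2 / (W xi)\<^sup>2 \<le> 1 / W xi"
    proof -
     have "xi\<^sup>2 * 1 \<le> W xi * 1" by (simp add: W_def)
     then show ?thesis using W_pos[of xi] by (simp add: field_simps power2_eq_square)
    qed
    have "2 * \<bar>xi\<bar> \<le> 2 * W xi" using sum_squares_bound[of 1 "\<bar>xi\<bar>"] by (simp add: W_def)
    moreover have "D \<le> D * W xi" using D W_ge_1[of xi] by (simp add: mult_le_cancel_left1)
    ultimately have "2 * \<bar>xi\<bar> + D \<le> (2 + D) * W xi" by (simp add: distrib_right)
    then have "xi\<^sup>2 / (W xi)\<^sup>2 * (2 * \<bar>xi\<bar> + D) \<le> (1 / W xi) * ((2 + D) * W xi)"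
     using W1 D W_pos[of xi] by (intro mult_mono) auto
    then show "xi\<^sup>2 / (W xi)\<^sup>2 * (2 * \<bar>xi\<bar> + D) \<le> 2 + D" using W_pos[of xi] by simp
   qed
   finally show ?thesis .
  qed
  have "(NN x. ennreal (f x)) \<le> ennreal (a + b / \<tau>)"
  proof (cases "\<bar>xi\<bar> \<ge> N")
   case False
   have "(NN x. ennreal (f x)) = (NN x. ennreal (N\<^sup>2 * e x)) + (NN x. ennreal ((xi\<^sup>2 / (W xi)\<^sup>2) * e x))"
    using False e01 by (subst nn_integral_add[symmetric]) (auto simp: f_def)
   also have "(NN x. ennreal (N\<^sup>2 * e x)) = ennreal (N\<^sup>2) * (NN x. ennreal (e x))"
    by (intro nn_integral_cmult_real e01) auto
   also have "ennreal (N\<^sup>2) * (NN x. ennreal (e x)) + (NN x. ennreal ((xi\<^sup>2 / (W xi)\<^sup>2) * e x))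
     \<le> ennreal (N\<^sup>2) * ennreal (2 * N + D) + ennreal (2 + D)"
    using False by (intro add_mono mult_left_mono last order_trans[OF ie] ennreal_leI) auto
   also have "... = ennreal a" using D N by (simp add: a_def ennreal_mult[symmetric] ennreal_plus[symmetric] del: ennreal_plus)
   also have "... \<le> ennreal (a + b / \<tau>)" using c \<tau> by (intro ennreal_leI) (simp add: b_def)
   finally show ?thesis .
  next
   case True
   then have x1: "\<bar>xi\<bar> \<ge> 1" using N by linarith
   then have x2: "xi\<^sup>2 > 0" by auto
   have A: "A > 0" using \<tau> c x2 by (simp add: A_def)
   have "(NN x. ennreal (f x)) = (NN x. ennreal (xi\<^sup>2) * (ennreal ((1 / (1 + A * \<bar>x\<bar>))\<^sup>2) + ennreal ((1 / (1 + A * \<bar>xi - x\<bar>))\<^sup>2)) + ennreal ((xi\<^sup>2 / (W xi)\<^sup>2) * e x))"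
   proof (intro nn_integral_cong)
    fix x
    have "ennreal (xi\<^sup>2) * (ennreal ((1 / (1 + A * \<bar>x\<bar>))\<^sup>2) + ennreal ((1 / (1 + A * \<bar>xi - x\<bar>))\<^sup>2)) = ennreal (xi\<^sup>2 * ((1 / (1 + A * \<bar>x\<bar>))\<^sup>2 + (1 / (1 + A * \<bar>xi - x\<bar>))\<^sup>2))"
     by (subst ennreal_plus[symmetric], simp, simp, subst ennreal_mult[symmetric]) auto
    then show "ennreal (f x) = ennreal (xi\<^sup>2) * (ennreal ((1 / (1 + A * \<bar>x\<bar>))\<^sup>2) + ennreal ((1 / (1 + A * \<bar>xi - x\<bar>))\<^sup>2)) + ennreal ((xi\<^sup>2 / (W xi)\<^sup>2) * e x)"
     using True e01[of x] unfolding f_def by (simp add: ennreal_plus[symmetric] del: ennreal_plus)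
   qed
   also have "... = ennreal (xi\<^sup>2) * ((NN x. ennreal ((1 / (1 + A * \<bar>x\<bar>))\<^sup>2)) + (NN x. ennreal ((1 / (1 + A * \<bar>xi - x\<bar>))\<^sup>2))) + (NN x. ennreal ((xi\<^sup>2 / (W xi)\<^sup>2) * e x))"
    by (subst nn_integral_add, simp, simp, subst nn_integral_cmult, simp, subst nn_integral_add) auto
   also have "(NN x. ennreal ((1 / (1 + A * \<bar>xi - x\<bar>))\<^sup>2)) = ennreal (2 / A)"
    using nn_integral_shift[of "\<lambda>x. ennreal ((1 / (1 + A * \<bar>x\<bar>))\<^sup>2)" xi] nn_inverse_square[OF A] by (simp add: abs_minus_commute)
   also have "(NN x. ennreal ((1 / (1 + A * \<bar>x\<bar>))\<^sup>2)) = ennreal (2 / A)" by (rule nn_inverse_square[OF A])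
   also have "ennreal (xi\<^sup>2) * (ennreal (2 / A) + ennreal (2 / A)) + (NN x. ennreal ((xi\<^sup>2 / (W xi)\<^sup>2) * e x)) \<le> ennreal (xi\<^sup>2) * (ennreal (2 / A) + ennreal (2 / A)) + ennreal (2 + D)"
    by (intro add_left_mono last)
   also have "... = ennreal (xi\<^sup>2 * (2 / A + 2 / A) + (2 + D))"
    using A D by (simp add: ennreal_mult[symmetric] ennreal_plus[symmetric] del: ennreal_plus)
   also have "xi\<^sup>2 * (2 / A + 2 / A) = b / \<tau>" using x2 c \<tau> by (simp add: A_def b_def field_simps)
   also have "ennreal (b / \<tau> + (2 + D)) \<le> ennreal (a + b / \<tau>)" using N D by (intro ennreal_leI) (simp add: a_def)
   finally show ?thesis .
  qed
  then have I: "ennreal (C2 * \<tau>\<^sup>2) * (NN x. ennreal (f x)) \<le> ennreal (C2 * \<tau>\<^sup>2) * ennreal (a + b / \<tau>)"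
   by (intro mult_left_mono) auto
  have "(NN x. NN y. ennreal ((?K x y)\<^sup>2))
    \<le> (NN x. NN y. ennreal (C2 * \<tau>\<^sup>2) * ennreal (f x) * indicator {0..1::real} y)"
  proof (intro nn_integral_mono)
   fix x y
   have "ennreal ((?K x y)\<^sup>2) \<le> ennreal (C2 * \<tau>\<^sup>2 * f x * indicator {0..1} y)"
    by (intro ennreal_leI pt)
   also have "... = ennreal (C2 * \<tau>\<^sup>2) * ennreal (f x) * indicator {0..1::real} y"
    using C2 f0[of x] by (auto simp: indicator_def ennreal_mult)
   finally show "ennreal ((?K x y)\<^sup>2) \<le> ennreal (C2 * \<tau>\<^sup>2) * ennreal (f x) * indicator {0..1::real} y" .
  qed
  also have "... = ennreal (C2 * \<tau>\<^sup>2) * (NN x. ennreal (f x))"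
   by (subst nn_integral_cmult_indicator, simp) (simp add: nn_integral_cmult)
  also have "... \<le> ennreal (C2 * \<tau>\<^sup>2) * ennreal (a + b / \<tau>)" by (rule I)
  also have "... = ennreal (C2 * \<tau>\<^sup>2 * (a + b / \<tau> + 0 / (\<tau> * sqrt \<tau>)))"
   using C2 N D c \<tau> by (subst ennreal_mult[symmetric]) (auto simp: a_def b_def)
  also have "... \<le> ennreal (C2 * (a + b + 0) * sqrt \<tau>)"
   using C2 N D c \<tau> by (intro ennreal_leI sqrt_bound_collect) (auto simp: a_def b_def)
  finally show "(NN x. NN y. ennreal ((?K x y)\<^sup>2)) \<le> ennreal (C2 * (a + b + 0) * sqrt \<tau>)" .
 qed
qed

text \<open>The three disjunctions say that at most one factor is below \<open>L\<close>. Two others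
  supply L^2, the third is at least the minimum.\<close>

lemma min3_mult_le:
 fixes P Q R L :: real
 assumes "0 \<le> P" "0 \<le> Q" "0 \<le> R" "0 \<le> L" "L \<le> P \<or> L \<le> Q" "L \<le> P \<or> L \<le> R" "L \<le> Q \<or> L \<le> R"
 shows "min P (min Q R) * L\<^sup>2 \<le> P * Q * R"
proof -
 have aux: "min P (min Q R) * L\<^sup>2 \<le> X * Y * Z" if "L \<le> X" "L \<le> Y" "0 \<le> Z" "min P (min Q R) \<le> Z" for X Y Z
 proof -
  have "min P (min Q R) * (L * L) \<le> Z * (X * Y)" using that assms by (intro mult_mono) auto
  then show ?thesis by (simp add: power2_eq_square mult_ac)
 qed
 consider "L \<le> P" "L \<le> Q" | "L \<le> P" "L \<le> R" | "L \<le> Q" "L \<le> R" using assms(5-7) by linarith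
 then show ?thesis
 proof cases
  case 1 from aux[OF this, of R] assms show ?thesis by simp
 next
  case 2 from aux[OF this, of Q] assms show ?thesis by (simp add: mult_ac)
 next
  case 3 from aux[OF this, of P] assms show ?thesis by (simp add: mult_ac)
 qed
qed

text \<open>If two of xi - x, xi - y, x + y were below |xi|/8, all three frequencies would be near
  xi or -xi and would exceed |xi| in total by more than |xi|/2. So two factors are at least |xi|/8,
  and the phase is of size xi^4 times the third; 128 is twice 8^2.\<close>

lemma om3_lower:
 assumes \<alpha>: "\<alpha> \<noteq> 0" and xi: "\<bar>xi\<bar> \<ge> 1 + 6 * \<bar>\<beta>\<bar> / \<bar>\<alpha>\<bar>"
  and E: "\<bar>x\<bar> + \<bar>y\<bar> + \<bar>xi - x - y\<bar> - \<bar>xi\<bar> < \<bar>xi\<bar> / 2"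
 shows "2 * (\<bar>\<alpha>\<bar> / 128) * xi^4 * min \<bar>xi - x\<bar> (min \<bar>xi - y\<bar> \<bar>x + y\<bar>) \<le> \<bar>om3 \<alpha> \<beta> xi x y\<bar>"
proof -
 let ?p = "xi - x" and ?q = "xi - y" and ?r = "x + y"
 let ?S = "?p\<^sup>2 + ?q\<^sup>2 + ?r\<^sup>2"
 have "xi\<^sup>2 \<le> ?S"
 proof -
  \<comment> \<open>\<open>?p\<close>, \<open>?q\<close> and \<open>?r\<close> add up to 2 xi, so
    the sum of their squares is at least 4/3 of xi^2; the squared differences express the
    defect.\<close>
  have "0 \<le> (?p - ?q)\<^sup>2 + (?q - ?r)\<^sup>2 + (?r - ?p)\<^sup>2" by simp
  moreover have "(?p - ?q)\<^sup>2 + (?q - ?r)\<^sup>2 + (?r - ?p)\<^sup>2 = 3 * ?S - 4 * xi\<^sup>2" by (simp add: power2_eq_square algebra_simps)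
  moreover have "Z \<le> S" if "0 \<le> A" "A = 3 * S - 4 * Z" "0 \<le> Z" for A S Z :: real using that by linarith
  ultimately show ?thesis using zero_le_power2[of xi] by blast
 qed
 then have fac: "\<bar>5/2 * \<alpha> * ?S - 3 * \<beta>\<bar> \<ge> \<bar>\<alpha>\<bar> * xi\<^sup>2" by (rule phase_factor_ge[OF \<alpha> xi])
 have m: "min \<bar>?p\<bar> (min \<bar>?q\<bar> \<bar>?r\<bar>) * (\<bar>xi\<bar> / 8)\<^sup>2 \<le> \<bar>?p\<bar> * \<bar>?q\<bar> * \<bar>?r\<bar>"
  by (rule min3_mult_le) (use E in \<open>linarith+\<close>)
 have "(min \<bar>?p\<bar> (min \<bar>?q\<bar> \<bar>?r\<bar>) * (\<bar>xi\<bar> / 8)\<^sup>2) * (\<bar>\<alpha>\<bar> * xi\<^sup>2) \<le> (\<bar>?p\<bar> * \<bar>?q\<bar> * \<bar>?r\<bar>) * \<bar>5/2 * \<alpha> * ?S - 3 * \<beta>\<bar>"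
  by (intro mult_mono[OF m fac]) auto
 also have "... = \<bar>om3 \<alpha> \<beta> xi x y\<bar>" unfolding om3_def phi_diff3 by (simp add: abs_mult)
 also have "(min \<bar>?p\<bar> (min \<bar>?q\<bar> \<bar>?r\<bar>) * (\<bar>xi\<bar> / 8)\<^sup>2) * (\<bar>\<alpha>\<bar> * xi\<^sup>2) = 2 * (\<bar>\<alpha>\<bar> / 128) * xi^4 * min \<bar>?p\<bar> (min \<bar>?q\<bar> \<bar>?r\<bar>)"
 proof -
  have "(M * (\<bar>xi\<bar> / 8)\<^sup>2) * (\<bar>\<alpha>\<bar> * xi\<^sup>2) = 2 * (\<bar>\<alpha>\<bar> / 128) * (xi\<^sup>2 * xi\<^sup>2) * M" for M
   by (simp add: power_divide)
  moreover have "xi\<^sup>2 * xi\<^sup>2 = xi^4" by (simp add: eval_nat_numeral)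
  ultimately show ?thesis by (simp only:)
 qed
 finally show ?thesis .
qed

lemma nn_decay_plane:
 assumes c: "c > 0"
 shows "(NN x. NN y. ennreal (exp (- (c * (\<bar>x\<bar> + \<bar>y\<bar> + \<bar>xi - x - y\<bar> - \<bar>xi\<bar>))))) \<le> ennreal ((2 * \<bar>xi\<bar> + 4 / c)\<^sup>2)"
proof -
 let ?g = "\<lambda>x. ennreal (exp (- (c * max 0 (\<bar>x\<bar> - \<bar>xi\<bar>))))"
 have "(NN x. NN y. ennreal (exp (- (c * (\<bar>x\<bar> + \<bar>y\<bar> + \<bar>xi - x - y\<bar> - \<bar>xi\<bar>))))) \<le> (NN x. NN y. ?g x * ?g y)"
 proof (intro nn_integral_mono)
  fix x y :: real
  have "max 0 (\<bar>x\<bar> - \<bar>xi\<bar>) + max 0 (\<bar>y\<bar> - \<bar>xi\<bar>) \<le> \<bar>x\<bar> + \<bar>y\<bar> + \<bar>xi - x - y\<bar> - \<bar>xi\<bar>"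
   by (auto simp: max_def)
  then have "c * (max 0 (\<bar>x\<bar> - \<bar>xi\<bar>) + max 0 (\<bar>y\<bar> - \<bar>xi\<bar>)) \<le> c * (\<bar>x\<bar> + \<bar>y\<bar> + \<bar>xi - x - y\<bar> - \<bar>xi\<bar>)"
   using c by (intro mult_left_mono) auto
  then have "exp (- (c * (\<bar>x\<bar> + \<bar>y\<bar> + \<bar>xi - x - y\<bar> - \<bar>xi\<bar>))) \<le> exp (- (c * max 0 (\<bar>x\<bar> - \<bar>xi\<bar>))) * exp (- (c * max 0 (\<bar>y\<bar> - \<bar>xi\<bar>)))"
   unfolding exp_add[symmetric] exp_le_cancel_iff distrib_left by linarith
  then have "ennreal (exp (- (c * (\<bar>x\<bar> + \<bar>y\<bar> + \<bar>xi - x - y\<bar> - \<bar>xi\<bar>)))) \<le> ennreal (exp (- (c * max 0 (\<bar>x\<bar> - \<bar>xi\<bar>))) * exp (- (c * max 0 (\<bar>y\<bar> - \<bar>xi\<bar>))))"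
   by (rule ennreal_leI)
  then show "ennreal (exp (- (c * (\<bar>x\<bar> + \<bar>y\<bar> + \<bar>xi - x - y\<bar> - \<bar>xi\<bar>)))) \<le> ?g x * ?g y"
   by (simp add: ennreal_mult)
 qed
 also have "... = (NN x. ?g x) * (NN x. ?g x)"
  by (subst nn_integral_cmult, simp) (simp add: nn_integral_multc)
 also have "... \<le> ennreal (2 * \<bar>xi\<bar> + 4 / c) * ennreal (2 * \<bar>xi\<bar> + 4 / c)"
  by (intro mult_mono nn_soft c) auto
 also have "... = ennreal ((2 * \<bar>xi\<bar> + 4 / c)\<^sup>2)"
  unfolding power2_eq_square by (rule ennreal_mult[symmetric]) (use c in auto)
 finally show ?thesis .
qed

text \<open>xi - x, xi - y and x + y are xi minus each of the three frequencies. If xi - x = p is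
  fixed, the other two add up to p, and since |x| is at least |xi| - |p| the excess is at least |y|
  - |p|. So the variable along the line ranges over a segment of length 2|p| up to exponential
  tails, not 2|xi|; this gain near resonance is what makes the cubic estimate close. The other two
  lines follow by exchanging roles.\<close>

lemma nn_resonant_lines:
 fixes h :: "real => ennreal"
 assumes \<sigma>: "\<sigma> > 0" and [measurable]: "h \<in> bm"
 defines "e \<equiv> \<lambda>xi x y. ennreal (exp (- (\<sigma> * (\<bar>x\<bar> + \<bar>y\<bar> + \<bar>xi - x - y\<bar> - \<bar>xi\<bar>))))"
 shows "(NN x. NN y. h (xi - x) * e xi x y) \<le> (NN p. h p * ennreal (2 * \<bar>p\<bar> + 4 / \<sigma>))"
  and "(NN x. NN y. h (xi - y) * e xi x y) \<le> (NN p. h p * ennreal (2 * \<bar>p\<bar> + 4 / \<sigma>))"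
  and "(NN x. NN y. h (x + y) * e xi x y) \<le> (NN p. h p * ennreal (2 * \<bar>p\<bar> + 4 / \<sigma>))"
proof -
 have em [measurable]: "(\<lambda>(x, y). e xi x y) \<in> borel_measurable (borel \<Otimes>\<^sub>M borel)" for xi unfolding e_def by measurable
 have soft: "(NN y. F y) \<le> ennreal (2 * \<bar>p\<bar> + 4 / \<sigma>)"
  if "\<And>y. F y \<le> ennreal (exp (- (\<sigma> * max 0 (\<bar>y\<bar> - \<bar>p\<bar>))))" for F p
  using nn_soft[OF \<sigma>, of "\<bar>p\<bar>"] that by (meson abs_ge_zero nn_integral_mono order_trans)
 have reflect: "(NN x. g (xi - x)) = (NN p. g p)" if [measurable]: "g \<in> bm" for g
  using nn_integral_real_affine[of g "-1" xi] by simp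
 have A: "(NN x. NN y. h (xi - x) * e' x y) \<le> (NN p. h p * ennreal (2 * \<bar>p\<bar> + 4 / \<sigma>))"
  if m: "(\<lambda>(x, y). e' x y) \<in> borel_measurable (borel \<Otimes>\<^sub>M borel)" and b: "\<And>x y. e' x y \<le> ennreal (exp (- (\<sigma> * max 0 (\<bar>y\<bar> - \<bar>xi - x\<bar>))))" for e'
 proof -
  note [measurable] = m
  have "(NN x. NN y. h (xi - x) * e' x y) = (NN x. h (xi - x) * (NN y. e' x y))"
   by (intro nn_integral_cong nn_integral_cmult) measurable
  also have "... \<le> (NN x. h (xi - x) * ennreal (2 * \<bar>xi - x\<bar> + 4 / \<sigma>))"
   by (intro nn_integral_mono mult_left_mono soft b) auto
  also have "... = (NN p. h p * ennreal (2 * \<bar>p\<bar> + 4 / \<sigma>))"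
   by (rule reflect[of "\<lambda>p. h p * ennreal (2 * \<bar>p\<bar> + 4 / \<sigma>)"]) measurable
  finally show ?thesis .
 qed
 show 1: "(NN x. NN y. h (xi - x) * e xi x y) \<le> (NN p. h p * ennreal (2 * \<bar>p\<bar> + 4 / \<sigma>))"
  by (rule A[OF em]) (use \<sigma> in \<open>auto simp: e_def max_def intro!: ennreal_leI\<close>)
 have "(NN x. NN y. h (xi - y) * e xi x y) = (NN y. NN x. h (xi - y) * e xi x y)"
  by (rule lborel_pair.Fubini') measurable
 also have "... \<le> (NN p. h p * ennreal (2 * \<bar>p\<bar> + 4 / \<sigma>))"
 proof (rule A)
  show "(\<lambda>(x, y). e xi y x) \<in> borel_measurable (borel \<Otimes>\<^sub>M borel)" unfolding e_def by measurable
 qed (use \<sigma> in \<open>auto simp: e_def max_def intro!: ennreal_leI\<close>)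
 finally show "(NN x. NN y. h (xi - y) * e xi x y) \<le> (NN p. h p * ennreal (2 * \<bar>p\<bar> + 4 / \<sigma>))" .
 have "(NN x. NN y. h (x + y) * e xi x y) = (NN x. NN r. h r * e xi x (r - x))"
 proof (rule nn_integral_cong)
  fix x
  show "(NN y. h (x + y) * e xi x y) = (NN r. h r * e xi x (r - x))"
   using nn_integral_real_affine[of "\<lambda>r. h r * e xi x (r - x)" 1 x] by simp
 qed
 also have "... = (NN r. NN x. h r * e xi x (r - x))"
  by (rule lborel_pair.Fubini') measurable
 also have "... = (NN r. NN x. h (xi - (xi - r)) * e xi x (xi - (xi - r) - x))" by simp
 also have "... = (NN u. NN x. h (xi - u) * e xi x (xi - u - x))"
  by (rule reflect[of "\<lambda>u. NN x. h (xi - u) * e xi x (xi - u - x)"]) measurable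
 also have "... \<le> (NN p. h p * ennreal (2 * \<bar>p\<bar> + 4 / \<sigma>))"
 proof (rule A)
  show "(\<lambda>(x, y). e xi y (xi - x - y)) \<in> borel_measurable (borel \<Otimes>\<^sub>M borel)" unfolding e_def by measurable
 qed (use \<sigma> in \<open>auto simp: e_def max_def intro!: ennreal_leI\<close>)
 finally show "(NN x. NN y. h (x + y) * e xi x y) \<le> (NN p. h p * ennreal (2 * \<bar>p\<bar> + 4 / \<sigma>))" .
qed

text \<open>Three regimes. Below \<open>N\<close> the phase is given up (term \<open>l\<close>). If
  the excess is at least |xi|/2, half of the decay leaves exp(-\<open>\<sigma>\<close>|xi|/4), which
  beats xi^2 and the area of the interaction region (term with \<open>e2\<close>). Otherwise
  \<open>om3_lower\<close> applies and the square is bounded by a sum over the three resonant lines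
  (terms with \<open>h\<close>), integrated by \<open>nn_resonant_lines\<close> and
  \<open>nn_h_bound\<close>.\<close>

lemma kernel3_bound:
 assumes \<alpha>: "\<alpha> \<noteq> 0" and \<sigma>: "\<sigma> > 0"
 shows "\<exists>C\<ge>0. \<forall>\<tau>. 0 < \<tau> \<longrightarrow> \<tau> \<le> 1 \<longrightarrow> (\<forall>xi. (NN x. NN y. ennreal ((ker \<tau> xi (k3 \<sigma> xi x y) (om3 \<alpha> \<beta> xi x y) x y (xi - x - y))\<^sup>2)) \<le> ennreal (C * sqrt \<tau>))"
proof -
 define N where "N = 1 + 6 * \<bar>\<beta>\<bar> / \<bar>\<alpha>\<bar>"
 have N: "N \<ge> 1" by (simp add: N_def)
 define c where "c = \<bar>\<alpha>\<bar> / 128"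
 have c: "c > 0" using \<alpha> by (simp add: c_def)
 define C2 where "C2 = 2 * (18 * (1 + 8 / \<sigma>\<^sup>2))\<^sup>2"
 have C2: "C2 \<ge> 0" by (simp add: C2_def)
 define D where "D = 4 / \<sigma>"
 have D: "D \<ge> 0" using \<sigma> by (simp add: D_def)
 define a1 where "a1 = 8 * (fact 4 / (\<sigma>/4)^4) + 2 * (4 / (\<sigma>/2))\<^sup>2 * (fact 2 / (\<sigma>/4)^2)"
 have a1: "a1 \<ge> 0" using \<sigma> by (simp add: a1_def)
 define a where "a = N\<^sup>2 * (2 * N + D)\<^sup>2 + a1 + 2 * (2 + D)\<^sup>2"
 define b where "b = 6 * (2 + D) / c"
 \<comment> \<open>Three lines, each with 4 R / A^(3/2) from \<open>nn_h_bound\<close> at R = 3|xi|,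
   times xi^2; the power of tau is kept apart.\<close>
 define g where "g = 36 / (c * sqrt c)"
 have abg: "a \<ge> 0" "b \<ge> 0" "g \<ge> 0" using a1 D c by (auto simp: a_def b_def g_def)
 show ?thesis
 proof (intro exI[of _ "C2 * (a + b + g)"] conjI allI impI)
  show "0 \<le> C2 * (a + b + g)" using C2 abg by auto
  fix \<tau> xi :: real assume \<tau>: "0 < \<tau>" "\<tau> \<le> 1"
  let ?K = "\<lambda>x y. ker \<tau> xi (k3 \<sigma> xi x y) (om3 \<alpha> \<beta> xi x y) x y (xi - x - y)"
  let ?X = "xi\<^sup>2 * exp (- ((\<sigma>/4) * \<bar>xi\<bar>))"
  define A where "A = \<tau> * c * xi\<^sup>2"
  define E where "E x y = \<bar>x\<bar> + \<bar>y\<bar> + \<bar>xi - x - y\<bar> - \<bar>xi\<bar>" for x y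
  have E0: "E x y \<ge> 0" for x y unfolding E_def by linarith
  define e where "e x y = exp (- (\<sigma> * E x y))" for x y
  define e2 where "e2 x y = exp (- ((\<sigma>/2) * E x y))" for x y
  have e01: "0 \<le> e x y" "e x y \<le> 1" "0 \<le> e2 x y" for x y using E0[of x y] \<sigma> by (auto simp: e_def e2_def)
  \<comment> \<open>With excess below |xi|/2 all three distances are at most 3|xi|, so the cutoff
    loses nothing, and it provides the bounded range that \<open>nn_h_bound\<close>
    requires.\<close>
  define h where "h p = (if \<bar>xi\<bar> \<ge> N then xi\<^sup>2 * ((1 / (1 + A * \<bar>p\<bar>))\<^sup>2 * indicator {-(3 * \<bar>xi\<bar>)..3 * \<bar>xi\<bar>} p) else 0)" for p
  have h0: "h p \<ge> 0" for p by (simp add: h_def)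
  define l where "l = (if \<bar>xi\<bar> \<ge> N then 0 else N\<^sup>2)"
  have l0: "l \<ge> 0" by (simp add: l_def)
  define f where "f x y = h (xi - x) * e x y + h (xi - y) * e x y + h (x + y) * e x y + (l * e x y
    + xi\<^sup>2 * exp (- ((\<sigma>/4) * \<bar>xi\<bar>)) * e2 x y + (xi\<^sup>2 / (W xi)\<^sup>2) * e x y)" for x y
  have pt: "(?K x y)\<^sup>2 \<le> C2 * \<tau>\<^sup>2 * f x y" for x y
  proof -
   have "W x \<le> 2 * W xi * (1 + (E x y)\<^sup>2)" "W y \<le> 2 * W xi * (1 + (E x y)\<^sup>2)" "W (xi - x - y) \<le> 2 * W xi * (1 + (E x y)\<^sup>2)"
    by (intro weight_sum_le E0; simp add: E_def)+
   then have w: "W x + W y + W (xi - x - y) \<le> 6 * W xi * (1 + (E x y)\<^sup>2)" by linarith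
   have k: "\<bar>k3 \<sigma> xi x y\<bar> \<le> \<bar>xi\<bar> * exp (- (\<sigma> * E x y))" by (simp add: k3_def E_def abs_mult)
   let ?\<Psi> = "(1 / (1 + \<tau> * \<bar>om3 \<alpha> \<beta> xi x y\<bar> / W xi))\<^sup>2"
   have "(?K x y)\<^sup>2 \<le> C2 * \<tau>\<^sup>2 * (xi\<^sup>2 * e x y * ?\<Psi> + (xi\<^sup>2 / (W xi)\<^sup>2) * e x y)"
    unfolding C2_def e_def by (rule ker_sq_bound[OF \<sigma> E0 k w \<tau>(1)])
   also have "... \<le> C2 * \<tau>\<^sup>2 * f x y"
   proof (intro mult_left_mono)
    have "1 \<le> 1 + \<tau> * \<bar>om3 \<alpha> \<beta> xi x y\<bar> / W xi" using \<tau> W_pos[of xi] by simp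
    then have P01: "0 \<le> ?\<Psi>" "?\<Psi> \<le> 1" by (auto intro!: power_le_one)
    have parts: "0 \<le> h (xi - x) * e x y" "0 \<le> h (xi - y) * e x y" "0 \<le> h (x + y) * e x y" "0 \<le> l * e x y"
      "0 \<le> xi\<^sup>2 * exp (- ((\<sigma>/4) * \<bar>xi\<bar>)) * e2 x y"
     using h0 e01[of x y] l0 by auto
    have main: "xi\<^sup>2 * e x y * ?\<Psi> \<le> h (xi - x) * e x y + h (xi - y) * e x y + h (x + y) * e x y + (l * e x y
    + xi\<^sup>2 * exp (- ((\<sigma>/4) * \<bar>xi\<bar>)) * e2 x y)"
    proof (cases "\<bar>xi\<bar> \<ge> N")
     case False
     then have "xi\<^sup>2 \<le> N\<^sup>2" by (metis abs_ge_zero linear power2_abs power_mono)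
     then have "xi\<^sup>2 * e x y * ?\<Psi> \<le> N\<^sup>2 * e x y * 1" using e01[of x y] P01 by (intro mult_mono) auto
     also have "... = l * e x y" using False by (simp add: l_def)
     finally show ?thesis using parts by linarith
    next
     case big: True
     then have x1: "\<bar>xi\<bar> \<ge> 1" using N by linarith
     show ?thesis
     proof (cases "E x y < \<bar>xi\<bar> / 2")
      case False
      have "e x y \<le> exp (- ((\<sigma>/4) * \<bar>xi\<bar>)) * e2 x y"
      proof -
       have "(\<sigma>/4) * \<bar>xi\<bar> + (\<sigma>/2) * E x y \<le> \<sigma> * E x y"
       proof -
        have "(\<sigma>/2) * (\<bar>xi\<bar> / 2) \<le> (\<sigma>/2) * E x y" using False \<sigma> by (intro mult_left_mono) auto
        moreover have "(\<sigma>/2) * (\<bar>xi\<bar> / 2) = (\<sigma>/4) * \<bar>xi\<bar>" "\<sigma> * E x y = (\<sigma>/2) * E x y + (\<sigma>/2) * E x y" by simp_all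
        ultimately show ?thesis by linarith
       qed
       then show ?thesis unfolding e_def e2_def exp_add[symmetric] exp_le_cancel_iff by linarith
      qed
      then have "xi\<^sup>2 * e x y * ?\<Psi> \<le> xi\<^sup>2 * (exp (- ((\<sigma>/4) * \<bar>xi\<bar>)) * e2 x y) * 1"
       using e01[of x y] P01 by (intro mult_mono) auto
      then show ?thesis using parts by simp
     next
      case True
      define d where "d = min \<bar>xi - x\<bar> (min \<bar>xi - y\<bar> \<bar>x + y\<bar>)"
      have d0: "d \<ge> 0" by (simp add: d_def)
      have "?\<Psi> \<le> (1 / (1 + A * d))\<^sup>2"
       unfolding A_def
      proof (rule resonance_weight_le[OF \<tau>(1) c x1 _ d0])
       show "2 * c * xi ^ 4 * d \<le> \<bar>om3 \<alpha> \<beta> xi x y\<bar>"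
        unfolding c_def d_def by (rule om3_lower[OF \<alpha>]) (use big True in \<open>auto simp: N_def E_def\<close>)
      qed
      then have le: "xi\<^sup>2 * e x y * ?\<Psi> \<le> xi\<^sup>2 * e x y * (1 / (1 + A * d))\<^sup>2"
       using e01[of x y] by (intro mult_left_mono) auto
      have hd: "xi\<^sup>2 * e x y * (1 / (1 + A * \<bar>p\<bar>))\<^sup>2 = h p * e x y" if "\<bar>p\<bar> \<le> 3 * \<bar>xi\<bar>" for p
       using that big by (auto simp: h_def indicator_def abs_le_iff)
      have bds: "\<bar>xi - x\<bar> \<le> 3 * \<bar>xi\<bar>" "\<bar>xi - y\<bar> \<le> 3 * \<bar>xi\<bar>" "\<bar>x + y\<bar> \<le> 3 * \<bar>xi\<bar>"
       using True unfolding E_def by linarith+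
      have "d = \<bar>xi - x\<bar> \<or> d = \<bar>xi - y\<bar> \<or> d = \<bar>x + y\<bar>" unfolding d_def min_def by auto
      then consider "d = \<bar>xi - x\<bar>" | "d = \<bar>xi - y\<bar>" | "d = \<bar>x + y\<bar>" by blast
      then show ?thesis
      proof cases
       case 1 show ?thesis using le hd[OF bds(1)] parts unfolding 1 by linarith
      next
       case 2 show ?thesis using le hd[OF bds(2)] parts unfolding 2 by linarith
      next
       case 3 show ?thesis using le hd[OF bds(3)] parts unfolding 3 by linarith
      qed
     qed
    qed
    then show "xi\<^sup>2 * e x y * ?\<Psi> + (xi\<^sup>2 / (W xi)\<^sup>2) * e x y \<le> f x y" unfolding f_def by linarith
   qed (use C2 in auto)
   finally show ?thesis .
  qed
  have [measurable]: "h \<in> bm" unfolding h_def by measurable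
  have [measurable]: "(\<lambda>(x, y). e x y) \<in> borel_measurable (borel \<Otimes>\<^sub>M borel)" unfolding e_def E_def by measurable
  have [measurable]: "(\<lambda>(x, y). e2 x y) \<in> borel_measurable (borel \<Otimes>\<^sub>M borel)" unfolding e2_def E_def by measurable
  let ?II = "\<lambda>F :: real => real => ennreal. NN x. NN y. F x y"
  define Ih where "Ih = (NN p. ennreal (h p) * ennreal (2 * \<bar>p\<bar> + 4 / \<sigma>))"
  have i1: "?II (\<lambda>x y. ennreal (h (xi - x)) * ennreal (e x y)) \<le> Ih" "?II (\<lambda>x y. ennreal (h (xi - y)) * ennreal (e x y)) \<le> Ih"
    "?II (\<lambda>x y. ennreal (h (x + y)) * ennreal (e x y)) \<le> Ih"
   unfolding Ih_def e_def E_def by (rule nn_resonant_lines[OF \<sigma>, of "\<lambda>p. ennreal (h p)"], measurable)+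
  have Ih: "Ih \<le> ennreal (2 * (2 + D) / (\<tau> * c) + 12 / (c * sqrt c) / (\<tau> * sqrt \<tau>))"
  proof (cases "\<bar>xi\<bar> \<ge> N")
   case False
   then have "Ih = 0" by (simp add: Ih_def h_def)
   then show ?thesis by simp
  next
   case True
   then have x2: "xi\<^sup>2 > 0" "\<bar>xi\<bar> > 0" using N by auto
   have A: "A > 0" using \<tau> c x2 by (simp add: A_def)
   have "Ih = (NN p. ennreal (xi\<^sup>2) * (ennreal ((2 * \<bar>p\<bar> + D) * (1 / (1 + A * \<bar>p\<bar>))\<^sup>2) * indicator {-(3 * \<bar>xi\<bar>)..3 * \<bar>xi\<bar>} p))"
    unfolding Ih_def
   proof (intro nn_integral_cong)
    fix p
    have i: "ennreal (a * (X * indicator S p)) = ennreal a * (ennreal X * indicator S p)" if "a \<ge> 0" "X \<ge> 0" for a X and S :: "real set"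
     using that by (auto simp: indicator_def ennreal_mult)
    have "ennreal (h p) * ennreal (2 * \<bar>p\<bar> + 4 / \<sigma>) = ennreal (h p * (2 * \<bar>p\<bar> + D))"
     unfolding D_def by (rule ennreal_mult[symmetric]) (use h0 \<sigma> in auto)
    also have "h p * (2 * \<bar>p\<bar> + D) = xi\<^sup>2 * (((2 * \<bar>p\<bar> + D) * (1 / (1 + A * \<bar>p\<bar>))\<^sup>2) * indicator {-(3 * \<bar>xi\<bar>)..3 * \<bar>xi\<bar>} p)"
     using True unfolding h_def by (simp only: if_True mult_ac)
    finally show "ennreal (h p) * ennreal (2 * \<bar>p\<bar> + 4 / \<sigma>) = ennreal (xi\<^sup>2) * (ennreal ((2 * \<bar>p\<bar> + D) * (1 / (1 + A * \<bar>p\<bar>))\<^sup>2) * indicator {-(3 * \<bar>xi\<bar>)..3 * \<bar>xi\<bar>} p)"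
     using D by (subst (asm) i) auto
   qed
   also have "... = ennreal (xi\<^sup>2) * (NN p. ennreal ((2 * \<bar>p\<bar> + D) * (1 / (1 + A * \<bar>p\<bar>))\<^sup>2) * indicator {-(3 * \<bar>xi\<bar>)..3 * \<bar>xi\<bar>} p)"
    by (rule nn_integral_cmult) measurable
   also have "... \<le> ennreal (xi\<^sup>2) * ennreal ((2 + D) * (2 / A) + 4 * (3 * \<bar>xi\<bar>) / (A * sqrt A))"
    by (intro mult_left_mono nn_h_bound A D) auto
   also have "... = ennreal (xi\<^sup>2 * ((2 + D) * (2 / A) + 4 * (3 * \<bar>xi\<bar>) / (A * sqrt A)))"
    using A D by (simp add: ennreal_mult)
   also have "xi\<^sup>2 * ((2 + D) * (2 / A) + 4 * (3 * \<bar>xi\<bar>) / (A * sqrt A)) = 2 * (2 + D) / (\<tau> * c) + 12 / (c * sqrt c) / (\<tau> * sqrt \<tau>)"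
   proof -
    have sA: "sqrt A = sqrt \<tau> * sqrt c * \<bar>xi\<bar>" by (simp add: A_def real_sqrt_mult)
    have t1: "xi\<^sup>2 * ((2 + D) * (2 / A)) = 2 * (2 + D) / (\<tau> * c)" using x2 \<tau> c by (simp add: A_def field_simps)
    have t2: "xi\<^sup>2 * (4 * (3 * \<bar>xi\<bar>) / (A * sqrt A)) = 12 / (c * sqrt c) / (\<tau> * sqrt \<tau>)"
     unfolding sA unfolding A_def using x2 \<tau> c by (simp add: field_simps)
    show ?thesis unfolding distrib_left t1 t2 ..
   qed
   finally show ?thesis .
  qed
  have i4: "?II (\<lambda>x y. ennreal l * ennreal (e x y)) \<le> ennreal (N\<^sup>2 * (2 * N + D)\<^sup>2)"
  proof (cases "\<bar>xi\<bar> \<ge> N")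
   case True then show ?thesis by (simp add: l_def)
  next
   case False
   have "?II (\<lambda>x y. ennreal l * ennreal (e x y)) = ennreal l * ?II (\<lambda>x y. ennreal (e x y))"
    by (simp add: nn_integral_cmult)
   also have "... \<le> ennreal (N\<^sup>2) * ennreal ((2 * \<bar>xi\<bar> + D)\<^sup>2)"
    using nn_decay_plane[OF \<sigma>, of xi] False by (intro mult_mono) (auto simp: l_def e_def E_def D_def)
   also have "... = ennreal (N\<^sup>2 * (2 * \<bar>xi\<bar> + D)\<^sup>2)" by (simp add: ennreal_mult)
   also have "... \<le> ennreal (N\<^sup>2 * (2 * N + D)\<^sup>2)"
    using False D by (intro ennreal_leI mult_left_mono power_mono) auto
   finally show ?thesis .
  qed
  have i5: "?II (\<lambda>x y. ennreal ?X * ennreal (e2 x y)) \<le> ennreal a1"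
  proof -
   have "?II (\<lambda>x y. ennreal ?X * ennreal (e2 x y)) = ennreal ?X * ?II (\<lambda>x y. ennreal (e2 x y))"
    by (simp add: nn_integral_cmult)
   also have "... \<le> ennreal ?X * ennreal ((2 * \<bar>xi\<bar> + 4 / (\<sigma>/2))\<^sup>2)"
    unfolding e2_def E_def using \<sigma> by (intro mult_left_mono nn_decay_plane) auto
   also have "... = ennreal (xi\<^sup>2 * exp (- ((\<sigma>/4) * \<bar>xi\<bar>)) * (2 * \<bar>xi\<bar> + 4 / (\<sigma>/2))\<^sup>2)"
    by (rule ennreal_mult[symmetric]) auto
   also have "... \<le> ennreal a1"
    unfolding a1_def using \<sigma> by (intro ennreal_leI exp_decay_bound) auto
   finally show ?thesis .
  qed
  have i6: "?II (\<lambda>x y. ennreal (xi\<^sup>2 / (W xi)\<^sup>2) * ennreal (e x y)) \<le> ennreal (2 * (2 + D)\<^sup>2)"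
  proof -
   have "?II (\<lambda>x y. ennreal (xi\<^sup>2 / (W xi)\<^sup>2) * ennreal (e x y)) = ennreal (xi\<^sup>2 / (W xi)\<^sup>2) * ?II (\<lambda>x y. ennreal (e x y))"
    by (simp add: nn_integral_cmult)
   also have "... \<le> ennreal (xi\<^sup>2 / (W xi)\<^sup>2) * ennreal ((2 * \<bar>xi\<bar> + D)\<^sup>2)"
    unfolding e_def E_def D_def by (intro mult_left_mono nn_decay_plane \<sigma>) auto
   also have "... = ennreal (xi\<^sup>2 / (W xi)\<^sup>2 * (2 * \<bar>xi\<bar> + D)\<^sup>2)"
    by (rule ennreal_mult[symmetric]) auto
   also have "... \<le> ennreal (2 * (2 + D)\<^sup>2)"
    using two_small_factor[of xi D] D by (intro ennreal_leI) simp
   finally show ?thesis .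
  qed
  have "?II (\<lambda>x y. ennreal ((?K x y)\<^sup>2))
    \<le> ?II (\<lambda>x y. ennreal (C2 * \<tau>\<^sup>2) * (ennreal (h (xi - x)) * ennreal (e x y) + (ennreal (h (xi - y)) * ennreal (e x y) + (ennreal (h (x + y)) * ennreal (e x y)
     + (ennreal l * ennreal (e x y) + (ennreal ?X * ennreal (e2 x y) + ennreal (xi\<^sup>2 / (W xi)\<^sup>2) * ennreal (e x y)))))))"
  proof (intro nn_integral_mono)
   fix x y
   have "ennreal ((?K x y)\<^sup>2) \<le> ennreal (C2 * \<tau>\<^sup>2 * f x y)"
    by (intro ennreal_leI pt)
   also have "... = ennreal (C2 * \<tau>\<^sup>2) * (ennreal (h (xi - x)) * ennreal (e x y) + (ennreal (h (xi - y)) * ennreal (e x y) + (ennreal (h (x + y)) * ennreal (e x y)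
     + (ennreal l * ennreal (e x y) + (ennreal ?X * ennreal (e2 x y) + ennreal (xi\<^sup>2 / (W xi)\<^sup>2) * ennreal (e x y))))))"
    using C2 h0 e01[of x y] l0 unfolding f_def
    by (simp add: ennreal_mult[symmetric] ennreal_plus[symmetric] add.assoc del: ennreal_plus)
   finally show "ennreal ((?K x y)\<^sup>2) \<le> ennreal (C2 * \<tau>\<^sup>2) * (ennreal (h (xi - x)) * ennreal (e x y) + (ennreal (h (xi - y)) * ennreal (e x y) + (ennreal (h (x + y)) * ennreal (e x y)
     + (ennreal l * ennreal (e x y) + (ennreal ?X * ennreal (e2 x y) + ennreal (xi\<^sup>2 / (W xi)\<^sup>2) * ennreal (e x y))))))" .
  qed
  also have "... = ennreal (C2 * \<tau>\<^sup>2) * (?II (\<lambda>x y. ennreal (h (xi - x)) * ennreal (e x y)) + (?II (\<lambda>x y. ennreal (h (xi - y)) * ennreal (e x y)) + (?II (\<lambda>x y. ennreal (h (x + y)) * ennreal (e x y))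
     + (?II (\<lambda>x y. ennreal l * ennreal (e x y)) + (?II (\<lambda>x y. ennreal ?X * ennreal (e2 x y)) + ?II (\<lambda>x y. ennreal (xi\<^sup>2 / (W xi)\<^sup>2) * ennreal (e x y)))))))"
  proof -
   have add: "?II (\<lambda>x y. F x y + G x y) = ?II F + ?II G"
    if "(\<lambda>(x, y). F x y) \<in> borel_measurable (borel \<Otimes>\<^sub>M borel)" "(\<lambda>(x, y). G x y) \<in> borel_measurable (borel \<Otimes>\<^sub>M borel)" for F G :: "real => real => ennreal"
   proof -
    note [measurable] = that
    have "?II (\<lambda>x y. F x y + G x y) = (NN x. (NN y. F x y) + (NN y. G x y))"
     by (intro nn_integral_cong nn_integral_add) measurable
    also have "... = ?II F + ?II G" by (rule nn_integral_add) measurable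
    finally show ?thesis .
   qed
   have cm: "?II (\<lambda>x y. cc * F x y) = cc * ?II F" if "(\<lambda>(x, y). F x y) \<in> borel_measurable (borel \<Otimes>\<^sub>M borel)" for cc and F :: "real => real => ennreal"
   proof -
    note [measurable] = that
    have "?II (\<lambda>x y. cc * F x y) = (NN x. cc * (NN y. F x y))"
     by (intro nn_integral_cong nn_integral_cmult) measurable
    also have "... = cc * ?II F" by (rule nn_integral_cmult) measurable
    finally show ?thesis .
   qed
   show ?thesis
    by (subst cm, measurable, subst add, measurable, subst add, measurable, subst add, measurable, subst add, measurable, subst add, measurable)
  qed
  also have "... \<le> ennreal (C2 * \<tau>\<^sup>2) * (Ih + (Ih + (Ih + (ennreal (N\<^sup>2 * (2 * N + D)\<^sup>2) + (ennreal a1 + ennreal (2 * (2 + D)\<^sup>2))))))"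
   by (intro mult_left_mono add_mono i1 i4 i5 i6) auto
  also have "... \<le> ennreal (C2 * \<tau>\<^sup>2) * (ennreal (2 * (2 + D) / (\<tau> * c) + 12 / (c * sqrt c) / (\<tau> * sqrt \<tau>)) + (ennreal (2 * (2 + D) / (\<tau> * c) + 12 / (c * sqrt c) / (\<tau> * sqrt \<tau>)) + (ennreal (2 * (2 + D) / (\<tau> * c) + 12 / (c * sqrt c) / (\<tau> * sqrt \<tau>))
    + (ennreal (N\<^sup>2 * (2 * N + D)\<^sup>2) + (ennreal a1 + ennreal (2 * (2 + D)\<^sup>2))))))"
   by (intro mult_left_mono add_mono Ih order_refl) auto
  also have "... = ennreal (C2 * \<tau>\<^sup>2 * (a + b / \<tau> + g / (\<tau> * sqrt \<tau>)))"
  proof -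
   define u where "u = 2 * (2 + D) / (\<tau> * c) + 12 / (c * sqrt c) / (\<tau> * sqrt \<tau>)"
   have u0: "u \<ge> 0" using D c \<tau> by (simp add: u_def)
   have u3: "3 * u = b / \<tau> + g / (\<tau> * sqrt \<tau>)"
   proof -
    have "b / \<tau> = 3 * (2 * (2 + D) / (\<tau> * c))" by (simp add: b_def mult.commute)
    moreover have "g / (\<tau> * sqrt \<tau>) = 3 * (12 / (c * sqrt c) / (\<tau> * sqrt \<tau>))" by (simp add: g_def)
    ultimately show ?thesis unfolding u_def by (simp only: distrib_left)
   qed
   have e: "ennreal u + (ennreal u + (ennreal u + (ennreal (N\<^sup>2 * (2 * N + D)\<^sup>2) + (ennreal a1 + ennreal (2 * (2 + D)\<^sup>2))))) = ennreal (a + 3 * u)"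
    using u0 a1 D N by (simp add: ennreal_plus[symmetric] a_def add_ac del: ennreal_plus)
   have "ennreal (C2 * \<tau>\<^sup>2) * ennreal (a + 3 * u) = ennreal (C2 * \<tau>\<^sup>2 * (a + 3 * u))"
    by (rule ennreal_mult[symmetric]) (use C2 abg u0 in auto)
   then show ?thesis unfolding u_def[symmetric] e u3 by (simp only: add.assoc)
  qed
  also have "... \<le> ennreal (C2 * (a + b + g) * sqrt \<tau>)"
   by (intro ennreal_leI sqrt_bound_collect \<tau> C2 abg)
  finally show "?II (\<lambda>x y. ennreal ((?K x y)\<^sup>2)) \<le> ennreal (C2 * (a + b + g) * sqrt \<tau>)" .
 qed
qed

section \<open>Trilinear estimates by oscillation in time\<close>

text \<open>\<open>f\<close> is absolutely continuous on [0, \<open>\<tau>\<close>], starts at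
  \<open>c\<close> and has derivative \<open>h\<close> almost everywhere. The integral form avoids
  differentiation.\<close>

definition prim :: "real => complex => (real => complex) => (real => complex) => bool" where
 "prim \<tau> c h f \<longleftrightarrow> set_integrable lborel {0..\<tau>} h \<and> (\<forall>t\<in>{0..\<tau>}. f t = c + (LINT s:{0..t}|lborel. h s))"

lemma prim_integrable:
 assumes "prim \<tau> c h f" "t \<le> \<tau>"
 shows "set_integrable lborel {0..t} h"
 using assms by (auto simp: prim_def intro: set_integrable_subset)

lemma prim_0: "prim \<tau> c h f \<Longrightarrow> 0 \<le> \<tau> \<Longrightarrow> f 0 = c"
proof -
 assume "prim \<tau> c h f" "0 \<le> \<tau>"
 then have "f 0 = c + (LINT s|lborel. indicator {0..0} s *\<^sub>R h s)" by (auto simp: prim_def set_lebesgue_integral_def)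
 also have "(LINT s|lborel. indicator {0..0} s *\<^sub>R h s) = 0"
  by (rule integral_eq_zero_AE, rule AE_mp[OF AE_lborel_singleton[of 0]]) (auto intro!: AE_I2 simp: indicator_def)
 finally show ?thesis by simp
qed

lemma indicator_Icc_measurable2 [measurable]:
 "(\<lambda>z. indicator {0..fst z} (snd z) :: real) \<in> borel_measurable (borel \<Otimes>\<^sub>M (borel :: real measure))"
proof -
 have "(\<lambda>z. indicator {0..fst z} (snd z) :: real) = (\<lambda>z. if 0 \<le> snd z \<and> snd z \<le> (fst z :: real) then 1 else 0)"
  by (auto simp: fun_eq_iff indicator_def)
 then show ?thesis by simp
qed

lemma primitive_measurable:
 assumes h: "set_integrable lborel {0..\<tau>} (h :: real => complex)"
 shows "(\<lambda>t. indicator {0..\<tau>} t *\<^sub>R (LINT s:{0..t}|lborel. h s)) \<in> bm"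
proof -
 let ?h = "\<lambda>s. indicator {0..\<tau>} s *\<^sub>R h s"
 have [measurable]: "?h \<in> bm" using h by (auto simp: set_integrable_def)
 have eq: "indicator {0..\<tau>} t *\<^sub>R (LINT s:{0..t}|lborel. h s) = indicator {0..\<tau>} t *\<^sub>R (LINT s|lborel. indicator {0..fst (t, s)} (snd (t, s)) *\<^sub>R ?h s)" for t
  unfolding set_lebesgue_integral_def
  by (cases "t \<in> {0..\<tau>}") (auto intro!: Bochner_Integration.integral_cong simp: indicator_def)
 show ?thesis unfolding eq by measurable
qed

lemma prim_measurable:
 assumes "prim \<tau> c h f"
 shows "(\<lambda>t. indicator {0..\<tau>} t *\<^sub>R f t) \<in> bm"
proof -
 have "(\<lambda>t. indicator {0..\<tau>} t *\<^sub>R f t) = (\<lambda>t. indicator {0..\<tau>} t *\<^sub>R c + indicator {0..\<tau>} t *\<^sub>R (LINT s:{0..t}|lborel. h s))"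
  using assms by (auto simp: prim_def fun_eq_iff indicator_def)
 then show ?thesis using primitive_measurable[of \<tau> h] assms by (simp add: prim_def)
qed

lemma set_integral_norm_le:
 fixes h :: "real => complex"
 assumes "set_integrable lborel {0..\<tau>} h" "t \<le> \<tau>"
 shows "cmod (LINT s:{0..t}|lborel. h s) \<le> (LINT s:{0..\<tau>}|lborel. cmod (h s))"
proof -
 have i: "set_integrable lborel {0..t} h" using assms by (auto intro: set_integrable_subset)
 have "cmod (LINT s:{0..t}|lborel. h s) \<le> (LINT s:{0..t}|lborel. cmod (h s))"
  using integral_norm_bound[of lborel "\<lambda>s. indicator {0..t} s *\<^sub>R h s"] by (simp add: set_lebesgue_integral_def)
 also have "... \<le> (LINT s:{0..\<tau>}|lborel. cmod (h s))"
  using assms set_integrable_norm[OF i] set_integrable_norm[OF assms(1)]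
  unfolding set_lebesgue_integral_def set_integrable_def
  by (intro integral_mono) (auto simp: indicator_def)
 finally show ?thesis .
qed

lemma prim_bounded:
 assumes "prim \<tau> c h f" "t \<in> {0..\<tau>}"
 shows "cmod (f t) \<le> cmod c + (LINT s:{0..\<tau>}|lborel. cmod (h s))"
proof -
 have "cmod (f t) \<le> cmod c + cmod (LINT s:{0..t}|lborel. h s)" using assms by (simp add: prim_def norm_triangle_ineq)
 then show ?thesis using set_integral_norm_le[of \<tau> h t] assms by (simp add: prim_def) 
qed

lemma set_integrable_mult_prim:
 assumes h: "set_integrable lborel {0..\<tau>} h" and f: "prim \<tau> c g f"
 shows "set_integrable lborel {0..\<tau>} (\<lambda>s. h s * f s)"
 unfolding set_integrable_def
proof (rule Bochner_Integration.integrable_bound)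
 let ?B = "cmod c + (LINT s:{0..\<tau>}|lborel. cmod (g s))"
 show "integrable lborel (\<lambda>s. of_real ?B * (indicator {0..\<tau>} s *\<^sub>R h s))"
  using h by (intro integrable_mult_right) (simp add: set_integrable_def)
 have "(\<lambda>s. (indicator {0..\<tau>} s *\<^sub>R h s) * (indicator {0..\<tau>} s *\<^sub>R f s)) \<in> borel_measurable lborel"
  using h prim_measurable[OF f] by (intro borel_measurable_times) (auto simp: set_integrable_def)
 moreover have "(\<lambda>s. (indicator {0..\<tau>} s *\<^sub>R h s) * (indicator {0..\<tau>} s *\<^sub>R f s)) = (\<lambda>s. indicator {0..\<tau>} s *\<^sub>R (h s * f s))"
  by (auto simp: fun_eq_iff indicator_def)
 ultimately show "(\<lambda>s. indicator {0..\<tau>} s *\<^sub>R (h s * f s)) \<in> borel_measurable lborel" by simp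
 show "AE s in lborel. norm (indicator {0..\<tau>} s *\<^sub>R (h s * f s)) \<le> norm (of_real ?B * (indicator {0..\<tau>} s *\<^sub>R h s))"
 proof (intro AE_I2)
  fix s
  show "norm (indicator {0..\<tau>} s *\<^sub>R (h s * f s)) \<le> norm (of_real ?B * (indicator {0..\<tau>} s *\<^sub>R h s))"
  proof (cases "s \<in> {0..\<tau>}")
   case True
   have "cmod (f s) \<le> \<bar>?B\<bar>" using prim_bounded[OF f True] by linarith
   then have "cmod (h s) * cmod (f s) \<le> cmod (h s) * \<bar>?B\<bar>" by (intro mult_left_mono) auto
   then show ?thesis using True by (simp add: norm_mult mult.commute del: of_real_add)
  qed simp
 qed
qed

text \<open>Product rule by Fubini: the product of the two integrals is an integral over the square
  [0,t]^2, split along the diagonal. On one side the inner integral rebuilds f2 - c2, on the other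
  f1 - c1.\<close>

lemma prim_mult:
 assumes f1: "prim \<tau> c1 h1 f1" and f2: "prim \<tau> c2 h2 f2"
 shows "prim \<tau> (c1 * c2) (\<lambda>s. h1 s * f2 s + h2 s * f1 s) (\<lambda>s. f1 s * f2 s)"
 unfolding prim_def
proof (intro conjI ballI)
 have h: "set_integrable lborel {0..\<tau>} h1" "set_integrable lborel {0..\<tau>} h2" using f1 f2 by (auto simp: prim_def)
 have i12: "set_integrable lborel {0..\<tau>} (\<lambda>s. h1 s * f2 s)" "set_integrable lborel {0..\<tau>} (\<lambda>s. h2 s * f1 s)"
  by (rule set_integrable_mult_prim; fact)+
 show "set_integrable lborel {0..\<tau>} (\<lambda>s. h1 s * f2 s + h2 s * f1 s)"
  by (rule set_integral_add(1)[OF i12])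
 fix t assume t: "t \<in> {0..\<tau>}"
 define g1 where "g1 s = indicator {0..t} s *\<^sub>R h1 s" for s
 define g2 where "g2 s = indicator {0..t} s *\<^sub>R h2 s" for s
 have gi: "integrable lborel g1" "integrable lborel g2"
  using prim_integrable[OF f1, of t] prim_integrable[OF f2, of t] t by (auto simp: g1_def[abs_def] g2_def[abs_def] set_integrable_def)
 then have [measurable]: "g1 \<in> bm" "g2 \<in> bm" by auto
 define I1 where "I1 = (LINT s|lborel. g1 s)"
 define I2 where "I2 = (LINT s|lborel. g2 s)"
 have ft: "f1 t = c1 + I1" "f2 t = c2 + I2"
  using f1 f2 t by (auto simp: prim_def I1_def I2_def g1_def g2_def set_lebesgue_integral_def)
 have ip: "integrable (lborel \<Otimes>\<^sub>M lborel) (\<lambda>(a, b). g1 a * g2 b)"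
 proof (rule lborel_pair.Fubini_integrable)
  show "integrable lborel (\<lambda>a. LINT b|lborel. norm (case (a, b) of (a, b) => g1 a * g2 b))"
   using gi by (simp add: norm_mult)
 qed (use gi in auto)
 \<comment> \<open>Indicator of the lower triangle; it includes the diagonal, which is a null
   set.\<close>
 define L where "L z = (if snd z \<le> (fst z :: real) then 1 else (0::complex))" for z
 have [measurable]: "L \<in> borel_measurable (borel \<Otimes>\<^sub>M borel)" unfolding L_def by measurable
 have iL: "integrable (lborel \<Otimes>\<^sub>M lborel) (\<lambda>(a, b). g1 a * (g2 b * L (a, b)))"
  by (rule Bochner_Integration.integrable_bound[OF ip], measurable) (auto intro!: AE_I2 simp: L_def norm_mult)
 have iM: "integrable (lborel \<Otimes>\<^sub>M lborel) (\<lambda>(a, b). g2 b * (g1 a * (1 - L (a, b))))"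
  by (rule Bochner_Integration.integrable_bound[OF ip], measurable) (auto intro!: AE_I2 simp: L_def norm_mult)
 have "I1 * I2 = (LINT a|lborel. LINT b|lborel. g1 a * g2 b)"
  unfolding I1_def I2_def by simp
 also have "... = integral\<^sup>L (lborel \<Otimes>\<^sub>M lborel) (\<lambda>(a, b). g1 a * g2 b)"
  using lborel_pair.integral_fst'[OF ip] by simp
 also have "... = integral\<^sup>L (lborel \<Otimes>\<^sub>M lborel) (\<lambda>z. (case z of (a, b) => g1 a * (g2 b * L (a, b))) + (case z of (a, b) => g2 b * (g1 a * (1 - L (a, b)))))"
  by (intro Bochner_Integration.integral_cong refl) (auto simp: algebra_simps)
 also have "... = integral\<^sup>L (lborel \<Otimes>\<^sub>M lborel) (\<lambda>(a, b). g1 a * (g2 b * L (a, b))) + integral\<^sup>L (lborel \<Otimes>\<^sub>M lborel) (\<lambda>(a, b). g2 b * (g1 a * (1 - L (a, b))))"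
  by (rule Bochner_Integration.integral_add[OF iL iM])
 also have "integral\<^sup>L (lborel \<Otimes>\<^sub>M lborel) (\<lambda>(a, b). g1 a * (g2 b * L (a, b))) = (LINT a|lborel. LINT b|lborel. g1 a * (g2 b * L (a, b)))"
  using lborel_pair.integral_fst'[OF iL] by simp
 also have "... = (LINT a|lborel. indicator {0..t} a *\<^sub>R (h1 a * (f2 a - c2)))"
 proof (rule Bochner_Integration.integral_cong[OF refl])
  fix a
  show "(LINT b|lborel. g1 a * (g2 b * L (a, b))) = indicator {0..t} a *\<^sub>R (h1 a * (f2 a - c2))"
  proof (cases "a \<in> {0..t}")
   case True
   have "(LINT b|lborel. g2 b * L (a, b)) = (LINT s:{0..a}|lborel. h2 s)"
    unfolding set_lebesgue_integral_def using True
    by (intro Bochner_Integration.integral_cong refl) (auto simp: g2_def L_def indicator_def)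
   also have "... = f2 a - c2" using f2 True t by (auto simp: prim_def)
   finally show ?thesis using True by (simp add: g1_def)
  qed (simp add: g1_def)
 qed
 also have "integral\<^sup>L (lborel \<Otimes>\<^sub>M lborel) (\<lambda>(a, b). g2 b * (g1 a * (1 - L (a, b)))) = (LINT b|lborel. LINT a|lborel. g2 b * (g1 a * (1 - L (a, b))))"
  using lborel_pair.integral_snd[OF iM] by simp
 also have "... = (LINT b|lborel. indicator {0..t} b *\<^sub>R (h2 b * (f1 b - c1)))"
 proof (rule Bochner_Integration.integral_cong[OF refl])
  fix b
  show "(LINT a|lborel. g2 b * (g1 a * (1 - L (a, b)))) = indicator {0..t} b *\<^sub>R (h2 b * (f1 b - c1))"
  proof (cases "b \<in> {0..t}")
   case True
   have "(LINT a|lborel. g1 a * (1 - L (a, b))) = (LINT s|lborel. indicator {0..b} s *\<^sub>R h1 s)"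
   proof (rule integral_cong_AE)
    have "(\<lambda>s. indicator {0..b} s *\<^sub>R h1 s) = (\<lambda>s. indicator {0..b} s *\<^sub>R g1 s)"
     using True by (auto simp: fun_eq_iff g1_def indicator_def)
    then show "(\<lambda>s. indicator {0..b} s *\<^sub>R h1 s) \<in> borel_measurable lborel" by simp
    show "AE s in lborel. g1 s * (1 - L (s, b)) = indicator {0..b} s *\<^sub>R h1 s"
     by (rule AE_mp[OF AE_lborel_singleton[of b]]) (use True in \<open>auto intro!: AE_I2 simp: g1_def L_def indicator_def\<close>)
   qed simp
   also have "... = f1 b - c1" using f1 True t by (auto simp: prim_def set_lebesgue_integral_def)
   finally show ?thesis using True by (simp add: g2_def)
  qed (simp add: g2_def)
 qed
 finally have II: "I1 * I2 = (LINT s:{0..t}|lborel. h1 s * (f2 s - c2)) + (LINT s:{0..t}|lborel. h2 s * (f1 s - c1))"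
  by (simp add: set_lebesgue_integral_def)
 have it: "set_integrable lborel {0..t} (\<lambda>s. h1 s * f2 s)" "set_integrable lborel {0..t} (\<lambda>s. h2 s * f1 s)"
   "set_integrable lborel {0..t} (\<lambda>s. h1 s * c2)" "set_integrable lborel {0..t} (\<lambda>s. h2 s * c1)"
  using i12 t h by (auto intro: set_integrable_subset)
 have e1: "(LINT s:{0..t}|lborel. h1 s * (f2 s - c2)) = (LINT s:{0..t}|lborel. h1 s * f2 s) - I1 * c2"
  unfolding right_diff_distrib set_integral_diff(2)[OF it(1,3)] by (simp add: I1_def g1_def set_lebesgue_integral_def)
 have e2: "(LINT s:{0..t}|lborel. h2 s * (f1 s - c1)) = (LINT s:{0..t}|lborel. h2 s * f1 s) - I2 * c1"
  unfolding right_diff_distrib set_integral_diff(2)[OF it(2,4)] by (simp add: I2_def g2_def set_lebesgue_integral_def)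
 show "f1 t * f2 t = c1 * c2 + (LINT s:{0..t}|lborel. h1 s * f2 s + h2 s * f1 s)"
  unfolding ft set_integral_add(2)[OF it(1,2)] using II unfolding e1 e2 by (simp add: algebra_simps)
qed

lemma prim_cis: "prim \<tau> 1 (\<lambda>s. \<i> * of_real \<omega> * cis (s * \<omega>)) (\<lambda>s. cis (s * \<omega>))"
 unfolding prim_def
proof (intro conjI ballI)
 have c: "continuous_on A (\<lambda>s. \<i> * of_real \<omega> * cis (s * \<omega>))" for A
  by (intro continuous_intros continuous_on_cis)
 show "set_integrable lborel {0..\<tau>} (\<lambda>s. \<i> * of_real \<omega> * cis (s * \<omega>))"
  by (rule borel_integrable_atLeastAtMost'[OF c])
 fix t assume t: "t \<in> {0..\<tau>}"
 have cd: "((\<lambda>x. cis (x * \<omega>)) has_vector_derivative (\<i> * of_real \<omega> * cis (x * \<omega>))) (at x)" for x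
 proof -
  have "((\<lambda>z. exp (\<i> * z * of_real \<omega>)) has_field_derivative (\<i> * of_real \<omega> * exp (\<i> * of_real x * of_real \<omega>))) (at (of_real x))"
   by (auto intro!: derivative_eq_intros simp: mult_ac)
  from has_vector_derivative_real_field[OF this] show ?thesis
   by (simp add: comp_def cis_conv_exp mult_ac)
 qed
 have "(LINT s|lborel. indicator {0..t} s *\<^sub>R (\<i> * of_real \<omega> * cis (s * \<omega>))) = cis (t * \<omega>) - cis (0 * \<omega>)"
 proof (rule integral_FTC_Icc)
  show "0 \<le> t" using t by simp
  show "((\<lambda>s. cis (s * \<omega>)) has_vector_derivative \<i> * of_real \<omega> * cis (s * \<omega>)) (at s within {0..t})" for s
   by (rule has_vector_derivative_at_within[OF cd])
 qed (rule c)
 then show "cis (t * \<omega>) = 1 + (LINT s:{0..t}|lborel. \<i> * of_real \<omega> * cis (s * \<omega>))"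
  by (simp only: set_lebesgue_integral_def mult_zero_left cis_zero add_diff_eq add_diff_cancel_left')
qed

lemma set_integral_cmod_le:
 fixes h :: "real => complex"
 assumes b: "\<And>s. s \<in> {0..t} \<Longrightarrow> cmod (h s) \<le> r" and t: "0 \<le> t"
 shows "cmod (LINT s:{0..t}|lborel. h s) \<le> t * r"
proof (cases "set_integrable lborel {0..t} h")
 case True
 have ii: "integrable lborel (indicator {0..t} :: real => real)"
  by (rule integrable_real_indicator) (use t in auto)
 have r: "r \<ge> 0" using b[of 0] t by (auto intro: order_trans[OF norm_ge_zero])
 have "cmod (LINT s:{0..t}|lborel. h s) \<le> (LINT s:{0..t}|lborel. cmod (h s))"
  using integral_norm_bound[of lborel "\<lambda>s. indicator {0..t} s *\<^sub>R h s"] by (simp add: set_lebesgue_integral_def)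
 also have "... \<le> (LINT s:{0..t}|lborel. r)"
 proof (rule set_integral_mono)
  show "set_integrable lborel {0..t} (\<lambda>s. cmod (h s))" by (rule set_integrable_norm[OF True])
  show "set_integrable lborel {0..t} (\<lambda>s. r)" unfolding set_integrable_def by (rule integrable_scaleR_left[OF ii])
 qed (rule b)
 also have "... = t * r"
  unfolding set_lebesgue_integral_def using t by (subst Bochner_Integration.integral_scaleR_left[OF ii]) simp
 finally show ?thesis .
next
 case False
 have r: "r \<ge> 0" using b[of 0] t by (auto intro: order_trans[OF norm_ge_zero])
 show ?thesis using False r t by (simp add: set_lebesgue_integral_def set_integrable_def not_integrable_integral_eq)
qed

section \<open>Oscillatory integrals in time\<close>

lemma cmod_shift_ge: "\<kappa> > 0 \<Longrightarrow> (\<kappa> + \<bar>\<omega>\<bar>) / 2 \<le> cmod (of_real \<kappa> + \<i> * of_real \<omega>)"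
 using abs_Re_le_cmod[of "of_real \<kappa> + \<i> * of_real \<omega>"] abs_Im_le_cmod[of "of_real \<kappa> + \<i> * of_real \<omega>"] by simp

text \<open>Integration by parts expresses i omega I by boundary terms and an integral with one
  differentiated factor, hence w1 + w2 + w3. Adding kappa I to both sides, where |I| <= tau r1 r2 r3
  trivially, replaces i omega by kappa + i omega, of modulus at least (kappa + |omega|)/2. Small and
  large phases need no separate treatment.\<close>

lemma oscillatory_bound_real:
 assumes \<tau>: "0 < \<tau>" and \<kappa>: "\<kappa> > 0"
  and f: "prim \<tau> c1 h1 f1" "prim \<tau> c2 h2 f2" "prim \<tau> c3 h3 f3"
  and b: "\<And>s. s \<in> {0..\<tau>} \<Longrightarrow> cmod (f1 s) \<le> r1" "\<And>s. s \<in> {0..\<tau>} \<Longrightarrow> cmod (f2 s) \<le> r2" "\<And>s. s \<in> {0..\<tau>} \<Longrightarrow> cmod (f3 s) \<le> r3"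
  and w: "(LINT s:{0..\<tau>}|lborel. cmod (h1 s)) \<le> w1 * r1" "(LINT s:{0..\<tau>}|lborel. cmod (h2 s)) \<le> w2 * r2" "(LINT s:{0..\<tau>}|lborel. cmod (h3 s)) \<le> w3 * r3"
  and t: "t \<in> {0..\<tau>}"
 shows "cmod (LINT s:{0..t}|lborel. cis (s * \<omega>) * (f1 s * f2 s * f3 s)) \<le> 2 * (\<kappa> * \<tau> + 2 + (w1 + w2 + w3)) / (\<kappa> + \<bar>\<omega>\<bar>) * (r1 * r2 * r3)"
proof -
 have r: "r1 \<ge> 0" "r2 \<ge> 0" "r3 \<ge> 0" using b[of 0] \<tau> by (auto intro: order_trans[OF norm_ge_zero])
 let ?F = "\<lambda>s. f1 s * f2 s * f3 s"
 let ?H = "\<lambda>s. (h1 s * f2 s + h2 s * f1 s) * f3 s + h3 s * (f1 s * f2 s)"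
 have pF: "prim \<tau> (c1 * c2 * c3) ?H ?F" by (rule prim_mult[OF prim_mult[OF f(1,2)] f(3)])
 have pE: "prim \<tau> (1 * (c1 * c2 * c3)) (\<lambda>s. \<i> * of_real \<omega> * cis (s * \<omega>) * ?F s + ?H s * cis (s * \<omega>)) (\<lambda>s. cis (s * \<omega>) * ?F s)"
  by (rule prim_mult[OF prim_cis pF])
 have Fb: "cmod (?F s) \<le> r1 * r2 * r3" if "s \<in> {0..\<tau>}" for s
  unfolding norm_mult using b that r by (intro mult_mono) auto
 have hi: "set_integrable lborel {0..\<tau>} h1" "set_integrable lborel {0..\<tau>} h2" "set_integrable lborel {0..\<tau>} h3" using f by (auto simp: prim_def)
 have Hi: "set_integrable lborel {0..\<tau>} ?H" using pF by (simp add: prim_def)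
 define I where "I = (LINT s:{0..t}|lborel. cis (s * \<omega>) * ?F s)"
 have cF: "set_integrable lborel {0..\<tau>} (\<lambda>s. cis (s * \<omega>) * ?F s)"
  by (rule set_integrable_mult_prim[OF _ pF]) (auto intro!: borel_integrable_atLeastAtMost' continuous_intros continuous_on_cis)
 have Hc: "set_integrable lborel {0..\<tau>} (\<lambda>s. ?H s * cis (s * \<omega>))"
  by (rule set_integrable_mult_prim[OF Hi prim_cis])
 have sub: "set_integrable lborel {0..t} q" if "set_integrable lborel {0..\<tau>} q" for q :: "real => complex"
  using that t by (auto intro: set_integrable_subset)
 have IH: "cmod (LINT s:{0..t}|lborel. ?H s * cis (s * \<omega>)) \<le> (w1 + w2 + w3) * (r1 * r2 * r3)"
 proof -
  have "cmod (LINT s:{0..t}|lborel. ?H s * cis (s * \<omega>)) \<le> (LINT s:{0..\<tau>}|lborel. cmod (?H s * cis (s * \<omega>)))"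
   by (rule set_integral_norm_le[OF Hc]) (use t in simp)
  also have "... \<le> (LINT s:{0..\<tau>}|lborel. cmod (h1 s) * (r2 * r3) + cmod (h2 s) * (r1 * r3) + cmod (h3 s) * (r1 * r2))"
  proof (rule set_integral_mono)
   show "set_integrable lborel {0..\<tau>} (\<lambda>s. cmod (?H s * cis (s * \<omega>)))" by (rule set_integrable_norm[OF Hc])
   show "set_integrable lborel {0..\<tau>} (\<lambda>s. cmod (h1 s) * (r2 * r3) + cmod (h2 s) * (r1 * r3) + cmod (h3 s) * (r1 * r2))"
    by (intro set_integral_add(1) set_integrable_mult_left set_integrable_norm hi impI)
   fix s assume s: "s \<in> {0..\<tau>}"
   have "cmod (?H s * cis (s * \<omega>)) \<le> cmod ((h1 s * f2 s + h2 s * f1 s) * f3 s) + cmod (h3 s * (f1 s * f2 s))"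
    unfolding norm_mult[of "?H s"] norm_cis mult_1_right by (rule norm_triangle_ineq)
   also have "cmod ((h1 s * f2 s + h2 s * f1 s) * f3 s) \<le> (cmod (h1 s * f2 s) + cmod (h2 s * f1 s)) * cmod (f3 s)"
    unfolding norm_mult[of "h1 s * f2 s + h2 s * f1 s"] by (intro mult_right_mono norm_triangle_ineq) auto
   also have "... = cmod (h1 s) * (cmod (f2 s) * cmod (f3 s)) + cmod (h2 s) * (cmod (f1 s) * cmod (f3 s))"
    by (simp add: norm_mult algebra_simps)
   also have "cmod (h3 s * (f1 s * f2 s)) = cmod (h3 s) * (cmod (f1 s) * cmod (f2 s))" by (simp add: norm_mult)
   finally have "cmod (?H s * cis (s * \<omega>)) \<le> cmod (h1 s) * (cmod (f2 s) * cmod (f3 s)) + cmod (h2 s) * (cmod (f1 s) * cmod (f3 s)) + cmod (h3 s) * (cmod (f1 s) * cmod (f2 s))"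
    by simp
   also have "... \<le> cmod (h1 s) * (r2 * r3) + cmod (h2 s) * (r1 * r3) + cmod (h3 s) * (r1 * r2)"
    using b s r by (intro add_mono mult_left_mono mult_mono) auto
   finally show "cmod (?H s * cis (s * \<omega>)) \<le> cmod (h1 s) * (r2 * r3) + cmod (h2 s) * (r1 * r3) + cmod (h3 s) * (r1 * r2)" .
  qed
  also have "... = (LINT s:{0..\<tau>}|lborel. cmod (h1 s)) * (r2 * r3) + (LINT s:{0..\<tau>}|lborel. cmod (h2 s)) * (r1 * r3) + (LINT s:{0..\<tau>}|lborel. cmod (h3 s)) * (r1 * r2)"
  proof -
   have m: "set_integrable lborel {0..\<tau>} (\<lambda>s. cmod (h1 s) * (r2 * r3))" "set_integrable lborel {0..\<tau>} (\<lambda>s. cmod (h2 s) * (r1 * r3))" "set_integrable lborel {0..\<tau>} (\<lambda>s. cmod (h3 s) * (r1 * r2))"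
    by (intro set_integrable_mult_left set_integrable_norm hi impI)+
   show ?thesis unfolding set_integral_add(2)[OF set_integral_add(1)[OF m(1,2)] m(3)] set_integral_add(2)[OF m(1,2)] by simp
  qed
  also have "... \<le> (w1 * r1) * (r2 * r3) + (w2 * r2) * (r1 * r3) + (w3 * r3) * (r1 * r2)"
   using w r by (intro add_mono mult_right_mono) auto
  finally show ?thesis by (simp add: algebra_simps)
 qed
 have "cis (t * \<omega>) * ?F t = c1 * c2 * c3 + ((LINT s:{0..t}|lborel. \<i> * of_real \<omega> * cis (s * \<omega>) * ?F s) + (LINT s:{0..t}|lborel. ?H s * cis (s * \<omega>)))"
 proof -
  have "set_integrable lborel {0..t} (\<lambda>s. \<i> * of_real \<omega> * (cis (s * \<omega>) * ?F s))"
   by (intro set_integrable_mult_right sub cF)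
  then have "set_integrable lborel {0..t} (\<lambda>s. \<i> * of_real \<omega> * cis (s * \<omega>) * ?F s)" by (simp only: mult.assoc)
  from set_integral_add(2)[OF this sub[OF Hc]] show ?thesis using pE t unfolding prim_def by auto
 qed
 also have "(LINT s:{0..t}|lborel. \<i> * of_real \<omega> * cis (s * \<omega>) * ?F s) = \<i> * of_real \<omega> * I"
  unfolding I_def by (simp only: mult.assoc[of "\<i> * of_real \<omega>"] set_integral_mult_right)
 finally have key: "(of_real \<kappa> + \<i> * of_real \<omega>) * I = of_real \<kappa> * I + (cis (t * \<omega>) * ?F t - c1 * c2 * c3 - (LINT s:{0..t}|lborel. ?H s * cis (s * \<omega>)))"
  by (simp add: algebra_simps)
 have I1: "cmod I \<le> \<tau> * (r1 * r2 * r3)"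
 proof -
  have "cmod I \<le> t * (r1 * r2 * r3)" unfolding I_def
   by (rule set_integral_cmod_le) (use t Fb in \<open>auto simp: norm_mult\<close>)
  also have "... \<le> \<tau> * (r1 * r2 * r3)" using t r by (intro mult_right_mono) auto
  finally show ?thesis .
 qed
 have F0: "cmod (c1 * c2 * c3) \<le> r1 * r2 * r3" using Fb[of 0] prim_0[OF pF] \<tau> by simp
 have Ft: "cmod (cis (t * \<omega>) * ?F t) \<le> r1 * r2 * r3" using Fb[OF t] by (simp add: norm_mult)
 have "(\<kappa> + \<bar>\<omega>\<bar>) / 2 * cmod I \<le> cmod ((of_real \<kappa> + \<i> * of_real \<omega>) * I)"
  unfolding norm_mult[of _ I] by (intro mult_right_mono cmod_shift_ge \<kappa>) auto
 also have "... \<le> cmod (of_real \<kappa> * I) + (cmod (cis (t * \<omega>) * ?F t) + cmod (c1 * c2 * c3) + cmod (LINT s:{0..t}|lborel. ?H s * cis (s * \<omega>)))"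
  unfolding key by (intro order_trans[OF norm_triangle_ineq] add_mono order_refl order_trans[OF norm_triangle_ineq4])
 also have "... \<le> \<kappa> * (\<tau> * (r1 * r2 * r3)) + (r1 * r2 * r3 + r1 * r2 * r3 + (w1 + w2 + w3) * (r1 * r2 * r3))"
 proof (intro add_mono F0 Ft IH)
  show "cmod (of_real \<kappa> * I) \<le> \<kappa> * (\<tau> * (r1 * r2 * r3))" using I1 \<kappa> by (simp add: norm_mult)
 qed
 also have "... = (\<kappa> * \<tau> + 2 + (w1 + w2 + w3)) * (r1 * r2 * r3)" by (simp add: algebra_simps)
 finally have "(\<kappa> + \<bar>\<omega>\<bar>) / 2 * cmod I \<le> (\<kappa> * \<tau> + 2 + (w1 + w2 + w3)) * (r1 * r2 * r3)" .
 then have "(\<kappa> + \<bar>\<omega>\<bar>) * cmod I \<le> 2 * ((\<kappa> * \<tau> + 2 + (w1 + w2 + w3)) * (r1 * r2 * r3))" by linarith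
 moreover have "\<kappa> + \<bar>\<omega>\<bar> > 0" using \<kappa> by simp
 ultimately have "cmod I \<le> 2 * ((\<kappa> * \<tau> + 2 + (w1 + w2 + w3)) * (r1 * r2 * r3)) / (\<kappa> + \<bar>\<omega>\<bar>)"
  by (simp add: pos_le_divide_eq mult.commute)
 then show ?thesis unfolding I_def by (simp only: mult.assoc times_divide_eq_left)
qed

text \<open>Extended majorants with 0 times infinity equal to 0 need care: an infinite product makes
  the claim trivial, a zero majorant makes the integrand vanish, and otherwise all three are finite
  and the real version applies.\<close>

lemma oscillatory_bound:
 assumes \<tau>: "0 < \<tau>" and \<kappa>: "\<kappa> > 0" and w0: "w1 \<ge> 0" "w2 \<ge> 0" "w3 \<ge> 0"
  and f: "prim \<tau> c1 h1 f1" "prim \<tau> c2 h2 f2" "prim \<tau> c3 h3 f3"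
  and b: "\<And>s. s \<in> {0..\<tau>} \<Longrightarrow> ennreal (cmod (f1 s)) \<le> u1" "\<And>s. s \<in> {0..\<tau>} \<Longrightarrow> ennreal (cmod (f2 s)) \<le> u2" "\<And>s. s \<in> {0..\<tau>} \<Longrightarrow> ennreal (cmod (f3 s)) \<le> u3"
  and w: "(tnorm \<tau> (\<lambda>s. h1 s)) \<le> ennreal w1 * u1"
   "(tnorm \<tau> (\<lambda>s. h2 s)) \<le> ennreal w2 * u2"
   "(tnorm \<tau> (\<lambda>s. h3 s)) \<le> ennreal w3 * u3"
  and t: "t \<in> {0..\<tau>}"
 shows "ennreal (cmod (LINT s:{0..t}|lborel. cis (s * \<omega>) * (f1 s * f2 s * f3 s))) \<le> ennreal (2 * (\<kappa> * \<tau> + 2 + (w1 + w2 + w3)) / (\<kappa> + \<bar>\<omega>\<bar>)) * (u1 * u2 * u3)"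
proof -
 let ?co = "2 * (\<kappa> * \<tau> + 2 + (w1 + w2 + w3)) / (\<kappa> + \<bar>\<omega>\<bar>)"
 have "\<kappa> * \<tau> > 0" using \<tau> \<kappa> by simp
 then have "\<kappa> * \<tau> + 2 + (w1 + w2 + w3) > 0" using w0 by linarith
 then have co: "?co > 0" using \<kappa> by (intro divide_pos_pos mult_pos_pos) auto
 consider "u1 * u2 * u3 = \<top>" | "u1 = 0 \<or> u2 = 0 \<or> u3 = 0" | "u1 \<noteq> \<top>" "u2 \<noteq> \<top>" "u3 \<noteq> \<top>"
  by (metis ennreal_top_mult ennreal_mult_top mult_eq_0_iff)
 then show ?thesis
 proof cases
  case 1
  moreover have et: "ennreal r * \<top> = \<top>" if "r > 0" for r using that by (simp add: ennreal_mult_top)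
  ultimately show ?thesis using et[OF co] by (simp only: top_greatest)
 next
  case 2
  have "f1 s * f2 s * f3 s = 0" if "s \<in> {0..t}" for s
   using 2 b[of s] that t by auto
  then have "(LINT s:{0..t}|lborel. cis (s * \<omega>) * (f1 s * f2 s * f3 s)) = (LINT s:{0..t}|lborel. 0)"
   unfolding set_lebesgue_integral_def by (intro Bochner_Integration.integral_cong refl) (auto simp: indicator_def)
  then show ?thesis by (simp add: set_lebesgue_integral_def)
 next
  case 3
  then obtain r1 r2 r3 where r: "r1 \<ge> 0" "u1 = ennreal r1" "r2 \<ge> 0" "u2 = ennreal r2" "r3 \<ge> 0" "u3 = ennreal r3"
   by (metis ennreal_cases)
  have conv: "(LINT s:{0..\<tau>}|lborel. cmod (h s)) \<le> v * r"
   if "set_integrable lborel {0..\<tau>} h" "(tnorm \<tau> h) \<le> ennreal v * ennreal r" "v \<ge> 0" "r \<ge> 0"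
   for h :: "real => complex" and v r
  proof -
   have i: "integrable lborel (\<lambda>s. indicator {0..\<tau>} s *\<^sub>R cmod (h s))"
    using set_integrable_norm[OF that(1)] by (simp add: set_integrable_def)
   have "ennreal (LINT s:{0..\<tau>}|lborel. cmod (h s)) = (NN s. ennreal (indicator {0..\<tau>} s *\<^sub>R cmod (h s)))"
    unfolding set_lebesgue_integral_def using i by (intro nn_integral_eq_integral[symmetric]) auto
   also have "... = (tnorm \<tau> h)"
    by (intro nn_integral_cong) (auto simp: indicator_def)
   also have "... \<le> ennreal (v * r)" using that by (simp add: ennreal_mult)
   finally show ?thesis using that(3,4) by (subst (asm) ennreal_le_iff) auto
  qed
  have hi: "set_integrable lborel {0..\<tau>} h1" "set_integrable lborel {0..\<tau>} h2" "set_integrable lborel {0..\<tau>} h3"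
   using f by (auto simp: prim_def)
  have bb: "cmod (f1 s) \<le> r1" "cmod (f2 s) \<le> r2" "cmod (f3 s) \<le> r3" if "s \<in> {0..\<tau>}" for s
   using b[OF that] r by auto
  have "cmod (LINT s:{0..t}|lborel. cis (s * \<omega>) * (f1 s * f2 s * f3 s)) \<le> ?co * (r1 * r2 * r3)"
   using w unfolding r(2,4,6)
   by (intro oscillatory_bound_real[OF \<tau> \<kappa> f] bb t conv hi w0 r) auto
  then have "ennreal (cmod (LINT s:{0..t}|lborel. cis (s * \<omega>) * (f1 s * f2 s * f3 s))) \<le> ennreal (?co * (r1 * r2 * r3))"
   by (rule ennreal_leI)
  also have "... = ennreal ?co * (ennreal r1 * ennreal r2 * ennreal r3)"
  proof -
   have "ennreal (?co * (r1 * r2 * r3)) = ennreal ?co * ennreal (r1 * r2 * r3)"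
    by (rule ennreal_mult) (use co r in auto)
   also have "ennreal (r1 * r2 * r3) = ennreal r1 * ennreal r2 * ennreal r3"
    using r by (simp add: ennreal_mult)
   finally show ?thesis .
  qed
  finally show ?thesis unfolding r(2,4,6) .
 qed
qed

section \<open>Dominated paths and trilinear operators\<close>

definition pth :: "(real => complex) => path => path" where
 "pth v0 g t xi = v0 xi + (LINT s:{0..t}|lborel. g s xi)"

text \<open>Integrability in time is demanded at every frequency, not almost every, so that
  \<open>pth\<close> is meaningful everywhere; \<open>cutg\<close> restores it where it
  fails.\<close>

definition good :: "real => (real => complex) => path => bool" where
 "good \<tau> v0 g \<longleftrightarrow> v0 \<in> bm \<and> joint g
   \<and> (\<forall>xi. set_integrable lborel {0..\<tau>} (\<lambda>s. g s xi))"

text \<open>\<open>pth v0 g\<close> is the path with initial value \<open>v0\<close> and time derivative \<open>g\<close>.\<close>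

definition dom :: "real => (real => complex) => path => (real => ennreal) => bool" where
 "dom \<tau> v0 g U \<longleftrightarrow> good \<tau> v0 g \<and> U \<in> bm
   \<and> (\<forall>xi. \<forall>t\<in>{0..\<tau>}. ennreal (cmod (pth v0 g t xi)) \<le> U xi)
   \<and> (\<forall>xi. (tnorm \<tau> (\<lambda>s. g s xi)) \<le> ennreal (W xi) * U xi)"

lemma good_prim: "good \<tau> v0 g \<Longrightarrow> prim \<tau> (v0 xi) (\<lambda>s. g s xi) (\<lambda>s. pth v0 g s xi)"
 by (auto simp: good_def prim_def pth_def)

lemma compose2_measurable:
 assumes "joint q"
  and "f \<in> borel_measurable M" "g \<in> borel_measurable M"
 shows "(\<lambda>w. q (f w) (g w)) \<in> borel_measurable M"
 using measurable_compose[OF measurable_Pair[OF assms(2,3)] assms(1)] by simp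

lemma compose3_measurable:
 assumes "(\<lambda>(a, b, c). q a b c) \<in> borel_measurable (borel \<Otimes>\<^sub>M borel \<Otimes>\<^sub>M borel)"
  and "f \<in> borel_measurable M" "g \<in> borel_measurable M" "h \<in> borel_measurable M"
 shows "(\<lambda>w. q (f w) (g w) (h w)) \<in> borel_measurable M"
 using measurable_compose[OF measurable_Pair[OF assms(2) measurable_Pair[OF assms(3,4)]] assms(1)] by simp

lemma pth_measurable:
 assumes g: "good \<tau> v0 g"
 shows "joint (pth v0 g)"
proof -
 have m: "joint g" and [measurable]: "v0 \<in> bm"
  using g by (auto simp: good_def)
 note [measurable (raw)] = compose2_measurable[OF m]
 have eq: "pth v0 g (fst z) (snd z) = v0 (snd z) + (LINT s|lborel. (if 0 \<le> s \<and> s \<le> fst z then g s (snd z) else 0))" for z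
  unfolding pth_def set_lebesgue_integral_def
  by (intro arg_cong2[where f="(+)"] refl Bochner_Integration.integral_cong) (auto simp: indicator_def)
 have [measurable]: "(\<lambda>(z, s). if 0 \<le> s \<and> s \<le> fst z then g s (snd z) else 0) \<in> borel_measurable ((borel \<Otimes>\<^sub>M borel) \<Otimes>\<^sub>M lborel)"
  unfolding split_beta by measurable
 show ?thesis unfolding eq by measurable
qed

abbreviation P2 :: "(real \<times> real) measure" where "P2 \<equiv> lborel \<Otimes>\<^sub>M lborel"

lemmas P2_sf = lborel_pair.sigma_finite_measure_axioms

interpretation lP2: pair_sigma_finite lborel P2
 by (intro pair_sigma_finite.intro sigma_finite_lborel P2_sf)

text \<open>One format for both nonlinear terms. \<open>H1\<close> is the change of variables from
  (xi, x, y) to the three interacting frequencies, \<open>KB\<close> the kernel bound;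
  \<open>T_norm\<close> rests on these two.\<close>

locale trilinear =
 fixes k Om p1 p2 p3 :: "real => real => real => real" and C :: real
 assumes meas: "(\<lambda>(a, b, c). k a b c) \<in> borel_measurable (borel \<Otimes>\<^sub>M borel \<Otimes>\<^sub>M borel)"
   "(\<lambda>(a, b, c). Om a b c) \<in> borel_measurable (borel \<Otimes>\<^sub>M borel \<Otimes>\<^sub>M borel)"
   "(\<lambda>(a, b, c). p1 a b c) \<in> borel_measurable (borel \<Otimes>\<^sub>M borel \<Otimes>\<^sub>M borel)"
   "(\<lambda>(a, b, c). p2 a b c) \<in> borel_measurable (borel \<Otimes>\<^sub>M borel \<Otimes>\<^sub>M borel)"
   "(\<lambda>(a, b, c). p3 a b c) \<in> borel_measurable (borel \<Otimes>\<^sub>M borel \<Otimes>\<^sub>M borel)"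
  and H1: "\<And>F1 F2 F3 :: real => ennreal. F1 \<in> bm \<Longrightarrow> F2 \<in> bm \<Longrightarrow> F3 \<in> bm \<Longrightarrow>
    (NN xi. NN x. NN y. F1 (p1 xi x y) * F2 (p2 xi x y) * F3 (p3 xi x y))
     \<le> (NN x. F1 x) * (NN x. F2 x) * (NN x. F3 x)"
  and C0: "C \<ge> 0"
  and KB: "\<And>\<tau> xi. 0 < \<tau> \<Longrightarrow> \<tau> \<le> 1 \<Longrightarrow>
    (NN x. NN y. ennreal ((ker \<tau> xi (k xi x y) (Om xi x y) (p1 xi x y) (p2 xi x y) (p3 xi x y))\<^sup>2)) \<le> ennreal (C * sqrt \<tau>)"
begin

lemmas raw [measurable (raw)] = meas[THEN compose3_measurable]

definition K :: "real => real => real \<times> real => real" where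
 "K \<tau> xi z = ker \<tau> xi (k xi (fst z) (snd z)) (Om xi (fst z) (snd z)) (p1 xi (fst z) (snd z)) (p2 xi (fst z) (snd z)) (p3 xi (fst z) (snd z))"

text \<open>A positive majorant of \<open>N\<close>: it will dominate the time integral of
  \<open>N\<close> over every [0,t], and W times it will dominate the time integral of |N|.\<close>

definition T :: "real => (real => ennreal) => (real => ennreal) => (real => ennreal) => real => ennreal" where
 "T \<tau> U1 U2 U3 xi = (\<integral>\<^sup>+z. ennreal (K \<tau> xi z) * (U1 (p1 xi (fst z) (snd z)) * U2 (p2 xi (fst z) (snd z)) * U3 (p3 xi (fst z) (snd z))) \<partial>P2)"

definition N :: "path => path => path => path" where
 "N v1 v2 v3 s xi = (LINT z|P2. of_real (k xi (fst z) (snd z)) * (cis (s * Om xi (fst z) (snd z)) *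
   (v1 s (p1 xi (fst z) (snd z)) * v2 s (p2 xi (fst z) (snd z)) * v3 s (p3 xi (fst z) (snd z)))))"

lemma K_measurable [measurable]: "(\<lambda>w. K \<tau> (fst w) (snd w)) \<in> borel_measurable (borel \<Otimes>\<^sub>M P2)"
 unfolding K_def ker_def by measurable

lemma T_measurable [measurable]:
 assumes [measurable]: "U1 \<in> bm" "U2 \<in> bm" "U3 \<in> bm"
 shows "T \<tau> U1 U2 U3 \<in> bm"
 unfolding T_def K_def ker_def by measurable

text \<open>Cauchy-Schwarz at fixed xi separates the kernel, bounded uniformly in xi by
  \<open>KB\<close>, from the product of majorants. \<open>H1\<close> then factors the integral of
  the squares.\<close>

lemma T_norm:
 assumes \<tau>: "0 < \<tau>" "\<tau> \<le> 1" and [measurable]: "U1 \<in> bm" "U2 \<in> bm" "U3 \<in> bm"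
 shows "(NN xi. (T \<tau> U1 U2 U3 xi)\<^sup>2) \<le> ennreal (C * sqrt \<tau>) *
  ((sqn U1) * (sqn U2) * (sqn U3))"
proof -
 let ?G = "\<lambda>xi z. (U1 (p1 xi (fst z) (snd z)))\<^sup>2 * (U2 (p2 xi (fst z) (snd z)))\<^sup>2 * (U3 (p3 xi (fst z) (snd z)))\<^sup>2"
 have "(T \<tau> U1 U2 U3 xi)\<^sup>2 \<le> ennreal (C * sqrt \<tau>) * (\<integral>\<^sup>+z. ?G xi z \<partial>P2)" for xi
 proof -
  have "(T \<tau> U1 U2 U3 xi)\<^sup>2 \<le> (\<integral>\<^sup>+z. (ennreal (K \<tau> xi z))\<^sup>2 \<partial>P2) *
    (\<integral>\<^sup>+z. (U1 (p1 xi (fst z) (snd z)) * U2 (p2 xi (fst z) (snd z)) * U3 (p3 xi (fst z) (snd z)))\<^sup>2 \<partial>P2)"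
   unfolding T_def by (rule Cauchy_Schwarz_nn_integral) (unfold K_def ker_def, measurable)
  also have "(\<integral>\<^sup>+z. (U1 (p1 xi (fst z) (snd z)) * U2 (p2 xi (fst z) (snd z)) * U3 (p3 xi (fst z) (snd z)))\<^sup>2 \<partial>P2) = (\<integral>\<^sup>+z. ?G xi z \<partial>P2)"
   by (simp only: power_mult_distrib)
  also have "(\<integral>\<^sup>+z. (ennreal (K \<tau> xi z))\<^sup>2 \<partial>P2) \<le> ennreal (C * sqrt \<tau>)"
  proof -
   have Kp: "0 \<le> K \<tau> xi z" for z
    unfolding K_def ker_def using \<tau> W_pos less_imp_le[OF W_pos]
    by (intro mult_nonneg_nonneg add_nonneg_nonneg divide_nonneg_nonneg) auto
   have "(\<integral>\<^sup>+z. (ennreal (K \<tau> xi z))\<^sup>2 \<partial>P2) = (\<integral>\<^sup>+z. ennreal ((K \<tau> xi z)\<^sup>2) \<partial>P2)"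
    by (intro nn_integral_cong ennreal_power Kp)
   also have "... = (NN x. NN y. ennreal ((K \<tau> xi (x, y))\<^sup>2))"
    by (rule lborel.nn_integral_fst[symmetric]) (unfold K_def ker_def, measurable)
   also have "... \<le> ennreal (C * sqrt \<tau>)" unfolding K_def fst_conv snd_conv by (rule KB[OF \<tau>])
   finally show ?thesis .
  qed
  finally show ?thesis by (simp add: mult_right_mono)
 qed
 then have "(NN xi. (T \<tau> U1 U2 U3 xi)\<^sup>2) \<le> (NN xi. ennreal (C * sqrt \<tau>) * (\<integral>\<^sup>+z. ?G xi z \<partial>P2))"
  by (intro nn_integral_mono)
 also have "... = ennreal (C * sqrt \<tau>) * (NN xi. (\<integral>\<^sup>+z. ?G xi z \<partial>P2))"
  by (rule nn_integral_cmult) measurable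
 also have "(NN xi. (\<integral>\<^sup>+z. ?G xi z \<partial>P2)) = (NN xi. NN x. NN y. (U1 (p1 xi x y))\<^sup>2 * (U2 (p2 xi x y))\<^sup>2 * (U3 (p3 xi x y))\<^sup>2)"
 proof (intro nn_integral_cong)
  fix xi
  have "(\<lambda>z. ?G xi z) \<in> borel_measurable P2" by measurable
  from lborel.nn_integral_fst[OF this] show "(\<integral>\<^sup>+z. ?G xi z \<partial>P2) = (NN x. NN y. (U1 (p1 xi x y))\<^sup>2 * (U2 (p2 xi x y))\<^sup>2 * (U3 (p3 xi x y))\<^sup>2)"
   by simp
 qed
 also have "... \<le> (sqn U1) * (sqn U2) * (sqn U3)"
  by (rule H1) measurable
 finally show ?thesis by (simp add: mult_left_mono)
qed

context
 fixes \<tau> :: real and v1 v2 v3 :: "real => complex" and g1 g2 g3 :: "path" and U1 U2 U3 :: "real => ennreal"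
 assumes \<tau>: "0 < \<tau>" "\<tau> \<le> 1" and d: "dom \<tau> v1 g1 U1" "dom \<tau> v2 g2 U2" "dom \<tau> v3 g3 U3"
begin

definition G :: "real => real => real \<times> real => complex" where
 "G xi s z = of_real (k xi (fst z) (snd z)) * (cis (s * Om xi (fst z) (snd z)) *
   (pth v1 g1 s (p1 xi (fst z) (snd z)) * pth v2 g2 s (p2 xi (fst z) (snd z)) * pth v3 g3 s (p3 xi (fst z) (snd z))))"

definition Q :: "real => real \<times> real => ennreal" where
 "Q xi z = U1 (p1 xi (fst z) (snd z)) * U2 (p2 xi (fst z) (snd z)) * U3 (p3 xi (fst z) (snd z))"

lemma G_measurable: "(\<lambda>w. G (fst w) (fst (snd w)) (snd (snd w))) \<in> borel_measurable (borel \<Otimes>\<^sub>M borel \<Otimes>\<^sub>M P2)"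
proof -
 have m: "joint (pth v1 g1)"
  "joint (pth v2 g2)"
  "joint (pth v3 g3)"
  using d by (auto simp: dom_def intro: pth_measurable)
 note [measurable (raw)] = m[THEN compose2_measurable]
 show ?thesis unfolding G_def by measurable
qed

lemma Q_measurable: "(\<lambda>w. Q (fst w) (snd w)) \<in> borel_measurable (borel \<Otimes>\<^sub>M P2)"
proof -
 have [measurable]: "U1 \<in> bm" "U2 \<in> bm" "U3 \<in> bm"
  using d by (auto simp: dom_def)
 show ?thesis unfolding Q_def by measurable
qed

lemma N_eq_G: "N (pth v1 g1) (pth v2 g2) (pth v3 g3) s xi = (LINT z|P2. G xi s z)"
 by (simp add: N_def G_def)

lemma N_measurable: "joint (N (pth v1 g1) (pth v2 g2) (pth v3 g3))"
proof -
 have m: "(\<lambda>(z, w). G (snd z) (fst z) w) \<in> borel_measurable ((borel \<Otimes>\<^sub>M borel) \<Otimes>\<^sub>M P2)"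
  using measurable_compose[OF _ G_measurable, of "\<lambda>u. (snd (fst u), fst (fst u), snd u)" "(borel \<Otimes>\<^sub>M borel) \<Otimes>\<^sub>M P2"]
  by (simp add: split_beta)
 show ?thesis unfolding N_eq_G by (rule sigma_finite_measure.borel_measurable_lebesgue_integral[OF P2_sf m])
qed

lemma G_bound:
 assumes s: "s \<in> {0..\<tau>}"
 shows "ennreal (cmod (G xi s z)) \<le> ennreal \<bar>k xi (fst z) (snd z)\<bar> * Q xi z"
proof -
 have "ennreal (cmod (G xi s z)) = ennreal \<bar>k xi (fst z) (snd z)\<bar> * (ennreal (cmod (pth v1 g1 s (p1 xi (fst z) (snd z))))
   * ennreal (cmod (pth v2 g2 s (p2 xi (fst z) (snd z)))) * ennreal (cmod (pth v3 g3 s (p3 xi (fst z) (snd z)))))"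
  by (simp add: G_def norm_mult ennreal_mult)
 also have "... \<le> ennreal \<bar>k xi (fst z) (snd z)\<bar> * Q xi z"
  unfolding Q_def using d s by (intro mult_left_mono mult_mono) (auto simp: dom_def)
 finally show ?thesis .
qed

text \<open>The summand \<open>\<tau> / W xi\<close> of \<open>ker\<close> alone gives this.\<close>

lemma k_le_K: "\<bar>k xi (fst z) (snd z)\<bar> \<le> W xi / \<tau> * K \<tau> xi z"
proof -
 have "\<bar>k xi (fst z) (snd z)\<bar> * (\<tau> / W xi) \<le> K \<tau> xi z"
  unfolding K_def ker_def using \<tau> less_imp_le[OF W_pos] by (intro mult_left_mono) (auto intro!: divide_nonneg_nonneg add_nonneg_nonneg)
 then show ?thesis using \<tau> W_pos[of xi] by (simp add: field_simps)
qed

lemma T_eq: "T \<tau> U1 U2 U3 xi = (\<integral>\<^sup>+z. ennreal (K \<tau> xi z) * Q xi z \<partial>P2)"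
 by (simp add: T_def Q_def)

lemma kQ_le: "(\<integral>\<^sup>+z. ennreal \<bar>k xi (fst z) (snd z)\<bar> * Q xi z \<partial>P2) \<le> ennreal (W xi / \<tau>) * T \<tau> U1 U2 U3 xi"
proof -
 have [measurable]: "Q xi \<in> borel_measurable P2"
  using measurable_compose[OF _ Q_measurable, of "\<lambda>z. (xi, z)" P2] by simp
 have [measurable]: "K \<tau> xi \<in> borel_measurable P2"
  using measurable_compose[OF _ K_measurable, of "\<lambda>z. (xi, z)" P2] by simp
 have "(\<integral>\<^sup>+z. ennreal \<bar>k xi (fst z) (snd z)\<bar> * Q xi z \<partial>P2) \<le> (\<integral>\<^sup>+z. ennreal (W xi / \<tau>) * (ennreal (K \<tau> xi z) * Q xi z) \<partial>P2)"
 proof (rule nn_integral_mono)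
  fix z
  have "ennreal \<bar>k xi (fst z) (snd z)\<bar> \<le> ennreal (W xi / \<tau> * K \<tau> xi z)" by (intro ennreal_leI k_le_K)
  also have "... = ennreal (W xi / \<tau>) * ennreal (K \<tau> xi z)" using \<tau> less_imp_le[OF W_pos[of xi]] by (intro ennreal_mult') auto
  finally show "ennreal \<bar>k xi (fst z) (snd z)\<bar> * Q xi z \<le> ennreal (W xi / \<tau>) * (ennreal (K \<tau> xi z) * Q xi z)"
   unfolding mult.assoc[symmetric] by (rule mult_right_mono) simp
 qed
 also have "... = ennreal (W xi / \<tau>) * T \<tau> U1 U2 U3 xi" unfolding T_eq by (rule nn_integral_cmult) measurable
 finally show ?thesis .
qed

context
 fixes xi :: real
 assumes fin: "T \<tau> U1 U2 U3 xi < \<infinity>"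
begin

lemma kQ_fin: "(\<integral>\<^sup>+z. ennreal \<bar>k xi (fst z) (snd z)\<bar> * Q xi z \<partial>P2) < \<infinity>"
 using kQ_le[of xi] fin by (auto intro: le_less_trans simp: ennreal_mult_less_top)

lemma N_integrable:
 assumes s: "s \<in> {0..\<tau>}" shows "integrable P2 (G xi s)"
proof (rule integrableI_bounded)
 show "G xi s \<in> borel_measurable P2"
  using measurable_compose[OF _ G_measurable, of "\<lambda>z. (xi, s, z)" P2] by simp
 show "(\<integral>\<^sup>+z. ennreal (norm (G xi s z)) \<partial>P2) < \<infinity>"
  by (rule le_less_trans[OF nn_integral_mono[OF G_bound[OF s]] kQ_fin])
qed

text \<open>The factor 1/tau lost in \<open>kQ_le\<close> is regained from the length of the time
  interval, which leaves exactly the weight that \<open>dom\<close> allows.\<close>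

lemma G_joint_integrable:
 assumes t: "t \<in> {0..\<tau>}"
 shows "integrable (lborel \<Otimes>\<^sub>M P2) (\<lambda>(s, z). indicator {0..t} s *\<^sub>R G xi s z)"
  and "(NN s. (\<integral>\<^sup>+z. ennreal (cmod (G xi s z)) \<partial>P2) * indicator {0..t} s) \<le> ennreal (W xi) * T \<tau> U1 U2 U3 xi"
proof -
 have m: "(\<lambda>(s, z). indicator {0..t} s *\<^sub>R G xi s z) \<in> borel_measurable (lborel \<Otimes>\<^sub>M P2)"
 proof -
  have "(\<lambda>w. G xi (fst w) (snd w)) \<in> borel_measurable (lborel \<Otimes>\<^sub>M P2)"
   using measurable_compose[OF _ G_measurable, of "\<lambda>w. (xi, fst w, snd w)" "lborel \<Otimes>\<^sub>M P2"] by simp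
  then show ?thesis unfolding split_beta by measurable
 qed
 have "(NN s. (\<integral>\<^sup>+z. ennreal (cmod (G xi s z)) \<partial>P2) * indicator {0..t} s)
   \<le> (NN s. ennreal (W xi / \<tau>) * T \<tau> U1 U2 U3 xi * indicator {0..t} s)"
 proof (rule nn_integral_mono)
  fix s
  have "(\<integral>\<^sup>+z. ennreal (cmod (G xi s z)) \<partial>P2) \<le> ennreal (W xi / \<tau>) * T \<tau> U1 U2 U3 xi" if "s \<in> {0..t}"
   by (rule order_trans[OF nn_integral_mono[OF G_bound] kQ_le]) (use that t in auto)
  then show "(\<integral>\<^sup>+z. ennreal (cmod (G xi s z)) \<partial>P2) * indicator {0..t} s \<le> ennreal (W xi / \<tau>) * T \<tau> U1 U2 U3 xi * indicator {0..t} s"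
   by (auto simp: indicator_def)
 qed
 also have "... = ennreal (W xi / \<tau>) * T \<tau> U1 U2 U3 xi * ennreal t"
  using t by (subst nn_integral_cmult_indicator) auto
 also have "... \<le> ennreal (W xi / \<tau>) * T \<tau> U1 U2 U3 xi * ennreal \<tau>"
  using t by (intro mult_left_mono ennreal_leI) auto
 also have "... = (ennreal (W xi / \<tau>) * ennreal \<tau>) * T \<tau> U1 U2 U3 xi" by (simp only: mult_ac)
 also have "ennreal (W xi / \<tau>) * ennreal \<tau> = ennreal (W xi)"
  using \<tau> less_imp_le[OF W_pos[of xi]] by (subst ennreal_mult[symmetric]) auto
 finally show bnd: "(NN s. (\<integral>\<^sup>+z. ennreal (cmod (G xi s z)) \<partial>P2) * indicator {0..t} s) \<le> ennreal (W xi) * T \<tau> U1 U2 U3 xi" .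
 show "integrable (lborel \<Otimes>\<^sub>M P2) (\<lambda>(s, z). indicator {0..t} s *\<^sub>R G xi s z)"
 proof (rule integrableI_bounded[OF m])
  have "(\<integral>\<^sup>+w. ennreal (norm (case w of (s, z) => indicator {0..t} s *\<^sub>R G xi s z)) \<partial>(lborel \<Otimes>\<^sub>M P2))
    = (NN s. \<integral>\<^sup>+z. ennreal (norm (case (s, z) of (s, z) => indicator {0..t} s *\<^sub>R G xi s z)) \<partial>P2)"
   by (rule sigma_finite_measure.nn_integral_fst[OF P2_sf, symmetric])
    (rule measurable_compose[OF measurable_compose[OF m borel_measurable_norm] measurable_ennreal])
  also have "... = (NN s. (\<integral>\<^sup>+z. ennreal (cmod (G xi s z)) \<partial>P2) * indicator {0..t} s)"
   by (intro nn_integral_cong) (auto simp: indicator_def)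
  also have "... < \<infinity>" using bnd fin by (auto intro: le_less_trans simp: ennreal_mult_less_top)
  finally show "(\<integral>\<^sup>+w. ennreal (norm (case w of (s, z) => indicator {0..t} s *\<^sub>R G xi s z)) \<partial>(lborel \<Otimes>\<^sub>M P2)) < \<infinity>" .
 qed
qed

lemma N_time_bound:
 "(tnorm \<tau> (\<lambda>s. N (pth v1 g1) (pth v2 g2) (pth v3 g3) s xi)) \<le> ennreal (W xi) * T \<tau> U1 U2 U3 xi"
proof -
 have "(tnorm \<tau> (\<lambda>s. N (pth v1 g1) (pth v2 g2) (pth v3 g3) s xi))
   \<le> (NN s. (\<integral>\<^sup>+z. ennreal (cmod (G xi s z)) \<partial>P2) * indicator {0..\<tau>} s)"
  unfolding N_eq_G by (intro nn_integral_mono mult_right_mono norm_integral_le_nn) auto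
 also have "... \<le> ennreal (W xi) * T \<tau> U1 U2 U3 xi" by (rule G_joint_integrable) (use \<tau> in auto)
 finally show ?thesis .
qed

text \<open>Time is integrated first, at a fixed interaction, so that the phase acts before absolute
  values are taken. With kappa = W xi / tau, \<open>oscillatory_bound\<close> reproduces the first
  summand of \<open>ker\<close>.\<close>

lemma N_integral_bound:
 assumes t: "t \<in> {0..\<tau>}"
 shows "ennreal (cmod (LINT s:{0..t}|lborel. N (pth v1 g1) (pth v2 g2) (pth v3 g3) s xi)) \<le> T \<tau> U1 U2 U3 xi"
proof -
 have "(LINT s:{0..t}|lborel. N (pth v1 g1) (pth v2 g2) (pth v3 g3) s xi) = (LINT s|lborel. LINT z|P2. indicator {0..t} s *\<^sub>R G xi s z)"
  unfolding N_eq_G set_lebesgue_integral_def by simp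
 also have "... = (LINT z|P2. LINT s|lborel. indicator {0..t} s *\<^sub>R G xi s z)"
  by (rule lP2.Fubini_integral[symmetric, OF G_joint_integrable(1)[OF t]])
 finally have eq: "(LINT s:{0..t}|lborel. N (pth v1 g1) (pth v2 g2) (pth v3 g3) s xi) = (LINT z|P2. (LINT s:{0..t}|lborel. G xi s z))"
  by (simp add: set_lebesgue_integral_def)
 have "ennreal (cmod (LINT s:{0..t}|lborel. N (pth v1 g1) (pth v2 g2) (pth v3 g3) s xi)) \<le> (\<integral>\<^sup>+z. ennreal (cmod (LINT s:{0..t}|lborel. G xi s z)) \<partial>P2)"
  unfolding eq by (rule norm_integral_le_nn)
 also have "... \<le> T \<tau> U1 U2 U3 xi"
  unfolding T_eq
 proof (rule nn_integral_mono)
  fix z :: "real \<times> real"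
  let ?x = "fst z" and ?y = "snd z"
  let ?co = "2 * (W xi / \<tau> * \<tau> + 2 + (W (p1 xi ?x ?y) + W (p2 xi ?x ?y) + W (p3 xi ?x ?y))) / (W xi / \<tau> + \<bar>Om xi ?x ?y\<bar>)"
  have gd: "good \<tau> v1 g1" "good \<tau> v2 g2" "good \<tau> v3 g3" using d by (auto simp: dom_def)
  have osc: "ennreal (cmod (LINT s:{0..t}|lborel. cis (s * Om xi ?x ?y) * (pth v1 g1 s (p1 xi ?x ?y) * pth v2 g2 s (p2 xi ?x ?y) * pth v3 g3 s (p3 xi ?x ?y))))
    \<le> ennreal ?co * (U1 (p1 xi ?x ?y) * U2 (p2 xi ?x ?y) * U3 (p3 xi ?x ?y))"
   by (rule oscillatory_bound[OF \<tau>(1) _ _ _ _ good_prim[OF gd(1)] good_prim[OF gd(2)] good_prim[OF gd(3)] _ _ _ _ _ _ t])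
    (use d \<tau> W_pos less_imp_le[OF W_pos] in \<open>auto simp: dom_def\<close>)
  have "ennreal (cmod (LINT s:{0..t}|lborel. G xi s z)) = ennreal \<bar>k xi ?x ?y\<bar> * ennreal (cmod (LINT s:{0..t}|lborel. cis (s * Om xi ?x ?y) * (pth v1 g1 s (p1 xi ?x ?y) * pth v2 g2 s (p2 xi ?x ?y) * pth v3 g3 s (p3 xi ?x ?y))))"
   unfolding G_def by (simp only: set_integral_mult_right norm_mult norm_of_real ennreal_mult abs_ge_zero norm_ge_zero)
  also have "... \<le> ennreal \<bar>k xi ?x ?y\<bar> * (ennreal ?co * Q xi z)"
   unfolding Q_def by (rule mult_left_mono[OF osc]) simp
  also have "... = ennreal (\<bar>k xi ?x ?y\<bar> * ?co) * Q xi z"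
   by (simp only: mult.assoc[symmetric] ennreal_mult' abs_ge_zero)
  also have "... \<le> ennreal (K \<tau> xi z) * Q xi z"
  proof (intro mult_right_mono ennreal_leI)
   have "W xi / \<tau> * \<tau> = W xi" using \<tau> by simp
   then show "\<bar>k xi ?x ?y\<bar> * ?co \<le> K \<tau> xi z"
    unfolding K_def ker_def using \<tau> less_imp_le[OF W_pos] by (intro mult_left_mono) auto
  qed simp
  finally show "ennreal (cmod (LINT s:{0..t}|lborel. G xi s z)) \<le> ennreal (K \<tau> xi z) * Q xi z" .
 qed
 finally show ?thesis .
qed

end
end
end

section \<open>The fixed point\<close>

text \<open>\<open>r\<close> bounds the square of the norm, so sums of paths come with the factors 2
  of (x + y)^2 <= 2 x^2 + 2 y^2.\<close>

definition nb :: "real => (real => complex) => path => ennreal => bool" where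
 "nb \<tau> v0 g r \<longleftrightarrow> (\<exists>U. dom \<tau> v0 g U \<and> (sqn U) \<le> r)"

lemma nb_mono: "nb \<tau> v0 g r \<Longrightarrow> r \<le> r' \<Longrightarrow> nb \<tau> v0 g r'"
 by (auto simp: nb_def intro: order_trans)

lemma nb_good: "nb \<tau> v0 g r \<Longrightarrow> good \<tau> v0 g"
 by (auto simp: nb_def dom_def)

section \<open>Algebra of path bounds\<close>

lemma ennreal_sq_add_le: "(a + b)\<^sup>2 \<le> 2 * a\<^sup>2 + 2 * (b :: ennreal)\<^sup>2"
proof (cases "a = \<top> \<or> b = \<top>")
 case True then show ?thesis by (auto simp: ennreal_mult_top power2_eq_square)
next
 case False
 then obtain x y where xy: "a = ennreal x" "x \<ge> 0" "b = ennreal y" "y \<ge> 0" by (metis ennreal_cases)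
 have "(x + y)\<^sup>2 \<le> 2 * x\<^sup>2 + 2 * y\<^sup>2" using sum_squares_bound[of x y] by (simp add: power2_sum)
 then have "ennreal ((x + y)\<^sup>2) \<le> ennreal (2 * x\<^sup>2 + 2 * y\<^sup>2)" by (rule ennreal_leI)
 also have "... = 2 * (ennreal x)\<^sup>2 + 2 * (ennreal y)\<^sup>2"
  using xy by (simp add: ennreal_power ennreal_mult)
 finally show ?thesis using xy by (simp add: ennreal_power ennreal_plus[symmetric] del: ennreal_plus)
qed

lemma nn_sq_add_le:
 assumes [measurable]: "U \<in> borel_measurable lborel" "V \<in> borel_measurable lborel"
 shows "(NN xi. (U xi + V xi)\<^sup>2) \<le> 2 * (sqn U) + 2 * (NN xi. (V xi :: ennreal)\<^sup>2)"
proof -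
 have "(NN xi. (U xi + V xi)\<^sup>2) \<le> (NN xi. 2 * (U xi)\<^sup>2 + 2 * (V xi)\<^sup>2)"
  by (intro nn_integral_mono ennreal_sq_add_le)
 also have "... = 2 * (sqn U) + 2 * (sqn V)"
  by (subst nn_integral_add) (auto simp: nn_integral_cmult)
 finally show ?thesis .
qed

lemma good_integrable: "good \<tau> v0 g \<Longrightarrow> t \<le> \<tau> \<Longrightarrow> set_integrable lborel {0..t} (\<lambda>s. g s xi)"
 using prim_integrable[OF good_prim] by blast

lemma good_add:
 assumes "good \<tau> v0 g" "good \<tau> v0' g'"
 shows "good \<tau> (\<lambda>xi. v0 xi + v0' xi) (\<lambda>s xi. g s xi + g' s xi)"
 using assms by (auto simp: good_def)

lemma pth_add:
 assumes "good \<tau> v0 g" "good \<tau> v0' g'" "t \<le> \<tau>"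
 shows "pth (\<lambda>xi. v0 xi + v0' xi) (\<lambda>s xi. g s xi + g' s xi) t xi = pth v0 g t xi + pth v0' g' t xi"
 unfolding pth_def set_integral_add(2)[OF good_integrable[OF assms(1,3)] good_integrable[OF assms(2,3)]] by simp

lemma good_uminus: "good \<tau> v0 g \<Longrightarrow> good \<tau> (\<lambda>xi. - v0 xi) (\<lambda>s xi. - g s xi)"
 by (auto simp: good_def set_integrable_def)

lemma pth_uminus: "pth (\<lambda>xi. - v0 xi) (\<lambda>s xi. - g s xi) t xi = - pth v0 g t xi"
 by (simp add: pth_def set_lebesgue_integral_def)

lemma dom_uminus: "dom \<tau> v0 g U \<Longrightarrow> dom \<tau> (\<lambda>xi. - v0 xi) (\<lambda>s xi. - g s xi) U"
 by (auto simp: dom_def good_uminus pth_uminus)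

lemma dom_add:
 assumes a: "dom \<tau> v0 g U" and b: "dom \<tau> v0' g' U'"
 shows "dom \<tau> (\<lambda>xi. v0 xi + v0' xi) (\<lambda>s xi. g s xi + g' s xi) (\<lambda>xi. U xi + U' xi)"
proof -
 have gd: "good \<tau> v0 g" "good \<tau> v0' g'" and [measurable]: "U \<in> bm" "U' \<in> bm"
  using a b by (auto simp: dom_def)
 have ab: "s \<in> {0..\<tau>} \<Longrightarrow> ennreal (cmod (pth v0 g s xi)) \<le> U xi" "s \<in> {0..\<tau>} \<Longrightarrow> ennreal (cmod (pth v0' g' s xi)) \<le> U' xi"
  "(tnorm \<tau> (\<lambda>s. g s xi)) \<le> ennreal (W xi) * U xi"
  "(tnorm \<tau> (\<lambda>s. g' s xi)) \<le> ennreal (W xi) * U' xi" for s xi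
  using a b unfolding dom_def by blast+
 have tri: "ennreal (cmod (x + y)) \<le> ennreal (cmod x) + ennreal (cmod y)" for x y
  using ennreal_leI[OF norm_triangle_ineq[of x y]] by simp
 show ?thesis
  unfolding dom_def
 proof (intro conjI allI ballI)
  show "good \<tau> (\<lambda>xi. v0 xi + v0' xi) (\<lambda>s xi. g s xi + g' s xi)" by (rule good_add[OF gd])
  show "(\<lambda>xi. U xi + U' xi) \<in> bm" by measurable
  fix xi
  show "ennreal (cmod (pth (\<lambda>xi. v0 xi + v0' xi) (\<lambda>s xi. g s xi + g' s xi) t xi)) \<le> U xi + U' xi" if t: "t \<in> {0..\<tau>}" for t
  proof -
   have "ennreal (cmod (pth v0 g t xi + pth v0' g' t xi)) \<le> ennreal (cmod (pth v0 g t xi)) + ennreal (cmod (pth v0' g' t xi))" by (rule tri)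
   also have "... \<le> U xi + U' xi" using ab(1)[OF t] ab(2)[OF t] by (rule add_mono)
   finally show ?thesis using t by (simp add: pth_add[OF gd])
  qed
  have [measurable]: "(\<lambda>s. g s xi) \<in> bm" "(\<lambda>s. g' s xi) \<in> bm"
   using gd compose2_measurable[of g "\<lambda>s. s" borel "\<lambda>_. xi"] compose2_measurable[of g' "\<lambda>s. s" borel "\<lambda>_. xi"]
   unfolding good_def by simp_all
  have "(tnorm \<tau> (\<lambda>s. g s xi + g' s xi))
    \<le> (NN s. ennreal (cmod (g s xi)) * indicator {0..\<tau>} s + ennreal (cmod (g' s xi)) * indicator {0..\<tau>} s)"
   unfolding distrib_right[symmetric] by (intro nn_integral_mono mult_right_mono tri) auto
  also have "... = (tnorm \<tau> (\<lambda>s. g s xi)) + (tnorm \<tau> (\<lambda>s. g' s xi))"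
   by (rule nn_integral_add) auto
  also have "... \<le> ennreal (W xi) * U xi + ennreal (W xi) * U' xi" using ab(3,4) by (rule add_mono)
  finally show "(tnorm \<tau> (\<lambda>s. g s xi + g' s xi)) \<le> ennreal (W xi) * (U xi + U' xi)"
   by (simp add: distrib_left)
 qed
qed

lemma nb_add:
 assumes "nb \<tau> v0 g r" "nb \<tau> v0' g' r'"
 shows "nb \<tau> (\<lambda>xi. v0 xi + v0' xi) (\<lambda>s xi. g s xi + g' s xi) (2 * r + 2 * r')"
proof -
 obtain U U' where U: "dom \<tau> v0 g U" "(sqn U) \<le> r" "dom \<tau> v0' g' U'" "(sqn U') \<le> r'"
  using assms by (auto simp: nb_def)
 have "(NN xi. (U xi + U' xi)\<^sup>2) \<le> 2 * (sqn U) + 2 * (sqn U')"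
  using U by (intro nn_sq_add_le) (auto simp: dom_def)
 also have "... \<le> 2 * r + 2 * r'" using U by (intro add_mono mult_left_mono) auto
 finally show ?thesis unfolding nb_def using dom_add[OF U(1,3)] by blast
qed

lemma nb_uminus: "nb \<tau> v0 g r \<Longrightarrow> nb \<tau> (\<lambda>xi. - v0 xi) (\<lambda>s xi. - g s xi) r"
 by (auto simp: nb_def intro: dom_uminus)

lemma nb_diff:
 assumes "nb \<tau> v0 g r" "nb \<tau> v0' g' r'"
 shows "nb \<tau> (\<lambda>xi. v0 xi - v0' xi) (\<lambda>s xi. g s xi - g' s xi) (2 * r + 2 * r')"
 using nb_add[OF assms(1) nb_uminus[OF assms(2)]] by simp

lemma pth_zero_g: "pth v0 (\<lambda>s xi. 0) t xi = v0 xi"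
 by (simp add: pth_def set_lebesgue_integral_def)

lemma dom_const:
 assumes "v0 \<in> bm"
 shows "dom \<tau> v0 (\<lambda>s xi. 0) (\<lambda>xi. ennreal (cmod (v0 xi)))"
 using assms by (auto simp: dom_def good_def pth_zero_g set_integrable_def)

lemma nb_const: "v0 \<in> bm \<Longrightarrow> nb \<tau> v0 (\<lambda>s xi. 0) (l2sq v0)"
 unfolding nb_def by (intro exI[of _ "\<lambda>xi. ennreal (cmod (v0 xi))"]) (simp add: dom_const ennreal_power)

text \<open>\<open>dom\<close> speaks of every frequency, but its majorant may be infinite: the
  value infinity on the exceptional null set costs nothing in L^2 and makes the bounds hold
  everywhere.\<close>

lemma domI_AE:
 assumes gd: "good \<tau> v0 g" and [measurable]: "U \<in> bm"
  and ae: "AE xi in lborel. (\<forall>t\<in>{0..\<tau>}. ennreal (cmod (pth v0 g t xi)) \<le> U xi)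
    \<and> (tnorm \<tau> (\<lambda>s. g s xi)) \<le> ennreal (W xi) * U xi"
  and r: "(sqn U) \<le> r"
 shows "nb \<tau> v0 g r"
proof -
 obtain Z where Z0: "\<And>xi. xi \<in> space lborel - Z \<Longrightarrow> (\<forall>t\<in>{0..\<tau>}. ennreal (cmod (pth v0 g t xi)) \<le> U xi)
    \<and> (tnorm \<tau> (\<lambda>s. g s xi)) \<le> ennreal (W xi) * U xi" and Z: "Z \<in> null_sets lborel"
  by (rule AE_E3[OF ae]) blast
 have [measurable]: "Z \<in> sets borel" using Z by auto
 define V where "V xi = (if xi \<in> Z then \<top> else U xi)" for xi
 have [measurable]: "V \<in> bm" unfolding V_def by measurable
 have "dom \<tau> v0 g V"
  unfolding dom_def
 proof (intro conjI allI ballI gd)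
  fix xi
  have W0: "ennreal (W xi) \<noteq> 0" using W_pos[of xi] by simp
  show "ennreal (cmod (pth v0 g t xi)) \<le> V xi" if "t \<in> {0..\<tau>}" for t
   using Z0[of xi] that by (simp add: V_def)
  show "(tnorm \<tau> (\<lambda>s. g s xi)) \<le> ennreal (W xi) * V xi"
   using Z0[of xi] W0 W_pos[of xi] by (simp add: V_def ennreal_mult_top)
 qed simp
 moreover have "(sqn V) = (sqn U)"
  using AE_not_in[OF Z] by (intro nn_integral_cong_AE) (auto simp: V_def)
 ultimately show ?thesis using r unfolding nb_def by (intro exI[of _ V]) simp
qed

text \<open>The formula for the next iterate may fail to be integrable in time at some frequencies;
  the path is set to zero there so that the result is \<open>good\<close>. For the iterates these
  frequencies form a null set, by \<open>rhs_finite\<close>.\<close>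

definition cutg :: "real => path => path" where
 "cutg \<tau> g s xi = (if (tnorm \<tau> (\<lambda>s. g s xi)) < \<infinity> then g s xi else 0)"

lemma time_norm_measurable:
 assumes m: "joint g"
 shows "(\<lambda>xi. NN s. ennreal (cmod (g s xi)) * indicator {0..\<tau>::real} s) \<in> bm"
proof -
 note [measurable (raw)] = compose2_measurable[OF m]
 show ?thesis by measurable
qed

lemma cutg_good:
 assumes m: "joint g" and v0: "v0 \<in> bm"
 shows "good \<tau> v0 (cutg \<tau> g)"
 unfolding good_def
proof (intro conjI allI v0)
 note [measurable (raw)] = compose2_measurable[OF m]
 note [measurable] = time_norm_measurable[OF m, of \<tau>]
 show "joint (cutg \<tau> g)"
  unfolding cutg_def by measurable
 fix xi
 show "set_integrable lborel {0..\<tau>} (\<lambda>s. cutg \<tau> g s xi)"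
 proof (cases "(tnorm \<tau> (\<lambda>s. g s xi)) < \<infinity>")
  case True
  have "integrable lborel (\<lambda>s. indicator {0..\<tau>} s *\<^sub>R g s xi)"
  proof (rule integrableI_bounded)
   have "(NN s. ennreal (norm (indicator {0..\<tau>} s *\<^sub>R g s xi))) = (tnorm \<tau> (\<lambda>s. g s xi))"
    by (intro nn_integral_cong) (auto simp: indicator_def)
   then show "(NN s. ennreal (norm (indicator {0..\<tau>} s *\<^sub>R g s xi))) < \<infinity>" using True by simp
  qed measurable
  then show ?thesis using True by (simp add: set_integrable_def cutg_def)
 qed (simp add: cutg_def set_integrable_def)
qed

lemma ennreal_sum6_sq_le:
 "(a + (b + (c + (d + (e + f)))))\<^sup>2 \<le> 2 * a\<^sup>2 + 4 * b\<^sup>2 + 8 * c\<^sup>2 + 16 * d\<^sup>2 + 32 * e\<^sup>2 + 32 * (f :: ennreal)\<^sup>2"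
proof -
 have step: "(x + y)\<^sup>2 \<le> 2 * x\<^sup>2 + 2 * z" if "y\<^sup>2 \<le> z" for x y z :: ennreal
  by (rule order_trans[OF ennreal_sq_add_le]) (intro add_left_mono mult_left_mono that, simp)
 have "(a + (b + (c + (d + (e + f)))))\<^sup>2 \<le> 2 * a\<^sup>2 + 2 * (2 * b\<^sup>2 + 2 * (2 * c\<^sup>2 + 2 * (2 * d\<^sup>2 + 2 * (2 * e\<^sup>2 + 2 * f\<^sup>2))))"
  by (intro step ennreal_sq_add_le)
 also have "... = 2 * a\<^sup>2 + 4 * b\<^sup>2 + 8 * c\<^sup>2 + 16 * d\<^sup>2 + 32 * e\<^sup>2 + 32 * f\<^sup>2"
  by (simp add: distrib_left add.assoc mult.assoc[symmetric])
 finally show ?thesis .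
qed

text \<open>A dummy third factor, through which the quadratic term becomes trilinear.\<close>

definition chi :: "real => complex" where "chi xi = indicator {0..1} xi"

lemma chi_measurable [measurable]: "chi \<in> bm" unfolding chi_def by measurable

definition uchi :: "real => ennreal" where "uchi xi = ennreal (cmod (chi xi))"

lemma uchi_norm: "(sqn uchi) = 1"
proof -
 have "(sqn uchi) = (NN xi. indicator {0..1::real} xi)"
  by (intro nn_integral_cong) (auto simp: uchi_def chi_def indicator_def)
 then show ?thesis by simp
qed

text \<open>The two conditions of \<open>dom\<close> at one frequency, for a path starting at
  zero.\<close>

definition tb :: "real => real => (real => complex) => ennreal => bool" where
 "tb \<tau> w q T \<longleftrightarrow> q \<in> bm \<and> (tnorm \<tau> q) \<le> ennreal w * T
   \<and> (\<forall>t\<in>{0..\<tau>}. ennreal (cmod (LINT s:{0..t}|lborel. q s)) \<le> T)"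

lemma set_integrableI_time_norm:
 fixes q :: "real => complex"
 assumes [measurable]: "q \<in> bm" and f: "(tnorm \<tau> q) < \<infinity>" and t: "t \<le> \<tau>"
 shows "set_integrable lborel {0..t} q"
 unfolding set_integrable_def
proof (rule integrableI_bounded)
 have "(NN s. ennreal (norm (indicator {0..t} s *\<^sub>R q s))) \<le> (tnorm \<tau> q)"
  using t by (intro nn_integral_mono) (auto simp: indicator_def)
 then show "(NN s. ennreal (norm (indicator {0..t} s *\<^sub>R q s))) < \<infinity>" using f by (rule le_less_trans)
qed measurable

lemma tb_fin: "tb \<tau> w q T \<Longrightarrow> T < \<infinity> \<Longrightarrow> (tnorm \<tau> q) < \<infinity>"
 unfolding tb_def by (auto intro: le_less_trans simp: ennreal_mult_less_top)

lemma ennreal_norm_triangle: "ennreal (cmod (x + y)) \<le> ennreal (cmod x) + ennreal (cmod y)"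
 using ennreal_leI[OF norm_triangle_ineq[of x y]] by simp

lemma tb_add:
 assumes a: "tb \<tau> w q T" "T < \<infinity>" and b: "tb \<tau> w q' T'" "T' < \<infinity>"
 shows "tb \<tau> w (\<lambda>s. q s + q' s) (T + T')"
proof -
 have [measurable]: "q \<in> bm" "q' \<in> bm" using a b by (auto simp: tb_def)
 have "(tnorm \<tau> (\<lambda>s. q s + q' s))
   \<le> (NN s. ennreal (cmod (q s)) * indicator {0..\<tau>} s + ennreal (cmod (q' s)) * indicator {0..\<tau>} s)"
  unfolding distrib_right[symmetric] by (intro nn_integral_mono mult_right_mono ennreal_norm_triangle) auto
 also have "... = (tnorm \<tau> q) + (tnorm \<tau> q')"
  by (rule nn_integral_add) auto
 also have "... \<le> ennreal w * T + ennreal w * T'" using a b unfolding tb_def by (intro add_mono) blast+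
 finally have 1: "(tnorm \<tau> (\<lambda>s. q s + q' s)) \<le> ennreal w * (T + T')"
  by (simp only: distrib_left)
 have 2: "ennreal (cmod (LINT s:{0..t}|lborel. q s + q' s)) \<le> T + T'" if t: "t \<in> {0..\<tau>}" for t
 proof -
  have "(LINT s:{0..t}|lborel. q s + q' s) = (LINT s:{0..t}|lborel. q s) + (LINT s:{0..t}|lborel. q' s)"
   using t by (intro set_integral_add(2) set_integrableI_time_norm[OF _ tb_fin[OF a]] set_integrableI_time_norm[OF _ tb_fin[OF b]]) auto
  also have "ennreal (cmod ...) \<le> ennreal (cmod (LINT s:{0..t}|lborel. q s)) + ennreal (cmod (LINT s:{0..t}|lborel. q' s))"
   by (rule ennreal_norm_triangle)
  also have "... \<le> T + T'" using a(1) b(1) t unfolding tb_def by (intro add_mono) blast+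
  finally show ?thesis .
 qed
 show ?thesis unfolding tb_def using 1 2 by auto
qed

lemma tb_cmult:
 assumes a: "tb \<tau> w q T"
 shows "tb \<tau> w (\<lambda>s. c * q s) (ennreal (cmod c) * T)"
proof -
 have [measurable]: "q \<in> bm" using a by (auto simp: tb_def)
 have "(tnorm \<tau> (\<lambda>s. c * q s)) = (NN s. ennreal (cmod c) * (ennreal (cmod (q s)) * indicator {0..\<tau>} s))"
  by (intro nn_integral_cong) (simp only: norm_mult ennreal_mult norm_ge_zero mult.assoc)
 also have "... = ennreal (cmod c) * (tnorm \<tau> q)"
  by (rule nn_integral_cmult) measurable
 also have "... \<le> ennreal (cmod c) * (ennreal w * T)" using a unfolding tb_def by (intro mult_left_mono) auto
 finally have 1: "(tnorm \<tau> (\<lambda>s. c * q s)) \<le> ennreal w * (ennreal (cmod c) * T)"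
  by (simp only: mult_ac)
 have 2: "ennreal (cmod (LINT s:{0..t}|lborel. c * q s)) \<le> ennreal (cmod c) * T" if t: "t \<in> {0..\<tau>}" for t
 proof -
  have "ennreal (cmod (LINT s:{0..t}|lborel. q s)) \<le> T" using a t unfolding tb_def by blast
  then show ?thesis by (simp only: set_integral_mult_right norm_mult ennreal_mult norm_ge_zero) (rule mult_left_mono, auto)
 qed
 show ?thesis unfolding tb_def using 1 2 by auto
qed

text \<open>Without any oscillation the time integral of |q| is its own majorant, since the weight
  is at least 1. The damping term, which loses no derivative, enters in this way.\<close>

lemma tb_time_norm:
 assumes [measurable]: "q \<in> bm" and w: "1 \<le> w"
 shows "tb \<tau> w q (tnorm \<tau> q)"
 unfolding tb_def
proof (intro conjI ballI)
 let ?T = "NN s. ennreal (cmod (q s)) * indicator {0..\<tau>} s"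
 have "1 * ?T \<le> ennreal w * ?T" using w by (intro mult_right_mono) auto
 then show "?T \<le> ennreal w * ?T" by simp
 fix t assume t: "t \<in> {0..\<tau>}"
 have "ennreal (cmod (LINT s:{0..t}|lborel. q s)) \<le> (NN s. ennreal (cmod (indicator {0..t} s *\<^sub>R q s)))"
  unfolding set_lebesgue_integral_def by (rule norm_integral_le_nn)
 also have "... \<le> ?T" using t by (intro nn_integral_mono) (auto simp: indicator_def)
 finally show "ennreal (cmod (LINT s:{0..t}|lborel. q s)) \<le> ?T" .
qed simp

lemma tb_cong:
 assumes a: "tb \<tau> w q T" and [measurable]: "q' \<in> bm" and eq: "\<And>s. s \<in> {0..\<tau>} \<Longrightarrow> q' s = q s"
 shows "tb \<tau> w q' T"
proof -
 have "(tnorm \<tau> q') = (tnorm \<tau> q)"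
  by (intro nn_integral_cong) (auto simp: eq indicator_def)
 moreover have "(LINT s:{0..t}|lborel. q' s) = (LINT s:{0..t}|lborel. q s)" if "t \<in> {0..\<tau>}" for t
  using that by (intro set_lebesgue_integral_cong) (auto simp: eq)
 ultimately show ?thesis using a by (auto simp: tb_def)
qed

lemma (in trilinear) N_tb:
 assumes "0 < \<tau>" "\<tau> \<le> 1" "dom \<tau> v1 g1 U1" "dom \<tau> v2 g2 U2" "dom \<tau> v3 g3 U3" "T \<tau> U1 U2 U3 xi < \<infinity>"
 shows "tb \<tau> (W xi) (\<lambda>s. N (pth v1 g1) (pth v2 g2) (pth v3 g3) s xi) (T \<tau> U1 U2 U3 xi)"
 unfolding tb_def
 using N_time_bound[OF assms] N_integral_bound[OF assms]
  compose2_measurable[OF N_measurable[OF assms(1-5)], of "\<lambda>s. s" borel "\<lambda>_. xi"] by simp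

lemma L2_finite_AE:
 assumes "(sqn f) < \<infinity>" "f \<in> bm"
 shows "AE xi in lborel. f xi < (\<infinity> :: ennreal)"
proof -
 have "AE xi in lborel. (f xi)\<^sup>2 \<noteq> \<infinity>" using assms by (intro nn_integral_PInf_AE) auto
 then show ?thesis by eventually_elim (auto simp: power2_eq_square ennreal_mult_top less_top[symmetric])
qed

lemma (in trilinear) T_finite_AE:
 assumes \<tau>: "0 < \<tau>" "\<tau> \<le> 1" and "(sqn V1) < \<infinity>" "(sqn V2) < \<infinity>" "(sqn V3) < \<infinity>"
  and m: "V1 \<in> bm" "V2 \<in> bm" "V3 \<in> bm"
 shows "AE xi in lborel. T \<tau> V1 V2 V3 xi < \<infinity>"
 using assms T_norm[OF \<tau> m] by (intro L2_finite_AE T_measurable) (auto intro: le_less_trans simp: ennreal_mult_less_top)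

text \<open>The integrand \<open>G\<close> again, now as a function of the paths themselves, so that
  a multilinear difference can be expanded inside the integral.\<close>

definition (in trilinear) I :: "path => path => path => real => real => real \<times> real => complex" where
 "I v1 v2 v3 xi s z = of_real (k xi (fst z) (snd z)) * (cis (s * Om xi (fst z) (snd z)) *
   (v1 s (p1 xi (fst z) (snd z)) * v2 s (p2 xi (fst z) (snd z)) * v3 s (p3 xi (fst z) (snd z))))"

lemma (in trilinear) N_eq_I: "N v1 v2 v3 s xi = (LINT z|P2. I v1 v2 v3 xi s z)"
 by (simp add: N_def I_def)

lemma (in trilinear) I_integrable:
 assumes "0 < \<tau>" "\<tau> \<le> 1" "dom \<tau> v1 g1 U1" "dom \<tau> v2 g2 U2" "dom \<tau> v3 g3 U3" "T \<tau> U1 U2 U3 xi < \<infinity>" "s \<in> {0..\<tau>}"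
 shows "integrable P2 (I (pth v1 g1) (pth v2 g2) (pth v3 g3) xi s)"
proof -
 have "I (pth v1 g1) (pth v2 g2) (pth v3 g3) xi s = G v1 v2 v3 g1 g2 g3 xi s"
  by (rule ext) (simp only: G_def[OF assms(1-5)] I_def)
 then show ?thesis using N_integrable[OF assms] by simp
qed

text \<open>\<open>A\<close> is the quadratic term, \<open>B\<close> the cubic one and
  \<open>Hop\<close> the damping in the unknown v. The damping is known through a Lipschitz bound in
  the time norm, with the same rate sqrt tau as the nonlinear terms.\<close>

locale evo = A: trilinear kA oA a1 a2 a3 CA + B: trilinear kB oB b1 b2 b3 CB
 for kA oA a1 a2 a3 CA kB oB b1 b2 b3 CB +
 fixes cA cB :: complex and Hop :: "real => path => path" and M :: real
 assumes M0: "M \<ge> 0"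
  and Hop0: "\<And>\<tau>. Hop \<tau> (\<lambda>_ _. 0) = (\<lambda>_ _. 0)"
  and HopM: "\<And>\<tau> v0 g r. 0 < \<tau> \<Longrightarrow> nb \<tau> v0 g r \<Longrightarrow> r < \<infinity> \<Longrightarrow> joint (Hop \<tau> (pth v0 g))"
  and HopL: "\<And>\<tau> v0 g r v0' g' r' D. 0 < \<tau> \<Longrightarrow> \<tau> \<le> 1 \<Longrightarrow> nb \<tau> v0 g r \<Longrightarrow> r < \<infinity> \<Longrightarrow> nb \<tau> v0' g' r' \<Longrightarrow> r' < \<infinity> \<Longrightarrow>
    dom \<tau> (\<lambda>xi. v0 xi - v0' xi) (\<lambda>s xi. g s xi - g' s xi) D \<Longrightarrow>
    (NN xi. (tnorm \<tau> (\<lambda>s. Hop \<tau> (pth v0 g) s xi - Hop \<tau> (pth v0' g') s xi))\<^sup>2)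
     \<le> ennreal (M * sqrt \<tau>) * (sqn D)"
begin

abbreviation X where "X \<equiv> pth chi (\<lambda>s xi. 0)"

definition rhs :: "real => path => path" where
 "rhs \<tau> v s xi = cA * A.N v v X s xi + cB * B.N v v v s xi + Hop \<tau> v s xi"

definition stp :: "real => (real => complex) => path => path" where
 "stp \<tau> v0 g = cutg \<tau> (rhs \<tau> (pth v0 g))"

lemma dom_chi: "dom \<tau> chi (\<lambda>s xi. 0) uchi"
 using dom_const[OF chi_measurable] by (simp add: uchi_def[abs_def])

lemma rhs_measurable:
 assumes "0 < \<tau>" "\<tau> \<le> 1" "nb \<tau> v0 g r" "r < \<infinity>"
 shows "joint (rhs \<tau> (pth v0 g))"
proof -
 obtain U where U: "dom \<tau> v0 g U" using assms(3) by (auto simp: nb_def)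
 note [measurable] = A.N_measurable[OF assms(1,2) U U dom_chi] B.N_measurable[OF assms(1,2) U U U] HopM[OF assms(1,3,4)]
 show ?thesis unfolding rhs_def by measurable
qed

lemma stp_good:
 assumes "0 < \<tau>" "\<tau> \<le> 1" "nb \<tau> v0 g r" "r < \<infinity>" "w \<in> bm"
 shows "good \<tau> w (stp \<tau> v0 g)"
 unfolding stp_def by (rule cutg_good[OF rhs_measurable[OF assms(1-4)] assms(5)])

lemma zero_nb: "nb \<tau> (\<lambda>_. 0) (\<lambda>s xi. 0) 0"
 using nb_const[of "\<lambda>_. 0"] by simp

lemma pth_zero: "pth (\<lambda>_. 0) (\<lambda>s xi. 0) = (\<lambda>_ _. 0)"
 by (simp add: fun_eq_iff pth_zero_g)

lemma rhs_zero: "rhs \<tau> (\<lambda>_ _. 0) = (\<lambda>_ _. 0)"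
 by (simp add: rhs_def fun_eq_iff Hop0 A.N_def B.N_def)

lemma stp_zero: "stp \<tau> (\<lambda>_. 0) (\<lambda>s xi. 0) = (\<lambda>_ _. 0)"
 unfolding stp_def pth_zero rhs_zero by (simp add: cutg_def fun_eq_iff)

definition rfin :: "real => path => real => bool" where
 "rfin \<tau> v xi \<longleftrightarrow> (tnorm \<tau> (\<lambda>s. rhs \<tau> v s xi)) < \<infinity>"

text \<open>The majorants are in L^2, hence finite almost everywhere, and so is the time norm that
  they control. The damping is estimated by comparison with its value at the zero path.\<close>

lemma rhs_finite:
 assumes \<tau>: "0 < \<tau>" "\<tau> \<le> 1" and v: "nb \<tau> v0 g (ennreal R)"
 shows "AE xi in lborel. rfin \<tau> (pth v0 g) xi"
proof -
 obtain U where U: "dom \<tau> v0 g U" "(sqn U) \<le> ennreal R" using v by (auto simp: nb_def)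
 have [measurable]: "U \<in> bm" "uchi \<in> bm"
  using U by (auto simp: dom_def uchi_def[abs_def])
 let ?v = "pth v0 g" and ?cA = "ennreal (cmod cA)" and ?cB = "ennreal (cmod cB)"
 define Hv where "Hv xi = (tnorm \<tau> (\<lambda>s. Hop \<tau> ?v s xi))" for xi
 have Rf: "ennreal R < \<infinity>" by simp
 have hm: "joint (Hop \<tau> ?v)"
  using HopM[OF \<tau>(1) v Rf] by auto
 have [measurable]: "Hv \<in> bm" unfolding Hv_def by (intro time_norm_measurable hm)
 have Dn: "(sqn U) < \<infinity>" "(sqn uchi) < \<infinity>"
  using U(2) uchi_norm by (auto intro: le_less_trans)
 have "(sqn Hv) \<le> ennreal (M * sqrt \<tau>) * (sqn U)"
  using HopL[OF \<tau> v Rf zero_nb, of U] U(1) unfolding Hv_def pth_zero Hop0 by simp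
 then have Hf: "AE xi in lborel. Hv xi < \<infinity>"
  using Dn by (intro L2_finite_AE) (auto intro: le_less_trans simp: ennreal_mult_less_top)
 have "AE xi in lborel. A.T \<tau> U U uchi xi < \<infinity> \<and> B.T \<tau> U U U xi < \<infinity> \<and> Hv xi < \<infinity>"
  by (intro AE_conjI A.T_finite_AE[OF \<tau>] B.T_finite_AE[OF \<tau>] Hf Dn) measurable
 then show ?thesis
 proof (rule AE_mp, intro AE_I2 impI)
  fix xi assume "A.T \<tau> U U uchi xi < \<infinity> \<and> B.T \<tau> U U U xi < \<infinity> \<and> Hv xi < \<infinity>"
  then have f: "A.T \<tau> U U uchi xi < \<infinity>" "B.T \<tau> U U U xi < \<infinity>" "Hv xi < \<infinity>" by auto
  have Xm: "?cA * x < \<infinity>" "?cB * x < \<infinity>" if "x < \<infinity>" for x using that by (auto simp: ennreal_mult_less_top)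
  have addf: "x + y < \<infinity>" if "x < \<infinity>" "y < \<infinity>" for x y :: ennreal using that by auto
  have hs: "(\<lambda>s. Hop \<tau> ?v s xi) \<in> bm"
   using compose2_measurable[OF hm, of "\<lambda>s. s" borel "\<lambda>_. xi"] by simp
  have rv: "tb \<tau> (W xi) (\<lambda>s. rhs \<tau> ?v s xi) (?cA * A.T \<tau> U U uchi xi + ?cB * B.T \<tau> U U U xi + Hv xi)"
   unfolding rhs_def Hv_def
   by (intro tb_add tb_cmult A.N_tb[OF \<tau> U(1) U(1) dom_chi] B.N_tb[OF \<tau> U(1) U(1) U(1)] tb_time_norm hs W_ge_1 f Xm addf f(3)[unfolded Hv_def])
  show "rfin \<tau> ?v xi" unfolding rfin_def by (rule tb_fin[OF rv]) (intro addf Xm f)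
 qed
qed

text \<open>One summand per slot in which a difference can stand: two for the quadratic term, three
  for the cubic, one for the damping. The powers of 2 are those of
  \<open>ennreal_sum6_sq_le\<close>.\<close>

definition ET :: "real => real" where
 "ET R = 2 * (cmod cA)\<^sup>2 * CA * R + 4 * (cmod cA)\<^sup>2 * CA * R + 8 * (cmod cB)\<^sup>2 * CB * R\<^sup>2 + 16 * (cmod cB)\<^sup>2 * CB * R\<^sup>2
  + 32 * (cmod cB)\<^sup>2 * CB * R\<^sup>2 + 32 * M"

lemma ET_nonneg: "R \<ge> 0 \<Longrightarrow> ET R \<ge> 0"
 unfolding ET_def using A.C0 B.C0 M0 by (intro add_nonneg_nonneg mult_nonneg_nonneg) auto

text \<open>The gain \<open>sqrt \<tau>\<close> comes from the kernel bounds, i.e. from integrating by parts in time.\<close>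

lemma stp_lipschitz:
 assumes \<tau>: "0 < \<tau>" "\<tau> \<le> 1" and R: "0 \<le> R"
  and v: "nb \<tau> v0 g (ennreal R)" and w: "nb \<tau> w0 h (ennreal R)"
  and d: "nb \<tau> (\<lambda>xi. v0 xi - w0 xi) (\<lambda>s xi. g s xi - h s xi) r" and False: "r < \<infinity>"
 shows "nb \<tau> (\<lambda>_. 0) (\<lambda>s xi. stp \<tau> v0 g s xi - stp \<tau> w0 h s xi) (ennreal (ET (4 * R) * sqrt \<tau>) * r)"
proof -
 obtain U1 where U1: "dom \<tau> v0 g U1" "(sqn U1) \<le> ennreal R" using v by (auto simp: nb_def)
 obtain U2 where U2: "dom \<tau> w0 h U2" "(sqn U2) \<le> ennreal R" using w by (auto simp: nb_def)
 obtain D where D: "dom \<tau> (\<lambda>xi. v0 xi - w0 xi) (\<lambda>s xi. g s xi - h s xi) D" "(sqn D) \<le> r" using d by (auto simp: nb_def)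
 \<comment> \<open>A common majorant of both paths, so that mixed products in the expansion of the
   difference involve only \<open>U\<close> and \<open>D\<close>.\<close>
 define U where "U xi = U1 xi + U2 xi" for xi
 have [measurable]: "U1 \<in> bm" "U2 \<in> bm" "D \<in> bm"
  using U1 U2 D by (auto simp: dom_def)
 have [measurable]: "U \<in> bm" unfolding U_def by measurable
 have [measurable]: "uchi \<in> bm" unfolding uchi_def[abs_def] by measurable
 have domU: "dom \<tau> v0 g U" "dom \<tau> w0 h U"
 proof -
  have "dom \<tau> q f U" if "dom \<tau> q f V" "\<And>xi. V xi \<le> U xi" for q f V
   using that(1) order_trans[OF _ that(2)] order_trans[OF _ mult_left_mono[OF that(2)]]
   by (auto simp: dom_def)
  then show "dom \<tau> v0 g U" "dom \<tau> w0 h U" using U1(1) U2(1) by (auto simp: U_def add_increasing add_increasing2)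
 qed
 have U4: "(sqn U) \<le> ennreal (4 * R)"
 proof -
  have "(sqn U) \<le> 2 * (sqn U1) + 2 * (sqn U2)"
   unfolding U_def by (rule nn_sq_add_le) auto
  also have "... \<le> 2 * ennreal R + 2 * ennreal R" by (intro add_mono mult_left_mono U1 U2) auto
  also have "... = ennreal (4 * R)" using R by (simp add: ennreal_mult mult_2[symmetric] mult.assoc[symmetric] distrib_right[symmetric])
  finally show ?thesis .
 qed
 let ?v = "pth v0 g" and ?w = "pth w0 h" and ?d = "pth (\<lambda>xi. v0 xi - w0 xi) (\<lambda>s xi. g s xi - h s xi)"
 define HD where "HD xi = (tnorm \<tau> (\<lambda>s. Hop \<tau> ?v s xi - Hop \<tau> ?w s xi))" for xi
 have Rf: "ennreal R < \<infinity>" by simp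
 have hm: "joint (Hop \<tau> ?v)" "joint (Hop \<tau> ?w)"
  using HopM[OF \<tau>(1) v Rf] HopM[OF \<tau>(1) w Rf] by auto
 note [measurable] = hm
 have [measurable]: "HD \<in> bm" unfolding HD_def
  by (rule time_norm_measurable[where g="\<lambda>s xi. Hop \<tau> ?v s xi - Hop \<tau> ?w s xi"]) measurable
 let ?cA = "ennreal (cmod cA)" and ?cB = "ennreal (cmod cB)"
 define Out where "Out xi = ?cA * A.T \<tau> D U uchi xi + (?cA * A.T \<tau> U D uchi xi + (?cB * B.T \<tau> D U U xi + (?cB * B.T \<tau> U D U xi + (?cB * B.T \<tau> U U D xi + HD xi))))" for xi
 have [measurable]: "Out \<in> bm" unfolding Out_def by measurable
 have Dn: "(sqn D) < \<infinity>" "(sqn U) < \<infinity>" "(sqn uchi) < \<infinity>"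
  using D(2) False U4 uchi_norm by (auto simp: less_top[symmetric] top_unique intro: le_less_trans)
 have HDn: "(sqn HD) \<le> ennreal (M * sqrt \<tau>) * (sqn D)"
  unfolding HD_def by (rule HopL[OF \<tau> v Rf w Rf D(1)])
 have HDf: "AE xi in lborel. HD xi < \<infinity>"
  using HDn Dn by (intro L2_finite_AE) (auto intro: le_less_trans simp: ennreal_mult_less_top)
 have ae: "AE xi in lborel. rfin \<tau> ?v xi \<and> rfin \<tau> ?w xi \<and> A.T \<tau> U U uchi xi < \<infinity> \<and> B.T \<tau> U U U xi < \<infinity> \<and> A.T \<tau> D U uchi xi < \<infinity> \<and> A.T \<tau> U D uchi xi < \<infinity>
   \<and> B.T \<tau> D U U xi < \<infinity> \<and> B.T \<tau> U D U xi < \<infinity> \<and> B.T \<tau> U U D xi < \<infinity> \<and> HD xi < \<infinity>"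
  by (intro AE_conjI rhs_finite[OF \<tau> v] rhs_finite[OF \<tau> w] A.T_finite_AE[OF \<tau>] B.T_finite_AE[OF \<tau>] HDf Dn) measurable
 have gd: "good \<tau> v0 g" "good \<tau> w0 h" using domU by (auto simp: dom_def)
 have dd: "?d s xi = ?v s xi - ?w s xi" if "s \<in> {0..\<tau>}" for s xi
  using pth_add[OF gd(1) good_uminus[OF gd(2)], of s xi] that by (simp add: pth_uminus)
 have good': "good \<tau> (\<lambda>_. 0) (stp \<tau> v0 g)" "good \<tau> (\<lambda>_. 0) (stp \<tau> w0 h)"
  by (intro stp_good[OF \<tau> v Rf] stp_good[OF \<tau> w Rf] borel_measurable_const)+
 show ?thesis
 proof (rule domI_AE)
  show "good \<tau> (\<lambda>_. 0) (\<lambda>s xi. stp \<tau> v0 g s xi - stp \<tau> w0 h s xi)"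
   using good_add[OF good'(1) good_uminus[OF good'(2)]] by simp
  show "Out \<in> bm" by measurable
  show "(sqn Out) \<le> ennreal (ET (4 * R) * sqrt \<tau>) * r"
  proof -
   let ?u = "ennreal (4 * R)"
   have tA1: "(NN xi. (A.T \<tau> D U uchi xi)\<^sup>2) \<le> ennreal (CA * sqrt \<tau>) * (?u * r)"
    by (rule order_trans[OF A.T_norm[OF \<tau>]]) (auto simp: uchi_norm mult.commute[of ?u r] intro!: mult_left_mono mult_mono D(2) U4)
   have tA2: "(NN xi. (A.T \<tau> U D uchi xi)\<^sup>2) \<le> ennreal (CA * sqrt \<tau>) * (?u * r)"
    by (rule order_trans[OF A.T_norm[OF \<tau>]]) (auto simp: uchi_norm intro!: mult_left_mono mult_mono D(2) U4)
   have tB1: "(NN xi. (B.T \<tau> D U U xi)\<^sup>2) \<le> ennreal (CB * sqrt \<tau>) * (r * ?u * ?u)"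
    by (rule order_trans[OF B.T_norm[OF \<tau>]]) (auto intro!: mult_left_mono mult_mono D(2) U4)
   have tB2: "(NN xi. (B.T \<tau> U D U xi)\<^sup>2) \<le> ennreal (CB * sqrt \<tau>) * (?u * r * ?u)"
    by (rule order_trans[OF B.T_norm[OF \<tau>]]) (auto intro!: mult_left_mono mult_mono D(2) U4)
   have tB3: "(NN xi. (B.T \<tau> U U D xi)\<^sup>2) \<le> ennreal (CB * sqrt \<tau>) * (?u * ?u * r)"
    by (rule order_trans[OF B.T_norm[OF \<tau>]]) (auto intro!: mult_left_mono mult_mono D(2) U4)
   have tH: "(sqn HD) \<le> ennreal (M * sqrt \<tau>) * r"
    by (rule order_trans[OF HDn]) (intro mult_left_mono D(2), simp)
   have "(sqn Out) \<le> (NN xi. 2 * (?cA * A.T \<tau> D U uchi xi)\<^sup>2 + 4 * (?cA * A.T \<tau> U D uchi xi)\<^sup>2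
     + 8 * (?cB * B.T \<tau> D U U xi)\<^sup>2 + 16 * (?cB * B.T \<tau> U D U xi)\<^sup>2 + 32 * (?cB * B.T \<tau> U U D xi)\<^sup>2 + 32 * (HD xi)\<^sup>2)"
    unfolding Out_def by (intro nn_integral_mono ennreal_sum6_sq_le)
   also have "... = 2 * (?cA\<^sup>2 * (NN xi. (A.T \<tau> D U uchi xi)\<^sup>2)) + 4 * (?cA\<^sup>2 * (NN xi. (A.T \<tau> U D uchi xi)\<^sup>2))
     + 8 * (?cB\<^sup>2 * (NN xi. (B.T \<tau> D U U xi)\<^sup>2)) + 16 * (?cB\<^sup>2 * (NN xi. (B.T \<tau> U D U xi)\<^sup>2))
     + 32 * (?cB\<^sup>2 * (NN xi. (B.T \<tau> U U D xi)\<^sup>2)) + 32 * (sqn HD)"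
    unfolding power_mult_distrib by (simp add: nn_integral_add nn_integral_cmult)
   also have "... \<le> 2 * (?cA\<^sup>2 * (ennreal (CA * sqrt \<tau>) * (?u * r))) + 4 * (?cA\<^sup>2 * (ennreal (CA * sqrt \<tau>) * (?u * r)))
     + 8 * (?cB\<^sup>2 * (ennreal (CB * sqrt \<tau>) * (r * ?u * ?u))) + 16 * (?cB\<^sup>2 * (ennreal (CB * sqrt \<tau>) * (?u * r * ?u)))
     + 32 * (?cB\<^sup>2 * (ennreal (CB * sqrt \<tau>) * (?u * ?u * r))) + 32 * (ennreal (M * sqrt \<tau>) * r)"
    by (intro add_mono mult_left_mono tA1 tA2 tB1 tB2 tB3 tH) auto
   also have "... = ennreal (ET (4 * R) * sqrt \<tau>) * r"
   proof -
    define \<rho> where "\<rho> = sqrt \<tau>"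
    have p: "\<rho> \<ge> 0" "CA \<ge> 0" "CB \<ge> 0" "M \<ge> 0" "R \<ge> 0" using \<tau> A.C0 B.C0 M0 R by (auto simp: \<rho>_def)
    have n: "(2::ennreal) = ennreal 2" "(4::ennreal) = ennreal 4" "(8::ennreal) = ennreal 8" "(16::ennreal) = ennreal 16" "(32::ennreal) = ennreal 32" by simp_all
    have cc: "?cA\<^sup>2 = ennreal ((cmod cA)\<^sup>2)" "?cB\<^sup>2 = ennreal ((cmod cB)\<^sup>2)" by (simp_all add: ennreal_power)
    have t1: "ennreal x * (ennreal y * (ennreal (c * \<rho>) * (?u * r))) = ennreal (x * y * c * \<rho> * (4 * R)) * r" if "x \<ge> 0" "y \<ge> 0" "c \<ge> 0" for x y c
     using that p by (simp add: ennreal_mult mult_ac)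
    have t2: "ennreal x * (ennreal y * (ennreal (c * \<rho>) * (r * ?u * ?u))) = ennreal (x * y * c * \<rho> * (4 * R) * (4 * R)) * r" if "x \<ge> 0" "y \<ge> 0" "c \<ge> 0" for x y c
     using that p by (simp add: ennreal_mult mult_ac)
    have t3: "ennreal x * (ennreal y * (ennreal (c * \<rho>) * (?u * r * ?u))) = ennreal (x * y * c * \<rho> * (4 * R) * (4 * R)) * r" if "x \<ge> 0" "y \<ge> 0" "c \<ge> 0" for x y c
     using that p by (simp add: ennreal_mult mult_ac)
    have t4: "ennreal x * (ennreal y * (ennreal (c * \<rho>) * (?u * ?u * r))) = ennreal (x * y * c * \<rho> * (4 * R) * (4 * R)) * r" if "x \<ge> 0" "y \<ge> 0" "c \<ge> 0" for x y c
     using that p by (simp add: ennreal_mult mult_ac)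
    have t5: "ennreal x * (ennreal (c * \<rho>) * r) = ennreal (x * c * \<rho>) * r" if "x \<ge> 0" "c \<ge> 0" for x c
     using that p by (simp add: ennreal_mult mult_ac)
    have ad: "ennreal x * r + ennreal y * r = ennreal (x + y) * r" if "x \<ge> 0" "y \<ge> 0" for x y
     using that by (simp add: distrib_right)
    show ?thesis unfolding n cc \<rho>_def[symmetric]
     using p by (simp only: t1 t2 t3 t4 t5 ad zero_le_numeral zero_le_power2 mult_nonneg_nonneg add_nonneg_nonneg)
      (rule arg_cong[where f="\<lambda>x. ennreal x * r"], simp add: ET_def algebra_simps power2_eq_square)
   qed
   finally show ?thesis .
  qed
  show "AE xi in lborel. (\<forall>t\<in>{0..\<tau>}. ennreal (cmod (pth (\<lambda>_. 0) (\<lambda>s xi. stp \<tau> v0 g s xi - stp \<tau> w0 h s xi) t xi)) \<le> Out xi)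
    \<and> (tnorm \<tau> (\<lambda>s. stp \<tau> v0 g s xi - stp \<tau> w0 h s xi)) \<le> ennreal (W xi) * Out xi"
  proof (rule AE_mp[OF ae], intro AE_I2 impI)
   fix xi
   assume "rfin \<tau> ?v xi \<and> rfin \<tau> ?w xi \<and> A.T \<tau> U U uchi xi < \<infinity> \<and> B.T \<tau> U U U xi < \<infinity> \<and> A.T \<tau> D U uchi xi < \<infinity> \<and> A.T \<tau> U D uchi xi < \<infinity>
   \<and> B.T \<tau> D U U xi < \<infinity> \<and> B.T \<tau> U D U xi < \<infinity> \<and> B.T \<tau> U U D xi < \<infinity> \<and> HD xi < \<infinity>"
   then have f: "A.T \<tau> U U uchi xi < \<infinity>" "B.T \<tau> U U U xi < \<infinity>" "A.T \<tau> D U uchi xi < \<infinity>" "A.T \<tau> U D uchi xi < \<infinity>"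
    "B.T \<tau> D U U xi < \<infinity>" "B.T \<tau> U D U xi < \<infinity>" "B.T \<tau> U U D xi < \<infinity>" "HD xi < \<infinity>"
    and rf: "rfin \<tau> ?v xi" "rfin \<tau> ?w xi" by auto
   show "(\<forall>t\<in>{0..\<tau>}. ennreal (cmod (pth (\<lambda>_. 0) (\<lambda>s xi. stp \<tau> v0 g s xi - stp \<tau> w0 h s xi) t xi)) \<le> Out xi)
    \<and> (tnorm \<tau> (\<lambda>s. stp \<tau> v0 g s xi - stp \<tau> w0 h s xi)) \<le> ennreal (W xi) * Out xi"
   proof -
    have W1: "1 \<le> W xi" by (rule W_ge_1)
    have sec: "(\<lambda>s. q s xi) \<in> bm" if "joint q" for q :: "path"
     using compose2_measurable[OF that, of "\<lambda>s. s" borel "\<lambda>_. xi"] by simp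
    have hs [measurable]: "(\<lambda>s. Hop \<tau> ?v s xi) \<in> bm" "(\<lambda>s. Hop \<tau> ?w s xi) \<in> bm"
     by (intro sec hm)+
    have Xm: "?cA * x < \<infinity>" "?cB * x < \<infinity>" if "x < \<infinity>" for x using that by (auto simp: ennreal_mult_less_top)
    have addf: "x + y < \<infinity>" if "x < \<infinity>" "y < \<infinity>" for x y :: ennreal using that by auto
    have st: "stp \<tau> v0 g s xi = rhs \<tau> ?v s xi" "stp \<tau> w0 h s xi = rhs \<tau> ?w s xi" for s
     using rf by (auto simp: stp_def cutg_def rfin_def)
    \<comment> \<open>Telescoping of a multilinear difference: slots before the difference hold the
      second path, slots after it the first.\<close>
    define q where "q s = cA * A.N ?d ?v X s xi + (cA * A.N ?w ?d X s xi + (cB * B.N ?d ?v ?v s xi + (cB * B.N ?w ?d ?v s xi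
     + (cB * B.N ?w ?w ?d s xi + (Hop \<tau> ?v s xi - Hop \<tau> ?w s xi)))))" for s
    have tq: "tb \<tau> (W xi) q (Out xi)"
     unfolding q_def[abs_def] Out_def HD_def
     by (intro tb_add tb_cmult A.N_tb[OF \<tau> D(1) domU(1) dom_chi] A.N_tb[OF \<tau> domU(2) D(1) dom_chi]
       B.N_tb[OF \<tau> D(1) domU(1) domU(1)] B.N_tb[OF \<tau> domU(2) D(1) domU(1)] B.N_tb[OF \<tau> domU(2) domU(2) D(1)]
       tb_time_norm borel_measurable_diff hs W1 f Xm addf f(8)[unfolded HD_def])
    \<comment> \<open>Combining the integrals requires every integrand to be integrable at this xi
      and s; the finiteness of all the \<open>T\<close> values provides it.\<close>
    have Oq: "stp \<tau> v0 g s xi - stp \<tau> w0 h s xi = q s" if s: "s \<in> {0..\<tau>}" for s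
    proof -
     note iA = A.I_integrable[OF \<tau> domU(1) domU(1) dom_chi f(1) s] A.I_integrable[OF \<tau> domU(2) domU(2) dom_chi f(1) s]
      A.I_integrable[OF \<tau> D(1) domU(1) dom_chi f(3) s] A.I_integrable[OF \<tau> domU(2) D(1) dom_chi f(4) s]
     note iB = B.I_integrable[OF \<tau> domU(1) domU(1) domU(1) f(2) s] B.I_integrable[OF \<tau> domU(2) domU(2) domU(2) f(2) s]
      B.I_integrable[OF \<tau> D(1) domU(1) domU(1) f(5) s] B.I_integrable[OF \<tau> domU(2) D(1) domU(1) f(6) s] B.I_integrable[OF \<tau> domU(2) domU(2) D(1) f(7) s]
     have A: "A.N ?v ?v X s xi - A.N ?w ?w X s xi = A.N ?d ?v X s xi + A.N ?w ?d X s xi"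
      unfolding A.N_eq_I Bochner_Integration.integral_diff[OF iA(1,2), symmetric] Bochner_Integration.integral_add[OF iA(3,4), symmetric]
      by (rule Bochner_Integration.integral_cong[OF refl], simp only: A.I_def dd[OF s]) (simp add: algebra_simps)
     have B: "B.N ?v ?v ?v s xi - B.N ?w ?w ?w s xi = B.N ?d ?v ?v s xi + (B.N ?w ?d ?v s xi + B.N ?w ?w ?d s xi)"
      unfolding B.N_eq_I Bochner_Integration.integral_diff[OF iB(1,2), symmetric] Bochner_Integration.integral_add[OF iB(4,5), symmetric]
       Bochner_Integration.integral_add[OF iB(3) Bochner_Integration.integrable_add[OF iB(4,5)], symmetric]
      by (rule Bochner_Integration.integral_cong[OF refl], simp only: B.I_def dd[OF s]) (simp add: algebra_simps)
     have "stp \<tau> v0 g s xi - stp \<tau> w0 h s xi = cA * (A.N ?v ?v X s xi - A.N ?w ?w X s xi) + cB * (B.N ?v ?v ?v s xi - B.N ?w ?w ?w s xi)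
       + (Hop \<tau> ?v s xi - Hop \<tau> ?w s xi)"
      unfolding st rhs_def by (simp add: algebra_simps)
     then show ?thesis unfolding A B q_def by (simp only: distrib_left add.assoc)
    qed
    have gms: "(\<lambda>s. stp \<tau> v0 g s xi - stp \<tau> w0 h s xi) \<in> bm"
     using good' by (intro borel_measurable_diff sec) (simp_all add: good_def)
    from tb_cong[OF tq gms Oq] show ?thesis unfolding tb_def pth_def by (simp only: add_0) simp
   qed
  qed
 qed
qed

end

section \<open>Completeness of the space of paths\<close>

lemma ennreal_twice_add: "x \<ge> 0 \<Longrightarrow> y \<ge> 0 \<Longrightarrow> 2 * ennreal x + 2 * ennreal y = ennreal (2 * x + 2 * y)"
 by (simp add: ennreal_mult)

lemma nb_cong:
 assumes n: "nb \<tau> v0 g r" and gd: "good \<tau> v0 g'"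
  and ae: "AE xi in lborel. (tnorm \<tau> (\<lambda>s. g s xi - g' s xi)) = 0"
 shows "nb \<tau> v0 g' r"
proof -
 obtain U where U: "dom \<tau> v0 g U" "(sqn U) \<le> r" using n by (auto simp: nb_def)
 have Um: "U \<in> bm" and gg: "good \<tau> v0 g" using U by (auto simp: dom_def)
 have dU: "ennreal (cmod (pth v0 g t xi)) \<le> U xi" if "t \<in> {0..\<tau>}" for t xi using U(1) that unfolding dom_def by blast
 have dV: "(tnorm \<tau> (\<lambda>s. g s xi)) \<le> ennreal (W xi) * U xi" for xi using U(1) unfolding dom_def by blast
 have sec: "(\<lambda>s. q s xi) \<in> bm" if "good \<tau> v0 q" for q xi
  using that compose2_measurable[of q "\<lambda>s. s" borel "\<lambda>_. xi"] by (simp add: good_def)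
 show ?thesis
 proof (rule domI_AE[OF gd Um _ U(2)], rule AE_mp[OF ae], intro AE_I2 impI)
  fix xi
  note [measurable] = sec[OF gg, of xi] sec[OF gd, of xi]
  assume "(tnorm \<tau> (\<lambda>s. g s xi - g' s xi)) = 0"
  then have "AE s in lborel. ennreal (cmod (g s xi - g' s xi)) * indicator {0..\<tau>} s = 0"
   by (subst (asm) nn_integral_0_iff_AE) auto
  then have e: "AE s in lborel. s \<in> {0..\<tau>} \<longrightarrow> g' s xi = g s xi"
   by eventually_elim (auto simp: indicator_def)
  have 1: "(LINT s:{0..t}|lborel. g' s xi) = (LINT s:{0..t}|lborel. g s xi)" if "t \<in> {0..\<tau>}" for t
   unfolding set_lebesgue_integral_def
   by (rule integral_cong_AE, measurable, use e in eventually_elim) (use that in \<open>auto simp: indicator_def\<close>)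
  have 2: "(tnorm \<tau> (\<lambda>s. g' s xi)) = (tnorm \<tau> (\<lambda>s. g s xi))"
   by (rule nn_integral_cong_AE, use e in eventually_elim) (auto simp: indicator_def)
  show "(\<forall>t\<in>{0..\<tau>}. ennreal (cmod (pth v0 g' t xi)) \<le> U xi)
    \<and> (tnorm \<tau> (\<lambda>s. g' s xi)) \<le> ennreal (W xi) * U xi"
   using dU[of _ xi] dV[of xi] 1 2 by (simp add: pth_def)
 qed
qed

text \<open>Divided by W, the time norm of \<open>h\<close> is dominated by majorants of arbitrarily
  small L^2 norm, hence zero almost everywhere; W has no zeros.\<close>

lemma nb_vanish:
 assumes m: "joint h" and n: "\<And>\<epsilon>. \<epsilon> > 0 \<Longrightarrow> nb \<tau> v0 h (ennreal \<epsilon>)"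
 shows "AE xi in lborel. (tnorm \<tau> (\<lambda>s. h s xi)) = 0"
proof -
 define f where "f xi = (tnorm \<tau> (\<lambda>s. h s xi))" for xi
 have [measurable]: "f \<in> bm" unfolding f_def by (rule time_norm_measurable[OF m])
 have [measurable]: "W \<in> bm" unfolding W_def[abs_def] by measurable
 have small: "(NN xi. (ennreal (1 / W xi) * f xi)\<^sup>2) \<le> ennreal \<epsilon>" if e: "\<epsilon> > 0" for \<epsilon>
 proof -
  obtain U where U: "dom \<tau> v0 h U" "(sqn U) \<le> ennreal \<epsilon>" using n[OF e] by (auto simp: nb_def)
  have "ennreal (1 / W xi) * f xi \<le> U xi" for xi
  proof -
   have "f xi \<le> ennreal (W xi) * U xi" using U(1) unfolding dom_def f_def by blast
   then have "ennreal (1 / W xi) * f xi \<le> ennreal (1 / W xi) * (ennreal (W xi) * U xi)" by (rule mult_left_mono) simp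
   also have "... = (ennreal (1 / W xi) * ennreal (W xi)) * U xi" by (simp only: mult.assoc)
   also have "ennreal (1 / W xi) * ennreal (W xi) = 1" using W_pos[of xi] by (subst ennreal_mult[symmetric]) auto
   finally show ?thesis by simp
  qed
  then have "(NN xi. (ennreal (1 / W xi) * f xi)\<^sup>2) \<le> (sqn U)" by (intro nn_integral_mono power_mono) auto
  then show ?thesis using U(2) by (rule order_trans)
 qed
 have "(NN xi. (ennreal (1 / W xi) * f xi)\<^sup>2) \<le> 0"
  by (rule ennreal_le_epsilon) (use small in simp)
 then have "(NN xi. (ennreal (1 / W xi) * f xi)\<^sup>2) = 0" by simp
 then have "AE xi in lborel. (ennreal (1 / W xi) * f xi)\<^sup>2 = 0" by (subst (asm) nn_integral_0_iff_AE) auto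
 then have "AE xi in lborel. f xi = 0"
 proof eventually_elim
  case (elim xi)
  then show ?case using W_pos[of xi] by (auto simp: ennreal_eq_0_iff divide_le_0_iff)
 qed
 then show ?thesis unfolding f_def .
qed

lemma nb_l2sq:
 assumes n: "nb \<tau> v0 g r" and t: "t \<in> {0..\<tau>}"
 shows "l2sq (pth v0 g t) \<le> r"
proof -
 obtain U where U: "dom \<tau> v0 g U" "(sqn U) \<le> r" using n by (auto simp: nb_def)
 have "ennreal ((cmod (pth v0 g t xi))\<^sup>2) \<le> (U xi)\<^sup>2" for xi
 proof -
  have "ennreal (cmod (pth v0 g t xi)) \<le> U xi" using U(1) t unfolding dom_def by blast
  then have "(ennreal (cmod (pth v0 g t xi)))\<^sup>2 \<le> (U xi)\<^sup>2" by (rule power_mono) simp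
  then show ?thesis by (simp add: ennreal_power)
 qed
 then have "l2sq (pth v0 g t) \<le> (sqn U)" by (intro nn_integral_mono)
 then show ?thesis using U(2) by (rule order_trans)
qed

lemma tb_telescope:
 assumes "\<And>n. tb \<tau> w (\<lambda>s. h (Suc n) s - h n s) (c n)" "\<And>n. c n < \<infinity>" "n \<le> m"
 shows "tb \<tau> w (\<lambda>s. h m s - h n s) (\<Sum>j<m - n. c (n + j))"
 using assms(3)
proof (induction m rule: dec_induct)
 case base
 show ?case by (simp add: tb_def set_lebesgue_integral_def)
next
 case (step m)
 have "tb \<tau> w (\<lambda>s. (h m s - h n s) + (h (Suc m) s - h m s)) ((\<Sum>j<m - n. c (n + j)) + c m)"
  by (intro tb_add step.IH assms(1)) (use assms(2) in \<open>auto simp: less_top[symmetric]\<close>)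
 moreover have "(\<Sum>j<Suc m - n. c (n + j)) = (\<Sum>j<m - n. c (n + j)) + c m"
  using step.hyps by (simp add: Suc_diff_le)
 ultimately show ?case by simp
qed

text \<open>Summable majorants of the increments give absolute convergence at almost every time, and
  the bound on the time norm passes to the limit. The sharper bound on the integral, free of
  \<open>w\<close>, needs a detour: it holds for h_m - h_n, the remainder H - h_m costs w C_m
  through the time norm, and m is sent to infinity.\<close>

lemma tb_limit:
 assumes e: "\<And>n. tb \<tau> w (\<lambda>s. h (Suc n) s - h n s) (c n)" and [measurable]: "\<And>n. h n \<in> bm"
  and w: "w \<ge> 0" and c: "(\<Sum>n. c n) < \<infinity>"
 shows "tb \<tau> w (\<lambda>s. lim (\<lambda>n. h n s) - h n s) (\<Sum>j. c (n + j))"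
proof -
 define H where "H s = lim (\<lambda>n. h n s)" for s
 have [measurable]: "H \<in> bm" unfolding H_def by measurable
 have cf: "c n < \<infinity>" for n using c le_less_trans[OF sum_le_suminf[of c "{n}"]] by simp
 define x where "x n = enn2real (c n)" for n
 have x: "c n = ennreal (x n)" "x n \<ge> 0" for n using cf[of n] by (auto simp: x_def)
 have sx: "summable x"
  using c unfolding x(1) by (intro summable_suminf_not_top) (auto simp: x)
 define C where "C n = (\<Sum>j. x (j + n))" for n
 have Cn: "(\<Sum>j. c (n + j)) = ennreal (C n)" for n
  unfolding x(1) C_def using summable_ignore_initial_segment[OF sx, of n] x(2)
  by (subst suminf_ennreal2) (auto simp: add.commute)
 have C0: "C \<longlonglongrightarrow> 0" unfolding C_def by (rule suminf_exist_split2[OF sx])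
 have Cpos: "C n \<ge> 0" for n unfolding C_def using summable_ignore_initial_segment[OF sx, of n] x(2) by (intro suminf_nonneg) auto
 have tn: "(NN s. (\<Sum>j. ennreal (cmod (h (Suc (n + j)) s - h (n + j) s)) * indicator {0..\<tau>} s)) \<le> ennreal w * ennreal (C n)" for n
 proof -
  have "(NN s. (\<Sum>j. ennreal (cmod (h (Suc (n + j)) s - h (n + j) s)) * indicator {0..\<tau>} s))
   = (\<Sum>j. NN s. ennreal (cmod (h (Suc (n + j)) s - h (n + j) s)) * indicator {0..\<tau>} s)"
   by (rule nn_integral_suminf) measurable
  also have "... \<le> (\<Sum>j. ennreal w * c (n + j))"
   by (intro suminf_le) (use e in \<open>auto simp: tb_def\<close>)
  also have "... = ennreal w * ennreal (C n)" by (simp add: Cn)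
  finally show ?thesis .
 qed
 have le1: "ennreal (cmod (h m s - h n s)) \<le> (\<Sum>j. ennreal (cmod (h (Suc (n + j)) s - h (n + j) s)))" if "n \<le> m" for n m s
 proof -
  have "ennreal (cmod (h m s - h n s)) \<le> (\<Sum>j<m - n. ennreal (cmod (h (Suc (n + j)) s - h (n + j) s)))"
   using that
  proof (induction m rule: dec_induct)
   case (step m)
   have "ennreal (cmod (h (Suc m) s - h n s)) \<le> ennreal (cmod (h m s - h n s)) + ennreal (cmod (h (Suc m) s - h m s))"
    using ennreal_norm_triangle[of "h m s - h n s" "h (Suc m) s - h m s"] by simp
   then show ?case using step by (simp add: Suc_diff_le) (meson add_right_mono order_trans)
  qed simp
  also have "... \<le> (\<Sum>j. ennreal (cmod (h (Suc (n + j)) s - h (n + j) s)))" by (rule sum_le_suminf) auto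
  finally show ?thesis .
 qed
 have "AE s in lborel. (\<Sum>j. ennreal (cmod (h (Suc (0 + j)) s - h (0 + j) s)) * indicator {0..\<tau>} s) \<noteq> \<infinity>"
 proof (rule nn_integral_PInf_AE)
  have "(NN s. (\<Sum>j. ennreal (cmod (h (Suc (0 + j)) s - h (0 + j) s)) * indicator {0..\<tau>} s)) < \<infinity>"
   using tn[of 0] by (rule le_less_trans) (simp add: ennreal_mult_less_top)
  then show "(NN s. (\<Sum>j. ennreal (cmod (h (Suc (0 + j)) s - h (0 + j) s)) * indicator {0..\<tau>} s)) \<noteq> \<infinity>"
   by (simp add: less_top[symmetric])
 qed measurable
 then have conv: "AE s in lborel. s \<in> {0..\<tau>} \<longrightarrow> (\<lambda>n. h n s) \<longlonglongrightarrow> H s"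
 proof (rule AE_mp, intro AE_I2 impI)
  fix s assume f: "(\<Sum>j. ennreal (cmod (h (Suc (0 + j)) s - h (0 + j) s)) * indicator {0..\<tau>} s) \<noteq> \<infinity>" and s: "s \<in> {0..\<tau>}"
  have "summable (\<lambda>j. cmod (h (Suc j) s - h j s))"
   using f s by (intro summable_suminf_not_top) auto
  then have "summable (\<lambda>j. h (Suc j) s - h j s)" by (rule summable_norm_cancel)
  then have "convergent (\<lambda>n. \<Sum>j<n. h (Suc j) s - h j s)" by (simp add: summable_iff_convergent)
  then have "convergent (\<lambda>n. h n s - h 0 s)"
   using sum_lessThan_telescope[of "\<lambda>n. h n s"] by (simp only:)
  then have "convergent (\<lambda>n. (h n s - h 0 s) + h 0 s)" by (intro convergent_add convergent_const)
  then show "(\<lambda>n. h n s) \<longlonglongrightarrow> H s" unfolding H_def by (simp add: convergent_LIMSEQ_iff)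
 qed
 have time: "(tnorm \<tau> (\<lambda>s. H s - h n s)) \<le> ennreal w * ennreal (C n)" for n
 proof (rule order_trans[OF _ tn[of n]], rule nn_integral_mono_AE, rule AE_mp[OF conv], intro AE_I2 impI)
  fix s assume c: "s \<in> {0..\<tau>} \<longrightarrow> (\<lambda>n. h n s) \<longlonglongrightarrow> H s"
  show "ennreal (cmod (H s - h n s)) * indicator {0..\<tau>} s \<le> (\<Sum>j. ennreal (cmod (h (Suc (n + j)) s - h (n + j) s)) * indicator {0..\<tau>} s)"
  proof (cases "s \<in> {0..\<tau>}")
   case True
   have "(\<lambda>m. ennreal (cmod (h m s - h n s))) \<longlonglongrightarrow> ennreal (cmod (H s - h n s))"
    using c True by (intro tendsto_ennrealI tendsto_norm tendsto_diff) auto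
   then have "ennreal (cmod (H s - h n s)) \<le> (\<Sum>j. ennreal (cmod (h (Suc (n + j)) s - h (n + j) s)))"
    by (rule LIMSEQ_le_const2) (use le1 in blast)
   then show ?thesis using True by simp
  qed simp
 qed
 have fin: "(tnorm \<tau> (\<lambda>s. H s - h n s)) < \<infinity>" for n
  using time[of n] by (rule le_less_trans) (simp add: ennreal_mult_less_top)
 have int: "cmod (LINT s:{0..t}|lborel. H s - h n s) \<le> C n" if t: "t \<in> {0..\<tau>}" for t n
 proof -
  have "cmod (LINT s:{0..t}|lborel. H s - h n s) \<le> w * C m + C n" if nm: "n \<le> m" for m
  proof -
   have tt: "tb \<tau> w (\<lambda>s. h m s - h n s) (\<Sum>j<m - n. c (n + j))" by (rule tb_telescope[of \<tau> w h c, OF e cf nm])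
   have le: "(\<Sum>j<m - n. c (n + j)) \<le> ennreal (C n)" unfolding Cn[symmetric] by (rule sum_le_suminf) auto
   have fs: "(\<Sum>j<m - n. c (n + j)) < \<infinity>" using le by (rule le_less_trans) simp
   have "(LINT s:{0..t}|lborel. H s - h n s) = (LINT s:{0..t}|lborel. (H s - h m s) + (h m s - h n s))" by simp
   also have "... = (LINT s:{0..t}|lborel. H s - h m s) + (LINT s:{0..t}|lborel. h m s - h n s)"
    using t by (intro set_integral_add(2) set_integrableI_time_norm[OF _ fin] set_integrableI_time_norm[OF _ tb_fin[OF tt fs]]) auto
   finally have "cmod (LINT s:{0..t}|lborel. H s - h n s) \<le> cmod (LINT s:{0..t}|lborel. H s - h m s) + cmod (LINT s:{0..t}|lborel. h m s - h n s)"
    by (metis norm_triangle_ineq)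
   moreover have "cmod (LINT s:{0..t}|lborel. H s - h m s) \<le> w * C m"
   proof -
    have "ennreal (cmod (LINT s:{0..t}|lborel. H s - h m s)) \<le> (NN s. ennreal (cmod (indicator {0..t} s *\<^sub>R (H s - h m s))))"
     unfolding set_lebesgue_integral_def by (rule norm_integral_le_nn)
    also have "... \<le> (tnorm \<tau> (\<lambda>s. H s - h m s))" using t by (intro nn_integral_mono) (auto simp: indicator_def)
    also have "... \<le> ennreal (w * C m)" using time[of m] w Cpos[of m] by (simp add: ennreal_mult)
    finally show ?thesis using w Cpos[of m] by (subst (asm) ennreal_le_iff) auto
   qed
   moreover have "cmod (LINT s:{0..t}|lborel. h m s - h n s) \<le> C n"
   proof -
    have "ennreal (cmod (LINT s:{0..t}|lborel. h m s - h n s)) \<le> ennreal (C n)"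
     using tt t le unfolding tb_def by (meson order_trans)
    then show ?thesis using Cpos[of n] by (subst (asm) ennreal_le_iff) auto
   qed
   ultimately show ?thesis by linarith
  qed
  moreover have "(\<lambda>m. w * C m + C n) \<longlonglongrightarrow> w * 0 + C n" by (intro tendsto_add tendsto_mult tendsto_const C0)
  ultimately show ?thesis by (intro LIMSEQ_le_const[where X="\<lambda>m. w * C m + C n"]) auto
 qed
 show ?thesis unfolding tb_def H_def[symmetric] Cn using time int by (auto intro!: ennreal_leI)
qed

text \<open>Peeling off the first term with (x + y)^2 <= 2 x^2 + 2 y^2 doubles the rest each time.
  The ratio 1/16 outweighs this, since 2/16 + 2/64 is at most 1/4; Fatou passes to the infinite
  sum.\<close>

lemma weighted_square_sum:
 assumes c: "\<And>j. (NN xi. (c j xi)\<^sup>2) \<le> ennreal (r * (1/16) ^ Suc j)" and r: "r \<ge> 0"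
  and [measurable]: "\<And>j. c j \<in> bm"
 shows "(NN xi. (\<Sum>j. c (n + j) xi :: ennreal)\<^sup>2) \<le> ennreal (r / 4 * (1/16) ^ n)"
proof -
 have part: "(NN xi. (\<Sum>j<m. c (n + j) xi)\<^sup>2) \<le> ennreal (r / 4 * (1/16) ^ n)" for m n
 proof (induction m arbitrary: n)
  case (Suc m)
  have "(NN xi. (\<Sum>j<Suc m. c (n + j) xi)\<^sup>2) = (NN xi. (c n xi + (\<Sum>j<m. c (Suc n + j) xi))\<^sup>2)"
   by (simp only: sum.lessThan_Suc_shift add_0_right add_Suc_right add_Suc)
  also have "... \<le> 2 * (NN xi. (c n xi)\<^sup>2) + 2 * (NN xi. (\<Sum>j<m. c (Suc n + j) xi)\<^sup>2)"
   by (rule nn_sq_add_le) measurable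
  also have "... \<le> 2 * ennreal (r * (1/16) ^ Suc n) + 2 * ennreal (r / 4 * (1/16) ^ Suc n)"
   by (intro add_mono mult_left_mono c Suc.IH) auto
  also have "... = ennreal (2 * (r * (1/16) ^ Suc n) + 2 * (r / 4 * (1/16) ^ Suc n))" using r by (intro ennreal_twice_add) auto
  also have "... \<le> ennreal (r / 4 * (1/16) ^ n)"
  proof (rule ennreal_leI)
   have "0 \<le> r * (1/16) ^ n" using r by simp
   then show "2 * (r * (1/16) ^ Suc n) + 2 * (r / 4 * (1/16) ^ Suc n) \<le> r / 4 * (1/16) ^ n" by (simp add: field_simps)
  qed
  finally show ?case .
 qed (use r in simp)
 have lim: "(\<Sum>j. c (n + j) xi)\<^sup>2 = liminf (\<lambda>m. (\<Sum>j<m. c (n + j) xi)\<^sup>2)" for xi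
 proof -
  have "(\<lambda>m. \<Sum>j<m. c (n + j) xi) \<longlonglongrightarrow> (\<Sum>j. c (n + j) xi)" by (rule summable_LIMSEQ) simp
  then have "(\<lambda>m. (\<Sum>j<m. c (n + j) xi)\<^sup>2) \<longlonglongrightarrow> (\<Sum>j. c (n + j) xi)\<^sup>2"
   unfolding power2_eq_square by (intro tendsto_mult_ennreal) auto
  then show ?thesis by (simp add: lim_imp_Liminf)
 qed
 have "(NN xi. (\<Sum>j. c (n + j) xi)\<^sup>2) \<le> liminf (\<lambda>m. NN xi. (\<Sum>j<m. c (n + j) xi)\<^sup>2)"
  unfolding lim by (rule nn_integral_liminf) measurable
 also have "... \<le> liminf (\<lambda>m::nat. ennreal (r / 4 * (1/16) ^ n))"
  using part by (intro Liminf_mono) auto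
 also have "... = ennreal (r / 4 * (1/16) ^ n)" by (simp add: Liminf_const)
 finally show ?thesis .
qed

text \<open>The tail sums \<open>C n\<close> of the majorants are in L^2, hence finite almost
  everywhere, and at each such frequency \<open>tb_limit\<close> controls the limit taken pointwise
  in time. Elsewhere the limit is cut to zero.\<close>

lemma nb_complete:
 assumes g0: "g 0 = (\<lambda>_ _. 0)" and gm: "\<And>n. joint (g n)"
  and st: "\<And>n. nb \<tau> (\<lambda>_. 0) (\<lambda>s xi. g (Suc n) s xi - g n s xi) (ennreal (r * (1/16) ^ Suc n))" and r: "r \<ge> 0"
 shows "\<exists>h. (\<forall>n. nb \<tau> (\<lambda>_. 0) (\<lambda>s xi. h s xi - g n s xi) (ennreal (r / 4 * (1/16) ^ n)))
  \<and> joint h"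
proof -
 have "\<forall>n. \<exists>U. dom \<tau> (\<lambda>_. 0) (\<lambda>s xi. g (Suc n) s xi - g n s xi) U \<and> (sqn U) \<le> ennreal (r * (1/16) ^ Suc n)"
  using st unfolding nb_def by blast
 from choice[OF this] obtain c where c: "\<And>n. dom \<tau> (\<lambda>_. 0) (\<lambda>s xi. g (Suc n) s xi - g n s xi) (c n)" "\<And>n. (NN xi. (c n xi)\<^sup>2) \<le> ennreal (r * (1/16) ^ Suc n)"
  by blast
 have [measurable]: "c n \<in> bm" for n using c(1)[of n] by (simp add: dom_def)
 define C where "C n xi = (\<Sum>j. c (n + j) xi)" for n xi
 have Cm [measurable]: "C n \<in> bm" for n unfolding C_def by measurable
 have Cn: "(NN xi. (C n xi)\<^sup>2) \<le> ennreal (r / 4 * (1/16) ^ n)" for n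
  unfolding C_def by (rule weighted_square_sum[OF c(2) r]) measurable
 define h where "h s xi = lim (\<lambda>n. g n s xi)" for s xi
 note [measurable (raw)] = gm[THEN compose2_measurable]
 have hm: "joint h" unfolding h_def by measurable
 have cg: "good \<tau> (\<lambda>_. 0) (cutg \<tau> h)" by (rule cutg_good[OF hm]) simp
 have sec: "(\<lambda>s. g n s xi) \<in> bm" for n xi by measurable
 have ae: "AE xi in lborel. C 0 xi < \<infinity>" by (intro L2_finite_AE Cm) (use Cn[of 0] in \<open>auto intro: le_less_trans\<close>)
 have tbe: "tb \<tau> (W xi) (\<lambda>s. g (Suc n) s xi - g n s xi) (c n xi)" for n xi
  using c(1)[of n] sec unfolding tb_def dom_def pth_def by simp
 have tbh: "tb \<tau> (W xi) (\<lambda>s. h s xi - g n s xi) (C n xi)" if "C 0 xi < \<infinity>" for n xi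
  unfolding h_def C_def using that by (intro tb_limit tbe sec less_imp_le[OF W_pos]) (simp add: C_def)
 have ch: "cutg \<tau> h s xi = h s xi" if "C 0 xi < \<infinity>" for s xi
  using tb_fin[OF tbh[OF that, of 0] that] by (simp add: cutg_def g0)
 have gg: "good \<tau> (\<lambda>_. 0) (g n)" for n
 proof (induction n)
  case (Suc n)
  have "good \<tau> (\<lambda>_. 0) (\<lambda>s xi. g (Suc n) s xi - g n s xi)" using c(1)[of n] by (simp add: dom_def)
  from good_add[OF Suc this] show ?case by simp
 qed (simp add: g0 good_def set_integrable_def)
 have "nb \<tau> (\<lambda>_. 0) (\<lambda>s xi. cutg \<tau> h s xi - g n s xi) (ennreal (r / 4 * (1/16) ^ n))" for n
 proof (rule domI_AE[OF _ Cm _ Cn], use good_add[OF cg good_uminus[OF gg]] in simp)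
  show "AE xi in lborel. (\<forall>t\<in>{0..\<tau>}. ennreal (cmod (pth (\<lambda>_. 0) (\<lambda>s xi. cutg \<tau> h s xi - g n s xi) t xi)) \<le> C n xi)
    \<and> (tnorm \<tau> (\<lambda>s. cutg \<tau> h s xi - g n s xi)) \<le> ennreal (W xi) * C n xi"
  proof (rule AE_mp[OF ae], intro AE_I2 impI)
   fix xi assume f: "C 0 xi < \<infinity>"
   show "(\<forall>t\<in>{0..\<tau>}. ennreal (cmod (pth (\<lambda>_. 0) (\<lambda>s xi. cutg \<tau> h s xi - g n s xi) t xi)) \<le> C n xi)
    \<and> (tnorm \<tau> (\<lambda>s. cutg \<tau> h s xi - g n s xi)) \<le> ennreal (W xi) * C n xi"
    using tbh[OF f, of n] unfolding tb_def pth_def ch[OF f] by simp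
  qed
 qed
 then show ?thesis using cg by (auto simp: good_def)
qed

section \<open>Contraction, existence and stability of fixed points\<close>

context evo
begin

text \<open>A fixed point is only asserted for almost every frequency, which is all that the \<open>L\<^sup>2\<close> theory sees.\<close>

definition fixpt :: "real => (real => complex) => path => bool" where
 "fixpt \<tau> v0 g \<longleftrightarrow> (AE xi in lborel. (tnorm \<tau> (\<lambda>s. g s xi - stp \<tau> v0 g s xi)) = 0)"

lemma nb_scale:
 assumes k: "ET (4 * R) * sqrt \<tau> \<le> 1/16" and R: "R \<ge> 0" "x \<ge> 0" and d: "0 < \<tau>"
  and n: "nb \<tau> v0 g (ennreal (ET (4 * R) * sqrt \<tau>) * ennreal x)"
 shows "nb \<tau> v0 g (ennreal (x / 16))"
proof (rule nb_mono[OF n])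
 have "ET (4 * R) * sqrt \<tau> * x \<le> 1/16 * x" using k R by (intro mult_right_mono) auto
 then show "ennreal (ET (4 * R) * sqrt \<tau>) * ennreal x \<le> ennreal (x / 16)"
  using R d ET_nonneg[of "4 * R"] by (subst ennreal_mult[symmetric]) (auto intro!: ennreal_leI)
qed

text \<open>Squared distances shrink by 1/16 per step, so the iterates move by at most r/4 in
  squared norm away from the constant path and remain in the ball 4 r. \<open>ET\<close> is taken at
  16 r because \<open>stp_lipschitz\<close> on that ball works with the sum of two majorants, whose
  squared norm may be four times as large.\<close>

theorem picard:
 assumes \<tau>: "0 < \<tau>" "\<tau> \<le> 1" and r: "r \<ge> 0" and k: "ET (16 * r) * sqrt \<tau> \<le> 1/16"
  and v0 [measurable]: "v0 \<in> bm" and vr: "l2sq v0 \<le> ennreal r"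
 shows "\<exists>g. nb \<tau> v0 g (ennreal (4 * r)) \<and> fixpt \<tau> v0 g"
proof -
 define g where "g = rec_nat (\<lambda>_ _. 0) (\<lambda>_ h. stp \<tau> v0 h)"
 have g0: "g 0 = (\<lambda>_ _. 0)" and gS: "g (Suc n) = stp \<tau> v0 (g n)" for n by (simp_all add: g_def)
 have c0: "nb \<tau> v0 (\<lambda>s xi. 0) (ennreal r)" by (rule nb_mono[OF nb_const[OF v0] vr])
 have k': "ET (4 * (4 * r)) * sqrt \<tau> \<le> 1/16" using k by simp
 have r4: "0 \<le> 4 * r" using r by simp
 let ?P = "\<lambda>n. nb \<tau> (\<lambda>_. 0) (\<lambda>s xi. g (Suc n) s xi - g n s xi) (ennreal (r * (1/16) ^ Suc n))"
 have tail: "nb \<tau> (\<lambda>_. 0) (\<lambda>s xi. g n s xi - g j s xi) (ennreal (r / 4 * (1/16) ^ j))" if "j \<le> n" "\<And>i. i < n \<Longrightarrow> ?P i" for n j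
  using that(1)
 proof (induction rule: inc_induct)
  case base
  show ?case using nb_mono[OF zero_nb] by simp
 next
  case (step i)
  have "nb \<tau> (\<lambda>_. 0) (\<lambda>s xi. (g (Suc i) s xi - g i s xi) + (g n s xi - g (Suc i) s xi)) (2 * ennreal (r * (1/16) ^ Suc i) + 2 * ennreal (r / 4 * (1/16) ^ Suc i))"
   using nb_add[OF that(2)[OF step.hyps(2)] step.IH] by simp
  then have "nb \<tau> (\<lambda>_. 0) (\<lambda>s xi. g n s xi - g i s xi) (2 * ennreal (r * (1/16) ^ Suc i) + 2 * ennreal (r / 4 * (1/16) ^ Suc i))" by simp
  moreover have "2 * ennreal (r * (1/16) ^ Suc i) + 2 * ennreal (r / 4 * (1/16) ^ Suc i) \<le> ennreal (r / 4 * (1/16) ^ i)"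
  proof -
   have p: "0 \<le> r * (1/16) ^ i" using r by simp
   have "2 * ennreal (r * (1/16) ^ Suc i) + 2 * ennreal (r / 4 * (1/16) ^ Suc i) = ennreal (2 * (r * (1/16) ^ Suc i) + 2 * (r / 4 * (1/16) ^ Suc i))"
    using r by (intro ennreal_twice_add) auto
   also have "... \<le> ennreal (r / 4 * (1/16) ^ i)" by (rule ennreal_leI) (use p in \<open>simp add: field_simps\<close>)
   finally show ?thesis .
  qed
  ultimately show ?case by (rule nb_mono)
 qed
 have full: "nb \<tau> v0 h (ennreal (4 * r))" if "nb \<tau> (\<lambda>_. 0) h (ennreal (r / 4))" for h
 proof -
  have "2 * ennreal r + 2 * ennreal (r / 4) = ennreal (2 * r + 2 * (r / 4))" using r by (intro ennreal_twice_add) auto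
  also have "... \<le> ennreal (4 * r)" using r by (intro ennreal_leI) simp
  finally show ?thesis using nb_add[OF c0 that] by (auto intro: nb_mono)
 qed
 have bnd: "nb \<tau> v0 (g n) (ennreal (4 * r))" if "\<And>i. i < n \<Longrightarrow> ?P i" for n
  using full tail[of 0 n] that by (simp add: g0)
 \<comment> \<open>Strong induction: that an iterate stays in the ball, where the contraction is
   available, follows from the increments of all earlier steps.\<close>
 have P: "?P n" for n
 proof (induction n rule: less_induct)
  case (less n)
  show ?case
  proof (cases n)
   case 0
   have "nb \<tau> (\<lambda>_. 0) (\<lambda>s xi. stp \<tau> v0 (\<lambda>s xi. 0) s xi - stp \<tau> (\<lambda>_. 0) (\<lambda>s xi. 0) s xi) (ennreal (ET (4 * (4 * r)) * sqrt \<tau>) * ennreal r)"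
    using c0 by (intro stp_lipschitz[OF \<tau> r4] nb_mono[OF c0] nb_mono[OF zero_nb] ennreal_leI) (use r in auto)
   from nb_scale[OF k' r4 r \<tau>(1) this] show ?thesis by (simp add: 0 gS g0 stp_zero)
  next
   case (Suc m)
   have m1: "nb \<tau> v0 (g (Suc m)) (ennreal (4 * r))" "nb \<tau> v0 (g m) (ennreal (4 * r))"
    using less Suc by (auto intro!: bnd)
   have p: "0 \<le> r * (1/16) ^ Suc m" using r by simp
   have "nb \<tau> (\<lambda>xi. v0 xi - v0 xi) (\<lambda>s xi. g (Suc m) s xi - g m s xi) (ennreal (r * (1/16) ^ Suc m))"
    using less[of m] Suc by simp
   from stp_lipschitz[OF \<tau> r4 m1 this] have "nb \<tau> (\<lambda>_. 0) (\<lambda>s xi. g (Suc (Suc m)) s xi - g (Suc m) s xi) (ennreal (ET (4 * (4 * r)) * sqrt \<tau>) * ennreal (r * (1/16) ^ Suc m))"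
    by (simp only: gS) simp
   from nb_scale[OF k' r4 p \<tau>(1) this] show ?thesis by (simp add: Suc)
  qed
 qed
 have gm: "joint (g n)" for n
  using nb_good[OF bnd[OF P], of n] by (simp add: good_def)
 obtain h where h: "\<And>n. nb \<tau> (\<lambda>_. 0) (\<lambda>s xi. h s xi - g n s xi) (ennreal (r / 4 * (1/16) ^ n))"
  using nb_complete[OF g0 gm P r] by blast
 have hb: "nb \<tau> v0 h (ennreal (4 * r))" using full h[of 0] by (simp add: g0)
 \<comment> \<open>\<open>h\<close> and its image are compared through \<open>g (Suc n)\<close>,
   which is close to \<open>h\<close> and is itself the image of \<open>g n\<close>.\<close>
 have fe: "nb \<tau> (\<lambda>_. 0) (\<lambda>s xi. h s xi - stp \<tau> v0 h s xi) (ennreal (r * (1/16) ^ n))" for n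
 proof -
  have p: "0 \<le> r / 4 * (1/16) ^ n" "0 \<le> r * (1/16) ^ n" using r by simp_all
  have "nb \<tau> (\<lambda>xi. v0 xi - v0 xi) (\<lambda>s xi. h s xi - g n s xi) (ennreal (r / 4 * (1/16) ^ n))" using h[of n] by simp
  from stp_lipschitz[OF \<tau> r4 hb bnd[OF P] this]
  have "nb \<tau> (\<lambda>_. 0) (\<lambda>s xi. stp \<tau> v0 h s xi - g (Suc n) s xi) (ennreal (ET (4 * (4 * r)) * sqrt \<tau>) * ennreal (r / 4 * (1/16) ^ n))"
   by (simp only: gS) simp
  from nb_diff[OF h[of "Suc n"] nb_scale[OF k' r4 p(1) \<tau>(1) this]]
  have "nb \<tau> (\<lambda>_. 0) (\<lambda>s xi. h s xi - stp \<tau> v0 h s xi) (2 * ennreal (r / 4 * (1/16) ^ Suc n) + 2 * ennreal (r / 4 * (1/16) ^ n / 16))"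
   by simp
  moreover have "2 * ennreal (r / 4 * (1/16) ^ Suc n) + 2 * ennreal (r / 4 * (1/16) ^ n / 16) \<le> ennreal (r * (1/16) ^ n)"
  proof -
   have "2 * ennreal (r / 4 * (1/16) ^ Suc n) + 2 * ennreal (r / 4 * (1/16) ^ n / 16) = ennreal (2 * (r / 4 * (1/16) ^ Suc n) + 2 * (r / 4 * (1/16) ^ n / 16))"
    using r by (intro ennreal_twice_add) auto
   also have "... \<le> ennreal (r * (1/16) ^ n)" by (rule ennreal_leI) (use p in \<open>simp add: field_simps\<close>)
   finally show ?thesis .
  qed
  ultimately show ?thesis by (rule nb_mono)
 qed
 have "fixpt \<tau> v0 h"
  unfolding fixpt_def
 proof (rule nb_vanish)
  show "(\<lambda>z. h (fst z) (snd z) - stp \<tau> v0 h (fst z) (snd z)) \<in> borel_measurable (borel \<Otimes>\<^sub>M borel)"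
   using nb_good[OF fe[of 0]] by (simp add: good_def)
  fix \<epsilon> :: real assume e: "\<epsilon> > 0"
  have "(\<lambda>n. r * (1/16) ^ n) \<longlonglongrightarrow> r * 0" by (intro tendsto_mult tendsto_const LIMSEQ_power_zero) simp
  then have "\<forall>\<^sub>F n in sequentially. r * (1/16) ^ n < \<epsilon>" using e by (intro order_tendstoD) auto
  then obtain n where "r * (1/16) ^ n < \<epsilon>" by (auto simp: eventually_sequentially)
  then show "nb \<tau> (\<lambda>_. 0) (\<lambda>s xi. h s xi - stp \<tau> v0 h s xi) (ennreal \<epsilon>)" using nb_mono[OF fe[of n]] by (simp add: ennreal_leI)
 qed
 then show ?thesis using hb by blast
qed

text \<open>A bound x on the squared distance improves to 2 rho + x/8: the data enter with factor 2,
  and the images differ by at most x/16. Iterating from the trivial bound 16 r gives 4 rho + 16 r /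
  8^n. The \<open>\<epsilon>\<close> stands for the last term, since the majorant changes with n and
  no limit is taken.\<close>

theorem fixpt_stable:
 assumes \<tau>: "0 < \<tau>" "\<tau> \<le> 1" and r: "r \<ge> 0" and k: "ET (16 * r) * sqrt \<tau> \<le> 1/16"
  and v: "nb \<tau> v0 g (ennreal (4 * r))" "fixpt \<tau> v0 g" and w: "nb \<tau> w0 h (ennreal (4 * r))" "fixpt \<tau> w0 h"
  and \<rho>: "l2sq (\<lambda>xi. v0 xi - w0 xi) \<le> ennreal \<rho>" "\<rho> \<ge> 0" and \<epsilon>: "\<epsilon> > 0"
 shows "nb \<tau> (\<lambda>xi. v0 xi - w0 xi) (\<lambda>s xi. g s xi - h s xi) (ennreal (4 * \<rho> + \<epsilon>))"
proof -
 have k': "ET (4 * (4 * r)) * sqrt \<tau> \<le> 1/16" and r4: "0 \<le> 4 * r" using k r by simp_all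
 have gd: "good \<tau> v0 g" "good \<tau> w0 h" using v(1) w(1) by (auto intro: nb_good)
 have m [measurable]: "v0 \<in> bm" "w0 \<in> bm" using gd by (auto simp: good_def)
 have g0: "good \<tau> q f" if "good \<tau> p f" "q \<in> bm" for p q f using that by (simp add: good_def)
 have gsd: "good \<tau> (\<lambda>_. 0) (\<lambda>s xi. g s xi - h s xi)"
  using good_add[OF gd(1) good_uminus[OF gd(2)]] by (auto intro: g0)
 have step: "nb \<tau> (\<lambda>xi. v0 xi - w0 xi) (\<lambda>s xi. g s xi - h s xi) (ennreal (2 * \<rho> + x / 8))"
  if d: "nb \<tau> (\<lambda>xi. v0 xi - w0 xi) (\<lambda>s xi. g s xi - h s xi) (ennreal x)" and x: "x \<ge> 0" for x
 proof -
  have "nb \<tau> (\<lambda>_. 0) (\<lambda>s xi. stp \<tau> v0 g s xi - stp \<tau> w0 h s xi) (ennreal (ET (4 * (4 * r)) * sqrt \<tau>) * ennreal x)"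
   by (rule stp_lipschitz[OF \<tau> r4 v(1) w(1) d]) simp
  then have n1: "nb \<tau> (\<lambda>_. 0) (\<lambda>s xi. stp \<tau> v0 g s xi - stp \<tau> w0 h s xi) (ennreal (x / 16))" by (rule nb_scale[OF k' r4 x \<tau>(1)])
  have "AE xi in lborel. (tnorm \<tau> (\<lambda>s. (stp \<tau> v0 g s xi - stp \<tau> w0 h s xi) - (g s xi - h s xi))) = 0"
  proof (rule AE_mp[OF AE_conjI[OF v(2)[unfolded fixpt_def] w(2)[unfolded fixpt_def]]], intro AE_I2 impI)
   fix xi
   have sg: "good \<tau> v0 (stp \<tau> v0 g)" "good \<tau> w0 (stp \<tau> w0 h)" by (intro stp_good[OF \<tau> v(1)] stp_good[OF \<tau> w(1)] m; simp)+
   have sec: "(\<lambda>s. q s xi) \<in> bm" if "good \<tau> p q" for p q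
    using that compose2_measurable[of q "\<lambda>s. s" borel "\<lambda>_. xi"] by (simp add: good_def)
   note [measurable] = sec[OF sg(1)] sec[OF sg(2)] sec[OF gd(1)] sec[OF gd(2)]
   assume z: "(tnorm \<tau> (\<lambda>s. g s xi - stp \<tau> v0 g s xi)) = 0
    \<and> (tnorm \<tau> (\<lambda>s. h s xi - stp \<tau> w0 h s xi)) = 0"
   have "AE s in lborel. ennreal (cmod (g s xi - stp \<tau> v0 g s xi)) * indicator {0..\<tau>} s = 0"
    using z by (subst nn_integral_0_iff_AE[symmetric]) auto
   moreover have "AE s in lborel. ennreal (cmod (h s xi - stp \<tau> w0 h s xi)) * indicator {0..\<tau>} s = 0"
    using z by (subst nn_integral_0_iff_AE[symmetric]) auto
   ultimately have "AE s in lborel. ennreal (cmod ((stp \<tau> v0 g s xi - stp \<tau> w0 h s xi) - (g s xi - h s xi))) * indicator {0..\<tau>} s = 0"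
    by eventually_elim (auto simp: indicator_def)
   then show "(tnorm \<tau> (\<lambda>s. (stp \<tau> v0 g s xi - stp \<tau> w0 h s xi) - (g s xi - h s xi))) = 0"
    by (subst nn_integral_0_iff_AE) auto
  qed
  from nb_cong[OF n1 gsd this] have n2: "nb \<tau> (\<lambda>_. 0) (\<lambda>s xi. g s xi - h s xi) (ennreal (x / 16))" .
  have c: "nb \<tau> (\<lambda>xi. v0 xi - w0 xi) (\<lambda>s xi. 0) (ennreal \<rho>)" by (rule nb_mono[OF nb_const \<rho>(1)]) measurable
  have "nb \<tau> (\<lambda>xi. v0 xi - w0 xi) (\<lambda>s xi. g s xi - h s xi) (2 * ennreal \<rho> + 2 * ennreal (x / 16))" using nb_add[OF c n2] by simp
  moreover have "2 * ennreal \<rho> + 2 * ennreal (x / 16) = ennreal (2 * \<rho> + x / 8)"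
  proof -
   have "2 * ennreal \<rho> + 2 * ennreal (x / 16) = ennreal (2 * \<rho> + 2 * (x / 16))" using \<rho> x by (intro ennreal_twice_add) auto
   then show ?thesis by simp
  qed
  ultimately show ?thesis by simp
 qed
 have "nb \<tau> (\<lambda>xi. v0 xi - w0 xi) (\<lambda>s xi. g s xi - h s xi) (ennreal (4 * \<rho> + 16 * r * (1/8) ^ n))" for n
 proof (induction n)
  case 0
  have "2 * ennreal (4 * r) + 2 * ennreal (4 * r) = ennreal (16 * r)"
  proof -
   have "2 * ennreal (4 * r) + 2 * ennreal (4 * r) = ennreal (2 * (4 * r) + 2 * (4 * r))" using r by (intro ennreal_twice_add) auto
   then show ?thesis by simp
  qed
  with nb_diff[OF v(1) w(1)] have "nb \<tau> (\<lambda>xi. v0 xi - w0 xi) (\<lambda>s xi. g s xi - h s xi) (ennreal (16 * r))" by simp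
  then show ?case by (rule nb_mono) (use \<rho> in \<open>auto intro!: ennreal_leI\<close>)
 next
  case (Suc n)
  have p: "0 \<le> r * (1/8) ^ n" using r by simp
  have q: "0 \<le> 4 * \<rho> + 16 * r * (1/8) ^ n" using \<rho> p by (simp add: mult.assoc)
  show ?case by (rule nb_mono[OF step[OF Suc q]]) (use p \<rho> in \<open>auto intro!: ennreal_leI simp: field_simps\<close>)
 qed
 moreover have "\<exists>n. 16 * r * (1/8) ^ n < \<epsilon>"
 proof -
  have "(\<lambda>n. 16 * r * (1/8) ^ n) \<longlonglongrightarrow> 16 * r * 0" by (intro tendsto_mult tendsto_const LIMSEQ_power_zero) simp
  then have "\<forall>\<^sub>F n in sequentially. 16 * r * (1/8) ^ n < \<epsilon>" using \<epsilon> by (intro order_tendstoD) auto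
  then show ?thesis by (auto simp: eventually_sequentially)
 qed
 ultimately show ?thesis by (meson nb_mono ennreal_leI add_left_mono less_imp_le)
qed

text \<open>Where the time norm of \<open>rhs\<close> is finite the cut in \<open>stp\<close> is
  inactive, so the derivative of the path equals \<open>rhs\<close> at almost every time and the
  integrals agree.\<close>

lemma fixpt_solves:
 assumes \<tau>: "0 < \<tau>" "\<tau> \<le> 1" and v: "nb \<tau> v0 g (ennreal R)" "fixpt \<tau> v0 g"
 shows "AE xi in lborel. (tnorm \<tau> (\<lambda>s. rhs \<tau> (pth v0 g) s xi))
   = (tnorm \<tau> (\<lambda>s. g s xi)) \<and> (\<forall>t\<in>{0..\<tau>}. pth v0 g t xi = v0 xi + (LINT s:{0..t}|lborel. rhs \<tau> (pth v0 g) s xi))"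
proof (rule AE_mp[OF AE_conjI[OF v(2)[unfolded fixpt_def] rhs_finite[OF \<tau> v(1)]]], intro AE_I2 impI)
 fix xi
 assume z: "(tnorm \<tau> (\<lambda>s. g s xi - stp \<tau> v0 g s xi)) = 0 \<and> rfin \<tau> (pth v0 g) xi"
 then have st: "stp \<tau> v0 g s xi = rhs \<tau> (pth v0 g) s xi" for s by (simp add: stp_def cutg_def rfin_def)
 have gd: "good \<tau> v0 g" by (rule nb_good[OF v(1)])
 have sec: "(\<lambda>s. q s xi) \<in> bm" if "joint q" for q :: "path"
  using compose2_measurable[OF that, of "\<lambda>s. s" borel "\<lambda>_. xi"] by simp
 have [measurable]: "(\<lambda>s. g s xi) \<in> bm" "(\<lambda>s. rhs \<tau> (pth v0 g) s xi) \<in> bm"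
  using gd rhs_measurable[OF \<tau> v(1)] by (auto simp: good_def intro!: sec)
 have "AE s in lborel. ennreal (cmod (g s xi - rhs \<tau> (pth v0 g) s xi)) * indicator {0..\<tau>} s = 0"
  using z unfolding st by (subst nn_integral_0_iff_AE[symmetric]) auto
 then have e: "AE s in lborel. s \<in> {0..\<tau>} \<longrightarrow> g s xi = rhs \<tau> (pth v0 g) s xi"
  by eventually_elim (auto simp: indicator_def)
 have "(LINT s:{0..t}|lborel. g s xi) = (LINT s:{0..t}|lborel. rhs \<tau> (pth v0 g) s xi)" if "t \<in> {0..\<tau>}" for t
  unfolding set_lebesgue_integral_def
  by (rule integral_cong_AE, measurable, use e in eventually_elim) (use that in \<open>auto simp: indicator_def\<close>)
 moreover have "(tnorm \<tau> (\<lambda>s. rhs \<tau> (pth v0 g) s xi))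
   = (tnorm \<tau> (\<lambda>s. g s xi))"
  by (rule nn_integral_cong_AE, use e in eventually_elim) (auto simp: indicator_def)
 ultimately show "(tnorm \<tau> (\<lambda>s. rhs \<tau> (pth v0 g) s xi))
   = (tnorm \<tau> (\<lambda>s. g s xi)) \<and> (\<forall>t\<in>{0..\<tau>}. pth v0 g t xi = v0 xi + (LINT s:{0..t}|lborel. rhs \<tau> (pth v0 g) s xi))"
  by (auto simp: pth_def)
qed

end

section \<open>Back to the equation\<close>

lemma measurable_Pair2_section:
 assumes "joint q"
 shows "q (s :: real) \<in> borel_measurable (borel :: real measure)"
 using measurable_compose[OF measurable_Pair1'[of s borel borel] assms] by simp

lemma tail_antimono: "R \<le> R' \<Longrightarrow> tail f R' \<le> tail f R"
 unfolding tail_def by (intro nn_integral_mono) (auto simp: indicator_def)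

text \<open>The cut-off radii are chosen measurably for each parameter, so that the truncated transforms
 converge almost everywhere for \<^emph>\<open>every\<close> parameter value.\<close>

lemma has_fourier_joint:
 fixes w :: "path"
 assumes wm: "joint w" and sq: "\<And>s. square_integrable (w s)"
 shows "\<exists>H. joint H \<and> (\<forall>s. has_fourier (w s) (H s))"
proof -
 note [measurable (raw)] = compose2_measurable[OF wm]
 define P where "P k n s \<longleftrightarrow> tail (w s) (real n) \<le> ennreal ((1/4) ^ k)" for k n :: nat and s
 define N where "N k s = (LEAST n. P k n s)" for k s
 have [measurable]: "Measurable.pred borel (P k n)" for k n
  unfolding P_def tail_def by measurable
 have [measurable]: "N k \<in> measurable borel (count_space UNIV)" for k unfolding N_def by measurable
 have ex: "\<exists>n. P k n s" for k s
 proof -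
  have "((\<lambda>n. tail (w s) (real n)) \<longlongrightarrow> 0) sequentially"
   by (rule filterlim_compose[OF tail_tendsto[OF sq] filterlim_real_sequentially])
  then have "\<forall>\<^sub>F n in sequentially. tail (w s) (real n) < ennreal ((1/4) ^ k)" by (rule order_tendstoD) simp
  then show ?thesis by (auto simp: eventually_sequentially P_def intro: less_imp_le)
 qed
 have N: "P k (N k s) s" for k s unfolding N_def by (rule LeastI_ex[OF ex])
 have Nmono: "N k s \<le> N (Suc k) s" for k s
 proof -
  have "P k (N (Suc k) s) s" using N[of "Suc k" s] unfolding P_def by (rule order_trans) (intro ennreal_leI, simp)
  then show ?thesis unfolding N_def[of k] by (rule Least_le)
 qed
 \<comment> \<open>Adding k sends the radii to infinity even if the tails vanish early.\<close>
 define R where "R k s = real (N k s + k)" for k s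
 have Rm [measurable]: "R k \<in> bm" for k unfolding R_def by measurable
 define T where "T k s xi = fourier_trunc (R k s) (w s) xi" for k s xi
 have T_eq: "T k s xi = (LINT x|lborel. (if - R k s \<le> x \<and> x \<le> R k s then w s x * cis (- (x * xi)) else 0))" for k s xi
  unfolding T_def fourier_trunc_def set_lebesgue_integral_def by (intro Bochner_Integration.integral_cong refl) (auto simp: indicator_def)
 have Tm: "joint (T k)" for k
 proof -
  have "(\<lambda>(z, x). if - R k (fst z) \<le> x \<and> x \<le> R k (fst z) then w (fst z) x * cis (- (x * snd z)) else 0) \<in> borel_measurable ((borel \<Otimes>\<^sub>M borel) \<Otimes>\<^sub>M lborel)"
   unfolding split_beta by measurable
  then show ?thesis unfolding T_eq by measurable
 qed
 note [measurable (raw)] = Tm[THEN compose2_measurable]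
 define H where "H s xi = lim (\<lambda>k. T k s xi)" for s xi
 have Hm: "joint H" unfolding H_def by measurable
 have "has_fourier (w s) (H s)" for s
 proof -
  have Tb [measurable]: "T k s \<in> borel_measurable lborel" for k
   unfolding measurable_lborel2 by (rule measurable_Pair2_section[OF Tm])
  have Hb [measurable]: "H s \<in> bm"
   by (rule measurable_Pair2_section[OF Hm])
  have RS: "R k s \<le> R (Suc k) s" for k using Nmono[of k s] by (simp add: R_def)
  have "AE xi in lborel. convergent (\<lambda>k. T k s xi)"
  proof (rule AE_convergent_L2[where c="ennreal (2 * pi)"])
   fix k
   have "(NN xi. ennreal ((cmod (T (Suc k) s xi - T k s xi))\<^sup>2)) \<le> ennreal (2 * pi) * tail (w s) (R k s)"
    unfolding T_def by (rule fourier_trunc_tail[OF sq RS])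
   also have "... \<le> ennreal (2 * pi) * ennreal ((1/4) ^ k)"
    using order_trans[OF tail_antimono N[of k s, unfolded P_def], of "R k s"] by (intro mult_left_mono) (auto simp: R_def)
   finally show "(NN xi. ennreal ((cmod (T (Suc k) s xi - T k s xi))\<^sup>2)) \<le> ennreal (2 * pi) * ennreal ((1/4) ^ k)" .
  qed (auto simp: ennreal_less_top)
  then have lim: "AE xi in lborel. (\<lambda>k. T k s xi) \<longlonglongrightarrow> H s xi"
   by eventually_elim (simp add: H_def convergent_LIMSEQ_iff)
  obtain F where F: "has_fourier (w s) F" using has_fourier_exists[OF sq] by blast
  have [measurable]: "F \<in> borel_measurable lborel" using F by (auto simp: has_fourier_def square_integrable_def)
  have top: "filterlim (\<lambda>k. R k s) at_top sequentially"
   by (rule filterlim_at_top_mono[OF filterlim_real_sequentially]) (simp add: R_def)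
  have "((\<lambda>R. NN xi. ennreal ((cmod (F xi - fourier_trunc R (w s) xi))\<^sup>2)) \<longlongrightarrow> 0) at_top"
   using F by (simp add: has_fourier_def)
  from filterlim_compose[OF this top]
  have conv: "(\<lambda>k. NN xi. ennreal ((cmod (T k s xi - F xi))\<^sup>2)) \<longlonglongrightarrow> 0"
   by (simp add: T_def norm_minus_commute)
  have "(NN xi. ennreal ((cmod (H s xi - F xi))\<^sup>2)) \<le> 0"
  proof (rule ennreal_le_epsilon)
   fix e :: real assume e: "e > 0"
   have "\<forall>\<^sub>F k in sequentially. (NN xi. ennreal ((cmod (T k s xi - F xi))\<^sup>2)) < ennreal e"
    using conv by (rule order_tendstoD) (simp add: e)
   then have "\<forall>\<^sub>F k in sequentially. (NN xi. ennreal ((cmod (T k s xi - F xi))\<^sup>2)) \<le> ennreal e"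
    by eventually_elim simp
   from l2_fatou[OF _ _ lim this] show "(NN xi. ennreal ((cmod (H s xi - F xi))\<^sup>2)) \<le> 0 + ennreal e" by simp
  qed
  then have "(NN xi. ennreal ((cmod (H s xi - F xi))\<^sup>2)) = 0" by simp
  then have "AE xi in lborel. F xi = H s xi" by (subst (asm) nn_integral_0_iff_AE) auto
  then show ?thesis by (rule has_fourier_cong_AE[OF F Hb])
 qed
 then show ?thesis using Hm by blast
qed

section \<open>The two nonlinear terms as trilinear operators\<close>

lemma trilinear_quadratic:
 assumes \<alpha>: "\<alpha> \<noteq> 0" and \<sigma>: "\<sigma> > 0"
 shows "\<exists>C. trilinear (k2 \<sigma>) (om2 \<alpha> \<beta>) (\<lambda>xi x y. x) (\<lambda>xi x y. xi - x) (\<lambda>xi x y. y) C"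
proof -
 obtain C where C: "C \<ge> 0" "\<And>\<tau> xi. 0 < \<tau> \<Longrightarrow> \<tau> \<le> 1 \<Longrightarrow> (NN x. NN y. ennreal ((ker \<tau> xi (k2 \<sigma> xi x y) (om2 \<alpha> \<beta> xi x y) x (xi - x) y)\<^sup>2)) \<le> ennreal (C * sqrt \<tau>)"
  using kernel2_bound[OF \<alpha> \<sigma>, of \<beta>] by blast
 show ?thesis
 proof (intro exI[of _ C] trilinear.intro C)
  fix F1 F2 F3 :: "real => ennreal"
  assume [measurable]: "F1 \<in> bm" "F2 \<in> bm" "F3 \<in> bm"
  have "(NN xi. NN x. NN y. F1 x * F2 (xi - x) * F3 y)
    = (NN xi. NN x. F1 x * F2 (xi - x) * (NN y. F3 y))"
   by (subst nn_integral_cmult) auto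
  also have "... = (NN x. NN xi. F1 x * F2 (xi - x) * (NN y. F3 y))"
   by (rule lborel_pair.Fubini') measurable
  also have "... = (NN x. F1 x * (NN xi. F2 (xi - x)) * (NN y. F3 y))"
   by (simp add: nn_integral_multc nn_integral_cmult)
  also have "... = (NN x. F1 x) * (NN x. F2 x) * (NN x. F3 x)"
   by (simp add: nn_integral_shift nn_integral_multc)
  finally show "(NN xi. NN x. NN y. F1 x * F2 (xi - x) * F3 y)
    \<le> (NN x. F1 x) * (NN x. F2 x) * (NN x. F3 x)" by simp
 qed (unfold k2_def om2_def phi_def split_beta, measurable)
qed

lemma trilinear_cubic:
 assumes \<alpha>: "\<alpha> \<noteq> 0" and \<sigma>: "\<sigma> > 0"
 shows "\<exists>C. trilinear (k3 \<sigma>) (om3 \<alpha> \<beta>) (\<lambda>xi x y. x) (\<lambda>xi x y. y) (\<lambda>xi x y. xi - x - y) C"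
proof -
 obtain C where C: "C \<ge> 0" "\<And>\<tau> xi. 0 < \<tau> \<Longrightarrow> \<tau> \<le> 1 \<Longrightarrow> (NN x. NN y. ennreal ((ker \<tau> xi (k3 \<sigma> xi x y) (om3 \<alpha> \<beta> xi x y) x y (xi - x - y))\<^sup>2)) \<le> ennreal (C * sqrt \<tau>)"
  using kernel3_bound[OF \<alpha> \<sigma>, of \<beta>] by blast
 show ?thesis
 proof (intro exI[of _ C] trilinear.intro C)
  fix F1 F2 F3 :: "real => ennreal"
  assume [measurable]: "F1 \<in> bm" "F2 \<in> bm" "F3 \<in> bm"
  have sh: "(NN xi. F3 (xi - x - y)) = (NN x. F3 x)" for x y
   using nn_integral_shift[of F3 "x + y"] by (simp add: diff_diff_eq)
  have "(NN xi. NN x. NN y. F1 x * F2 y * F3 (xi - x - y))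
    = (NN x. NN xi. NN y. F1 x * F2 y * F3 (xi - x - y))"
   by (rule lborel_pair.Fubini') measurable
  also have "... = (NN x. NN y. NN xi. F1 x * F2 y * F3 (xi - x - y))"
   by (intro nn_integral_cong lborel_pair.Fubini') measurable
  also have "... = (NN x. F1 x) * (NN x. F2 x) * (NN x. F3 x)"
   by (simp add: nn_integral_cmult nn_integral_multc sh)
  finally show "(NN xi. NN x. NN y. F1 x * F2 y * F3 (xi - x - y))
    \<le> (NN x. F1 x) * (NN x. F2 x) * (NN x. F3 x)" by simp
 qed (unfold k3_def om3_def phi_def split_beta, measurable)
qed

section \<open>The damping term after the change of unknown\<close>

lemma weight_cancel: "cmod (of_real (exp x) * (cis t * (of_real (exp (- x)) * z))) = cmod z"
proof -
 have "of_real (exp x) * (cis t * (of_real (exp (- x)) * z)) = cis t * z * of_real (exp x * exp (- x))"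
  by (simp only: of_real_mult mult_ac)
 moreover have "exp x * exp (- x) = 1" by (simp add: exp_minus)
 ultimately show ?thesis by (simp only: norm_mult norm_cis) simp
qed

text \<open>The assumption \<open>mult\<close> packages the conclusion of \<open>mult_GF\<close>,
  that is, the regularity of \<open>a\<close> at the rate \<open>\<sigma>\<close>.\<close>

locale damping =
 fixes a :: "real => real" and \<sigma> \<alpha> \<beta> A :: real
 assumes \<sigma>: "\<sigma> > 0" and A0: "A \<ge> 0" and am: "continuous_on UNIV a"
  and mult: "\<And>F. GF \<sigma> F \<Longrightarrow> \<exists>H. has_fourier (\<lambda>x. of_real (a x) * ift F x) H \<and> GF \<sigma> H \<and>
   wl2 \<sigma> H \<le> ennreal (4 * A\<^sup>2) * wl2 \<sigma> F"
begin

text \<open>\<open>uh v\<close> undoes the change of unknown \<open>v(t,xi) = exp(\<sigma>|xi|) exp(i t \<phi>(xi)) u^(t,xi)\<close>.\<close>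

definition uh :: "path => path" where
 "uh v s xi = cis (- s * phi \<alpha> \<beta> xi) * (of_real (exp (- (\<sigma> * \<bar>xi\<bar>))) * v s xi)"

text \<open>Zero outside the time interval, so that it is square integrable for every s, as
  \<open>has_fourier_joint\<close> requires.\<close>

definition wf :: "real => path => path" where
 "wf \<tau> v s x = (if s \<in> {0..\<tau>} then of_real (a x) * ift (uh v s) x else 0)"

definition Hr :: "real => path => path" where
 "Hr \<tau> v = (SOME H. joint H \<and> (\<forall>s. has_fourier (wf \<tau> v s) (H s)))"

text \<open>The zero path is singled out because \<open>Hr\<close> is an arbitrary choice of
  transform: for that path it is known to vanish only almost everywhere, while \<open>evo\<close>
  asks for the zero function.\<close>

definition Hop :: "real => path => path" where
 "Hop \<tau> v s xi = (if v = (\<lambda>_ _. 0) then 0 else - (cis (s * phi \<alpha> \<beta> xi) * (of_real (exp (\<sigma> * \<bar>xi\<bar>)) * Hr \<tau> v s xi)))"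

lemma phi_measurable [measurable]: "phi \<alpha> \<beta> \<in> bm"
 unfolding phi_def[abs_def] by measurable

lemma a_measurable [measurable]: "a \<in> bm"
 by (rule borel_measurable_continuous_onI[OF am])

lemma uh_measurable:
 assumes "joint v"
 shows "joint (uh v)"
proof -
 note [measurable (raw)] = compose2_measurable[OF assms]
 show ?thesis unfolding uh_def by measurable
qed

lemma wf_measurable:
 assumes "joint v"
 shows "joint (wf \<tau> v)"
proof -
 note [measurable (raw)] = compose2_measurable[OF uh_measurable[OF assms]]
 have [measurable]: "(\<lambda>(z, xi). uh v (fst z) xi * cis (snd z * xi)) \<in> borel_measurable ((borel \<Otimes>\<^sub>M borel) \<Otimes>\<^sub>M lborel)"
  unfolding split_beta by measurable
 show ?thesis unfolding wf_def ift_def by measurable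
qed

lemma uh_weight: "cmod (of_real (exp (\<sigma> * \<bar>xi\<bar>)) * uh v s xi) = cmod (v s xi)"
 unfolding uh_def by (rule weight_cancel)

lemma uh_diff: "uh v s xi - uh v' s xi = cis (- s * phi \<alpha> \<beta> xi) * (of_real (exp (- (\<sigma> * \<bar>xi\<bar>))) * (v s xi - v' s xi))"
 by (simp add: uh_def algebra_simps)

lemma path_measurable: "nb \<tau> v0 g r \<Longrightarrow> joint (pth v0 g)"
 by (rule pth_measurable[OF nb_good])

lemma uh_GF:
 assumes n: "nb \<tau> v0 g r" and r: "r < \<infinity>" and s: "s \<in> {0..\<tau>}"
 shows "GF \<sigma> (uh (pth v0 g) s)"
 unfolding GF_def uh_weight
 using le_less_trans[OF nb_l2sq[OF n s] r] measurable_Pair2_section[OF uh_measurable[OF path_measurable[OF n]]]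
 by (rule conjI[rotated])

lemma Hr_spec:
 assumes n: "nb \<tau> v0 g r" and r: "r < \<infinity>"
 shows "joint (Hr \<tau> (pth v0 g)) \<and> (\<forall>s. has_fourier (wf \<tau> (pth v0 g) s) (Hr \<tau> (pth v0 g) s))"
proof -
 have "square_integrable (wf \<tau> (pth v0 g) s)" for s
 proof (cases "s \<in> {0..\<tau>}")
  case True
  then show ?thesis using mult[OF uh_GF[OF n r True]] by (auto simp: wf_def[abs_def] has_fourier_def)
 next
  case False
  then have "wf \<tau> (pth v0 g) s = (\<lambda>_. 0)" by (auto simp: wf_def fun_eq_iff)
  then show ?thesis by (simp add: square_integrable_def)
 qed
 from someI_ex[OF has_fourier_joint[OF wf_measurable[OF path_measurable[OF n]] this]] show ?thesis
  unfolding Hr_def[of \<tau> "pth v0 g"] .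
qed

lemma Hop_measurable:
 assumes n: "nb \<tau> v0 g r" and r: "r < \<infinity>"
 shows "joint (Hop \<tau> (pth v0 g))"
proof -
 note [measurable (raw)] = compose2_measurable[OF conjunct1[OF Hr_spec[OF n r]]]
 show ?thesis unfolding Hop_def by measurable
qed

lemma Hop_char:
 assumes n: "nb \<tau> v0 g r" and r: "r < \<infinity>" and s: "s \<in> {0..\<tau>}"
 shows "\<exists>H. has_fourier (\<lambda>x. of_real (a x) * ift (uh (pth v0 g) s) x) H \<and>
  (\<forall>xi. Hop \<tau> (pth v0 g) s xi = - (cis (s * phi \<alpha> \<beta> xi) * (of_real (exp (\<sigma> * \<bar>xi\<bar>)) * H xi)))"
proof (cases "pth v0 g = (\<lambda>_ _. 0)")
 case True
 then show ?thesis using has_fourier_0 by (intro exI[of _ "\<lambda>_. 0"]) (simp add: Hop_def uh_def ift_def)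
next
 case False
 have "wf \<tau> (pth v0 g) s = (\<lambda>x. of_real (a x) * ift (uh (pth v0 g) s) x)" using s by (simp add: wf_def fun_eq_iff)
 moreover have "has_fourier (wf \<tau> (pth v0 g) s) (Hr \<tau> (pth v0 g) s)" using Hr_spec[OF n r] by blast
 ultimately show ?thesis using False by (intro exI[of _ "Hr \<tau> (pth v0 g) s"]) (simp add: Hop_def)
qed

text \<open>The transforms behind the two values are chosen independently, but by linearity their
  difference agrees almost everywhere with a transform of \<open>a\<close> times the difference, to
  which \<open>mult\<close> applies. The weight in that estimate is the one built into the
  unknown.\<close>

lemma Hop_diff:
 assumes n: "nb \<tau> v0 g r" and r: "r < \<infinity>" and n': "nb \<tau> v0' g' r'" and r': "r' < \<infinity>" and s: "s \<in> {0..\<tau>}"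
 shows "l2sq (\<lambda>xi. Hop \<tau> (pth v0 g) s xi - Hop \<tau> (pth v0' g') s xi) \<le> ennreal (4 * A\<^sup>2) * l2sq (\<lambda>xi. pth v0 g s xi - pth v0' g' s xi)"
proof -
 obtain H where H: "has_fourier (\<lambda>x. of_real (a x) * ift (uh (pth v0 g) s) x) H" "\<And>xi. Hop \<tau> (pth v0 g) s xi = - (cis (s * phi \<alpha> \<beta> xi) * (of_real (exp (\<sigma> * \<bar>xi\<bar>)) * H xi))"
  using Hop_char[OF n r s] by blast
 obtain H' where H': "has_fourier (\<lambda>x. of_real (a x) * ift (uh (pth v0' g') s) x) H'" "\<And>xi. Hop \<tau> (pth v0' g') s xi = - (cis (s * phi \<alpha> \<beta> xi) * (of_real (exp (\<sigma> * \<bar>xi\<bar>)) * H' xi))"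
  using Hop_char[OF n' r' s] by blast
 let ?F = "\<lambda>xi. uh (pth v0 g) s xi - uh (pth v0' g') s xi"
 note G = uh_GF[OF n r s] uh_GF[OF n' r' s]
 have id: "ift ?F x = ift (uh (pth v0 g) s) x - ift (uh (pth v0' g') s) x" for x
  using ift_add[OF GF_integrable0[OF G(1) \<sigma>] GF_integrable0[OF GF_cmult[OF G(2), of "-1"] \<sigma>], of x] ift_cmult[of "-1" "uh (pth v0' g') s" x] by simp
 have eq: "(\<lambda>x. of_real (a x) * ift ?F x) = (\<lambda>x. of_real (a x) * ift (uh (pth v0 g) s) x - of_real (a x) * ift (uh (pth v0' g') s) x)"
  unfolding id right_diff_distrib ..
 obtain K where K: "has_fourier (\<lambda>x. of_real (a x) * ift ?F x) K"
  "wl2 \<sigma> K \<le> ennreal (4 * A\<^sup>2) * wl2 \<sigma> ?F"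
  using mult[OF GF_diff[OF G]] by blast
 have "AE xi in lborel. K xi = H xi - H' xi"
  by (rule has_fourier_unique_AE[OF K(1)[unfolded eq] has_fourier_diff[OF H(1) H'(1)]])
 then have "l2sq (\<lambda>xi. Hop \<tau> (pth v0 g) s xi - Hop \<tau> (pth v0' g') s xi) = wl2 \<sigma> K"
 proof (intro nn_integral_cong_AE, elim AE_mp, intro AE_I2 impI)
  fix xi assume k: "K xi = H xi - H' xi"
  have "Hop \<tau> (pth v0 g) s xi - Hop \<tau> (pth v0' g') s xi = - (cis (s * phi \<alpha> \<beta> xi) * (of_real (exp (\<sigma> * \<bar>xi\<bar>)) * K xi))"
   unfolding H H' k by (simp add: algebra_simps)
  then show "ennreal ((cmod (Hop \<tau> (pth v0 g) s xi - Hop \<tau> (pth v0' g') s xi))\<^sup>2) = ennreal ((cmod (of_real (exp (\<sigma> * \<bar>xi\<bar>)) * K xi))\<^sup>2)"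
   by (simp add: norm_mult)
 qed
 also have "... \<le> ennreal (4 * A\<^sup>2) * wl2 \<sigma> ?F" by (rule K(2))
 also have "wl2 \<sigma> ?F = l2sq (\<lambda>xi. pth v0 g s xi - pth v0' g' s xi)"
  unfolding uh_diff weight_cancel ..
 finally show ?thesis .
qed

text \<open>Cauchy-Schwarz in time gives one factor tau, integrating the bound of
  \<open>Hop_diff\<close> over [0, tau] another; tau^2 <= sqrt tau brings the result to the form
  shared with the nonlinear terms.\<close>

lemma Hop_lipschitz:
 assumes \<tau>: "0 < \<tau>" "\<tau> \<le> 1" and n: "nb \<tau> v0 g r" and r: "r < \<infinity>" and n': "nb \<tau> v0' g' r'" and r': "r' < \<infinity>"
  and D: "dom \<tau> (\<lambda>xi. v0 xi - v0' xi) (\<lambda>s xi. g s xi - g' s xi) D"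
 shows "(NN xi. (tnorm \<tau> (\<lambda>s. Hop \<tau> (pth v0 g) s xi - Hop \<tau> (pth v0' g') s xi))\<^sup>2)
   \<le> ennreal (4 * A\<^sup>2 * sqrt \<tau>) * (sqn D)"
proof -
 note [measurable (raw)] = compose2_measurable[OF Hop_measurable[OF n r]] compose2_measurable[OF Hop_measurable[OF n' r']]
 let ?h = "\<lambda>s xi. Hop \<tau> (pth v0 g) s xi - Hop \<tau> (pth v0' g') s xi"
 have "(tnorm \<tau> (\<lambda>s. ?h s xi))\<^sup>2 \<le> ennreal \<tau> * (NN s. ennreal ((cmod (?h s xi))\<^sup>2) * indicator {0..\<tau>} s)" for xi
 proof -
  have "(tnorm \<tau> (\<lambda>s. ?h s xi))\<^sup>2
   = (NN s. (ennreal (cmod (?h s xi)) * indicator {0..\<tau>} s) * indicator {0..\<tau>} s)\<^sup>2"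
   by (intro arg_cong[where f="\<lambda>x. x\<^sup>2"] nn_integral_cong) (auto simp: indicator_def)
  also have "... \<le> (NN s. (ennreal (cmod (?h s xi)) * indicator {0..\<tau>} s)\<^sup>2) * (NN s. (indicator {0..\<tau>} s)\<^sup>2)"
   by (rule Cauchy_Schwarz_nn_integral) measurable
  also have "(NN s. (indicator {0..\<tau>} s)\<^sup>2) = (NN s. indicator {0..\<tau>} s)"
   by (intro nn_integral_cong) (auto simp: indicator_def)
  also have "... = ennreal \<tau>" using \<tau> by simp
  also have "(NN s. (ennreal (cmod (?h s xi)) * indicator {0..\<tau>} s)\<^sup>2) = (NN s. ennreal ((cmod (?h s xi))\<^sup>2) * indicator {0..\<tau>} s)"
   by (intro nn_integral_cong) (auto simp: indicator_def ennreal_power)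
  finally show ?thesis by (simp only: mult.commute)
 qed
 then have "(NN xi. (tnorm \<tau> (\<lambda>s. ?h s xi))\<^sup>2)
   \<le> (NN xi. ennreal \<tau> * (NN s. ennreal ((cmod (?h s xi))\<^sup>2) * indicator {0..\<tau>} s))"
  by (intro nn_integral_mono)
 also have "... = ennreal \<tau> * (NN xi. NN s. ennreal ((cmod (?h s xi))\<^sup>2) * indicator {0..\<tau>} s)"
  by (rule nn_integral_cmult) measurable
 also have "(NN xi. NN s. ennreal ((cmod (?h s xi))\<^sup>2) * indicator {0..\<tau>} s)
   = (NN s. NN xi. ennreal ((cmod (?h s xi))\<^sup>2) * indicator {0..\<tau>} s)"
  by (rule lborel_pair.Fubini') measurable
 also have "... \<le> (NN s. ennreal (4 * A\<^sup>2) * (sqn D) * indicator {0..\<tau>} s)"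
 proof (rule nn_integral_mono)
  fix s
  have "l2sq (?h s) \<le> ennreal (4 * A\<^sup>2) * (sqn D)" if s: "s \<in> {0..\<tau>}"
  proof (rule order_trans[OF Hop_diff[OF n r n' r' s]], intro mult_left_mono nn_integral_mono)
   fix xi
   have "pth (\<lambda>xi. v0 xi - v0' xi) (\<lambda>s xi. g s xi - g' s xi) s xi = pth v0 g s xi - pth v0' g' s xi"
    using pth_add[OF nb_good[OF n] good_uminus[OF nb_good[OF n']], of s xi] s by (simp add: pth_uminus)
   moreover have "ennreal (cmod (pth (\<lambda>xi. v0 xi - v0' xi) (\<lambda>s xi. g s xi - g' s xi) s xi)) \<le> D xi"
    using D s unfolding dom_def by blast
   ultimately have "ennreal (cmod (pth v0 g s xi - pth v0' g' s xi)) \<le> D xi" by (simp only:)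
   then have "(ennreal (cmod (pth v0 g s xi - pth v0' g' s xi)))\<^sup>2 \<le> (D xi)\<^sup>2" by (rule power_mono) simp
   then show "ennreal ((cmod (pth v0 g s xi - pth v0' g' s xi))\<^sup>2) \<le> (D xi)\<^sup>2" by (simp add: ennreal_power)
  qed simp
  then show "(NN xi. ennreal ((cmod (?h s xi))\<^sup>2) * indicator {0..\<tau>} s) \<le> ennreal (4 * A\<^sup>2) * (sqn D) * indicator {0..\<tau>} s"
   by (cases "s \<in> {0..\<tau>}") auto
 qed
 also have "... = ennreal (4 * A\<^sup>2) * (sqn D) * ennreal \<tau>"
  using \<tau> by (subst nn_integral_cmult_indicator) auto
 finally have "(NN xi. (tnorm \<tau> (\<lambda>s. ?h s xi))\<^sup>2)
   \<le> ennreal \<tau> * (ennreal (4 * A\<^sup>2) * (sqn D) * ennreal \<tau>)" by (simp add: mult_left_mono)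
 also have "... = ennreal \<tau> * ennreal (4 * A\<^sup>2) * ennreal \<tau> * (sqn D)" by (simp only: mult_ac)
 also have "ennreal \<tau> * ennreal (4 * A\<^sup>2) * ennreal \<tau> = ennreal (\<tau> * (4 * A\<^sup>2) * \<tau>)"
  using \<tau> by (simp add: ennreal_mult)
 also have "ennreal (\<tau> * (4 * A\<^sup>2) * \<tau>) \<le> ennreal (4 * A\<^sup>2 * sqrt \<tau>)"
 proof (rule ennreal_leI)
  have "\<tau> \<le> sqrt \<tau>" using \<tau> by (intro real_le_rsqrt) (simp add: power2_eq_square mult_left_le)
  moreover have "\<tau> * \<tau> \<le> \<tau>" using \<tau> by (simp add: mult_left_le)
  ultimately have "\<tau> * \<tau> \<le> sqrt \<tau>" by linarith
  then have "4 * A\<^sup>2 * (\<tau> * \<tau>) \<le> 4 * A\<^sup>2 * sqrt \<tau>" by (intro mult_left_mono) auto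
  then show "\<tau> * (4 * A\<^sup>2) * \<tau> \<le> 4 * A\<^sup>2 * sqrt \<tau>" by (simp add: mult_ac)
 qed
 finally show ?thesis by (simp add: mult_right_mono)
qed

lemma evo_instance:
 assumes "trilinear kA oA a1 a2 a3 CA" "trilinear kB oB b1 b2 b3 CB"
 shows "evo kA oA a1 a2 a3 CA kB oB b1 b2 b3 CB Hop (4 * A\<^sup>2)"
proof (intro evo.intro evo_axioms.intro assms)
 show "Hop \<tau> (\<lambda>_ _. 0) = (\<lambda>_ _. 0)" for \<tau> by (simp add: Hop_def fun_eq_iff)
qed (auto intro: Hop_measurable Hop_lipschitz)

end

section \<open>Identification of the right-hand side with \<open>lower_terms\<close>\<close>

lemma P2_integral_iterated:
 fixes h :: "real \<times> real => complex"
 assumes [measurable]: "h \<in> borel_measurable P2" and f: "(NN x. NN y. ennreal (cmod (h (x, y)))) < \<infinity>"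
 shows "integrable P2 h" and "(LINT z|P2. h z) = (LINT x|lborel. LINT y|lborel. h (x, y))"
proof -
 show i: "integrable P2 h"
 proof (rule integrableI_bounded)
  have "(\<integral>\<^sup>+z. ennreal (norm (h z)) \<partial>P2) = (NN x. NN y. ennreal (cmod (h (x, y))))"
   by (rule lborel.nn_integral_fst[symmetric]) measurable
  then show "(\<integral>\<^sup>+z. ennreal (norm (h z)) \<partial>P2) < \<infinity>" using f by simp
 qed measurable
 show "(LINT z|P2. h z) = (LINT x|lborel. LINT y|lborel. h (x, y))"
  by (rule lborel_pair.integral_fst'[OF i, symmetric])
qed

lemma conv_cmult_right: "conv F (\<lambda>xi. G xi / c) xi = conv F G xi / c"
 by (simp add: conv_def)

lemma nn_product_shift_le:
 assumes [measurable]: "F \<in> bm"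
 shows "(NN y. ennreal (cmod (F y * F (z - y)))) \<le> l2sq F"
proof -
 have "(NN y. ennreal (cmod (F y * F (z - y)))) \<le> (NN y. ennreal (1/2) * (ennreal ((cmod (F y))\<^sup>2) + ennreal ((cmod (F (z - y)))\<^sup>2)))"
 proof (rule nn_integral_mono)
  fix y
  have "cmod (F y * F (z - y)) \<le> 1/2 * ((cmod (F y))\<^sup>2 + (cmod (F (z - y)))\<^sup>2)"
   using sum_squares_bound[of "cmod (F y)" "cmod (F (z - y))"] by (simp add: norm_mult)
  then have "ennreal (cmod (F y * F (z - y))) \<le> ennreal (1/2 * ((cmod (F y))\<^sup>2 + (cmod (F (z - y)))\<^sup>2))" by (rule ennreal_leI)
  also have "... = ennreal (1/2) * ennreal ((cmod (F y))\<^sup>2 + (cmod (F (z - y)))\<^sup>2)" by (rule ennreal_mult) auto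
  also have "ennreal ((cmod (F y))\<^sup>2 + (cmod (F (z - y)))\<^sup>2) = ennreal ((cmod (F y))\<^sup>2) + ennreal ((cmod (F (z - y)))\<^sup>2)"
   by (rule ennreal_plus) auto
  finally show "ennreal (cmod (F y * F (z - y))) \<le> ennreal (1/2) * (ennreal ((cmod (F y))\<^sup>2) + ennreal ((cmod (F (z - y)))\<^sup>2))" .
 qed
 also have "... = ennreal (1/2) * (l2sq F + (NN y. ennreal ((cmod (F (z - y)))\<^sup>2)))"
  by (subst nn_integral_cmult, measurable, subst nn_integral_add) auto
 also have "(NN y. ennreal ((cmod (F (z - y)))\<^sup>2)) = l2sq F"
 proof -
  have "(NN y. ennreal ((cmod (F (z - y)))\<^sup>2)) = l2sq (\<lambda>y. F (- y))"
   using nn_integral_shift[of "\<lambda>y. ennreal ((cmod (F (- y)))\<^sup>2)" z] by simp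
  then show ?thesis using l2sq_reflect[of F] by simp
 qed
 also have "ennreal (1/2) * (l2sq F + l2sq F) = ennreal (1/2) * (ennreal 2 * l2sq F)" by (simp add: mult_2)
 also have "... = ennreal (1/2 * 2) * l2sq F" by (simp only: mult.assoc[symmetric]) (subst ennreal_mult[symmetric], auto)
 finally show ?thesis by simp
qed

text \<open>Phases and weights of the inputs cancel against those of the kernel and leave the ones
  of the output frequency. \<open>A\<close>, \<open>B\<close>, \<open>C\<close> stand for values of
  \<open>phi\<close>, and \<open>p\<close>, \<open>q\<close>, \<open>r\<close> for absolute values
  of frequencies.\<close>

lemma phase_weight2:
 "of_real (exp (- (\<sigma> * (p + q - r)))) * (cis (s * (A - B - C)) * ((cis (s * B) * (of_real (exp (\<sigma> * p)) * f)) * (cis (s * C) * (of_real (exp (\<sigma> * q)) * g))))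
  = cis (s * A) * of_real (exp (\<sigma> * r)) * (f * g)"
proof -
 have e: "exp (- (\<sigma> * (p + q - r))) * exp (\<sigma> * p) * exp (\<sigma> * q) = exp (\<sigma> * r)" by (simp add: exp_add[symmetric] algebra_simps)
 have c: "cis (s * (A - B - C)) * cis (s * B) * cis (s * C) = cis (s * A)" by (simp add: cis_mult algebra_simps)
 have "of_real (exp (- (\<sigma> * (p + q - r)))) * (cis (s * (A - B - C)) * ((cis (s * B) * (of_real (exp (\<sigma> * p)) * f)) * (cis (s * C) * (of_real (exp (\<sigma> * q)) * g))))
  = (cis (s * (A - B - C)) * cis (s * B) * cis (s * C)) * of_real (exp (- (\<sigma> * (p + q - r))) * exp (\<sigma> * p) * exp (\<sigma> * q)) * (f * g)"
  by (simp only: of_real_mult mult_ac)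
 then show ?thesis unfolding e c .
qed

lemma phase_weight3:
 "of_real (exp (- (\<sigma> * (p + q + o' - r)))) * (cis (s * (A - B - C - D)) * ((cis (s * B) * (of_real (exp (\<sigma> * p)) * f)) * (cis (s * C) * (of_real (exp (\<sigma> * q)) * g)) * (cis (s * D) * (of_real (exp (\<sigma> * o')) * h))))
  = cis (s * A) * of_real (exp (\<sigma> * r)) * (f * (g * h))"
proof -
 have e: "exp (- (\<sigma> * (p + q + o' - r))) * exp (\<sigma> * p) * exp (\<sigma> * q) * exp (\<sigma> * o') = exp (\<sigma> * r)" by (simp add: exp_add[symmetric] algebra_simps)
 have c: "cis (s * (A - B - C - D)) * cis (s * B) * cis (s * C) * cis (s * D) = cis (s * A)" by (simp add: cis_mult algebra_simps)
 have "of_real (exp (- (\<sigma> * (p + q + o' - r)))) * (cis (s * (A - B - C - D)) * ((cis (s * B) * (of_real (exp (\<sigma> * p)) * f)) * (cis (s * C) * (of_real (exp (\<sigma> * q)) * g)) * (cis (s * D) * (of_real (exp (\<sigma> * o')) * h))))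
  = (cis (s * (A - B - C - D)) * cis (s * B) * cis (s * C) * cis (s * D)) * of_real (exp (- (\<sigma> * (p + q + o' - r))) * exp (\<sigma> * p) * exp (\<sigma> * q) * exp (\<sigma> * o')) * (f * (g * h))"
  by (simp only: of_real_mult mult_ac)
 then show ?thesis unfolding e c .
qed

definition sq2 :: "(real => complex) => real => complex" where
 "sq2 F xi = conv F F xi / of_real (2 * pi)"

definition cub3 :: "(real => complex) => real => complex" where
 "cub3 F xi = conv F (sq2 F) xi / of_real (2 * pi)"

text \<open>The transform of \<open>lower_terms\<close> at \<open>ift F\<close>, with
  \<open>H\<close> in the role of the transform of \<open>a\<close> times
  \<open>ift F\<close>.\<close>

definition Lhat :: "real => real => (real => complex) => (real => complex) => real => complex" where
 "Lhat \<mu> lam F H xi = of_real \<mu> * (\<i> * of_real xi * sq2 F xi) + of_real lam * (\<i> * of_real xi * cub3 F xi) + H xi"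

text \<open>Each convolution and the final derivative give up some exponential rate: 3/4 of
  \<open>\<sigma>\<close> is left after the square, 5/8 after the cube, 1/2 after differentiation.
  This loss is harmless, because the rate is only needed to give the integrand a meaning pointwise
  and under \<open>S_group\<close>, not to estimate it.\<close>

lemma lower_terms_ift:
 assumes F: "GF \<sigma> F" and \<sigma>: "\<sigma> > 0" and H: "GF \<sigma> H" and HF: "has_fourier (\<lambda>x. of_real (a x) * ift F x) H" and ac: "continuous_on UNIV a"
 shows "lower_terms \<mu> lam a (ift F) = ift (Lhat \<mu> lam F H)" and "GF (\<sigma> / 2) (Lhat \<mu> lam F H)"
proof -
 have F3: "GF (3 * \<sigma> / 4) F" by (rule GF_mono[OF F]) (use \<sigma> in simp)
 have div: "GF \<rho> (\<lambda>xi. G xi / of_real (2 * pi))" if "GF \<rho> G" for \<rho> G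
  using GF_cmult[OF that, of "1 / of_real (2 * pi)"] by simp
 have c2: "GF (3 * \<sigma> / 4) (sq2 F)"
  unfolding sq2_def[abs_def] by (intro div GF_conv[OF F F]) (use \<sigma> in auto)
 have c3: "GF (5 * \<sigma> / 8) (cub3 F)"
  unfolding cub3_def[abs_def] by (intro div GF_conv[OF F3 c2]) (use \<sigma> in auto)
 have i: "integrable lborel F" "integrable lborel (sq2 F)"
  by (rule GF_integrable0[OF F \<sigma>], rule GF_integrable0[OF c2]) (use \<sigma> in simp)
 have p2: "ift F y ^ 2 = ift (sq2 F) y" for y
  unfolding sq2_def[abs_def] power2_eq_square by (rule ift_mult[OF i(1) i(1)])
 have p3: "ift F y ^ 3 = ift (cub3 F) y" for y
 proof -
  have "ift F y ^ 3 = ift F y * ift F y ^ 2" by (simp add: power3_eq_cube power2_eq_square)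
  also have "... = ift (cub3 F) y" unfolding p2 cub3_def[abs_def] by (rule ift_mult[OF i])
  finally show ?thesis .
 qed
 have d2: "vector_derivative (\<lambda>y. ift F y ^ 2) (at x) = ift (\<lambda>xi. \<i> * of_real xi * sq2 F xi) x" for x
  unfolding p2 by (rule vector_derivative_at[OF ift_vector_derivative[OF c2]]) (use \<sigma> in simp)
 have d3: "vector_derivative (\<lambda>y. ift F y ^ 3) (at x) = ift (\<lambda>xi. \<i> * of_real xi * cub3 F xi) x" for x
  unfolding p3 by (rule vector_derivative_at[OF ift_vector_derivative[OF c3]]) (use \<sigma> in simp)
 have g2: "GF (\<sigma> / 2) (\<lambda>xi. of_real \<mu> * (\<i> * of_real xi * sq2 F xi))"
  using GF_cmult[OF GF_poly[OF c2, of "\<sigma> / 2" 1], of "of_real \<mu> * \<i>"] \<sigma> by (simp add: mult.assoc)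
 have g3: "GF (\<sigma> / 2) (\<lambda>xi. of_real lam * (\<i> * of_real xi * cub3 F xi))"
  using GF_cmult[OF GF_poly[OF c3, of "\<sigma> / 2" 1], of "of_real lam * \<i>"] \<sigma> by (simp add: mult.assoc)
 have gH: "GF (\<sigma> / 2) H" by (rule GF_mono[OF H]) (use \<sigma> in simp)
 show "GF (\<sigma> / 2) (Lhat \<mu> lam F H)" unfolding Lhat_def[abs_def] by (intro GF_add g2 g3 gH)
 have \<sigma>2: "\<sigma> / 2 > 0" using \<sigma> by simp
 have aF: "(\<lambda>x. of_real (a x) * ift F x) = ift H"
  by (rule has_fourier_eq_ift[OF HF _ H \<sigma>]) (intro continuous_on_mult continuous_on_of_real ac ift_continuous[OF i(1)])
 show "lower_terms \<mu> lam a (ift F) = ift (Lhat \<mu> lam F H)"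
 proof
  fix x
  have aFx: "of_real (a x) * ift F x = ift H x" using fun_cong[OF aF, of x] .
  have "ift (Lhat \<mu> lam F H) x = ift (\<lambda>xi. of_real \<mu> * (\<i> * of_real xi * sq2 F xi)) x + ift (\<lambda>xi. of_real lam * (\<i> * of_real xi * cub3 F xi)) x + ift H x"
   unfolding Lhat_def[abs_def] ift_add[OF GF_integrable0[OF GF_add[OF g2 g3] \<sigma>2] GF_integrable0[OF gH \<sigma>2]]
    ift_add[OF GF_integrable0[OF g2 \<sigma>2] GF_integrable0[OF g3 \<sigma>2]] ..
  then show "lower_terms \<mu> lam a (ift F) x = ift (Lhat \<mu> lam F H) x"
   unfolding lower_terms_def d2 d3 aFx ift_cmult by simp
 qed
qed

text \<open>In the constants the minus sign is Duhamel's, the imaginary unit belongs to the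
  derivative (its factor xi sits in the kernels), and every convolution brings 1/(2 pi).\<close>

locale flow = damping a \<sigma> \<alpha> \<beta> A +
 evo "k2 \<sigma>" "om2 \<alpha> \<beta>" "\<lambda>xi x y. x" "\<lambda>xi x y. xi - x" "\<lambda>xi x y. y" CA
  "k3 \<sigma>" "om3 \<alpha> \<beta>" "\<lambda>xi x y. x" "\<lambda>xi x y. y" "\<lambda>xi x y. xi - x - y" CB
  "- (\<i> * complex_of_real \<mu> / of_real (2 * pi))" "- (\<i> * complex_of_real lam / of_real (2 * pi) / of_real (2 * pi))"
  "damping.Hop a \<sigma> \<alpha> \<beta>" "4 * A\<^sup>2"
 for a \<sigma> \<alpha> \<beta> A CA CB and \<mu> lam :: real
begin

text \<open>Instantiated with coordinate projections, these rules would send the measurability prover into a loop.\<close>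

declare A.raw [measurable del (raw)] B.raw [measurable del (raw)]

lemma v_of_uh: "v s xi = cis (s * phi \<alpha> \<beta> xi) * (of_real (exp (\<sigma> * \<bar>xi\<bar>)) * uh v s xi)"
proof -
 have "cis (s * phi \<alpha> \<beta> xi) * (of_real (exp (\<sigma> * \<bar>xi\<bar>)) * uh v s xi)
  = (cis (s * phi \<alpha> \<beta> xi) * cis (- s * phi \<alpha> \<beta> xi)) * of_real (exp (\<sigma> * \<bar>xi\<bar>) * exp (- (\<sigma> * \<bar>xi\<bar>))) * v s xi"
  unfolding uh_def by (simp only: of_real_mult mult_ac)
 also have "cis (s * phi \<alpha> \<beta> xi) * cis (- s * phi \<alpha> \<beta> xi) = 1" by (simp add: cis_mult)
 also have "exp (\<sigma> * \<bar>xi\<bar>) * exp (- (\<sigma> * \<bar>xi\<bar>)) = 1" by (simp add: exp_minus)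
 finally show ?thesis by simp
qed

text \<open>The dummy variable integrates to 1: \<open>chi\<close> is the indicator of the same unit
  interval that \<open>k2\<close> carries, so the double integral collapses to a
  convolution.\<close>

lemma quadratic_term:
 assumes F: "GF \<sigma> (uh v s)"
 shows "A.N v v X s xi = cis (s * phi \<alpha> \<beta> xi) * (of_real (exp (\<sigma> * \<bar>xi\<bar>)) * (of_real xi * conv (uh v s) (uh v s) xi))"
proof -
 let ?F = "uh v s" and ?c = "of_real xi * (cis (s * phi \<alpha> \<beta> xi) * of_real (exp (\<sigma> * \<bar>xi\<bar>)))"
 have [measurable]: "?F \<in> bm" using F by (simp add: GF_def)
 have G2: "l2sq ?F < \<infinity>" using square_integrable_nn[OF GF_sq[OF F]] \<sigma> by simp
 define h where "h z = ?c * (?F (fst z) * ?F (xi - fst z)) * indicator {0..1} (snd z)" for z :: "real \<times> real"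
 have [measurable]: "h \<in> borel_measurable P2" unfolding h_def by measurable
 have "A.N v v X s xi = (LINT z|P2. h z)"
  unfolding A.N_def
 proof (rule Bochner_Integration.integral_cong[OF refl])
  fix z :: "real \<times> real"
  have ind: "(of_real (indicator {0..1} (snd z)) :: complex) * (w * chi (snd z)) = w * indicator {0..1} (snd z)" for w
   by (auto simp: chi_def indicator_def)
  have "of_real (k2 \<sigma> xi (fst z) (snd z)) * (cis (s * om2 \<alpha> \<beta> xi (fst z) (snd z)) * (v s (fst z) * v s (xi - fst z) * X s (snd z)))
   = of_real xi * (of_real (exp (- (\<sigma> * (\<bar>fst z\<bar> + \<bar>xi - fst z\<bar> - \<bar>xi\<bar>)))) * (cis (s * (phi \<alpha> \<beta> xi - phi \<alpha> \<beta> (fst z) - phi \<alpha> \<beta> (xi - fst z))) * (v s (fst z) * v s (xi - fst z))))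
     * (of_real (indicator {0..1} (snd z)) * chi (snd z))"
   unfolding k2_def om2_def pth_zero_g by (simp only: of_real_mult mult_ac)
  also have "... = of_real xi * (cis (s * phi \<alpha> \<beta> xi) * of_real (exp (\<sigma> * \<bar>xi\<bar>)) * (?F (fst z) * ?F (xi - fst z))) * (of_real (indicator {0..1} (snd z)) * chi (snd z))"
   unfolding v_of_uh[of v s "fst z"] v_of_uh[of v s "xi - fst z"] phase_weight2 ..
  also have "... = h z"
   using ind[of "?c * (?F (fst z) * ?F (xi - fst z))"] unfolding h_def by (simp only: mult_ac)
  finally show "of_real (k2 \<sigma> xi (fst z) (snd z)) * (cis (s * om2 \<alpha> \<beta> xi (fst z) (snd z)) * (v s (fst z) * v s (xi - fst z) * X s (snd z))) = h z" .
 qed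
 also have "... = (LINT x|lborel. LINT y|lborel. h (x, y))"
 proof (rule P2_integral_iterated(2))
  have "(NN x. NN y. ennreal (cmod (h (x, y))))
   = (NN x. NN y. ennreal (cmod ?c) * ennreal (cmod (?F x * ?F (xi - x))) * indicator {0..1::real} y)"
  proof (intro nn_integral_cong)
   fix x y :: real
   show "ennreal (cmod (h (x, y))) = ennreal (cmod ?c) * ennreal (cmod (?F x * ?F (xi - x))) * indicator {0..1::real} y"
    unfolding h_def fst_conv snd_conv
    by (cases "y \<in> {0..1}") (simp_all only: norm_mult ennreal_mult norm_ge_zero indicator_simps mult_nonneg_nonneg, simp_all)
  qed
  also have "... = ennreal (cmod ?c) * (NN x. ennreal (cmod (?F x * ?F (xi - x))))"
   by (simp add: nn_integral_cmult_indicator nn_integral_cmult)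
  also have "... < \<infinity>" using le_less_trans[OF nn_product_shift_le[of ?F xi] G2] by (simp add: ennreal_mult_less_top)
  finally show "(NN x. NN y. ennreal (cmod (h (x, y)))) < \<infinity>" .
 qed measurable
 also have "... = (LINT x|lborel. ?c * (?F x * ?F (xi - x)))"
 proof (rule Bochner_Integration.integral_cong[OF refl])
  fix x
  have "(LINT y|lborel. h (x, y)) = (LINT y|lborel. indicator {0..1::real} y *\<^sub>R (?c * (?F x * ?F (xi - x))))"
   by (intro Bochner_Integration.integral_cong refl) (auto simp: h_def indicator_def)
  also have "... = ?c * (?F x * ?F (xi - x))" by simp
  finally show "(LINT y|lborel. h (x, y)) = ?c * (?F x * ?F (xi - x))" .
 qed
 also have "... = ?c * conv ?F ?F xi" unfolding conv_def by simp
 finally show ?thesis by (simp only: mult_ac)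
qed

lemma cubic_term:
 assumes F: "GF \<sigma> (uh v s)"
 shows "B.N v v v s xi = cis (s * phi \<alpha> \<beta> xi) * (of_real (exp (\<sigma> * \<bar>xi\<bar>)) * (of_real xi * conv (uh v s) (conv (uh v s) (uh v s)) xi))"
proof -
 let ?F = "uh v s" and ?c = "of_real xi * (cis (s * phi \<alpha> \<beta> xi) * of_real (exp (\<sigma> * \<bar>xi\<bar>)))"
 have [measurable]: "?F \<in> bm" using F by (simp add: GF_def)
 have G2: "l2sq ?F < \<infinity>" using square_integrable_nn[OF GF_sq[OF F]] \<sigma> by simp
 have G1: "(NN x. ennreal (cmod (?F x))) < \<infinity>" using GF_integrable0[OF F \<sigma>] by (simp add: integrable_iff_bounded)
 define h where "h z = ?c * (?F (fst z) * (?F (snd z) * ?F (xi - fst z - snd z)))" for z :: "real \<times> real"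
 have [measurable]: "h \<in> borel_measurable P2" unfolding h_def by measurable
 have "B.N v v v s xi = (LINT z|P2. h z)"
  unfolding B.N_def
 proof (rule Bochner_Integration.integral_cong[OF refl])
  fix z :: "real \<times> real"
  have "of_real (k3 \<sigma> xi (fst z) (snd z)) * (cis (s * om3 \<alpha> \<beta> xi (fst z) (snd z)) * (v s (fst z) * v s (snd z) * v s (xi - fst z - snd z)))
   = of_real xi * (of_real (exp (- (\<sigma> * (\<bar>fst z\<bar> + \<bar>snd z\<bar> + \<bar>xi - fst z - snd z\<bar> - \<bar>xi\<bar>)))) *
     (cis (s * (phi \<alpha> \<beta> xi - phi \<alpha> \<beta> (fst z) - phi \<alpha> \<beta> (snd z) - phi \<alpha> \<beta> (xi - fst z - snd z))) * (v s (fst z) * v s (snd z) * v s (xi - fst z - snd z))))"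
   unfolding k3_def om3_def by (simp only: of_real_mult mult_ac)
  also have "... = of_real xi * (cis (s * phi \<alpha> \<beta> xi) * of_real (exp (\<sigma> * \<bar>xi\<bar>)) * (?F (fst z) * (?F (snd z) * ?F (xi - fst z - snd z))))"
   unfolding v_of_uh[of v s "fst z"] v_of_uh[of v s "snd z"] v_of_uh[of v s "xi - fst z - snd z"] phase_weight3 ..
  also have "... = h z" unfolding h_def by (simp only: mult_ac)
  finally show "of_real (k3 \<sigma> xi (fst z) (snd z)) * (cis (s * om3 \<alpha> \<beta> xi (fst z) (snd z)) * (v s (fst z) * v s (snd z) * v s (xi - fst z - snd z))) = h z" .
 qed
 also have "... = (LINT x|lborel. LINT y|lborel. h (x, y))"
 proof (rule P2_integral_iterated(2))
  have "(NN x. NN y. ennreal (cmod (h (x, y))))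
   = (NN x. NN y. ennreal (cmod ?c * cmod (?F x)) * ennreal (cmod (?F y * ?F (xi - x - y))))"
  proof (intro nn_integral_cong)
   fix x y
   have "cmod (h (x, y)) = (cmod ?c * cmod (?F x)) * cmod (?F y * ?F (xi - x - y))" by (simp only: h_def norm_mult fst_conv snd_conv mult.assoc)
   then show "ennreal (cmod (h (x, y))) = ennreal (cmod ?c * cmod (?F x)) * ennreal (cmod (?F y * ?F (xi - x - y)))"
    by (simp only:) (rule ennreal_mult, auto)
  qed
  also have "... = (NN x. ennreal (cmod ?c * cmod (?F x)) * (NN y. ennreal (cmod (?F y * ?F (xi - x - y)))))"
  proof (rule nn_integral_cong)
   fix x
   have "(\<lambda>y. ennreal (cmod (?F y * ?F (xi - x - y)))) \<in> borel_measurable lborel" by measurable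
   then show "(NN y. ennreal (cmod ?c * cmod (?F x)) * ennreal (cmod (?F y * ?F (xi - x - y))))
    = ennreal (cmod ?c * cmod (?F x)) * (NN y. ennreal (cmod (?F y * ?F (xi - x - y))))"
    by (rule nn_integral_cmult)
  qed
  also have "... \<le> (NN x. ennreal (cmod ?c * cmod (?F x)) * l2sq ?F)"
   by (rule nn_integral_mono, rule mult_left_mono[OF nn_product_shift_le]) auto
  also have "... = (NN x. ennreal (cmod ?c) * ennreal (cmod (?F x)) * l2sq ?F)"
   by (rule nn_integral_cong, subst ennreal_mult) auto
  also have "... = ennreal (cmod ?c) * (NN x. ennreal (cmod (?F x))) * l2sq ?F"
   by (subst nn_integral_multc, measurable, subst nn_integral_cmult) auto
  also have "... < \<infinity>" using G1 G2 by (simp add: ennreal_mult_less_top)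
  finally show "(NN x. NN y. ennreal (cmod (h (x, y)))) < \<infinity>" .
 qed measurable
 also have "... = (LINT x|lborel. ?c * (?F x * conv ?F ?F (xi - x)))"
  unfolding h_def fst_conv snd_conv conv_def by (simp only: integral_mult_right_zero)
 also have "... = ?c * conv ?F (conv ?F ?F) xi" unfolding conv_def[of _ "conv ?F ?F"] by (simp only: integral_mult_right_zero)
 finally show ?thesis by (simp only: mult_ac)
qed

lemma rhs_lower_terms:
 assumes n: "nb \<tau> v0 g r" and r: "r < \<infinity>" and s: "s \<in> {0..\<tau>}"
 shows "\<exists>H. GF \<sigma> H \<and> has_fourier (\<lambda>x. of_real (a x) * ift (uh (pth v0 g) s) x) H \<and>
  (\<forall>xi. rhs \<tau> (pth v0 g) s xi = - (cis (s * phi \<alpha> \<beta> xi) * (of_real (exp (\<sigma> * \<bar>xi\<bar>)) * Lhat \<mu> lam (uh (pth v0 g) s) H xi)))"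
proof -
 let ?v = "pth v0 g"
 have F: "GF \<sigma> (uh ?v s)" by (rule uh_GF[OF n r s])
 obtain H where H: "has_fourier (\<lambda>x. of_real (a x) * ift (uh ?v s) x) H"
  "\<And>xi. Hop \<tau> ?v s xi = - (cis (s * phi \<alpha> \<beta> xi) * (of_real (exp (\<sigma> * \<bar>xi\<bar>)) * H xi))"
  using Hop_char[OF n r s] by blast
 obtain K where K: "has_fourier (\<lambda>x. of_real (a x) * ift (uh ?v s) x) K" "GF \<sigma> K" using mult[OF F] by blast
 have "H \<in> bm" using H(1) by (simp add: has_fourier_def square_integrable_def)
 then have "GF \<sigma> H" by (rule GF_cong_AE[OF K(2) has_fourier_unique_AE[OF K(1) H(1)]])
 moreover have "rhs \<tau> ?v s xi = - (cis (s * phi \<alpha> \<beta> xi) * (of_real (exp (\<sigma> * \<bar>xi\<bar>)) * Lhat \<mu> lam (uh ?v s) H xi))" for xi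
 proof -
  have s3: "cub3 (uh ?v s) xi = conv (uh ?v s) (conv (uh ?v s) (uh ?v s)) xi / of_real (2 * pi) / of_real (2 * pi)"
   unfolding cub3_def sq2_def[abs_def] conv_cmult_right ..
  show ?thesis
   unfolding rhs_def quadratic_term[OF F] cubic_term[OF F] H(2) Lhat_def s3 sq2_def by (simp add: algebra_simps)
 qed
 ultimately show ?thesis using H(1) by blast
qed

end

section \<open>From fixed points to strong solutions\<close>

lemma pth_0: "good \<tau> v0 g \<Longrightarrow> 0 \<le> \<tau> \<Longrightarrow> pth v0 g 0 xi = v0 xi"
 by (rule prim_0[OF good_prim])

lemma pth_tendsto:
 assumes g: "good \<tau> v0 g" and X: "\<And>i. X i \<in> {0..\<tau>}" and lim: "X \<longlonglongrightarrow> t"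
 shows "(\<lambda>i. pth v0 g (X i) xi) \<longlonglongrightarrow> pth v0 g t xi"
 unfolding pth_def set_lebesgue_integral_def
proof (intro tendsto_add tendsto_const)
 have m: "(\<lambda>s. g s xi) \<in> bm"
  using g compose2_measurable[of g "\<lambda>s. s" borel "\<lambda>_. xi"] unfolding good_def by simp
 note [measurable] = m
 have t: "t \<in> {0..\<tau>}" using closed_sequentially[of "{0..\<tau>}" X t] X lim by simp
 show "(\<lambda>i. LINT s|lborel. indicator {0..X i} s *\<^sub>R g s xi) \<longlonglongrightarrow> (LINT s|lborel. indicator {0..t} s *\<^sub>R g s xi)"
 proof (rule integral_dominated_convergence)
  show "integrable lborel (\<lambda>s. norm (indicator {0..\<tau>} s *\<^sub>R g s xi))"
   using g by (intro integrable_norm) (simp add: good_def set_integrable_def)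
  show "AE s in lborel. norm (indicator {0..X i} s *\<^sub>R g s xi) \<le> norm (indicator {0..\<tau>} s *\<^sub>R g s xi)" for i
   using X[of i] by (intro AE_I2) (auto simp: indicator_def)
  show "AE s in lborel. (\<lambda>i. indicator {0..X i} s *\<^sub>R g s xi) \<longlonglongrightarrow> indicator {0..t} s *\<^sub>R g s xi"
  proof (rule AE_mp[OF AE_lborel_singleton[of t]], intro AE_I2 impI)
   fix s assume "s \<noteq> t"
   then consider "s < t" | "t < s" by linarith
   then have "\<forall>\<^sub>F i in sequentially. indicator {0..X i} s *\<^sub>R g s xi = indicator {0..t} s *\<^sub>R g s xi"
   proof cases
    case 1
    have "\<forall>\<^sub>F i in sequentially. s < X i" by (rule order_tendstoD(1)[OF lim 1])
    then show ?thesis by eventually_elim (use 1 in \<open>simp add: indicator_def\<close>)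
   next
    case 2
    have "\<forall>\<^sub>F i in sequentially. X i < s" by (rule order_tendstoD(2)[OF lim 2])
    then show ?thesis by eventually_elim (use 2 in \<open>simp add: indicator_def\<close>)
   qed
   then show "(\<lambda>i. indicator {0..X i} s *\<^sub>R g s xi) \<longlonglongrightarrow> indicator {0..t} s *\<^sub>R g s xi" by (rule tendsto_eventually)
  qed
 qed measurable
qed

text \<open>Half of the exponential beats W, and Cauchy-Schwarz does the rest. This is the absolute
  convergence that allows time and frequency integrals to be exchanged in
  \<open>duhamel\<close>.\<close>

lemma weighted_L2_integral_finite:
 assumes \<sigma>: "\<sigma> > 0" and [measurable]: "U \<in> bm" and f: "(sqn U) < \<infinity>"
 shows "(NN xi. ennreal (exp (- (\<sigma> * \<bar>xi\<bar>))) * (ennreal (W xi) * U xi)) < \<infinity>"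
proof -
 let ?C = "1 + 8 / \<sigma>\<^sup>2"
 have w: "exp (- (\<sigma> * \<bar>xi\<bar>)) * W xi \<le> ?C * exp (- (\<sigma> / 2 * \<bar>xi\<bar>))" for xi
 proof -
  have f: "(fact 2 / (\<sigma> / 2) ^ 2) = 8 / \<sigma>\<^sup>2" by (simp add: power_divide fact_numeral)
  have "\<bar>xi\<bar> ^ 2 \<le> (fact 2 / (\<sigma> / 2) ^ 2) * exp (\<sigma> / 2 * \<bar>xi\<bar>)" by (rule pow_le_exp) (use \<sigma> in auto)
  then have "xi\<^sup>2 \<le> 8 / \<sigma>\<^sup>2 * exp (\<sigma> / 2 * \<bar>xi\<bar>)" unfolding f power2_abs .
  moreover have "1 \<le> exp (\<sigma> / 2 * \<bar>xi\<bar>)" using \<sigma> by simp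
  ultimately have "W xi \<le> ?C * exp (\<sigma> / 2 * \<bar>xi\<bar>)" unfolding W_def distrib_right by linarith
  then have "exp (- (\<sigma> * \<bar>xi\<bar>)) * W xi \<le> exp (- (\<sigma> * \<bar>xi\<bar>)) * (?C * exp (\<sigma> / 2 * \<bar>xi\<bar>))" by (rule mult_left_mono) simp
  also have "... = ?C * (exp (- (\<sigma> * \<bar>xi\<bar>)) * exp (\<sigma> / 2 * \<bar>xi\<bar>))" by (simp only: mult_ac)
  also have "exp (- (\<sigma> * \<bar>xi\<bar>)) * exp (\<sigma> / 2 * \<bar>xi\<bar>) = exp (- (\<sigma> / 2 * \<bar>xi\<bar>))" by (simp add: exp_add[symmetric])
  finally show ?thesis .
 qed
 have C: "?C \<ge> 0" by simp
 have "(NN xi. ennreal (exp (- (\<sigma> * \<bar>xi\<bar>))) * (ennreal (W xi) * U xi)) \<le> (NN xi. ennreal ?C * (ennreal (exp (- (\<sigma> / 2 * \<bar>xi\<bar>))) * U xi))"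
 proof (rule nn_integral_mono)
  fix xi
  have "ennreal (exp (- (\<sigma> * \<bar>xi\<bar>))) * ennreal (W xi) = ennreal (exp (- (\<sigma> * \<bar>xi\<bar>)) * W xi)"
   by (rule ennreal_mult[symmetric]) (use less_imp_le[OF W_pos] in auto)
  also have "... \<le> ennreal (?C * exp (- (\<sigma> / 2 * \<bar>xi\<bar>)))" by (rule ennreal_leI[OF w])
  also have "... = ennreal ?C * ennreal (exp (- (\<sigma> / 2 * \<bar>xi\<bar>)))" by (rule ennreal_mult[OF C]) simp
  finally show "ennreal (exp (- (\<sigma> * \<bar>xi\<bar>))) * (ennreal (W xi) * U xi) \<le> ennreal ?C * (ennreal (exp (- (\<sigma> / 2 * \<bar>xi\<bar>))) * U xi)"
   unfolding mult.assoc[symmetric] by (rule mult_right_mono) simp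
 qed
 also have "... = ennreal ?C * (NN xi. ennreal (exp (- (\<sigma> / 2 * \<bar>xi\<bar>))) * U xi)" by (rule nn_integral_cmult) measurable
 also have "... < \<infinity>"
 proof -
  have "(NN xi. ennreal (exp (- (\<sigma> / 2 * \<bar>xi\<bar>))) * U xi)\<^sup>2 \<le> (NN xi. (ennreal (exp (- (\<sigma> / 2 * \<bar>xi\<bar>))))\<^sup>2) * (sqn U)"
   by (rule Cauchy_Schwarz_nn_integral) measurable
  also have "(NN xi. (ennreal (exp (- (\<sigma> / 2 * \<bar>xi\<bar>))))\<^sup>2) = (NN xi. ennreal (exp (- (\<sigma> * \<bar>xi\<bar>))))"
  proof (rule nn_integral_cong)
   fix xi
   have "(exp (- (\<sigma> / 2 * \<bar>xi\<bar>)))\<^sup>2 = exp (- (\<sigma> * \<bar>xi\<bar>))" unfolding power2_eq_square exp_add[symmetric] by simp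
   then show "(ennreal (exp (- (\<sigma> / 2 * \<bar>xi\<bar>))))\<^sup>2 = ennreal (exp (- (\<sigma> * \<bar>xi\<bar>)))" by (simp add: ennreal_power)
  qed
  also have "... = ennreal (2 / \<sigma>)" by (rule nn_exp_abs[OF \<sigma>])
  finally have "(NN xi. ennreal (exp (- (\<sigma> / 2 * \<bar>xi\<bar>))) * U xi)\<^sup>2 < \<infinity>" by (rule le_less_trans) (use f in \<open>simp add: ennreal_mult_less_top\<close>)
  then have "(NN xi. ennreal (exp (- (\<sigma> / 2 * \<bar>xi\<bar>))) * U xi) < \<infinity>"
   by (auto simp: power2_eq_square ennreal_mult_less_top less_top)
  then show ?thesis by (simp add: ennreal_mult_less_top)
 qed
 finally show ?thesis .
qed

text \<open>At time 0 the Duhamel integral runs over a null set and the phase of the group is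
  trivial.\<close>

lemma strong_solution_initial:
 assumes u: "strong_solution \<alpha> \<beta> \<mu> lam a \<sigma> \<tau> u0 u" and \<tau>: "0 \<le> \<tau>" and \<sigma>: "\<sigma> > 0" and u0: "u0 \<in> Gspace \<sigma>"
 shows "u 0 = u0"
proof
 fix x
 have z: "(LINT s:{0..0::real}|lborel. f s) = (0::complex)" for f
  unfolding set_lebesgue_integral_def
  by (rule integral_eq_zero_AE, rule AE_mp[OF AE_lborel_singleton[of 0]], intro AE_I2) (auto simp: indicator_def)
 have "u 0 x = S_group \<alpha> \<beta> 0 u0 x"
  using u \<tau> z unfolding strong_solution_def by (simp del: atLeastAtMost_singleton)
 also have "... = ift (\<lambda>xi. cis (- 0 * (\<alpha> * xi ^ 5 - \<beta> * xi ^ 3)) * fourier u0 xi) x"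
  unfolding S_group_ift[OF Gspace_has_fourier(1)[OF u0] Gspace_GF[OF u0] \<sigma>, of \<alpha> \<beta> 0] ..
 also have "... = ift (fourier u0) x" by simp
 also have "... = u0 x" using Gspace_ift[OF u0 \<sigma>] by metis
 finally show "u 0 x = u0 x" .
qed

text \<open>Boundedness, which \<open>cfunspace\<close> also demands, is automatic on a compact
  interval.\<close>

lemma mspace_CGmetric:
 "mspace (CGmetric \<sigma> \<tau>) = {u. (\<forall>t\<in>{0..\<tau>}. u t \<in> Gspace \<sigma>) \<and> u \<in> extensional {0..\<tau>}
   \<and> continuous_map (top_of_set {0..\<tau>}) (mtopology_of (Gmetric \<sigma>)) u}"
proof -
 have "compactin (top_of_set {0..\<tau>}) (topspace (top_of_set {0..\<tau>}))"
  by (simp add: compactin_subtopology compact_Icc)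
 then show ?thesis
  unfolding CGmetric_def by (subst compactin_mspace_cfunspace) (auto simp: mspace_Gmetric)
qed

context flow
begin

definition sol :: "real => (real => complex) => path => path" where
 "sol \<tau> v0 g t = (if t \<in> {0..\<tau>} then ift (uh (pth v0 g) t) else undefined)"

lemma sol_Gspace: "nb \<tau> v0 g (ennreal R) \<Longrightarrow> t \<in> {0..\<tau>} \<Longrightarrow> sol \<tau> v0 g t \<in> Gspace \<sigma>"
 unfolding sol_def by (simp add: ift_in_Gspace[OF uh_GF \<sigma>])

lemma uh_cancel: "of_real (exp (\<sigma> * \<bar>xi\<bar>)) * uh v s xi = cis (- s * phi \<alpha> \<beta> xi) * v s xi"
proof -
 have "of_real (exp (\<sigma> * \<bar>xi\<bar>)) * uh v s xi = of_real (exp (\<sigma> * \<bar>xi\<bar>) * exp (- (\<sigma> * \<bar>xi\<bar>))) * (cis (- s * phi \<alpha> \<beta> xi) * v s xi)"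
  unfolding uh_def by (simp only: of_real_mult mult_ac)
 also have "exp (\<sigma> * \<bar>xi\<bar>) * exp (- (\<sigma> * \<bar>xi\<bar>)) = 1" by (simp add: exp_minus)
 finally show ?thesis by simp
qed

text \<open>At each frequency the path is continuous in time, and U + U dominates the differences
  for all times at once, so dominated convergence gives continuity in the norm. Here the supremum in
  time inside the L^2 norm pays off.\<close>

lemma sol_continuous:
 assumes n: "nb \<tau> v0 g (ennreal R)"
 shows "continuous_map (top_of_set {0..\<tau>}) (mtopology_of (Gmetric \<sigma>)) (sol \<tau> v0 g)"
proof -
 interpret Metric_space "Gspace \<sigma>" "Gdist \<sigma>" by (rule Metric_space_G)
 obtain U where U: "dom \<tau> v0 g U" "(sqn U) \<le> ennreal R" using n by (auto simp: nb_def)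
 have gd: "good \<tau> v0 g" by (rule nb_good[OF n])
 have Um [measurable]: "U \<in> bm" using U(1) by (simp add: dom_def)
 have pm [measurable]: "pth v0 g s \<in> bm" for s
  by (rule measurable_Pair2_section[OF pth_measurable[OF gd]])
 have bU: "ennreal (cmod (pth v0 g s xi)) \<le> U xi" if "s \<in> {0..\<tau>}" for s xi using U(1) that unfolding dom_def by blast
 have cisc: "isCont cis z" for z
  using continuous_on_cis[OF continuous_on_id, of UNIV] by (simp add: continuous_on_eq_continuous_at)
 let ?d = "\<lambda>t s. Gdist \<sigma> (sol \<tau> v0 g t) (sol \<tau> v0 g s)"
 have lim: "(?d t \<longlongrightarrow> 0) (at t within {0..\<tau>})" if t: "t \<in> {0..\<tau>}" for t
  unfolding tendsto_at_iff_sequentially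
 proof (intro allI impI)
  fix Y assume Y: "\<forall>i. Y i \<in> {0..\<tau>} - {t}" "Y \<longlonglongrightarrow> t"
  have Yi: "Y i \<in> {0..\<tau>}" for i using Y by auto
  have sq: "ennreal ((?d t (Y i))\<^sup>2) = l2sq (\<lambda>xi. cis (- t * phi \<alpha> \<beta> xi) * pth v0 g t xi - cis (- Y i * phi \<alpha> \<beta> xi) * pth v0 g (Y i) xi)" for i
   using t Yi[of i] Gdist_ift[OF uh_GF[OF n _ t] uh_GF[OF n _ Yi[of i]] \<sigma>]
   by (simp add: sol_def right_diff_distrib uh_cancel)
  have "(\<lambda>i. l2sq (\<lambda>xi. cis (- t * phi \<alpha> \<beta> xi) * pth v0 g t xi - cis (- Y i * phi \<alpha> \<beta> xi) * pth v0 g (Y i) xi)) \<longlonglongrightarrow> integral\<^sup>N lborel (\<lambda>xi :: real. 0)"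
  proof (rule nn_integral_dominated_convergence[where w="\<lambda>xi. (U xi + U xi)\<^sup>2"])
   show "AE xi in lborel. ennreal ((cmod (cis (- t * phi \<alpha> \<beta> xi) * pth v0 g t xi - cis (- Y i * phi \<alpha> \<beta> xi) * pth v0 g (Y i) xi))\<^sup>2) \<le> (U xi + U xi)\<^sup>2" for i
   proof (intro AE_I2)
    fix xi
    let ?z = "cis (- t * phi \<alpha> \<beta> xi) * pth v0 g t xi - cis (- Y i * phi \<alpha> \<beta> xi) * pth v0 g (Y i) xi"
    have "cmod ?z \<le> cmod (pth v0 g t xi) + cmod (pth v0 g (Y i) xi)"
     by (rule order_trans[OF norm_triangle_ineq4]) (simp add: norm_mult)
    then have "ennreal (cmod ?z) \<le> ennreal (cmod (pth v0 g t xi)) + ennreal (cmod (pth v0 g (Y i) xi))"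
     by (simp add: ennreal_plus[symmetric] ennreal_leI del: ennreal_plus)
    also have "... \<le> U xi + U xi" by (intro add_mono bU t Yi)
    finally have "(ennreal (cmod ?z))\<^sup>2 \<le> (U xi + U xi)\<^sup>2" by (rule power_mono) simp
    then show "ennreal ((cmod ?z)\<^sup>2) \<le> (U xi + U xi)\<^sup>2" by (simp add: ennreal_power)
   qed
   have "(NN xi. (U xi + U xi)\<^sup>2) \<le> 2 * (sqn U) + 2 * (sqn U)" by (rule nn_sq_add_le) auto
   also have "... < \<infinity>" using le_less_trans[OF U(2)] by (simp add: ennreal_mult_less_top)
   finally show "(NN xi. (U xi + U xi)\<^sup>2) < \<infinity>" .
   show "AE xi in lborel. (\<lambda>i. ennreal ((cmod (cis (- t * phi \<alpha> \<beta> xi) * pth v0 g t xi - cis (- Y i * phi \<alpha> \<beta> xi) * pth v0 g (Y i) xi))\<^sup>2)) \<longlonglongrightarrow> 0"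
   proof (intro AE_I2)
    fix xi
    have c: "(\<lambda>i. cis (- Y i * phi \<alpha> \<beta> xi)) \<longlonglongrightarrow> cis (- t * phi \<alpha> \<beta> xi)"
     by (rule isCont_tendsto_compose[OF cisc]) (intro tendsto_mult tendsto_minus Y(2) tendsto_const)
    have "(\<lambda>i. ennreal ((cmod (cis (- t * phi \<alpha> \<beta> xi) * pth v0 g t xi - cis (- Y i * phi \<alpha> \<beta> xi) * pth v0 g (Y i) xi))\<^sup>2))
     \<longlonglongrightarrow> ennreal ((cmod (cis (- t * phi \<alpha> \<beta> xi) * pth v0 g t xi - cis (- t * phi \<alpha> \<beta> xi) * pth v0 g t xi))\<^sup>2)"
     by (intro tendsto_ennrealI tendsto_power tendsto_norm tendsto_diff tendsto_mult tendsto_const c pth_tendsto[OF gd Yi Y(2)])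
    then show "(\<lambda>i. ennreal ((cmod (cis (- t * phi \<alpha> \<beta> xi) * pth v0 g t xi - cis (- Y i * phi \<alpha> \<beta> xi) * pth v0 g (Y i) xi))\<^sup>2)) \<longlonglongrightarrow> 0" by simp
   qed
  qed measurable
  then have "(\<lambda>i. ennreal ((?d t (Y i))\<^sup>2)) \<longlonglongrightarrow> ennreal 0" unfolding sq by simp
  then have "(\<lambda>i. (?d t (Y i))\<^sup>2) \<longlonglongrightarrow> 0" by (subst (asm) tendsto_ennreal_iff) auto
  then have "(\<lambda>i. sqrt ((?d t (Y i))\<^sup>2)) \<longlonglongrightarrow> sqrt 0" by (intro tendsto_real_sqrt)
  then show "(?d t \<circ> Y) \<longlonglongrightarrow> 0" by (simp add: o_def)
 qed
 show ?thesis
  unfolding mtopology_of_def mspace_Gmetric mdist_Gmetric continuous_map_to_metric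
 proof (intro ballI allI impI)
  fix t and \<epsilon> :: real assume t: "t \<in> topspace (top_of_set {0..\<tau>})" and \<epsilon>: "0 < \<epsilon>"
  then have t': "t \<in> {0..\<tau>}" by simp
  have "\<forall>\<^sub>F s in at t within {0..\<tau>}. ?d t s < \<epsilon>" using lim[OF t'] \<epsilon> by (rule order_tendstoD)
  then obtain d where d: "d > 0" "\<And>s. s \<in> {0..\<tau>} \<Longrightarrow> s \<noteq> t \<Longrightarrow> dist s t < d \<Longrightarrow> ?d t s < \<epsilon>"
   by (auto simp: eventually_at)
  show "\<exists>U. openin (top_of_set {0..\<tau>}) U \<and> t \<in> U \<and> (\<forall>y\<in>U. sol \<tau> v0 g y \<in> mball (sol \<tau> v0 g t) \<epsilon>)"
  proof (intro exI[of _ "{0..\<tau>} \<inter> ball t d"] conjI ballI)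
   show "openin (top_of_set {0..\<tau>}) ({0..\<tau>} \<inter> ball t d)" by (rule openin_open_Int) simp
   show "t \<in> {0..\<tau>} \<inter> ball t d" using t' d(1) by simp
   fix y assume y: "y \<in> {0..\<tau>} \<inter> ball t d"
   have "?d t y < \<epsilon>"
   proof (cases "y = t")
    case True then show ?thesis using \<epsilon> mdist_zero[OF sol_Gspace[OF n t']] by simp
   next
    case False then show ?thesis using d(2)[of y] y by (simp add: dist_commute)
   qed
   then show "sol \<tau> v0 g y \<in> mball (sol \<tau> v0 g t) \<epsilon>" using sol_Gspace[OF n] t' y by (simp add: in_mball)
  qed
 qed
qed

lemma sol_mspace:
 assumes n: "nb \<tau> v0 g (ennreal R)"
 shows "sol \<tau> v0 g \<in> mspace (CGmetric \<sigma> \<tau>)"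
 unfolding mspace_CGmetric using sol_Gspace[OF n] sol_continuous[OF n] by (auto simp: extensional_def sol_def)

text \<open>The integral equation for v at almost every frequency, multiplied by \<open>m\<close>,
  which undoes the change of unknown at time t, and then inverted. The work is Fubini for time and
  frequency.\<close>

lemma duhamel:
 assumes \<tau>: "0 < \<tau>" "\<tau> \<le> 1" and n: "nb \<tau> v0 g (ennreal R)" and f: "fixpt \<tau> v0 g" and t: "t \<in> {0..\<tau>}"
 defines "m \<equiv> \<lambda>xi. cis (- t * phi \<alpha> \<beta> xi) * of_real (exp (- (\<sigma> * \<bar>xi\<bar>)))"
 shows "set_integrable lborel {0..t} (\<lambda>s. ift (\<lambda>xi. m xi * rhs \<tau> (pth v0 g) s xi) x)"
  and "ift (uh (pth v0 g) t) x = ift (\<lambda>xi. m xi * v0 xi) x + (LINT s:{0..t}|lborel. ift (\<lambda>xi. m xi * rhs \<tau> (pth v0 g) s xi) x)"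
proof -
 let ?r = "rhs \<tau> (pth v0 g)"
 have Rf: "ennreal R < \<infinity>" by simp
 have gd: "good \<tau> v0 g" by (rule nb_good[OF n])
 have v0m [measurable]: "v0 \<in> bm" using gd by (simp add: good_def)
 note [measurable (raw)] = compose2_measurable[OF rhs_measurable[OF \<tau> n Rf]]
 have mm [measurable]: "m \<in> bm" unfolding m_def by measurable
 have pm [measurable]: "pth v0 g t \<in> bm" by (rule measurable_Pair2_section[OF pth_measurable[OF gd]])
 obtain U where U: "dom \<tau> v0 g U" "(sqn U) \<le> ennreal R" using n by (auto simp: nb_def)
 have Um: "U \<in> bm" using U(1) by (simp add: dom_def)
 have tn: "(tnorm \<tau> (\<lambda>s. g s xi)) \<le> ennreal (W xi) * U xi" for xi using U(1) unfolding dom_def by blast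
 have mn: "cmod (m xi) = exp (- (\<sigma> * \<bar>xi\<bar>))" for xi by (simp add: m_def norm_mult)
 define h where "h z = indicator {0..t} (fst z) *\<^sub>R (m (snd z) * ?r (fst z) (snd z) * cis (x * snd z))" for z
 have hm [measurable]: "h \<in> borel_measurable P2" unfolding h_def by measurable
 have alg: "(p * b) * i = (p * (v + i) + (-1) * (p * v)) * b" for p b i v :: complex by algebra
 have solves: "AE xi in lborel. (tnorm \<tau> (\<lambda>s. ?r s xi))
   = (tnorm \<tau> (\<lambda>s. g s xi)) \<and> (\<forall>t\<in>{0..\<tau>}. pth v0 g t xi = v0 xi + (LINT s:{0..t}|lborel. ?r s xi))"
  by (rule fixpt_solves[OF \<tau> n f])
 have ih: "integrable P2 h"
 proof (rule P2_integral_iterated(1)[OF hm])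
  have "(NN s. NN xi. ennreal (cmod (h (s, xi)))) = (NN xi. NN s. ennreal (cmod (h (s, xi))))"
   by (rule lborel_pair.Fubini') measurable
  also have "... \<le> (NN xi. ennreal (exp (- (\<sigma> * \<bar>xi\<bar>))) * (ennreal (W xi) * U xi))"
  proof (rule nn_integral_mono_AE, rule AE_mp[OF solves], intro AE_I2 impI)
   fix xi
   assume e: "(tnorm \<tau> (\<lambda>s. ?r s xi))
    = (tnorm \<tau> (\<lambda>s. g s xi)) \<and> (\<forall>t\<in>{0..\<tau>}. pth v0 g t xi = v0 xi + (LINT s:{0..t}|lborel. ?r s xi))"
   have "(NN s. ennreal (cmod (h (s, xi)))) \<le> (NN s. ennreal (exp (- (\<sigma> * \<bar>xi\<bar>))) * (ennreal (cmod (?r s xi)) * indicator {0..\<tau>} s))"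
   proof (rule nn_integral_mono)
    fix s
    have "ennreal (cmod (m xi * ?r s xi * cis (x * xi))) = ennreal (exp (- (\<sigma> * \<bar>xi\<bar>))) * ennreal (cmod (?r s xi))"
     by (simp add: norm_mult mn ennreal_mult)
    then show "ennreal (cmod (h (s, xi))) \<le> ennreal (exp (- (\<sigma> * \<bar>xi\<bar>))) * (ennreal (cmod (?r s xi)) * indicator {0..\<tau>} s)"
     using t by (cases "s \<in> {0..t}") (simp_all add: h_def)
   qed
   also have "... = ennreal (exp (- (\<sigma> * \<bar>xi\<bar>))) * (tnorm \<tau> (\<lambda>s. ?r s xi))"
    by (rule nn_integral_cmult) measurable
   also have "... \<le> ennreal (exp (- (\<sigma> * \<bar>xi\<bar>))) * (ennreal (W xi) * U xi)"
    using e tn[of xi] by (intro mult_left_mono) auto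
   finally show "(NN s. ennreal (cmod (h (s, xi)))) \<le> ennreal (exp (- (\<sigma> * \<bar>xi\<bar>))) * (ennreal (W xi) * U xi)" .
  qed
  also have "... < \<infinity>" by (rule weighted_L2_integral_finite[OF \<sigma> Um le_less_trans[OF U(2) Rf]])
  finally show "(NN s. NN xi. ennreal (cmod (h (s, xi)))) < \<infinity>" .
 qed
 have hi: "(LINT xi|lborel. h (s, xi)) / of_real (2 * pi) = indicator {0..t} s *\<^sub>R ift (\<lambda>xi. m xi * ?r s xi) x" for s
  unfolding h_def ift_def fst_conv snd_conv by (simp add: indicator_def)
 have "integrable lborel (\<lambda>s. (LINT xi|lborel. h (s, xi)) / of_real (2 * pi))"
  by (intro integrable_divide lborel_pair.integrable_fst'[OF ih])
 then show si: "set_integrable lborel {0..t} (\<lambda>s. ift (\<lambda>xi. m xi * ?r s xi) x)"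
  unfolding set_integrable_def hi .
 have "GF \<sigma> (uh (pth v0 g) t)" by (rule uh_GF[OF n Rf t])
 then have iu: "integrable lborel (uh (pth v0 g) t)" by (rule GF_integrable0[OF _ \<sigma>])
 have "GF \<sigma> (\<lambda>xi. m xi * v0 xi)"
  unfolding GF_def
 proof
  show "(\<lambda>xi. m xi * v0 xi) \<in> bm" by measurable
  have z: "0 \<in> {0..\<tau>}" using \<tau> by simp
  have "pth v0 g 0 = v0" using pth_0[OF gd] \<tau> by (simp add: fun_eq_iff)
  then have "l2sq v0 < \<infinity>" using le_less_trans[OF nb_l2sq[OF n z] Rf] by simp
  moreover have "cmod (of_real (exp (\<sigma> * \<bar>xi\<bar>)) * (m xi * v0 xi)) = cmod (v0 xi)" for xi
   unfolding m_def mult.assoc by (rule weight_cancel)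
  ultimately show "l2sq (\<lambda>xi. of_real (exp (\<sigma> * \<bar>xi\<bar>)) * (m xi * v0 xi)) < \<infinity>" by simp
 qed
 then have iv: "integrable lborel (\<lambda>xi. m xi * v0 xi)" by (rule GF_integrable0[OF _ \<sigma>])
 have "(LINT s:{0..t}|lborel. ift (\<lambda>xi. m xi * ?r s xi) x) = (LINT s|lborel. LINT xi|lborel. h (s, xi)) / of_real (2 * pi)"
  unfolding set_lebesgue_integral_def hi[symmetric] by simp
 also have "(LINT s|lborel. LINT xi|lborel. h (s, xi)) = (LINT xi|lborel. LINT s|lborel. h (s, xi))"
  using lborel_pair.Fubini_integral[of "\<lambda>s xi. h (s, xi)"] ih by simp
 also have "... = (LINT xi|lborel. (uh (pth v0 g) t xi + (-1) * (m xi * v0 xi)) * cis (x * xi))"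
 proof (rule integral_cong_AE)
  show "(\<lambda>xi. LINT s|lborel. h (s, xi)) \<in> borel_measurable lborel" by measurable
  show "(\<lambda>xi. (uh (pth v0 g) t xi + (-1) * (m xi * v0 xi)) * cis (x * xi)) \<in> borel_measurable lborel"
   using iu by measurable
  show "AE xi in lborel. (LINT s|lborel. h (s, xi)) = (uh (pth v0 g) t xi + (-1) * (m xi * v0 xi)) * cis (x * xi)"
  proof (rule AE_mp[OF solves], intro AE_I2 impI)
   fix xi
   assume "(tnorm \<tau> (\<lambda>s. ?r s xi))
    = (tnorm \<tau> (\<lambda>s. g s xi)) \<and> (\<forall>t\<in>{0..\<tau>}. pth v0 g t xi = v0 xi + (LINT s:{0..t}|lborel. ?r s xi))"
   then have p: "pth v0 g t xi = v0 xi + (LINT s:{0..t}|lborel. ?r s xi)" using t by blast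
   have "(LINT s|lborel. h (s, xi)) = (LINT s|lborel. (m xi * cis (x * xi)) * (indicator {0..t} s *\<^sub>R ?r s xi))"
    unfolding h_def fst_conv snd_conv by (intro Bochner_Integration.integral_cong refl) (simp add: mult_ac)
   also have "... = (m xi * cis (x * xi)) * (LINT s:{0..t}|lborel. ?r s xi)"
    unfolding set_lebesgue_integral_def by (rule integral_mult_right_zero)
   also have "... = (m xi * pth v0 g t xi + (-1) * (m xi * v0 xi)) * cis (x * xi)" unfolding p by (rule alg)
   also have "m xi * pth v0 g t xi = uh (pth v0 g) t xi" by (simp add: m_def uh_def mult.assoc)
   finally show "(LINT s|lborel. h (s, xi)) = (uh (pth v0 g) t xi + (-1) * (m xi * v0 xi)) * cis (x * xi)" .
  qed
 qed
 also have "... / of_real (2 * pi) = ift (\<lambda>xi. uh (pth v0 g) t xi + (-1) * (m xi * v0 xi)) x" by (simp only: ift_def)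
 also have "... = ift (uh (pth v0 g) t) x + (-1) * ift (\<lambda>xi. m xi * v0 xi) x"
  unfolding ift_add[OF iu integrable_mult_right[OF iv, of "-1"]] ift_cmult ..
 finally show "ift (uh (pth v0 g) t) x = ift (\<lambda>xi. m xi * v0 xi) x + (LINT s:{0..t}|lborel. ift (\<lambda>xi. m xi * ?r s xi) x)" by simp
qed

definition lift :: "(real => complex) => real => complex" where
 "lift u0 xi = of_real (exp (\<sigma> * \<bar>xi\<bar>)) * fourier u0 xi"

text \<open>The integrand lies in G at half the rate, and there \<open>S_group_ift\<close> computes
  the group. The phase at s contained in \<open>rhs\<close> turns the multiplier at time t of
  \<open>duhamel\<close> into that of the group at t - s.\<close>

lemma sol_strong:
 assumes \<tau>: "0 < \<tau>" "\<tau> \<le> 1" and u0: "u0 \<in> Gspace \<sigma>" and n: "nb \<tau> (lift u0) g (ennreal R)" and f: "fixpt \<tau> (lift u0) g"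
 shows "strong_solution \<alpha> \<beta> \<mu> lam a \<sigma> \<tau> u0 (sol \<tau> (lift u0) g)"
 unfolding strong_solution_def
proof (intro conjI ballI allI sol_mspace[OF n])
 fix t x assume t: "t \<in> {0..\<tau>}"
 let ?v = "pth (lift u0) g" and ?m = "\<lambda>xi. cis (- t * phi \<alpha> \<beta> xi) * of_real (exp (- (\<sigma> * \<bar>xi\<bar>)))"
 let ?J = "\<lambda>s. ift (\<lambda>xi. ?m xi * rhs \<tau> ?v s xi) x"
 have Rf: "ennreal R < \<infinity>" by simp
 have S: "S_group \<alpha> \<beta> (t - s) (lower_terms \<mu> lam a (sol \<tau> (lift u0) g s)) x = - ?J s" if s: "s \<in> {0..t}" for s
 proof -
  have s': "s \<in> {0..\<tau>}" using s t by simp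
  obtain H where H: "GF \<sigma> H" "has_fourier (\<lambda>x. of_real (a x) * ift (uh ?v s) x) H"
   and rh: "\<And>xi. rhs \<tau> ?v s xi = - (cis (s * phi \<alpha> \<beta> xi) * (of_real (exp (\<sigma> * \<bar>xi\<bar>)) * Lhat \<mu> lam (uh ?v s) H xi))"
   using rhs_lower_terms[OF n Rf s'] by blast
  note L = lower_terms_ift[OF uh_GF[OF n Rf s'] \<sigma> H am, of \<mu> lam]
  have \<sigma>2: "\<sigma> / 2 > 0" using \<sigma> by simp
  have "S_group \<alpha> \<beta> (t - s) (lower_terms \<mu> lam a (sol \<tau> (lift u0) g s)) x
   = ift (\<lambda>xi. cis (- (t - s) * (\<alpha> * xi ^ 5 - \<beta> * xi ^ 3)) * Lhat \<mu> lam (uh ?v s) H xi) x"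
   using s' by (simp add: sol_def L(1) S_group_ift[OF GF_has_fourier[OF L(2) \<sigma>2] L(2) \<sigma>2])
  also have "(\<lambda>xi. cis (- (t - s) * (\<alpha> * xi ^ 5 - \<beta> * xi ^ 3)) * Lhat \<mu> lam (uh ?v s) H xi) = (\<lambda>xi. (-1) * (?m xi * rhs \<tau> ?v s xi))"
  proof
   fix xi
   have "(-1) * (?m xi * rhs \<tau> ?v s xi) = (cis (- t * phi \<alpha> \<beta> xi) * cis (s * phi \<alpha> \<beta> xi)) * of_real (exp (- (\<sigma> * \<bar>xi\<bar>)) * exp (\<sigma> * \<bar>xi\<bar>)) * Lhat \<mu> lam (uh ?v s) H xi"
    unfolding rh by (simp add: mult_ac)
   also have "exp (- (\<sigma> * \<bar>xi\<bar>)) * exp (\<sigma> * \<bar>xi\<bar>) = 1" by (simp add: exp_minus)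
   also have "cis (- t * phi \<alpha> \<beta> xi) * cis (s * phi \<alpha> \<beta> xi) = cis (- (t - s) * (\<alpha> * xi ^ 5 - \<beta> * xi ^ 3))"
    unfolding cis_mult phi_def by (simp add: algebra_simps)
   finally show "cis (- (t - s) * (\<alpha> * xi ^ 5 - \<beta> * xi ^ 3)) * Lhat \<mu> lam (uh ?v s) H xi = (-1) * (?m xi * rhs \<tau> ?v s xi)" by simp
  qed
  also have "ift (\<lambda>xi. (-1) * (?m xi * rhs \<tau> ?v s xi)) x = - ?J s" unfolding ift_cmult by simp
  finally show ?thesis .
 qed
 note D = duhamel[OF \<tau> n f t, of x]
 have "set_integrable lborel {0..t} (\<lambda>s. - ?J s)" using D(1) by (simp add: set_integrable_def)
 then show "set_integrable lborel {0..t} (\<lambda>s. S_group \<alpha> \<beta> (t - s) (lower_terms \<mu> lam a (sol \<tau> (lift u0) g s)) x)"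
  by (subst set_integrable_cong[OF refl refl S])
 have I: "(LINT s:{0..t}|lborel. S_group \<alpha> \<beta> (t - s) (lower_terms \<mu> lam a (sol \<tau> (lift u0) g s)) x) = - (LINT s:{0..t}|lborel. ?J s)"
 proof -
  have "(LINT s:{0..t}|lborel. S_group \<alpha> \<beta> (t - s) (lower_terms \<mu> lam a (sol \<tau> (lift u0) g s)) x) = (LINT s:{0..t}|lborel. - ?J s)"
   by (rule set_lebesgue_integral_cong, simp, use S in blast)
  then show ?thesis by (simp add: set_lebesgue_integral_def)
 qed
 have m0: "?m xi * lift u0 xi = cis (- t * (\<alpha> * xi ^ 5 - \<beta> * xi ^ 3)) * fourier u0 xi" for xi
 proof -
  have "?m xi * lift u0 xi = cis (- t * phi \<alpha> \<beta> xi) * of_real (exp (- (\<sigma> * \<bar>xi\<bar>)) * exp (\<sigma> * \<bar>xi\<bar>)) * fourier u0 xi"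
   unfolding lift_def by (simp only: of_real_mult mult_ac)
  also have "exp (- (\<sigma> * \<bar>xi\<bar>)) * exp (\<sigma> * \<bar>xi\<bar>) = 1" by (simp add: exp_minus)
  finally show ?thesis by (simp add: phi_def)
 qed
 have "S_group \<alpha> \<beta> t u0 x = ift (\<lambda>xi. ?m xi * lift u0 xi) x"
  unfolding m0 S_group_ift[OF Gspace_has_fourier(1)[OF u0] Gspace_GF[OF u0] \<sigma>] ..
 then show "sol \<tau> (lift u0) g t x = S_group \<alpha> \<beta> t u0 x - (LINT s:{0..t}|lborel. S_group \<alpha> \<beta> (t - s) (lower_terms \<mu> lam a (sol \<tau> (lift u0) g s)) x)"
  unfolding I using D(2) t by (simp add: sol_def)
qed

lemma l2sq_lift_diff:
 assumes "u0 \<in> Gspace \<sigma>" "u1 \<in> Gspace \<sigma>"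
 shows "l2sq (\<lambda>xi. lift u0 xi - lift u1 xi) = ennreal ((Gdist \<sigma> u0 u1)\<^sup>2)"
 using Gdist_ift[OF Gspace_GF[OF assms(1)] Gspace_GF[OF assms(2)] \<sigma>] Gspace_ift[OF assms(1) \<sigma>] Gspace_ift[OF assms(2) \<sigma>]
 by (simp add: lift_def right_diff_distrib)

text \<open>The factor 2 is the square root of the 4 in \<open>fixpt_stable\<close>; its
  \<open>\<epsilon>\<close> disappears because it is arbitrary.\<close>

lemma sol_dist:
 assumes \<tau>: "0 < \<tau>" "\<tau> \<le> 1" and r: "r \<ge> 0" and k: "ET (16 * r) * sqrt \<tau> \<le> 1/16"
  and u: "u0 \<in> Gspace \<sigma>" "u1 \<in> Gspace \<sigma>"
  and g: "nb \<tau> (lift u0) g (ennreal (4 * r))" "fixpt \<tau> (lift u0) g" and h: "nb \<tau> (lift u1) h (ennreal (4 * r))" "fixpt \<tau> (lift u1) h"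
  and t: "t \<in> {0..\<tau>}"
 shows "Gdist \<sigma> (sol \<tau> (lift u0) g t) (sol \<tau> (lift u1) h t) \<le> 2 * Gdist \<sigma> u0 u1"
proof -
 interpret Metric_space "Gspace \<sigma>" "Gdist \<sigma>" by (rule Metric_space_G)
 let ?d = "Gdist \<sigma> (sol \<tau> (lift u0) g t) (sol \<tau> (lift u1) h t)" and ?\<rho> = "(Gdist \<sigma> u0 u1)\<^sup>2"
 have "ennreal (?d\<^sup>2) = l2sq (\<lambda>xi. of_real (exp (\<sigma> * \<bar>xi\<bar>)) * (uh (pth (lift u0) g) t xi - uh (pth (lift u1) h) t xi))"
  using t Gdist_ift[OF uh_GF[OF g(1) _ t] uh_GF[OF h(1) _ t] \<sigma>] by (simp add: sol_def)
 also have "... = l2sq (\<lambda>xi. pth (lift u0) g t xi - pth (lift u1) h t xi)"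
  unfolding uh_diff weight_cancel ..
 also have "(\<lambda>xi. pth (lift u0) g t xi - pth (lift u1) h t xi) = pth (\<lambda>xi. lift u0 xi - lift u1 xi) (\<lambda>s xi. g s xi - h s xi) t"
  using pth_add[OF nb_good[OF g(1)] good_uminus[OF nb_good[OF h(1)]], of t] t by (simp add: pth_uminus fun_eq_iff)
 finally have e: "ennreal (?d\<^sup>2) = l2sq (pth (\<lambda>xi. lift u0 xi - lift u1 xi) (\<lambda>s xi. g s xi - h s xi) t)" .
 have "?d\<^sup>2 \<le> 4 * ?\<rho>"
 proof (rule field_le_epsilon)
  fix \<epsilon> :: real assume \<epsilon>: "\<epsilon> > 0"
  have "nb \<tau> (\<lambda>xi. lift u0 xi - lift u1 xi) (\<lambda>s xi. g s xi - h s xi) (ennreal (4 * ?\<rho> + \<epsilon>))"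
   by (rule fixpt_stable[OF \<tau> r k g h _ _ \<epsilon>]) (simp_all add: l2sq_lift_diff[OF u])
  from nb_l2sq[OF this t] have "ennreal (?d\<^sup>2) \<le> ennreal (4 * ?\<rho> + \<epsilon>)" unfolding e .
  then show "?d\<^sup>2 \<le> 4 * ?\<rho> + \<epsilon>" using \<epsilon> by (subst (asm) ennreal_le_iff) auto
 qed
 then have "?d\<^sup>2 \<le> (2 * Gdist \<sigma> u0 u1)\<^sup>2" by (simp add: power_mult_distrib)
 then show ?thesis by (rule power2_le_imp_le) simp
qed

text \<open>All data in the unit ball around \<open>w\<close> share a bound r on their squared norm
  and hence one time of existence. The solution depends on the datum with Lipschitz constant 2, from
  which continuity of the flow map follows.\<close>

theorem well_posed:
 assumes w: "w \<in> Gspace \<sigma>"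
 shows "\<exists>\<tau> B X. well_posed_near \<alpha> \<beta> \<mu> lam a \<sigma> w \<tau> B X"
proof -
 interpret M: Metric_space "Gspace \<sigma>" "Gdist \<sigma>" by (rule Metric_space_G)
 define B where "B = mball_of (Gmetric \<sigma>) w 1"
 have B: "u \<in> B \<longleftrightarrow> u \<in> Gspace \<sigma> \<and> Gdist \<sigma> w u < 1" for u
  using w by (simp add: B_def mspace_Gmetric mdist_Gmetric)
 have lm: "lift u \<in> bm" if "u \<in> Gspace \<sigma>" for u
 proof -
  have [measurable]: "fourier u \<in> bm" using Gspace_GF[OF that] by (simp add: GF_def)
  show ?thesis unfolding lift_def[abs_def] by measurable
 qed
 have "l2sq (lift w) < \<infinity>" using Gspace_GF[OF w] by (simp add: GF_def lift_def)
 then obtain c where c: "c \<ge> 0" "l2sq (lift w) = ennreal c" by (metis ennreal_cases infinity_ennreal_def order_less_irrefl)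
 \<comment> \<open>Twice the squared norm of \<open>w\<close> plus twice the squared radius 1 of the
   ball.\<close>
 define r where "r = 2 * c + 2"
 have r: "r \<ge> 0" using c by (simp add: r_def)
 have rB: "l2sq (lift u) \<le> ennreal r" if u: "u \<in> B" for u
 proof -
  have ug: "u \<in> Gspace \<sigma>" and du: "Gdist \<sigma> w u < 1" using u B by auto
  have [measurable]: "lift w \<in> borel_measurable lborel" "lift u \<in> borel_measurable lborel" using lm[OF w] lm[OF ug] by simp_all
  have "l2sq (\<lambda>xi. lift w xi - (lift w xi - lift u xi)) \<le> 2 * l2sq (lift w) + 2 * l2sq (\<lambda>xi. lift w xi - lift u xi)"
   by (rule nn_diff_sq_le) measurable
  also have "... = 2 * ennreal c + 2 * ennreal ((Gdist \<sigma> w u)\<^sup>2)" unfolding c(2) l2sq_lift_diff[OF w ug] ..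
  also have "... = ennreal (2 * c + 2 * (Gdist \<sigma> w u)\<^sup>2)" using c by (intro ennreal_twice_add) auto
  also have "... \<le> ennreal r" unfolding r_def using du by (intro ennreal_leI) (simp add: power_le_one)
  finally show ?thesis by simp
 qed
 define e where "e = ET (16 * r)"
 have e: "e \<ge> 0" unfolding e_def using r by (intro ET_nonneg) simp
 \<comment> \<open>Chosen so that sqrt tau is 1 / (16 (e + 1)); the added 1 covers e = 0 and forces
   \<open>\<tau> \<le> 1\<close>.\<close>
 define \<tau> where "\<tau> = (1 / (16 * (e + 1)))\<^sup>2"
 have "1 / (16 * (e + 1)) \<le> 1" using e by simp
 then have \<tau>: "0 < \<tau>" "\<tau> \<le> 1" unfolding \<tau>_def using e by (auto intro: power_le_one)
 have "sqrt \<tau> = 1 / (16 * (e + 1))" unfolding \<tau>_def using e by (simp add: real_sqrt_abs)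
 then have "e * sqrt \<tau> = e / (e + 1) / 16" by simp
 also have "... \<le> 1 / 16" using e by (intro divide_right_mono) auto
 finally have k: "ET (16 * r) * sqrt \<tau> \<le> 1/16" unfolding e_def[symmetric] .
 have "\<forall>u\<in>B. \<exists>g. nb \<tau> (lift u) g (ennreal (4 * r)) \<and> fixpt \<tau> (lift u) g"
  using picard[OF \<tau> r k lm rB] B by blast
 from bchoice[OF this] obtain g where g: "\<And>u. u \<in> B \<Longrightarrow> nb \<tau> (lift u) (g u) (ennreal (4 * r)) \<and> fixpt \<tau> (lift u) (g u)" by blast
 define \<Phi> where "\<Phi> u = sol \<tau> (lift u) (g u)" for u
 define X where "X = \<Phi> ` B"
 have BG: "u \<in> Gspace \<sigma>" if "u \<in> B" for u using that B by blast
 have ms: "\<Phi> u \<in> mspace (CGmetric \<sigma> \<tau>)" if "u \<in> B" for u unfolding \<Phi>_def using g[OF that] by (blast intro: sol_mspace)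
 have str: "strong_solution \<alpha> \<beta> \<mu> lam a \<sigma> \<tau> u (\<Phi> u)" if "u \<in> B" for u
  unfolding \<Phi>_def using g[OF that] by (blast intro: sol_strong[OF \<tau> BG[OF that]])
 have \<tau>0: "0 \<le> \<tau>" using \<tau> by simp
 have uniq: "v = \<Phi> u" if u: "u \<in> B" and v: "v \<in> X" "strong_solution \<alpha> \<beta> \<mu> lam a \<sigma> \<tau> u v" for u v
 proof -
  obtain u' where u': "u' \<in> B" "v = \<Phi> u'" using v(1) by (auto simp: X_def)
  have "v 0 = u" by (rule strong_solution_initial[OF v(2) \<tau>0 \<sigma> BG[OF u]])
  moreover have "v 0 = u'" unfolding u'(2) by (rule strong_solution_initial[OF str[OF u'(1)] \<tau>0 \<sigma> BG[OF u'(1)]])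
  ultimately show ?thesis using u'(2) by simp
 qed
 have XI: "\<Phi> u \<in> X" if "u \<in> B" for u using that by (simp add: X_def)
 have the: "(THE v. v \<in> X \<and> strong_solution \<alpha> \<beta> \<mu> lam a \<sigma> \<tau> u v) = \<Phi> u" if "u \<in> B" for u
  using XI[OF that] str[OF that] uniq[OF that] by (intro the_equality) blast+
 have dist: "mdist (CGmetric \<sigma> \<tau>) (\<Phi> u) (\<Phi> v) \<le> 2 * Gdist \<sigma> u v" if u: "u \<in> B" and v: "v \<in> B" for u v
  unfolding CGmetric_def
 proof (rule mdist_cfunspace_le)
  fix t assume "t \<in> topspace (top_of_set {0..\<tau>})"
  then have t: "t \<in> {0..\<tau>}" by simp
  show "mdist (Gmetric \<sigma>) (\<Phi> u t) (\<Phi> v t) \<le> 2 * Gdist \<sigma> u v"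
   unfolding mdist_Gmetric \<Phi>_def using g[OF u] g[OF v] by (intro sol_dist[OF \<tau> r k BG[OF u] BG[OF v] _ _ _ _ t]) blast+
 qed simp
 have "Lipschitz_continuous_map (submetric (Gmetric \<sigma>) B) (submetric (CGmetric \<sigma> \<tau>) X)
   (\<lambda>u. THE v. v \<in> X \<and> strong_solution \<alpha> \<beta> \<mu> lam a \<sigma> \<tau> u v)"
  unfolding Lipschitz_continuous_map_def
 proof
  show "(\<lambda>u. THE v. v \<in> X \<and> strong_solution \<alpha> \<beta> \<mu> lam a \<sigma> \<tau> u v) \<in> mspace (submetric (Gmetric \<sigma>) B) \<rightarrow> mspace (submetric (CGmetric \<sigma> \<tau>) X)"
   by (auto simp: the XI ms)
  show "\<exists>b. \<forall>u\<in>mspace (submetric (Gmetric \<sigma>) B). \<forall>v\<in>mspace (submetric (Gmetric \<sigma>) B).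
    mdist (submetric (CGmetric \<sigma> \<tau>) X) (THE w. w \<in> X \<and> strong_solution \<alpha> \<beta> \<mu> lam a \<sigma> \<tau> u w) (THE w. w \<in> X \<and> strong_solution \<alpha> \<beta> \<mu> lam a \<sigma> \<tau> v w)
     \<le> b * mdist (submetric (Gmetric \<sigma>) B) u v"
   by (rule exI[of _ 2]) (auto simp: the mdist_Gmetric dist)
 qed
 from Lipschitz_continuous_imp_continuous_map[OF this]
 have cont: "continuous_map (subtopology (mtopology_of (Gmetric \<sigma>)) B) (subtopology (mtopology_of (CGmetric \<sigma> \<tau>)) X)
   (\<lambda>u. THE v. v \<in> X \<and> strong_solution \<alpha> \<beta> \<mu> lam a \<sigma> \<tau> u v)"
  by (simp add: mtopology_of_submetric)
 have "well_posed_near \<alpha> \<beta> \<mu> lam a \<sigma> w \<tau> B X"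
  unfolding well_posed_near_def
 proof (intro conjI ballI)
  show "\<exists>c r. B = mball_of (Gmetric \<sigma>) c r" unfolding B_def by blast
  show "w \<in> B" using B w by simp
  show "X \<subseteq> mspace (CGmetric \<sigma> \<tau>)" using ms by (auto simp: X_def)
  show "\<exists>!v. v \<in> X \<and> strong_solution \<alpha> \<beta> \<mu> lam a \<sigma> \<tau> u v" if "u \<in> B" for u
   using XI[OF that] str[OF that] uniq[OF that] by (intro ex1I[of _ "\<Phi> u"]) blast+
 qed (fact \<tau> cont)+
 then show ?thesis by blast
qed

end

section \<open>The strip, and the use of the hypotheses on \<open>a\<close>\<close>

lemma CG_holomorphic_extension:
 assumes u: "u \<in> mspace (CGmetric \<sigma> \<tau>)" and t: "t \<in> {0..\<tau>}" and \<sigma>: "\<sigma> > 0"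
 shows "\<exists>U. U holomorphic_on strip \<sigma> \<and> (\<forall>x. U (of_real x) = u t x)"
proof -
 have "u t \<in> Gspace \<sigma>" using u t unfolding mspace_CGmetric by blast
 then show ?thesis
  using cift_holomorphic[OF Gspace_GF] Gspace_ift[OF _ \<sigma>] by (intro exI[of _ "cift (fourier (u t))"]) (metis cift_of_real)
qed

text \<open>Where a continuous function exceeds a constant it does so on an open set, and a nonempty
  open set has positive measure. This turns (A2) into pointwise bounds on the derivatives of
  \<open>a\<close>.\<close>

lemma continuous_le_esssup:
 fixes h :: "real => real"
 assumes c: "continuous_on UNIV h" and f: "esssup lborel (\<lambda>x. ennreal \<bar>h x\<bar>) < \<infinity>"
 shows "\<bar>h x\<bar> \<le> enn2real (esssup lborel (\<lambda>x. ennreal \<bar>h x\<bar>))"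
proof (rule ccontr)
 let ?M = "enn2real (esssup lborel (\<lambda>x. ennreal \<bar>h x\<bar>))"
 assume "\<not> \<bar>h x\<bar> \<le> ?M"
 then have x: "x \<in> {y. ?M < \<bar>h y\<bar>}" by simp
 have "open {y. ?M < \<bar>h y\<bar>}" by (intro open_Collect_less continuous_on_const continuous_on_rabs c)
 then obtain e where e: "e > 0" "ball x e \<subseteq> {y. ?M < \<bar>h y\<bar>}" using x by (metis openE)
 have "AE y in lborel. ennreal \<bar>h y\<bar> \<le> esssup lborel (\<lambda>x. ennreal \<bar>h x\<bar>)" by (rule esssup_AE)
 then have "AE y in lborel. y \<notin> ball x e"
 proof eventually_elim
  case (elim y)
  have "esssup lborel (\<lambda>x. ennreal \<bar>h x\<bar>) = ennreal ?M" using f by simp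
  then have "\<bar>h y\<bar> \<le> ?M" using elim by (metis ennreal_le_iff enn2real_nonneg)
  then show ?case using e(2) by force
 qed
 then have "emeasure lborel (ball x e) = 0" by (subst (asm) AE_iff_measurable[OF _ refl]) (auto simp: ball_def)
 moreover have "ball x e = {x - e<..<x + e}" by (simp add: ball_eq_greaterThanLessThan)
 ultimately show False using e(1) by simp
qed

theorem theorem1p2:
  fixes \<alpha> \<beta> \<mu> lam \<sigma>\<^sub>0 :: real and a :: "real \<Rightarrow> real"
  assumes "\<alpha> \<noteq> 0" and "\<sigma>\<^sub>0 > 0"
    and smooth: "\<And>k x. (deriv ^^ k) a differentiable (at x)"
    and A1: "\<exists>\<gamma>>0. \<forall>x. a x \<ge> \<gamma>"
    and A2: "(\<Sum>k. ennreal ((real k + 1) powr (1/4) * \<sigma>\<^sub>0 ^ k / fact k)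
               * esssup lborel (\<lambda>x. ennreal \<bar>(deriv ^^ k) a x\<bar>)) < \<infinity>"
  shows "locally_well_posed \<alpha> \<beta> \<mu> lam a \<sigma>\<^sub>0 \<and>
    (\<forall>u\<^sub>0\<in>Gspace \<sigma>\<^sub>0. \<exists>\<delta> B X. well_posed_near \<alpha> \<beta> \<mu> lam a \<sigma>\<^sub>0 u\<^sub>0 \<delta> B X \<and>
       (\<forall>u\<in>X. strong_solution \<alpha> \<beta> \<mu> lam a \<sigma>\<^sub>0 \<delta> u\<^sub>0 u \<longrightarrow>
          (\<forall>t\<in>{0..\<delta>}. \<exists>U. U holomorphic_on strip \<sigma>\<^sub>0 \<and>
             (\<forall>x. U (of_real x) = u t x))))"
proof -
 define E where "E k = esssup lborel (\<lambda>x. ennreal \<bar>(deriv ^^ k) a x\<bar>)" for k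
 define M where "M k = enn2real (E k)" for k
 let ?c = "\<lambda>k. (real k + 1) powr (1/4) * \<sigma>\<^sub>0 ^ k / fact k"
 have cpos: "?c k > 0" for k using \<open>\<sigma>\<^sub>0 > 0\<close> by simp
 \<comment> \<open>The weight (k + 1)^(1/4) is at least 1, so (A2) dominates the series whose sum
   \<open>A\<close> enters \<open>mult_GF\<close>.\<close>
 have cge: "\<sigma>\<^sub>0 ^ k / fact k \<le> ?c k" for k
 proof -
  have "1 \<le> (real k + 1) powr (1/4)" by (rule ge_one_powr_ge_zero) auto
  then have "1 * (\<sigma>\<^sub>0 ^ k / fact k) \<le> (real k + 1) powr (1/4) * (\<sigma>\<^sub>0 ^ k / fact k)" using \<open>\<sigma>\<^sub>0 > 0\<close> by (intro mult_right_mono) auto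
  then show ?thesis by simp
 qed
 have A2': "(\<Sum>k. ennreal (?c k) * E k) < \<infinity>" using A2 unfolding E_def .
 have Ef: "E k < \<infinity>" for k
 proof -
  have "ennreal (?c k) * E k \<le> (\<Sum>k. ennreal (?c k) * E k)"
   using sum_le_suminf[of "\<lambda>k. ennreal (?c k) * E k" "{k}"] by simp
  then have "ennreal (?c k) * E k < \<infinity>" using A2' by (rule le_less_trans)
  moreover have "y < \<infinity>" if "x > 0" "ennreal x * y < \<infinity>" for x y
   using that by (auto simp: ennreal_mult_less_top)
  ultimately show ?thesis using cpos[of k] by blast
 qed
 have EM: "E k = ennreal (M k)" "M k \<ge> 0" for k using Ef[of k] by (auto simp: M_def)
 have der: "((deriv ^^ k) a has_real_derivative (deriv ^^ Suc k) a x) (at x)" for k x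
  using smooth[of k x] by (simp add: DERIV_deriv_iff_real_differentiable)
 have cont: "continuous_on UNIV ((deriv ^^ k) a)" for k
  by (intro continuous_at_imp_continuous_on ballI DERIV_isCont[OF der])
 have Mb: "\<bar>(deriv ^^ k) a x\<bar> \<le> M k" for k x
  unfolding M_def E_def by (rule continuous_le_esssup[OF cont]) (use Ef[of k] in \<open>simp add: E_def\<close>)
 have "(\<Sum>k. ennreal (\<sigma>\<^sub>0 ^ k / fact k * M k)) \<le> (\<Sum>k. ennreal (?c k) * E k)"
 proof (intro suminf_le)
  fix k
  have "ennreal (\<sigma>\<^sub>0 ^ k / fact k * M k) \<le> ennreal (?c k * M k)" using cge[of k] EM(2)[of k] by (intro ennreal_leI mult_right_mono)
  also have "... = ennreal (?c k) * E k" unfolding EM(1) by (rule ennreal_mult) (use cpos[of k] EM(2)[of k] in auto)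
  finally show "ennreal (\<sigma>\<^sub>0 ^ k / fact k * M k) \<le> ennreal (?c k) * E k" .
 qed auto
 from le_less_trans[OF this A2'] have "(\<Sum>k. ennreal (\<sigma>\<^sub>0 ^ k / fact k * M k)) \<noteq> \<top>" by auto
 then have sm: "summable (\<lambda>k. \<sigma>\<^sub>0 ^ k / fact k * M k)"
  using EM(2) \<open>\<sigma>\<^sub>0 > 0\<close> by (intro summable_suminf_not_top) auto
 define A where "A = (\<Sum>k. \<sigma>\<^sub>0 ^ k / fact k * M k)"
 have As: "(\<lambda>k. \<sigma>\<^sub>0 ^ k / fact k * M k) sums A" unfolding A_def using sm by (rule summable_sums)
 have A0: "A \<ge> 0" unfolding A_def using EM(2) \<open>\<sigma>\<^sub>0 > 0\<close> by (intro suminf_nonneg sm) auto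
 have damp: "damping a \<sigma>\<^sub>0 A"
 proof
  show "\<exists>H. has_fourier (\<lambda>x. of_real (a x) * ift F x) H \<and> GF \<sigma>\<^sub>0 H \<and>
   wl2 \<sigma>\<^sub>0 H \<le> ennreal (4 * A\<^sup>2) * wl2 \<sigma>\<^sub>0 F" if "GF \<sigma>\<^sub>0 F" for F
   using mult_GF[of "\<lambda>k. (deriv ^^ k) a", OF der Mb As \<open>\<sigma>\<^sub>0 > 0\<close> that] by simp
  show "continuous_on UNIV a" using cont[of 0] by simp
 qed (use \<open>\<sigma>\<^sub>0 > 0\<close> A0 in auto)
 obtain CA CB where T: "trilinear (k2 \<sigma>\<^sub>0) (om2 \<alpha> \<beta>) (\<lambda>xi x y. x) (\<lambda>xi x y. xi - x) (\<lambda>xi x y. y) CA"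
  "trilinear (k3 \<sigma>\<^sub>0) (om3 \<alpha> \<beta>) (\<lambda>xi x y. x) (\<lambda>xi x y. y) (\<lambda>xi x y. xi - x - y) CB"
  using trilinear_quadratic[OF \<open>\<alpha> \<noteq> 0\<close> \<open>\<sigma>\<^sub>0 > 0\<close>] trilinear_cubic[OF \<open>\<alpha> \<noteq> 0\<close> \<open>\<sigma>\<^sub>0 > 0\<close>] by blast
 interpret flow a \<sigma>\<^sub>0 \<alpha> \<beta> A CA CB \<mu> lam
  by (intro flow.intro damp damping.evo_instance[OF damp T])
 have wp: "\<exists>\<tau> B X. well_posed_near \<alpha> \<beta> \<mu> lam a \<sigma>\<^sub>0 w \<tau> B X" if "w \<in> Gspace \<sigma>\<^sub>0" for w
  by (rule well_posed[OF that])
 have hol: "\<exists>U. U holomorphic_on strip \<sigma>\<^sub>0 \<and> (\<forall>x. U (of_real x) = u t x)"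
  if "strong_solution \<alpha> \<beta> \<mu> lam a \<sigma>\<^sub>0 \<tau> u\<^sub>0 u" "t \<in> {0..\<tau>}" for \<tau> u\<^sub>0 u t
  using that CG_holomorphic_extension[OF _ _ \<open>\<sigma>\<^sub>0 > 0\<close>] unfolding strong_solution_def by blast
 show ?thesis
 proof (intro conjI ballI)
  show "locally_well_posed \<alpha> \<beta> \<mu> lam a \<sigma>\<^sub>0" unfolding locally_well_posed_def using wp by blast
  fix w assume "w \<in> Gspace \<sigma>\<^sub>0"
  then obtain \<tau> B X where "well_posed_near \<alpha> \<beta> \<mu> lam a \<sigma>\<^sub>0 w \<tau> B X" using wp by blast
  then show "\<exists>\<tau> B X. well_posed_near \<alpha> \<beta> \<mu> lam a \<sigma>\<^sub>0 w \<tau> B X \<and>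
    (\<forall>u\<in>X. strong_solution \<alpha> \<beta> \<mu> lam a \<sigma>\<^sub>0 \<tau> w u \<longrightarrow>
     (\<forall>t\<in>{0..\<tau>}. \<exists>U. U holomorphic_on strip \<sigma>\<^sub>0 \<and> (\<forall>x. U (of_real x) = u t x)))"
   using hol by (intro exI[of _ \<tau>] exI[of _ B] exI[of _ X]) blast
 qed
qed

end
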